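(* Let $n\ge 5$ and let $F_0$ be a real-analytic, area-preserving and orientation-preserving map of a neighbourhood of the origin in $\mathbb R^2$ with $F_0(0)=0$ and $DF_0(0)=R_{\alpha_0}$, where $\lambda_0=e^{i\alpha_0}$ satisfies $\lambda_0^n=1$ and $\lambda_0^k\neq 1$ for all integers $1\le k<n$. Suppose that in the complex coordinate $z=x+iy$ the map has the form $$f_0=a(z\bar z)\,z+b(z\bar z)\,\bar z^{\,n-1}+O(|z|^{n+1}),$$ where $a,b$ are polynomials with complex coefficients and $a(0)=\lambda_0$. If $a'(0)=0$, $a''(0)\ne 0$ and $b(0)\neq 0$, then there is a formal canonical change of variables which conjugates $F_0$ with $R_{\alpha_0}\circ\Phi^1_{H_0}$, where the formal Hamiltonian $H_0$ has the form $$H_0(I,\varphi)=I^3A_0(I)+I^{n/2}B_0(I)\cos n\varphi ,$$ where $A_0(I)=\sum_{k\ge 0}a_kI^k$ and $B_0(I)=\sum_{k\ge 0}b_kI^k$ are formal series in $I$ with real coefficients such that - if $n=5$, then $a_k=0$ for $k\equiv 1\pmod 5$ and $b_k=0$ for $k\equiv 4\pmod 5$; - if $n\ge 6$, then $b_k=0$ for $k\equiv 2\pmod 3$. The coefficients of the series $A_0$ and $B_0$ are defined uniquely by the map $F_0$ provided the leading order is normalised to ensure $b_0>0$.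
   Context: $R_\alpha$ is the rotation of the plane by the angle $\alpha$, $R_\alpha=\begin{pmatrix}\cos\alpha&-\sin\alpha\\ \sin\alpha&\cos\alpha\end{pmatrix}$. The plane with coordinates $(x,y)$ is identified with the complex plane via $z=x+iy$, $\bar z=x-iy$. Symplectic polar coordinates $(I,\varphi)$ are defined by $x=\sqrt{2I}\cos\varphi$, $y=\sqrt{2I}\sin\varphi$, so $z=\sqrt{2I}e^{i\varphi}$, $z\bar z=2I$, and $I^{n/2}\cos n\varphi=2^{-n/2}\,\mathrm{Re}(z^n)$. Thus a Hamiltonian of the stated form is a real formal power series in $(x,y)$. For a formal power series $H$, $\Phi^t_H$ is the formal Hamiltonian flow generated by $H$ with respect to the area form, with the convention $\dot x=\partial H/\partial y$, $\dot y=-\partial H/\partial x$; $\Phi_H^1$ is the time-one map, understood as a formal power series. A formal canonical change of variables is an invertible pair of real formal power series in $(x,y)$ without constant term whose Jacobian determinant is identically $1$ (formally area-preserving). Conjugation is understood at the level of formal Taylor series at the origin. Any real-analytic area-preserving map with an elliptic fixed point at the origin that is resonant of order $n$ can be brought to the displayed form of $f_0$ by an analytic area-preserving change of variables; the theorem assumes that this has been done. *)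

theory Defs
  imports "HOL-Analysis.Analysis" "HOL-Library.Landau_Symbols"
    "HOL-Computational_Algebra.Computational_Algebra"
begin

text \<open>
  The ring \<open>K[[x,y]]\<close> is represented as \<open>K[[y]][[x]]\<close>: the outer index is the exponent of \<open>x\<close>,
  the inner one the exponent of \<open>y\<close>.
\<close>

type_synonym 'a fps2 = "'a fps fps"

definition coeff2 :: "'a fps2 \<Rightarrow> nat \<Rightarrow> nat \<Rightarrow> 'a" where
  "coeff2 f i j = fps_nth (fps_nth f i) j"

definition Abs_fps2 :: "(nat \<Rightarrow> nat \<Rightarrow> 'a) \<Rightarrow> 'a fps2" where
  "Abs_fps2 c = Abs_fps (\<lambda>i. Abs_fps (\<lambda>j. c i j))"

definition const2 :: "'a::comm_ring_1 \<Rightarrow> 'a fps2" where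
  "const2 c = fps_const (fps_const c)"

definition X2 :: "'a::comm_ring_1 fps2" where
  "X2 = fps_X"

definition Y2 :: "'a::comm_ring_1 fps2" where
  "Y2 = fps_const fps_X"

definition dx2 :: "'a::comm_ring_1 fps2 \<Rightarrow> 'a fps2" where
  "dx2 f = fps_deriv f"

definition dy2 :: "'a::comm_ring_1 fps2 \<Rightarrow> 'a fps2" where
  "dy2 f = Abs_fps (\<lambda>i. fps_deriv (fps_nth f i))"

text \<open>
  Substitution.  When the series being substituted have no constant term, \<open>g\<^sup>i h\<^sup>j\<close> has order at
  least \<open>i + j\<close>, so only the terms with \<open>i + j \<le> p + q\<close> contribute to the coefficient of
  \<open>x\<^sup>p y\<^sup>q\<close> and the finite sums below are the full ones.  Both operations are only meaningful, and
  only used, for such series.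
\<close>

definition subst1 :: "'a::comm_ring_1 fps \<Rightarrow> 'a fps2 \<Rightarrow> 'a fps2" where
  "subst1 A g = Abs_fps2 (\<lambda>p q. \<Sum>k\<le>p + q. fps_nth A k * coeff2 (g ^ k) p q)"

definition subst2 :: "'a::comm_ring_1 fps2 \<Rightarrow> 'a fps2 \<times> 'a fps2 \<Rightarrow> 'a fps2" where
  "subst2 f G = Abs_fps2 (\<lambda>p q. \<Sum>i\<le>p + q. \<Sum>j\<le>p + q.
     coeff2 f i j * coeff2 (fst G ^ i * snd G ^ j) p q)"

type_synonym formal_map = "real fps2 \<times> real fps2"

definition fm_id :: formal_map where
  "fm_id = (X2, Y2)"

definition fm_comp :: "formal_map \<Rightarrow> formal_map \<Rightarrow> formal_map" (infixl \<open>\<circ>\<^sub>f\<close> 55) where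
  "F \<circ>\<^sub>f G = (subst2 (fst F) G, subst2 (snd F) G)"

definition fm_linear :: "real^2^2 \<Rightarrow> formal_map" where
  "fm_linear M = (const2 (M$1$1) * X2 + const2 (M$1$2) * Y2,
                  const2 (M$2$1) * X2 + const2 (M$2$2) * Y2)"

definition no_constant_term :: "formal_map \<Rightarrow> bool" where
  "no_constant_term F \<longleftrightarrow> coeff2 (fst F) 0 0 = 0 \<and> coeff2 (snd F) 0 0 = 0"

definition fm_jacobian :: "formal_map \<Rightarrow> real fps2" where
  "fm_jacobian F = dx2 (fst F) * dy2 (snd F) - dy2 (fst F) * dx2 (snd F)"

definition fm_invertible :: "formal_map \<Rightarrow> bool" where
  "fm_invertible F \<longleftrightarrow>
     (\<exists>G. no_constant_term G \<and> F \<circ>\<^sub>f G = fm_id \<and> G \<circ>\<^sub>f F = fm_id)"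

definition formal_canonical :: "formal_map \<Rightarrow> bool" where
  "formal_canonical F \<longleftrightarrow> no_constant_term F \<and> fm_invertible F \<and> fm_jacobian F = 1"

text \<open>
  \<open>\<Phi>\<close> is the formal flow of \<open>x' = \<partial>H/\<partial>y\<close>, \<open>y' = - \<partial>H/\<partial>x\<close>: the differential equation
  is required coefficient by coefficient in the formal variables.
\<close>

definition formal_hamiltonian_flow :: "real fps2 \<Rightarrow> (real \<Rightarrow> formal_map) \<Rightarrow> bool" where
  "formal_hamiltonian_flow H \<Phi> \<longleftrightarrow>
     \<Phi> 0 = fm_id \<and> (\<forall>t. no_constant_term (\<Phi> t)) \<and>
     (\<forall>t i j.
        ((\<lambda>s. coeff2 (fst (\<Phi> s)) i j) has_real_derivative
            coeff2 (subst2 (dy2 H) (\<Phi> t)) i j) (at t) \<and>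
        ((\<lambda>s. coeff2 (snd (\<Phi> s)) i j) has_real_derivative
            coeff2 (subst2 (- dx2 H) (\<Phi> t)) i j) (at t))"

text \<open>\<open>I = z \<zeta> / 2 = (x\<^sup>2 + y\<^sup>2) / 2\<close>, where \<open>\<zeta>\<close> is the conjugate of \<open>z = x + \<i> y\<close>.\<close>

definition action_I :: "real fps2" where
  "action_I = const2 (1/2) * (X2 ^ 2 + Y2 ^ 2)"

text \<open>\<open>I\<^bsup>n/2\<^esup> cos (n \<phi>) = 2\<^bsup>-n/2\<^esup> Re (z\<^sup>n)\<close>; the real part is taken coefficientwise in \<open>(x, y)\<close>.\<close>

definition resonant_term :: "nat \<Rightarrow> real fps2" where
  "resonant_term n = const2 (2 powr (- real n / 2)) *
     Abs_fps2 (\<lambda>i j. Re (coeff2 ((X2 + const2 \<i> * Y2) ^ n) i j))"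

definition normal_form_hamiltonian :: "nat \<Rightarrow> real fps \<Rightarrow> real fps \<Rightarrow> real fps2" where
  "normal_form_hamiltonian n A B =
     action_I ^ 3 * subst1 A action_I + resonant_term n * subst1 B action_I"

definition has_power_series_at :: "(real^2 \<Rightarrow> real) \<Rightarrow> real fps2 \<Rightarrow> real^2 \<Rightarrow> bool" where
  "has_power_series_at f c p \<longleftrightarrow>
     (\<exists>r>0. \<forall>u v. \<bar>u\<bar> < r \<and> \<bar>v\<bar> < r \<longrightarrow>
        ((\<lambda>(i, j). coeff2 c i j * u ^ i * v ^ j) has_sum f (p + vector [u, v])) UNIV)"

definition has_taylor_map_at :: "(real^2 \<Rightarrow> real^2) \<Rightarrow> formal_map \<Rightarrow> real^2 \<Rightarrow> bool" where
  "has_taylor_map_at F T p \<longleftrightarrow>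
     has_power_series_at (\<lambda>q. F q $ 1) (fst T) p \<and> has_power_series_at (\<lambda>q. F q $ 2) (snd T) p"

definition real_analytic_map_on :: "(real^2 \<Rightarrow> real^2) \<Rightarrow> (real^2) set \<Rightarrow> bool" where
  "real_analytic_map_on F U \<longleftrightarrow> (\<forall>p\<in>U. \<exists>T. has_taylor_map_at F T p)"

text \<open>Area and orientation are both preserved, i.e. \<open>F\<close> pulls \<open>dx \<and> dy\<close> back to itself.\<close>

definition area_orientation_preserving_on :: "(real^2 \<Rightarrow> real^2) \<Rightarrow> (real^2) set \<Rightarrow> bool" where
  "area_orientation_preserving_on F U \<longleftrightarrow>
     (\<forall>p\<in>U. F differentiable (at p) \<and> det (matrix (frechet_derivative F (at p))) = 1)"

definition plane_rotation :: "real \<Rightarrow> real^2^2" where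
  "plane_rotation \<alpha> = vector [vector [cos \<alpha>, - sin \<alpha>], vector [sin \<alpha>, cos \<alpha>]]"

definition in_complex_coordinate :: "(real^2 \<Rightarrow> real^2) \<Rightarrow> complex \<Rightarrow> complex" where
  "in_complex_coordinate F z =
     (let w = F (vector [Re z, Im z]) in Complex (w $ 1) (w $ 2))"

end

theory Submission imports Defs begin

text \<open>
  A formal map \<open>F\<close> is replaced by its pull-back \<open>f \<mapsto> subst2 f F\<close>, a filtered automorphism of the
  ring of formal series preserving the Poisson bracket; the time-one map of \<open>H\<close> becomes
  \<open>exp {\<sqdot>, H}\<close>.  Since the rotation has finite order, averaging over it solves the linear
  homological equation order by order and brings the map to the form rotation \<open>\<circ>\<close> time-one map of
  a Hamiltonian commuting with the rotation; such a Hamiltonian is a series in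
  \<open>z\<^sup>j \<zeta>\<^sup>k\<close> with \<open>n\<close> dividing \<open>j - k\<close>, where \<open>\<zeta>\<close> is the conjugate of \<open>z\<close>.

  The Hamiltonian is then simplified by rotation-invariant changes of variables, order by order
  with respect to a quasi-homogeneous weight for which its leading part is
  \<open>\<alpha> (z \<zeta>)\<^sup>3 + \<beta> (z\<^sup>n + \<zeta>\<^sup>n)\<close>, or only \<open>\<beta> (z\<^sup>n + \<zeta>\<^sup>n)\<close> if \<open>n = 5\<close>.  In a fixed weight, the bracket
  with the leading part acts on the coefficients of the harmonics \<open>z\<^sup>n\<^sup>m\<close> as a three-term operator
  which can be inverted downwards in \<open>m\<close>.  Its kernel consists of the leading parts of the powers
  of the Hamiltonian, and the one remaining free parameter removes exactly the coefficients which
  vanish in the normal form.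

  Uniqueness: a conjugacy of two normal forms conjugates their \<open>n\<close>-th iterates, hence carries one
  Hamiltonian to the other and commutes with the rotation; it is a rotation followed by
  the time-one map of an invariant Hamiltonian, and the kernel computation shows that the latter
  is a series in the normal form itself.
\<close>

section \<open>Formal series in two variables\<close>

text \<open>The congruences on the coefficients come from the powers of the Hamiltonian
  \<open>G\<close> itself. Solving for a generator downwards in m, every unknown is fixed by the
  equation of the next higher harmonic, except a top unknown that is a pure power of z. Such an
  unknown exists only in the weights \<open>tau n * M\<close>, and it leaves one complex parameter.
  Its real part corresponds to \<open>G ^ M\<close>, which commutes with \<open>G\<close>; its
  imaginary part is spent on one further coefficient. For \<open>n \<ge> 6\<close> this is the
  coefficient of z^n (z \<zeta>)^p with p + 1 = 3 M, hence an index 2 modulo 3. For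
  \<open>n = 5\<close> the weight equation 2 (p + 1) = 5 M gives an index 4 modulo 5 when M is even;
  when M is odd it has no solution, and the coefficient of (z \<zeta>)^p with 2 p = 5 M + 3 takes
  its place, whose index in the series of I is p - 3, hence 1 modulo 5. The obstacle is that the
  homogeneous solution of the recursion might vanish at its lower end, where the parameter has to
  act; a sign argument excludes this.\<close>

lemma coeff2_Abs_fps2 [simp]: "coeff2 (Abs_fps2 c) i j = c i j"
  by (simp add: coeff2_def Abs_fps2_def)

lemma fps2_eqI: "(\<And>i j. coeff2 f i j = coeff2 g i j) \<Longrightarrow> f = g"
  by (simp add: coeff2_def fps_eq_iff)

lemma coeff2_add [simp]: "coeff2 (f + g) i j = coeff2 f i j + coeff2 g i j"
  and coeff2_0 [simp]: "coeff2 0 i j = 0"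
  by (simp_all add: coeff2_def)

lemma coeff2_diff [simp]: "coeff2 (f - g) i j = coeff2 f i j - coeff2 g i j"
  and coeff2_uminus [simp]: "coeff2 (- f) i j = - coeff2 f i j"
  for f g :: "'a::ab_group_add fps2"
  by (simp_all add: coeff2_def)

lemma coeff2_sum: "coeff2 (\<Sum>x\<in>A. f x) i j = (\<Sum>x\<in>A. coeff2 (f x) i j)"
  by (induction A rule: infinite_finite_induct) auto

lemma coeff2_const2: "coeff2 (const2 c) i j = (if i = 0 \<and> j = 0 then c else 0)"
  by (auto simp: coeff2_def const2_def)

lemma coeff2_1: "coeff2 1 i j = (if i = 0 \<and> j = 0 then 1 else 0)"
  by (auto simp: coeff2_def)

lemma coeff2_mult:
  "coeff2 (f * g) p q = (\<Sum>i\<le>p. \<Sum>j\<le>q. coeff2 f i j * coeff2 g (p - i) (q - j))"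
  by (simp add: coeff2_def fps_mult_nth fps_sum_nth atMost_atLeast0)

lemma coeff2_const2_mult [simp]: "coeff2 (const2 c * f) i j = c * coeff2 f i j"
  by (simp add: coeff2_def const2_def)

lemma coeff2_X2: "coeff2 X2 i j = (if i = 1 \<and> j = 0 then 1 else 0)"
  by (auto simp: coeff2_def X2_def)

lemma coeff2_Y2: "coeff2 Y2 i j = (if i = 0 \<and> j = 1 then 1 else 0)"
  by (auto simp: coeff2_def Y2_def)

lemma coeff2_monom: "coeff2 (X2 ^ a * Y2 ^ b) i j = (if i = a \<and> j = b then 1 else 0)"
  unfolding coeff2_def X2_def Y2_def fps_const_power fps_mult_right_const_nth
  by (simp add: fps_X_power_iff)

lemma coeff2_dx2 [simp]: "coeff2 (dx2 f) i j = of_nat (Suc i) * coeff2 f (Suc i) j"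
  unfolding coeff2_def dx2_def
  by (simp del: of_nat_Suc add: fps_of_nat [symmetric])

lemma coeff2_dy2 [simp]: "coeff2 (dy2 f) i j = of_nat (Suc j) * coeff2 f i (Suc j)"
  unfolding coeff2_def dy2_def by simp

lemma const2_simps:
  "const2 (a + b) = const2 a + const2 b" "const2 (a * b) = const2 a * const2 b"
  "const2 0 = 0" "const2 1 = 1" "const2 (- a) = - const2 a" "const2 (a - b) = const2 a - const2 b"
  by (simp_all add: const2_def fps_const_sub [symmetric] fps_const_neg[symmetric] del: fps_const_sub fps_const_neg)

lemma const2_power: "const2 (a ^ k) = const2 a ^ k"
  by (induction k) (simp_all add: const2_simps)

lemma const2_inject [simp]: "const2 a = const2 b \<longleftrightarrow> a = b"
  by (auto simp: const2_def)

lemma dx2_add [simp]: "dx2 (f + g) = dx2 f + dx2 g"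
  and dy2_add [simp]: "dy2 (f + g) = dy2 f + dy2 g"
  by (rule fps2_eqI; simp add: algebra_simps)+

lemma dx2_uminus [simp]: "dx2 (- f) = - dx2 f"
  and dy2_uminus [simp]: "dy2 (- f) = - dy2 f"
  by (rule fps2_eqI; simp add: algebra_simps)+

lemma dx2_diff [simp]: "dx2 (f - g) = dx2 f - dx2 g"
  and dy2_diff [simp]: "dy2 (f - g) = dy2 f - dy2 g"
  by (rule fps2_eqI; simp add: algebra_simps)+

lemma dx2_const2 [simp]: "dx2 (const2 c) = 0"
  and dy2_const2 [simp]: "dy2 (const2 c) = 0"
  and dx2_X2 [simp]: "dx2 X2 = 1" and dy2_X2 [simp]: "dy2 X2 = 0"
  and dx2_Y2 [simp]: "dx2 Y2 = 0" and dy2_Y2 [simp]: "dy2 Y2 = 1"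
  by (rule fps2_eqI; auto simp: coeff2_const2 coeff2_X2 coeff2_Y2 coeff2_1)+

lemma dx2_mult [simp]: "dx2 (f * g) = dx2 f * g + f * dx2 g"
  by (simp add: dx2_def algebra_simps)

lemma dy2_mult [simp]: "dy2 (f * g) = dy2 f * g + f * dy2 g"
  by (rule fps_ext) (simp add: dy2_def fps_mult_nth fps_deriv_sum sum.distrib add.commute)

lemma dx2_dy2: "dx2 (dy2 f) = dy2 (dx2 f)"
  by (rule fps2_eqI) (simp add: algebra_simps)

section \<open>The filtration by order of vanishing\<close>

definition vord :: "nat \<Rightarrow> 'a::zero fps2 \<Rightarrow> bool" where
  "vord N f \<longleftrightarrow> (\<forall>i j. i + j < N \<longrightarrow> coeff2 f i j = 0)"

lemma vordD: "vord N f \<Longrightarrow> i + j < N \<Longrightarrow> coeff2 f i j = 0"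
  by (simp add: vord_def)

lemma vord_mono: "vord N f \<Longrightarrow> M \<le> N \<Longrightarrow> vord M f"
  by (auto simp: vord_def)

lemma vord_0 [simp]: "vord N 0" and vord_zero [simp]: "vord 0 f"
  by (auto simp: vord_def)

lemma vord_add: "vord N f \<Longrightarrow> vord N g \<Longrightarrow> vord N (f + g)" for f :: "'a::monoid_add fps2"
  by (auto simp: vord_def)

lemma vord_diff: "vord N f \<Longrightarrow> vord N g \<Longrightarrow> vord N (f - g)" for f :: "'a::ab_group_add fps2"
  by (auto simp: vord_def)

lemma vord_uminus [simp]: "vord N (- f) \<longleftrightarrow> vord N f" for f :: "'a::ab_group_add fps2"
  by (auto simp: vord_def)

lemma vord_sum: "(\<And>x. x \<in> A \<Longrightarrow> vord N (f x)) \<Longrightarrow> vord N (\<Sum>x\<in>A. f x)"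
  by (auto simp: vord_def coeff2_sum intro!: sum.neutral)

lemma vord_mult:
  fixes f :: "'a::comm_ring_1 fps2"
  assumes "vord N f" "vord M g"
  shows "vord (N + M) (f * g)"
  unfolding vord_def coeff2_mult
proof (intro allI impI sum.neutral ballI)
  fix p q i j assume "p + q < N + M" "i \<in> {..p}" "j \<in> {..q}"
  then have "i + j < N \<or> (p - i) + (q - j) < M" by auto
  then show "coeff2 f i j * coeff2 g (p - i) (q - j) = 0"
    using assms by (auto simp: vord_def)
qed

lemma vord_mult_left: "vord N f \<Longrightarrow> vord N (f * g)"
  and vord_mult_right: "vord N f \<Longrightarrow> vord N (g * f)"
  for f :: "'a::comm_ring_1 fps2"
  using vord_mult[of N f 0 g] vord_mult[of 0 g N f] by auto

lemma vord_power: "vord N f \<Longrightarrow> vord (k * N) (f ^ k)" for f :: "'a::comm_ring_1 fps2"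
  by (induction k) (auto intro: vord_mult)

lemma vord_dx2: "vord (Suc N) f \<Longrightarrow> vord N (dx2 f)"
  and vord_dy2: "vord (Suc N) f \<Longrightarrow> vord N (dy2 f)"
  by (auto simp: vord_def)

lemma vord_X2 [simp]: "vord (Suc 0) X2" and vord_Y2 [simp]: "vord (Suc 0) Y2"
  by (auto simp: vord_def coeff2_X2 coeff2_Y2)

lemma vord_all: "(\<And>N. vord N f) \<Longrightarrow> f = 0"
  by (rule fps2_eqI) (metis coeff2_0 lessI vordD)

lemma vord_eqI: "(\<And>N. vord N (f - g)) \<Longrightarrow> f = g" for f :: "'a::ab_group_add fps2"
  using vord_all by fastforce

lemma vord_trans: "vord N (f - g) \<Longrightarrow> vord N (g - h) \<Longrightarrow> vord N (f - h)"
  for f :: "'a::ab_group_add fps2"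
  using vord_add by fastforce

lemma vord_commute: "vord N (f - g) \<longleftrightarrow> vord N (g - f)" for f :: "'a::ab_group_add fps2"
  by (metis minus_diff_eq vord_uminus)

lemma vord_diff_iff: "vord N (f - g) \<longleftrightarrow> (\<forall>i j. i + j < N \<longrightarrow> coeff2 f i j = coeff2 g i j)"
  for f :: "'a::ab_group_add fps2"
  by (auto simp: vord_def)

lemma vord_mult_cong:
  fixes f :: "'a::comm_ring_1 fps2"
  assumes "vord N (f - f')" "vord N (g - g')"
  shows "vord N (f * g - f' * g')"
proof -
  have "f * g - f' * g' = (f - f') * g + f' * (g - g')" by (simp add: algebra_simps)
  then show ?thesis using assms by (simp add: vord_add vord_mult_left vord_mult_right)
qed

text \<open>Cuts to the square \<open>i, j < N\<close> instead of to total degree below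
  \<open>N\<close>: both agree modulo order \<open>N\<close>, and the square keeps the two sums
  independent.\<close>

definition trunc2 :: "nat \<Rightarrow> 'a::comm_ring_1 fps2 \<Rightarrow> 'a fps2" where
  "trunc2 N f = (\<Sum>i<N. \<Sum>j<N. const2 (coeff2 f i j) * (X2 ^ i * Y2 ^ j))"

lemma coeff2_trunc2: "coeff2 (trunc2 N f) i j = (if i < N \<and> j < N then coeff2 f i j else 0)"
proof -
  have *: "coeff2 f x y * (if i = x \<and> j = y then 1 else 0) = (if y = j then (if x = i then coeff2 f i j else 0) else 0)" for x y
    by auto
  show ?thesis
    by (simp add: trunc2_def coeff2_sum coeff2_monom *) (cases "j < N"; simp)
qed

lemma vord_trunc2: "vord N (f - trunc2 N f)"
  by (auto simp: vord_def coeff2_trunc2)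

subsection \<open>Filtered homomorphisms\<close>

text \<open>The coefficient map \<open>\<kappa>\<close> makes room for the embedding of real into
  complex series and for complex conjugation. The condition on \<open>vord\<close> is continuity for
  the order filtration; it makes such a map determined by the images of the two variables.\<close>

definition fhom :: "('a::comm_ring_1 \<Rightarrow> 'b::comm_ring_1) \<Rightarrow> ('a fps2 \<Rightarrow> 'b fps2) \<Rightarrow> bool" where
  "fhom \<kappa> \<sigma> \<longleftrightarrow> \<kappa> 1 = 1 \<and> (\<forall>f g. \<sigma> (f + g) = \<sigma> f + \<sigma> g) \<and> (\<forall>f g. \<sigma> (f * g) = \<sigma> f * \<sigma> g) \<and>
     (\<forall>c. \<sigma> (const2 c) = const2 (\<kappa> c)) \<and> (\<forall>N f. vord N f \<longrightarrow> vord N (\<sigma> f))"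

context
  fixes \<kappa> :: "'a::comm_ring_1 \<Rightarrow> 'b::comm_ring_1" and \<sigma>
  assumes \<sigma>: "fhom \<kappa> \<sigma>"
begin

lemma fhom_add: "\<sigma> (f + g) = \<sigma> f + \<sigma> g"
  and fhom_mult: "\<sigma> (f * g) = \<sigma> f * \<sigma> g"
  and fhom_const2: "\<sigma> (const2 c) = const2 (\<kappa> c)"
  and fhom_vord: "vord N f \<Longrightarrow> vord N (\<sigma> f)"
  and fhom_kappa_1: "\<kappa> 1 = 1"
  using \<sigma> by (auto simp: fhom_def)

lemma fhom_0: "\<sigma> 0 = 0"
  by (metis add_cancel_left_left fhom_add)

lemma fhom_1: "\<sigma> 1 = 1"
  using fhom_const2[of 1] by (simp add: fhom_kappa_1 const2_simps)

lemma fhom_uminus: "\<sigma> (- f) = - \<sigma> f"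
  by (metis add.right_inverse add_eq_0_iff fhom_0 fhom_add)

lemma fhom_diff: "\<sigma> (f - g) = \<sigma> f - \<sigma> g"
  by (metis diff_conv_add_uminus fhom_add fhom_uminus)

lemma fhom_sum: "\<sigma> (\<Sum>x\<in>A. f x) = (\<Sum>x\<in>A. \<sigma> (f x))"
  by (induction A rule: infinite_finite_induct) (auto simp: fhom_0 fhom_add)

lemma fhom_power: "\<sigma> (f ^ k) = \<sigma> f ^ k"
  by (induction k) (auto simp: fhom_1 fhom_mult)

lemma fhom_vord_diff: "vord N (f - g) \<Longrightarrow> vord N (\<sigma> f - \<sigma> g)"
  by (metis fhom_diff fhom_vord)

lemma fhom_vord_X2: "vord (Suc 0) (\<sigma> X2)" and fhom_vord_Y2: "vord (Suc 0) (\<sigma> Y2)"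
  by (simp_all add: fhom_vord)

lemma fhom_kappa_add: "\<kappa> (a + b) = \<kappa> a + \<kappa> b"
  by (metis const2_inject const2_simps(1) fhom_add fhom_const2)

lemma fhom_kappa_mult: "\<kappa> (a * b) = \<kappa> a * \<kappa> b"
  by (metis const2_inject const2_simps(2) fhom_mult fhom_const2)

lemma fhom_kappa_of_nat: "\<kappa> (of_nat k) = of_nat k"
proof (induction k)
  case 0
  show ?case by (metis add_cancel_left_left fhom_kappa_add of_nat_0)
qed (simp add: fhom_kappa_add fhom_kappa_1)

lemma fhom_trunc2: "vord N (\<sigma> f - (\<Sum>i<N. \<Sum>j<N. const2 (\<kappa> (coeff2 f i j)) * (\<sigma> X2 ^ i * \<sigma> Y2 ^ j)))"
  using fhom_vord_diff[OF vord_trunc2[of N f]]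
  by (simp add: trunc2_def fhom_sum fhom_mult fhom_power fhom_const2)

end

text \<open>Modulo order \<open>N\<close> every series is a polynomial in the variables, and
  filtered maps respect congruence modulo order \<open>N\<close>.\<close>

lemma fhom_ext:
  assumes "fhom \<kappa> \<sigma>" "fhom \<kappa> \<tau>" "\<sigma> X2 = \<tau> X2" "\<sigma> Y2 = \<tau> Y2"
  shows "\<sigma> f = \<tau> f"
proof (rule vord_eqI)
  fix N
  show "vord N (\<sigma> f - \<tau> f)"
    using vord_diff[OF fhom_trunc2[OF assms(1), of N f] fhom_trunc2[OF assms(2), of N f]]
    by (simp add: assms(3,4))
qed

lemma fhom_comp: "fhom \<kappa> \<sigma> \<Longrightarrow> fhom \<kappa>' \<tau> \<Longrightarrow> fhom (\<lambda>c. \<kappa>' (\<kappa> c)) (\<lambda>f. \<tau> (\<sigma> f))"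
  by (simp (no_asm) add: fhom_def) (simp add: fhom_add fhom_mult fhom_const2 fhom_vord fhom_kappa_1)

lemma fhom_id: "fhom (\<lambda>c. c) (\<lambda>f. f)"
  by (auto simp: fhom_def)

text \<open>Density of polynomials again, now for a derivation along \<open>\<sigma>\<close>. Taking
  for \<open>D\<close> the difference of the two sides of the chain rule reduces that rule to the
  two variables; the loss of one order in \<open>ord\<close> is that of a partial derivative, and
  truncating at \<open>Suc N\<close> makes up for it.\<close>

lemma fhom_twisted_derivation_ext:
  assumes \<sigma>: "fhom \<kappa> \<sigma>"
    and add: "\<And>f g. D (f + g) = D f + D g"
    and mult: "\<And>f g. D (f * g) = D f * \<sigma> g + \<sigma> f * D g"
    and const: "\<And>c. D (const2 c) = 0" and X: "D X2 = 0" and Y: "D Y2 = 0"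
    and ord: "\<And>N f. vord (Suc N) f \<Longrightarrow> vord N (D f)"
  shows "D f = (0 :: 'b::comm_ring_1 fps2)"
proof (rule vord_all)
  fix N
  have pw: "D (g ^ k) = 0" if "D g = 0" for g k
  proof (induction k)
    case 0
    show ?case using const[of 1] by (simp add: const2_simps)
  qed (simp add: mult that)
  have sum: "D (sum g A) = (\<Sum>x\<in>A. D (g x))" for g and A :: "nat set"
  proof (induction A rule: infinite_finite_induct)
    case empty
    show ?case using const[of 0] by (simp add: const2_simps)
  next
    case (infinite A)
    then show ?case using const[of 0] by (simp add: const2_simps)
  qed (simp add: add)
  have "D (trunc2 (Suc N) f) = 0"
    by (simp add: trunc2_def sum mult const pw X Y del: sum.lessThan_Suc)
  moreover have "D f = D (f - trunc2 (Suc N) f) + D (trunc2 (Suc N) f)"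
    by (simp flip: add)
  ultimately show "vord N (D f)"
    using ord[OF vord_trunc2, of N f] by simp
qed

subsection \<open>Substitution\<close>

lemma vord_monom_subst:
  fixes G :: "'a::comm_ring_1 fps2 \<times> 'a fps2"
  assumes "vord (Suc 0) (fst G)" "vord (Suc 0) (snd G)"
  shows "vord (i + j) (fst G ^ i * snd G ^ j)"
  using vord_mult[OF vord_power[OF assms(1), of i] vord_power[OF assms(2), of j]] by simp

text \<open>The range of summation in \<open>subst2\<close> depends on the coefficient. Enlarging it
  adds only powers of too high an order, so one bound \<open>N\<close> serves all coefficients of
  degree below \<open>N\<close>, and substitution becomes congruent to a polynomial expression in
  \<open>G\<close>.\<close>

lemma coeff2_subst2:
  assumes "vord (Suc 0) (fst G)" "vord (Suc 0) (snd G)" "p + q < N"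
  shows "coeff2 (subst2 f G) p q =
    coeff2 (\<Sum>i<N. \<Sum>j<N. const2 (coeff2 f i j) * (fst G ^ i * snd G ^ j)) p q"
proof -
  have z: "coeff2 (fst G ^ i * snd G ^ j) p q = 0" if "p + q < i + j" for i j
    using vord_monom_subst[OF assms(1,2), of i j] that by (simp add: vord_def)
  have "(\<Sum>j<N. coeff2 f i j * coeff2 (fst G ^ i * snd G ^ j) p q) =
     (\<Sum>j\<le>p+q. coeff2 f i j * coeff2 (fst G ^ i * snd G ^ j) p q)" for i
    using assms(3) by (intro sum.mono_neutral_right) (auto simp: z)
  then have "(\<Sum>i<N. \<Sum>j<N. coeff2 f i j * coeff2 (fst G ^ i * snd G ^ j) p q) =
     (\<Sum>i<N. \<Sum>j\<le>p+q. coeff2 f i j * coeff2 (fst G ^ i * snd G ^ j) p q)" by simp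
  also have "\<dots> = (\<Sum>i\<le>p+q. \<Sum>j\<le>p+q. coeff2 f i j * coeff2 (fst G ^ i * snd G ^ j) p q)"
    using assms(3) by (intro sum.mono_neutral_right) (auto intro!: sum.neutral simp: z)
  finally show ?thesis by (simp add: subst2_def coeff2_sum)
qed

lemma vord_subst2_sum:
  assumes "vord (Suc 0) (fst G)" "vord (Suc 0) (snd G)" "N \<le> M"
  shows "vord N (subst2 f G - (\<Sum>i<M. \<Sum>j<M. const2 (coeff2 f i j) * (fst G ^ i * snd G ^ j)))"
  unfolding vord_diff_iff
proof (intro allI impI)
  fix i j assume "i + j < N"
  then have "i + j < M" using assms(3) by simp
  then show "coeff2 (subst2 f G) i j =
    coeff2 (\<Sum>i<M. \<Sum>j<M. const2 (coeff2 f i j) * (fst G ^ i * snd G ^ j)) i j"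
    by (rule coeff2_subst2[OF assms(1,2)])
qed

lemma subst2_add: "subst2 (f + g) G = subst2 f G + subst2 g G"
  by (rule fps2_eqI) (simp add: subst2_def sum.distrib algebra_simps)

lemma subst2_diff: "subst2 (f - g) G = subst2 f G - subst2 g G"
  by (rule fps2_eqI) (simp add: subst2_def sum_subtractf algebra_simps)

lemma subst2_vord:
  assumes "vord (Suc 0) (fst G)" "vord (Suc 0) (snd G)" "vord N f"
  shows "vord N (subst2 f G)"
proof -
  have "vord N (const2 (coeff2 f i j) * (fst G ^ i * snd G ^ j))" for i j
  proof (cases "i + j < N")
    case True
    then show ?thesis using assms(3) by (simp add: vordD const2_simps)
  next
    case False
    then show ?thesis using vord_monom_subst[OF assms(1,2), of i j]
      by (meson not_less vord_mono vord_mult_right)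
  qed
  then have "vord N (\<Sum>i<N. \<Sum>j<N. const2 (coeff2 f i j) * (fst G ^ i * snd G ^ j))"
    by (intro vord_sum)
  from vord_add[OF vord_subst2_sum[OF assms(1,2) order.refl, of N f] this]
  show ?thesis by simp
qed

lemma subst2_monom:
  assumes "vord (Suc 0) (fst G)" "vord (Suc 0) (snd G)"
  shows "subst2 (const2 c * (X2 ^ a * Y2 ^ b)) G = const2 c * (fst G ^ a * snd G ^ b)"
proof (rule vord_eqI)
  fix N
  define M where "M = N + a + b + 1"
  have *: "const2 (coeff2 (const2 c * (X2 ^ a * Y2 ^ b)) i j) * (fst G ^ i * snd G ^ j) =
    (if i = a then (if j = b then const2 c * (fst G ^ a * snd G ^ b) else 0) else 0)" for i j
    by (auto simp: coeff2_monom const2_simps)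
  have "(\<Sum>i<M. \<Sum>j<M. const2 (coeff2 (const2 c * (X2 ^ a * Y2 ^ b)) i j) * (fst G ^ i * snd G ^ j)) =
     (\<Sum>i<M. if i = a then const2 c * (fst G ^ a * snd G ^ b) else 0)"
    unfolding * by (intro sum.cong) (auto simp: M_def)
  also have "\<dots> = const2 c * (fst G ^ a * snd G ^ b)"
    by (simp add: M_def)
  finally show "vord N (subst2 (const2 c * (X2 ^ a * Y2 ^ b)) G - const2 c * (fst G ^ a * snd G ^ b))"
    using vord_subst2_sum[OF assms, of N M "const2 c * (X2 ^ a * Y2 ^ b)"]
    by (simp add: M_def)
qed

lemma subst2_sum: "subst2 (\<Sum>x\<in>A. f x) G = (\<Sum>x\<in>A. subst2 (f x) G)"
proof (induction A rule: infinite_finite_induct)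
  case (infinite A)
  then show ?case by (auto intro!: fps2_eqI simp: subst2_def)
next
  case empty
  then show ?case by (auto intro!: fps2_eqI simp: subst2_def)
qed (simp add: subst2_add)

text \<open>Evident for monomials, hence for truncations by bilinearity, hence modulo every order by
  continuity.\<close>

lemma subst2_mult:
  assumes G: "vord (Suc 0) (fst G)" "vord (Suc 0) (snd G)"
  shows "subst2 (f * g) G = subst2 f G * subst2 g G"
proof (rule vord_eqI)
  fix N
  have mono: "subst2 (const2 c * (X2 ^ a * Y2 ^ b) * (const2 c' * (X2 ^ a' * Y2 ^ b'))) G =
     subst2 (const2 c * (X2 ^ a * Y2 ^ b)) G * subst2 (const2 c' * (X2 ^ a' * Y2 ^ b')) G"
    for c c' a a' b b'
  proof -
    have "const2 c * (X2 ^ a * Y2 ^ b) * (const2 c' * (X2 ^ a' * Y2 ^ b')) =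
      const2 (c * c') * (X2 ^ (a + a') * Y2 ^ (b + b'))"
      by (simp add: const2_simps power_add algebra_simps)
    then show ?thesis
      by (simp only: subst2_monom[OF G]) (simp add: const2_simps power_add algebra_simps)
  qed
  let ?f = "trunc2 N f" and ?g = "trunc2 N g"
  have eq: "subst2 (?f * ?g) G = subst2 ?f G * subst2 ?g G"
    unfolding trunc2_def by (simp only: sum_distrib_left sum_distrib_right subst2_sum mono)
  have "vord N (subst2 (f * g) G - subst2 (?f * ?g) G)"
    unfolding subst2_diff[symmetric]
    by (intro subst2_vord G vord_mult_cong vord_trunc2)
  moreover have "vord N (subst2 ?f G * subst2 ?g G - subst2 f G * subst2 g G)"
    by (intro vord_mult_cong; unfold subst2_diff[symmetric]; intro subst2_vord G;
      metis vord_commute vord_trunc2)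
  ultimately show "vord N (subst2 (f * g) G - subst2 f G * subst2 g G)"
    unfolding eq by (rule vord_trans)
qed

lemma subst2_const2 [simp]:
  assumes "vord (Suc 0) (fst G)" "vord (Suc 0) (snd G)"
  shows "subst2 (const2 c) G = const2 c"
  using subst2_monom[OF assms, of c 0 0] by simp

lemma subst2_X2 [simp]:
  assumes "vord (Suc 0) (fst G)" "vord (Suc 0) (snd G)"
  shows "subst2 X2 G = fst G" "subst2 Y2 G = snd G"
  using subst2_monom[OF assms, of 1 1 0] subst2_monom[OF assms, of 1 0 1] by (simp_all add: const2_simps)

lemma fhom_subst2:
  assumes "vord (Suc 0) (fst G)" "vord (Suc 0) (snd G)"
  shows "fhom (\<lambda>c. c) (\<lambda>f. subst2 f G)"
  using assms by (auto simp: fhom_def subst2_add subst2_mult subst2_vord)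

text \<open>Filtered homomorphisms fixing the scalars are the same as substitutions; this is the
  bridge between operators and formal maps.\<close>

lemma subst2_fhom:
  assumes "fhom (\<lambda>c. c) \<sigma>"
  shows "subst2 f (\<sigma> X2, \<sigma> Y2) = \<sigma> f"
proof -
  have v: "vord (Suc 0) (fst (\<sigma> X2, \<sigma> Y2))" "vord (Suc 0) (snd (\<sigma> X2, \<sigma> Y2))"
    using fhom_vord_X2[OF assms] fhom_vord_Y2[OF assms] by auto
  show ?thesis
    by (rule fhom_ext[OF fhom_subst2[OF v] assms]) (use v in simp_all)
qed

subsection \<open>The Poisson bracket\<close>

text \<open>The sign fits the flow convention: \<open>pb X2 H\<close> and \<open>pb Y2 H\<close> are
  the components of the Hamiltonian vector field, so \<open>pb f H\<close> is the derivative of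
  \<open>f\<close> along the flow.\<close>

definition pb :: "'a::comm_ring_1 fps2 \<Rightarrow> 'a fps2 \<Rightarrow> 'a fps2" where
  "pb f g = dx2 f * dy2 g - dy2 f * dx2 g"

lemma pb_add_left: "pb (f + g) h = pb f h + pb g h"
  and pb_add_right: "pb h (f + g) = pb h f + pb h g"
  and pb_diff_left: "pb (f - g) h = pb f h - pb g h"
  and pb_diff_right: "pb h (f - g) = pb h f - pb h g"
  and pb_uminus_left: "pb (- f) h = - pb f h"
  and pb_uminus_right: "pb h (- f) = - pb h f"
  and pb_mult_left: "pb (f * g) h = pb f h * g + f * pb g h"
  and pb_mult_right: "pb h (f * g) = pb h f * g + f * pb h g"
  and pb_commute: "pb f g = - pb g f"
  and pb_self [simp]: "pb f f = 0"
  and pb_const2_left [simp]: "pb (const2 c) f = 0"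
  and pb_const2_right [simp]: "pb f (const2 c) = 0"
  by (simp_all add: pb_def algebra_simps)

lemma pb_0_left [simp]: "pb 0 h = 0" and pb_0_right [simp]: "pb h 0 = 0"
  using pb_const2_left[of 0 h] pb_const2_right[of h 0] by (simp_all add: const2_simps)

lemma pb_scale_left: "pb (const2 c * f) h = const2 c * pb f h"
  and pb_scale_right: "pb h (const2 c * f) = const2 c * pb h f"
  by (simp_all add: pb_mult_left pb_mult_right)

lemma pb_sum_left: "pb (\<Sum>x\<in>A. f x) h = (\<Sum>x\<in>A. pb (f x) h)"
  and pb_sum_right: "pb h (\<Sum>x\<in>A. f x) = (\<Sum>x\<in>A. pb h (f x))"
  by (induction A rule: infinite_finite_induct; simp add: pb_add_left pb_add_right)+

lemma pb_X2_left: "pb X2 h = dy2 h" and pb_Y2_left: "pb Y2 h = - dx2 h"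
  by (simp_all add: pb_def)

lemma pb_jacobi: "pb (pb f g) h = pb (pb f h) g + pb f (pb g h)"
  by (simp add: pb_def dx2_dy2 algebra_simps)

lemma fm_jacobian_pb: "fm_jacobian F = pb (fst F) (snd F)"
  by (simp add: fm_jacobian_def pb_def)

lemma fhom_dx2:
  assumes \<sigma>: "fhom \<kappa> \<sigma>"
  shows "dx2 (\<sigma> f) = \<sigma> (dx2 f) * dx2 (\<sigma> X2) + \<sigma> (dy2 f) * dx2 (\<sigma> Y2)"
proof -
  have "dx2 (\<sigma> f) - (\<sigma> (dx2 f) * dx2 (\<sigma> X2) + \<sigma> (dy2 f) * dx2 (\<sigma> Y2)) = 0"
    by (rule fhom_twisted_derivation_ext[OF \<sigma>, where D = "\<lambda>f. dx2 (\<sigma> f) - (\<sigma> (dx2 f) * dx2 (\<sigma> X2) + \<sigma> (dy2 f) * dx2 (\<sigma> Y2))"])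
      (simp_all add: fhom_add[OF \<sigma>] fhom_mult[OF \<sigma>] fhom_const2[OF \<sigma>] fhom_0[OF \<sigma>] fhom_1[OF \<sigma>]
        algebra_simps vord_diff vord_dx2 vord_dy2 vord_add vord_mult_left vord_mult_right fhom_vord[OF \<sigma>])
  then show ?thesis by simp
qed

lemma fhom_dy2:
  assumes \<sigma>: "fhom \<kappa> \<sigma>"
  shows "dy2 (\<sigma> f) = \<sigma> (dx2 f) * dy2 (\<sigma> X2) + \<sigma> (dy2 f) * dy2 (\<sigma> Y2)"
proof -
  have "dy2 (\<sigma> f) - (\<sigma> (dx2 f) * dy2 (\<sigma> X2) + \<sigma> (dy2 f) * dy2 (\<sigma> Y2)) = 0"
    by (rule fhom_twisted_derivation_ext[OF \<sigma>, where D = "\<lambda>f. dy2 (\<sigma> f) - (\<sigma> (dx2 f) * dy2 (\<sigma> X2) + \<sigma> (dy2 f) * dy2 (\<sigma> Y2))"])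
      (simp_all add: fhom_add[OF \<sigma>] fhom_mult[OF \<sigma>] fhom_const2[OF \<sigma>] fhom_0[OF \<sigma>] fhom_1[OF \<sigma>]
        algebra_simps vord_diff vord_dx2 vord_dy2 vord_add vord_mult_left vord_mult_right fhom_vord[OF \<sigma>])
  then show ?thesis by simp
qed

text \<open>Multiplicativity of determinants in the chain rule: the last factor is the Jacobian, so
  a pull-back preserves all brackets as soon as it does so on the two variables.\<close>

lemma fhom_pb:
  assumes \<sigma>: "fhom \<kappa> \<sigma>"
  shows "pb (\<sigma> f) (\<sigma> g) = \<sigma> (pb f g) * pb (\<sigma> X2) (\<sigma> Y2)"
  unfolding pb_def[of "\<sigma> f"]
  by (subst (1 2) fhom_dx2[OF \<sigma>], subst (1 2) fhom_dy2[OF \<sigma>])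
    (simp add: pb_def fhom_diff[OF \<sigma>] fhom_mult[OF \<sigma>] algebra_simps)

text \<open>Summing up to \<open>Suc p\<close> and \<open>Suc q\<close> adds only terms with a zero
  factor, and in this form both products of partial derivatives range over the same
  exponents.\<close>

lemma coeff2_pb:
  "coeff2 (pb f g) p q = (\<Sum>i\<le>Suc p. \<Sum>j\<le>Suc q.
     (of_nat i * of_nat (Suc q - j) - of_nat j * of_nat (Suc p - i)) *
       (coeff2 f i j * coeff2 g (Suc p - i) (Suc q - j)))"
proof -
  have 1: "coeff2 (dx2 f * dy2 g) p q = (\<Sum>i\<le>Suc p. \<Sum>j\<le>Suc q.
     of_nat i * of_nat (Suc q - j) * (coeff2 f i j * coeff2 g (Suc p - i) (Suc q - j)))"
  proof -
    have "(\<Sum>j\<le>Suc q. of_nat i * of_nat (Suc q - j) * (coeff2 f i j * coeff2 g (Suc p - i) (Suc q - j)))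
      = (\<Sum>j\<le>q. of_nat i * of_nat (Suc q - j) * (coeff2 f i j * coeff2 g (Suc p - i) (Suc q - j)))" for i
      by simp
    then show ?thesis
      by (simp add: coeff2_mult sum.atMost_Suc_shift[of _ p] Suc_diff_le algebra_simps del: of_nat_Suc sum.atMost_Suc)
  qed
  have 2: "coeff2 (dy2 f * dx2 g) p q = (\<Sum>i\<le>Suc p. \<Sum>j\<le>Suc q.
     of_nat j * of_nat (Suc p - i) * (coeff2 f i j * coeff2 g (Suc p - i) (Suc q - j)))"
  proof -
    have eq: "(\<Sum>j\<le>Suc q. of_nat j * of_nat (Suc p - i) * (coeff2 f i j * coeff2 g (Suc p - i) (Suc q - j)))
      = (\<Sum>j\<le>q. of_nat (Suc j) * of_nat (Suc p - i) * (coeff2 f i (Suc j) * coeff2 g (Suc p - i) (q - j)))" for i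
      by (simp add: sum.atMost_Suc_shift del: of_nat_Suc sum.atMost_Suc)
    have "(\<Sum>i\<le>Suc p. \<Sum>j\<le>Suc q. of_nat j * of_nat (Suc p - i) * (coeff2 f i j * coeff2 g (Suc p - i) (Suc q - j)))
      = (\<Sum>i\<le>p. \<Sum>j\<le>q. of_nat (Suc j) * of_nat (Suc p - i) * (coeff2 f i (Suc j) * coeff2 g (Suc p - i) (q - j)))"
      unfolding eq by simp
    also have "\<dots> = coeff2 (dy2 f * dx2 g) p q"
      unfolding coeff2_mult
      by (intro sum.cong refl) (simp add: Suc_diff_le mult_ac del: of_nat_Suc)
    finally show ?thesis ..
  qed
  show ?thesis
    unfolding pb_def coeff2_diff 1 2
    by (simp add: sum_subtractf[symmetric] left_diff_distrib del: sum.atMost_Suc)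
qed

section \<open>Exponentials of Hamiltonian derivations\<close>

definition adp :: "'a::comm_ring_1 fps2 \<Rightarrow> nat \<Rightarrow> 'a fps2 \<Rightarrow> 'a fps2" where
  "adp H k f = ((\<lambda>g. pb g H) ^^ k) f"

lemma adp_0 [simp]: "adp H 0 f = f"
  and adp_Suc: "adp H (Suc k) f = pb (adp H k f) H"
  by (simp_all add: adp_def)

lemma adp_Suc2: "adp H (Suc k) f = adp H k (pb f H)"
  by (simp add: adp_def funpow_swap1[of "\<lambda>g. pb g H"])

lemma adp_1 [simp]: "adp H (Suc 0) f = pb f H"
  by (simp add: adp_Suc)

lemma adp_add: "adp H (i + j) f = adp H i (adp H j f)"
  by (simp add: adp_def funpow_add)

lemma adp_plus: "adp H k (f + g) = adp H k f + adp H k g"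
  by (induction k) (simp_all add: adp_Suc pb_add_left)

lemma adp_zero [simp]: "adp H k 0 = 0"
  by (induction k) (simp_all add: adp_Suc)

lemma adp_scale: "adp H k (const2 c * f) = const2 c * adp H k f"
  by (induction k) (simp_all add: adp_Suc pb_scale_left)

lemma adp_sum: "adp H k (\<Sum>x\<in>A. f x) = (\<Sum>x\<in>A. adp H k (f x))"
  by (induction k) (simp_all add: adp_Suc pb_sum_left)

lemma adp_scale_H: "adp (const2 s * H) k f = const2 (s ^ k) * adp H k f"
  by (induction k) (simp_all add: adp_Suc pb_scale_left pb_scale_right const2_simps mult_ac(1) mult.left_commute)

lemma vord_pb:
  assumes "vord a f" "vord (b + 2) g"
  shows "vord (a + b) (pb f g)"
proof (cases a)
  case 0
  have "vord (Suc b) (dx2 g)" "vord (Suc b) (dy2 g)"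
    using assms(2) by (auto intro: vord_dx2 vord_dy2)
  then have "vord b (dx2 g)" "vord b (dy2 g)" by (auto elim: vord_mono)
  then show ?thesis by (simp add: pb_def 0 vord_diff vord_mult_right)
next
  case (Suc a')
  have "vord (Suc b) (dx2 g)" "vord (Suc b) (dy2 g)"
    using assms(2) by (auto intro: vord_dx2 vord_dy2)
  moreover have "vord a' (dx2 f)" "vord a' (dy2 f)"
    using assms(1) by (auto intro: vord_dx2 vord_dy2 simp: Suc)
  ultimately have "vord (a' + Suc b) (pb f g)"
    unfolding pb_def by (intro vord_diff vord_mult)
  then show ?thesis by (simp add: Suc)
qed

lemma vord_pb': "vord a f \<Longrightarrow> vord b g \<Longrightarrow> vord (a + b - 2) (pb f g)"
proof (cases "b \<ge> 2")
  case True
  assume "vord a f" "vord b g"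
  then show ?thesis using vord_pb[of a f "b - 2" g] True by (simp del: add_2_eq_Suc')
next
  case False
  assume *: "vord a f" "vord b g"
  show ?thesis
  proof (cases "a \<ge> 2")
    case True
    then have "vord (b + (a - 2)) (pb g f)" using vord_pb[of b g "a - 2" f] * by (simp del: add_2_eq_Suc')
    then show ?thesis using True by (subst pb_commute) (simp add: algebra_simps)
  next
    case F: False
    then have "a + b - 2 = 0" using False by simp
    then show ?thesis by simp
  qed
qed

lemma vord_adp: "vord (b + 2) H \<Longrightarrow> vord a f \<Longrightarrow> vord (a + k * b) (adp H k f)"
proof (induction k)
  case (Suc k)
  then show ?case using vord_pb[of "a + k * b" "adp H k f" b H] by (simp add: adp_Suc algebra_simps)
qed simp

text \<open>For \<open>H\<close> of order at least \<open>3\<close> the terms with \<open>k > p + q\<close> do not contribute.\<close>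

definition pexp :: "'a::field_char_0 fps2 \<Rightarrow> 'a fps2 \<Rightarrow> 'a fps2" where
  "pexp H f = Abs_fps2 (\<lambda>p q. \<Sum>k\<le>p + q. coeff2 (adp H k f) p q / fact k)"

lemma vord_adp_3: "vord 3 H \<Longrightarrow> vord k (adp H k f)"
  using vord_adp[of 1 H 0 f k] by (simp add: numeral_3_eq_3)

lemma coeff2_pexp:
  assumes "vord 3 H" "p + q < N"
  shows "coeff2 (pexp H f) p q = (\<Sum>k<N. coeff2 (adp H k f) p q / fact k)"
proof -
  have "(\<Sum>k<N. coeff2 (adp H k f) p q / fact k) = (\<Sum>k\<le>p + q. coeff2 (adp H k f) p q / fact k)"
    using assms(2) by (intro sum.mono_neutral_right) (auto simp: vordD[OF vord_adp_3[OF assms(1)]])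
  then show ?thesis by (simp add: pexp_def)
qed

lemma vord_pexp_sum:
  assumes "vord 3 H" "N \<le> M"
  shows "vord N (pexp H f - (\<Sum>k<M. const2 (1 / fact k) * adp H k f))"
  unfolding vord_diff_iff using assms(2)
  by (auto simp: coeff2_sum coeff2_pexp[OF assms(1), where N = M])

lemma pexp_plus: "pexp H (f + g) = pexp H f + pexp H g"
  by (rule fps2_eqI) (simp add: pexp_def adp_plus sum.distrib add_divide_distrib)

lemma pexp_fixed:
  assumes "pb f H = 0"
  shows "pexp H f = f"
proof (rule fps2_eqI)
  fix p q
  have "coeff2 (adp H (Suc k) f) p q = 0" for k
    by (simp add: adp_Suc2 assms)
  then show "coeff2 (pexp H f) p q = coeff2 f p q"
    by (simp add: pexp_def sum.atMost_shift)
qed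

lemma pexp_const2: "pexp H (const2 c) = const2 c"
  by (rule pexp_fixed) simp

lemma pexp_0: "pexp 0 f = f"
  by (rule pexp_fixed) simp

lemma pexp_vord:
  assumes "vord 3 H" "vord N f"
  shows "vord N (pexp H f)"
proof -
  have "vord N (adp H k f)" for k
    using vord_adp[of 1 H N f k] assms by (auto simp: numeral_3_eq_3 elim: vord_mono)
  then show ?thesis by (auto simp: vord_def pexp_def intro!: sum.neutral)
qed

text \<open>The square minus the triangle consists of the pairs with \<open>i + j \<ge> M\<close>;
  this turns a product of truncated exponential series into a truncated series along
  antidiagonals.\<close>

lemma vord_triangle_sum:
  fixes M :: nat and F :: "nat \<Rightarrow> nat \<Rightarrow> 'a::comm_ring_1 fps2"
  assumes "\<And>i j. i + j \<ge> M \<Longrightarrow> vord N (F i j)"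
  shows "vord N ((\<Sum>i<M. \<Sum>j<M. F i j) - (\<Sum>k<M. \<Sum>i\<le>k. F i (k - i)))"
proof -
  have sub: "{(i :: nat, j :: nat). i + j < M} \<subseteq> {..<M} \<times> {..<M}" by auto
  have "(\<Sum>i<M. \<Sum>j<M. F i j) = (\<Sum>(i, j)\<in>{..<M} \<times> {..<M}. F i j)"
    by (simp add: sum.cartesian_product)
  also have "\<dots> = (\<Sum>(i, j)\<in>{..<M} \<times> {..<M} - {(i, j). i + j < M}. F i j) + (\<Sum>(i, j)\<in>{(i, j). i + j < M}. F i j)"
    using sub by (subst sum.subset_diff) auto
  also have "(\<Sum>(i, j)\<in>{(i, j). i + j < M}. F i j) = (\<Sum>k<M. \<Sum>i\<le>k. F i (k - i))"
    by (rule sum.triangle_reindex)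
  finally have "(\<Sum>i<M. \<Sum>j<M. F i j) - (\<Sum>k<M. \<Sum>i\<le>k. F i (k - i)) =
    (\<Sum>(i, j)\<in>{..<M} \<times> {..<M} - {(i, j). i + j < M}. F i j)" by simp
  then show ?thesis by (auto intro!: vord_sum assms simp: not_less)
qed

text \<open>The product and the Poisson bracket are treated at once: each is bilinear, obeys the
  Leibniz rule and loses at most two orders. The divided powers of the derivation satisfy the
  Leibniz rule without binomial coefficients, so multiplying out the exponentials is a mere
  rearrangement.\<close>

lemma pexp_bilinear:
  fixes P :: "'a::field_char_0 fps2 \<Rightarrow> 'a fps2 \<Rightarrow> 'a fps2"
  assumes H: "vord 3 H"
    and addl: "\<And>f f' g. P (f + f') g = P f g + P f' g" and addr: "\<And>f g g'. P f (g + g') = P f g + P f g'"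
    and scl: "\<And>c f g. P (const2 c * f) g = const2 c * P f g" and scr: "\<And>c f g. P f (const2 c * g) = const2 c * P f g"
    and der: "\<And>f g. pb (P f g) H = P (pb f H) g + P f (pb g H)"
    and ord: "\<And>a b f g. vord a f \<Longrightarrow> vord b g \<Longrightarrow> vord (a + b - 2) (P f g)"
  shows "pexp H (P f g) = P (pexp H f) (pexp H g)"
proof (rule vord_eqI)
  fix N :: nat
  define e where "e k f = const2 (1 / fact k) * adp H k f" for k and f :: "'a fps2"
  have Le: "pb (e k f) H = const2 (of_nat (Suc k)) * e (Suc k) f" for k f
    by (simp add: e_def pb_scale_left adp_Suc mult.assoc[symmetric] const2_simps(2)[symmetric] del: of_nat_Suc)
  have z: "P 0 g = 0" "P f 0 = 0" for f g
    using scl[of 0 0 g] scr[of f 0 0] by (simp_all add: const2_simps)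
  have suml: "P (\<Sum>x\<in>A. u x) g = (\<Sum>x\<in>A. P (u x) g)" for A :: "nat set" and u g
    by (induction A rule: infinite_finite_induct) (simp_all add: z addl)
  have sumr: "P f (\<Sum>x\<in>A. u x) = (\<Sum>x\<in>A. P f (u x))" for A :: "nat set" and u f
    by (induction A rule: infinite_finite_induct) (simp_all add: z addr)
  have diffl: "P (u - v) g = P u g - P v g" and diffr: "P f (u - v) = P f u - P f v" for u v f g
    using addl[of "u - v" v g] addr[of f "u - v" v] by (simp_all add: algebra_simps)
  have leib: "e k (P f g) = (\<Sum>i\<le>k. P (e i f) (e (k - i) g))" for k
  proof (induction k)
    case 0
    show ?case by (simp add: e_def const2_simps)
  next
    case (Suc k)
    define T where "T i = P (e i f) (e (Suc k - i) g)" for i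
    have "const2 (of_nat (Suc k)) * e (Suc k) (P f g) = pb (e k (P f g)) H" by (simp add: Le)
    also have "\<dots> = (\<Sum>i\<le>k. P (pb (e i f) H) (e (k - i) g) + P (e i f) (pb (e (k - i) g) H))"
      by (simp add: Suc pb_sum_left der)
    also have "\<dots> = (\<Sum>i\<le>k. const2 (of_nat (Suc i)) * T (Suc i)) + (\<Sum>i\<le>k. const2 (of_nat (Suc k - i)) * T i)"
      by (simp add: Le scl scr T_def sum.distrib Suc_diff_le del: of_nat_Suc)
    also have "(\<Sum>i\<le>k. const2 (of_nat (Suc i)) * T (Suc i)) = (\<Sum>i\<le>Suc k. const2 (of_nat i) * T i)"
      by (simp add: sum.atMost_Suc_shift const2_simps del: sum.atMost_Suc of_nat_Suc)
    also have "(\<Sum>i\<le>k. const2 (of_nat (Suc k - i)) * T i) = (\<Sum>i\<le>Suc k. const2 (of_nat (Suc k - i)) * T i)"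
      by (simp add: const2_simps)
    also have "(\<Sum>i\<le>Suc k. const2 (of_nat i) * T i) + (\<Sum>i\<le>Suc k. const2 (of_nat (Suc k - i)) * T i)
       = (\<Sum>i\<le>Suc k. const2 (of_nat (Suc k)) * T i)"
      unfolding sum.distrib[symmetric] distrib_right[symmetric] const2_simps(1)[symmetric] of_nat_add[symmetric]
      by (intro sum.cong) auto
    also have "\<dots> = const2 (of_nat (Suc k)) * (\<Sum>i\<le>Suc k. T i)"
      by (simp add: sum_distrib_left del: of_nat_Suc sum.atMost_Suc)
    finally have eq: "const2 (of_nat (Suc k)) * e (Suc k) (P f g) = const2 (of_nat (Suc k)) * (\<Sum>i\<le>Suc k. T i)" .
    have ne: "const2 (of_nat (Suc k)) \<noteq> (0 :: 'a fps2)"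
      using const2_inject[of "of_nat (Suc k)" "0::'a"] by (simp add: const2_simps(3) del: of_nat_Suc)
    from eq show ?case unfolding mult_left_cancel[OF ne] T_def .
  qed
  \<comment> \<open>The two additional orders compensate for the loss permitted by
    \<open>ord\<close>.\<close>
  define M where "M = N + 2"
  have ev: "vord k (e k f)" for k f
    unfolding e_def by (intro vord_mult_right vord_adp_3 H)
  have A: "vord M (pexp H u - (\<Sum>k<M. e k u))" for u
    unfolding e_def by (rule vord_pexp_sum[OF H order.refl])
  have "vord N (P (pexp H f) (pexp H g) - P (\<Sum>k<M. e k f) (\<Sum>k<M. e k g))"
  proof -
    have "vord (M + 0 - 2) (P (pexp H f - (\<Sum>k<M. e k f)) (pexp H g))" "vord (0 + M - 2) (P (\<Sum>k<M. e k f) (pexp H g - (\<Sum>k<M. e k g)))"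
      using ord[OF A, of 0] ord[OF _ A, of 0] by auto
    then have "vord N (P (pexp H f - (\<Sum>k<M. e k f)) (pexp H g) + P (\<Sum>k<M. e k f) (pexp H g - (\<Sum>k<M. e k g)))"
      by (auto simp: M_def intro: vord_add)
    then show ?thesis by (simp only: diffl diffr) simp
  qed
  moreover have "vord N (P (\<Sum>k<M. e k f) (\<Sum>k<M. e k g) - (\<Sum>k<M. e k (P f g)))"
  proof -
    have "vord N (P (e i f) (e j g))" if "i + j \<ge> M" for i j
      using ord[OF ev[of i f] ev[of j g]] that by (auto simp: M_def elim: vord_mono)
    from vord_triangle_sum[of M N "\<lambda>i j. P (e i f) (e j g)", OF this]
    show ?thesis unfolding suml unfolding sumr leib .
  qed
  moreover have "vord N (pexp H (P f g) - (\<Sum>k<M. e k (P f g)))"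
    using A[of "P f g"] by (rule vord_mono) (simp add: M_def)
  ultimately show "vord N (pexp H (P f g) - P (pexp H f) (pexp H g))"
    by (meson vord_commute vord_trans)
qed

lemma pexp_mult:
  assumes "vord 3 H"
  shows "pexp H (f * g) = pexp H f * pexp H g"
  by (rule pexp_bilinear[OF assms])
    (auto simp: algebra_simps pb_mult_left intro: vord_mono[OF vord_mult])

lemma pexp_pb:
  assumes "vord 3 H"
  shows "pexp H (pb f g) = pb (pexp H f) (pexp H g)"
  by (rule pexp_bilinear[OF assms])
    (auto simp: pb_add_left pb_add_right pb_scale_left pb_scale_right vord_pb' intro: pb_jacobi)

lemma fhom_pexp:
  assumes "vord 3 H"
  shows "fhom (\<lambda>c. c) (pexp H)"
  using assms by (auto simp: fhom_def pexp_plus pexp_mult pexp_const2 pexp_vord)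

lemma fhom_kappa_inverse:
  fixes \<kappa> :: "'a::field_char_0 \<Rightarrow> 'b::field_char_0"
  assumes "fhom \<kappa> \<sigma>" "c \<noteq> 0"
  shows "\<kappa> (1 / c) = 1 / \<kappa> c"
proof -
  have "\<kappa> (1 / c) * \<kappa> c = 1"
    using assms(2) by (simp add: fhom_kappa_mult[OF assms(1), symmetric] fhom_kappa_1[OF assms(1)])
  then show ?thesis by (metis mult_not_zero nonzero_eq_divide_eq zero_neq_one)
qed

lemma fhom_kappa_fact:
  fixes \<kappa> :: "'a::field_char_0 \<Rightarrow> 'b::field_char_0"
  assumes "fhom \<kappa> \<sigma>"
  shows "\<kappa> (1 / fact k) = 1 / fact k"
  using fhom_kappa_inverse[OF assms, of "fact k"] fhom_kappa_of_nat[OF assms, of "fact k"] by simp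

text \<open>Intertwining the derivations suffices, since the coefficients \<open>1 / fact k\<close>
  are rational and thus respected by \<open>\<kappa>\<close>. \<open>H'\<close> need not be the
  image of \<open>H\<close>, which leaves room for the factor that a change of coordinates puts into
  the bracket.\<close>

lemma fhom_pexp_conj:
  fixes \<sigma> :: "'a::field_char_0 fps2 \<Rightarrow> 'b::field_char_0 fps2"
  assumes \<sigma>: "fhom \<kappa> \<sigma>" and H: "vord 3 H" "vord 3 H'" and pb: "\<And>f. \<sigma> (pb f H) = pb (\<sigma> f) H'"
  shows "\<sigma> (pexp H f) = pexp H' (\<sigma> f)"
proof (rule vord_eqI)
  fix N
  have ad: "\<sigma> (adp H k f) = adp H' k (\<sigma> f)" for k
    by (induction k) (simp_all add: adp_Suc pb)
  have "\<sigma> (\<Sum>k<N. const2 (1 / fact k) * adp H k f) = (\<Sum>k<N. const2 (1 / fact k) * adp H' k (\<sigma> f))"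
    by (simp only: fhom_sum[OF \<sigma>] fhom_mult[OF \<sigma>] fhom_const2[OF \<sigma>] ad fhom_kappa_fact[OF \<sigma>])
  then have "vord N (\<sigma> (pexp H f) - (\<Sum>k<N. const2 (1 / fact k) * adp H' k (\<sigma> f)))"
    using fhom_vord_diff[OF \<sigma> vord_pexp_sum[OF H(1) order.refl, of N f]] by simp
  moreover have "vord N (pexp H' (\<sigma> f) - (\<Sum>k<N. const2 (1 / fact k) * adp H' k (\<sigma> f)))"
    by (rule vord_pexp_sum[OF H(2) order.refl])
  ultimately show "vord N (\<sigma> (pexp H f) - pexp H' (\<sigma> f))"
    by (meson vord_commute vord_trans)
qed

lemma vord_const2_mult: "vord N f \<Longrightarrow> vord N (const2 c * f)"
  by (rule vord_mult_right)

text \<open>The group law in time: the two derivations are multiples of one another and commute, so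
  collecting terms along antidiagonals gives the binomial theorem.\<close>

lemma pexp_pexp:
  assumes H: "vord 3 H"
  shows "pexp (const2 s * H) (pexp (const2 t * H) f) = pexp (const2 (s + t) * H) f"
proof (rule vord_eqI)
  fix N
  note Hs = vord_const2_mult[OF H]
  define A where "A = (\<Sum>j<N. const2 (1 / fact j) * adp (const2 t * H) j f)"
  define F where "F i j = const2 (s ^ i / fact i * (t ^ j / fact j)) * adp H (i + j) f" for i j
  have 1: "vord N (pexp (const2 s * H) (pexp (const2 t * H) f) - pexp (const2 s * H) A)"
    unfolding A_def
    by (intro fhom_vord_diff[OF fhom_pexp] Hs vord_pexp_sum) simp
  have 2: "vord N (pexp (const2 s * H) A - (\<Sum>i<N. const2 (1 / fact i) * adp (const2 s * H) i A))"
    by (intro vord_pexp_sum Hs) simp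
  have eq: "(\<Sum>i<N. const2 (1 / fact i) * adp (const2 s * H) i A) = (\<Sum>i<N. \<Sum>j<N. F i j)"
    unfolding A_def F_def adp_sum adp_scale adp_scale_H sum_distrib_left adp_add
      mult.assoc[symmetric] const2_simps(2)[symmetric]
    by (intro sum.cong refl) (simp add: field_simps)
  have "vord N (F i j)" if "i + j \<ge> N" for i j
    unfolding F_def using vord_adp_3[OF H, of "i + j" f] that by (meson vord_mono vord_const2_mult)
  from vord_triangle_sum[of N N F, OF this]
  have 3: "vord N ((\<Sum>i<N. \<Sum>j<N. F i j) - (\<Sum>k<N. \<Sum>i\<le>k. F i (k - i)))" .
  have "(\<Sum>i\<le>k. F i (k - i)) = const2 (1 / fact k) * adp (const2 (s + t) * H) k f" for k
  proof -
    have "(\<Sum>i\<le>k. F i (k - i)) = const2 (\<Sum>i\<le>k. s ^ i / fact i * (t ^ (k - i) / fact (k - i))) * adp H k f"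
    proof -
      have "const2 (\<Sum>i\<in>A. c i) = (\<Sum>i\<in>A. const2 (c i))" for c :: "nat \<Rightarrow> 'a" and A
        by (induction A rule: infinite_finite_induct) (simp_all add: const2_simps)
      then show ?thesis by (simp add: F_def sum_distrib_right)
    qed
    also have "(\<Sum>i\<le>k. s ^ i / fact i * (t ^ (k - i) / fact (k - i))) = (s + t) ^ k / fact k"
      by (simp add: binomial_ring sum_divide_distrib binomial_fact field_simps)
    finally show ?thesis by (simp add: adp_scale_H mult.assoc[symmetric] const2_simps(2)[symmetric])
  qed
  with 3 have 3: "vord N ((\<Sum>i<N. \<Sum>j<N. F i j) - (\<Sum>k<N. const2 (1 / fact k) * adp (const2 (s + t) * H) k f))"
    by simp
  have 4: "vord N (pexp (const2 (s + t) * H) f - (\<Sum>k<N. const2 (1 / fact k) * adp (const2 (s + t) * H) k f))"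
    by (intro vord_pexp_sum Hs) simp
  from 1 2 3 4 show "vord N (pexp (const2 s * H) (pexp (const2 t * H) f) - pexp (const2 (s + t) * H) f)"
    unfolding eq by (meson vord_commute vord_trans)
qed

lemma pexp_uminus_cancel:
  assumes "vord 3 H"
  shows "pexp H (pexp (- H) f) = f" "pexp (- H) (pexp H f) = f"
  using pexp_pexp[OF assms, of 1 "-1" f] pexp_pexp[OF assms, of "-1" 1 f]
  by (simp_all add: const2_simps pexp_0)

lemma pexp_funpow:
  assumes "vord 3 H"
  shows "(pexp H ^^ n) f = pexp (const2 (of_nat n) * H) f"
proof (induction n)
  case 0
  show ?case by (simp add: const2_simps pexp_0)
next
  case (Suc n)
  then show ?case using pexp_pexp[OF assms, of 1 "of_nat n" f] by (simp add: const2_simps)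
qed

subsection \<open>Filtrations compatible with the bracket\<close>

text \<open>\<open>S N i j\<close> says that \<open>x\<^sup>i y\<^sup>j\<close> has weight at least \<open>N\<close>; the bracket lowers weights by \<open>\<delta>\<close>.\<close>

locale filt =
  fixes S :: "nat \<Rightarrow> nat \<Rightarrow> nat \<Rightarrow> bool" and \<delta> :: nat
  assumes S_mono: "S N i j \<Longrightarrow> M \<le> N \<Longrightarrow> S M i j"
    and S_le: "S N i j \<Longrightarrow> N \<le> i + j"
    and S_pb: "S a i j \<Longrightarrow> S (b + \<delta>) k l \<Longrightarrow> i * l \<noteq> j * k \<Longrightarrow> Suc p = i + k \<Longrightarrow> Suc q = j + l \<Longrightarrow>
      S (a + b) p q"
begin

text \<open>Besides bounding the weight this restricts the support: every monomial that occurs must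
  be admissible for \<open>S\<close>. With resonant weights, \<open>W\<close> therefore also records
  that only resonant monomials occur.\<close>

definition W :: "nat \<Rightarrow> 'a::zero fps2 \<Rightarrow> bool" where
  "W N f \<longleftrightarrow> (\<forall>i j. coeff2 f i j \<noteq> 0 \<longrightarrow> S N i j)"

lemma W_mono: "W N f \<Longrightarrow> M \<le> N \<Longrightarrow> W M f"
  by (auto simp: W_def intro: S_mono)

lemma W_vord: "W N f \<Longrightarrow> vord N f"
  using S_le by (force simp: W_def vord_def)

lemma W_0 [simp]: "W N 0"
  by (simp add: W_def)

lemma W_add: "W N f \<Longrightarrow> W N g \<Longrightarrow> W N (f + g)" for f :: "'a::monoid_add fps2"
  by (auto simp: W_def) (metis add_0)

lemma W_uminus [simp]: "W N (- f) \<longleftrightarrow> W N f" for f :: "'a::ab_group_add fps2"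
  by (simp add: W_def)

lemma W_diff: "W N f \<Longrightarrow> W N g \<Longrightarrow> W N (f - g)" for f :: "'a::ab_group_add fps2"
  using W_add[of N f "- g"] by simp

lemma W_const2_mult: "W N f \<Longrightarrow> W N (const2 c * f)"
  unfolding W_def by (metis coeff2_const2_mult mult_zero_right)

lemma W_pb:
  assumes "W a f" "W (b + \<delta>) g"
  shows "W (a + b) (pb f g)"
  unfolding W_def
proof (intro allI impI)
  fix p q assume "coeff2 (pb f g) p q \<noteq> 0"
  then obtain i j where ij: "i \<le> Suc p" "j \<le> Suc q"
    and n0: "(of_nat i * of_nat (Suc q - j) - of_nat j * of_nat (Suc p - i)) *
       (coeff2 f i j * coeff2 g (Suc p - i) (Suc q - j)) \<noteq> 0"
    unfolding coeff2_pb by (meson atMost_iff sum.not_neutral_contains_not_neutral)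
  from n0 have ne: "i * (Suc q - j) \<noteq> j * (Suc p - i)"
    by (metis diff_self mult_zero_left of_nat_mult)
  from n0 have "S a i j" "S (b + \<delta>) (Suc p - i) (Suc q - j)"
    using assms unfolding W_def by (metis mult_zero_left mult_zero_right)+
  from S_pb[OF this ne] show "S (a + b) p q" using ij by simp
qed

lemma W_adp:
  assumes "W (Suc \<delta>) H" "W a f"
  shows "W (a + k) (adp H k f)"
proof (induction k)
  case (Suc k)
  then show ?case using W_pb[of "a + k" "adp H k f" 1 H] assms by (simp add: adp_Suc)
qed (use assms in simp)

lemma W_coeff_sum:
  fixes c :: "nat \<Rightarrow> 'a::field"
  assumes "\<And>k. k \<in> A \<Longrightarrow> W N (f k)" "(\<Sum>k\<in>A. coeff2 (f k) p q / c k) \<noteq> 0"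
  shows "S N p q"
proof -
  from assms(2) obtain k where "k \<in> A" "coeff2 (f k) p q / c k \<noteq> 0"
    by (rule sum.not_neutral_contains_not_neutral)
  then have "coeff2 (f k) p q \<noteq> 0" by auto
  with assms(1)[OF \<open>k \<in> A\<close>] show ?thesis by (simp add: W_def)
qed

text \<open>In the expansion of the difference every term contains a bracket with \<open>K\<close>,
  which raises the weight by \<open>b\<close>; any further bracket raises it by at least one. Modulo
  the next weight, only the single bracket with \<open>K\<close> is left.\<close>

lemma W_pexp_perturb:
  assumes H: "W (Suc \<delta>) H" and K: "W (b + \<delta>) K" and b: "b \<ge> 1" and f: "W a f"
  shows "W (a + b + 1) (pexp (H + K) f - pexp H f - pb f K)"
proof -
  have HK: "W (1 + \<delta>) (H + K)"
    using H K b by (auto intro!: W_add elim: W_mono)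
  have d: "W (a + b + k) (adp (H + K) (Suc k) f - adp H (Suc k) f)" for k
  proof (induction k)
    case 0
    show ?case using W_pb[OF f K] by (simp add: pb_add_right)
  next
    case (Suc k)
    have eq: "adp (H + K) (Suc (Suc k)) f - adp H (Suc (Suc k)) f =
      pb (adp (H + K) (Suc k) f - adp H (Suc k) f) (H + K) + pb (adp H (Suc k) f) K"
      by (simp add: adp_Suc[of _ "Suc k"] pb_diff_left pb_add_right)
    have "W (a + b + Suc k) (pb (adp (H + K) (Suc k) f - adp H (Suc k) f) (H + K))"
      using W_pb[OF Suc HK] by simp
    moreover have "W (a + b + Suc k) (pb (adp H (Suc k) f) K)"
      using W_pb[OF W_adp[OF H f, of "Suc k"] K] by (simp add: algebra_simps)
    ultimately show ?case unfolding eq by (rule W_add)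
  qed
  define g where "g k = adp (H + K) k f - adp H k f - (if k = 1 then pb f K else 0)" for k
  have g: "W (a + b + 1) (g k)" for k
  proof -
    consider "k = 0" | "k = 1" | k' where "k = Suc (Suc k')" by (metis One_nat_def not0_implies_Suc)
    then show ?thesis
    proof cases
      case 3
      then show ?thesis using d[of "Suc k'"] by (auto simp: g_def elim: W_mono)
    qed (simp_all add: g_def pb_add_right)
  qed
  \<comment> \<open>\<open>pexp\<close> omits the summand \<open>k = 1\<close> in degree zero, so
    the linear term must have no coefficient there.\<close>
  have vK: "coeff2 (pb f K) p q = 0" if "p + q = 0" for p q
    using W_vord[OF W_pb[OF f K]] b that by (auto simp: vord_def)
  show ?thesis
    unfolding W_def
  proof (intro allI impI)
    fix p q assume ne: "coeff2 (pexp (H + K) f - pexp H f - pb f K) p q \<noteq> 0"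
    have "(\<Sum>k\<le>p + q. coeff2 (if k = 1 then pb f K else 0) p q / fact k) = (\<Sum>k\<le>p + q. if k = 1 then coeff2 (pb f K) p q else 0)"
      by (intro sum.cong) auto
    also have "\<dots> = coeff2 (pb f K) p q"
      using vK[of p q] by (cases "p + q = 0") auto
    finally have "coeff2 (pexp (H + K) f - pexp H f - pb f K) p q = (\<Sum>k\<le>p + q. coeff2 (g k) p q / fact k)"
      by (simp only: g_def coeff2_diff diff_divide_distrib sum_subtractf) (simp add: pexp_def)
    from ne[unfolded this] show "S (a + b + 1) p q" by (intro W_coeff_sum[where f = g and A = "{..p + q}" and c = fact] g) simp
  qed
qed

text \<open>Only the first bracket is assumed to have weight \<open>r\<close>. Thus \<open>H\<close>
  may contain terms of low weight that commute with \<open>f\<close>, a situation which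
  \<open>W_pexp_perturb\<close> does not cover.\<close>

lemma W_pexp_first:
  assumes H: "W (Suc \<delta>) H" and f: "W r (pb f H)" and r: "r \<ge> 1"
  shows "W (Suc r) (pexp H f - f - pb f H)"
proof -
  define g where "g k = adp H k f - (if k = 0 then f else 0) - (if k = 1 then pb f H else 0)" for k
  have g: "W (Suc r) (g k)" for k
  proof -
    consider "k = 0" | "k = 1" | k' where "k = Suc (Suc k')" by (metis One_nat_def not0_implies_Suc)
    then show ?thesis
    proof cases
      case 3
      then show ?thesis using W_adp[OF H f, of "Suc k'"]
        by (auto simp: g_def adp_Suc2[of _ "Suc k'"] elim: W_mono)
    qed (simp_all add: g_def)
  qed
  show ?thesis
    unfolding W_def
  proof (intro allI impI)
    fix p q assume ne: "coeff2 (pexp H f - f - pb f H) p q \<noteq> 0"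
    have 1: "(\<Sum>k\<le>p + q. coeff2 (if k = 0 then f else 0) p q / fact k) = coeff2 f p q"
    proof -
      have "(\<Sum>k\<le>p + q. coeff2 (if k = 0 then f else 0) p q / fact k) = (\<Sum>k\<le>p + q. if k = 0 then coeff2 f p q else 0)"
        by (intro sum.cong) auto
      then show ?thesis by simp
    qed
    show "S (Suc r) p q"
    proof (cases "p + q = 0")
      case True
      then have "coeff2 (pb f H) p q = 0" using W_vord[OF f] r by (simp add: vord_def)
      with ne True show ?thesis by (simp add: pexp_def)
    next
      case False
      have "(\<Sum>k\<le>p + q. coeff2 (if k = 1 then pb f H else 0) p q / fact k) = (\<Sum>k\<le>p + q. if k = 1 then coeff2 (pb f H) p q else 0)"
        by (intro sum.cong) auto
      also have "\<dots> = coeff2 (pb f H) p q"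
        using False by (auto simp: Suc_le_eq)
      finally have "coeff2 (pexp H f - f - pb f H) p q = (\<Sum>k\<le>p + q. coeff2 (g k) p q / fact k)"
        by (simp only: g_def coeff2_diff diff_divide_distrib sum_subtractf 1) (simp add: pexp_def)
      from ne[unfolded this] show ?thesis by (intro W_coeff_sum[where f = g and A = "{..p + q}" and c = fact] g) simp
    qed
  qed
qed

text \<open>Successive approximation with corrections of increasing weight. Pairs are approximated
  because a conjugating generator and the Hamiltonian it produces must be corrected together. The
  conclusion compares the limits with approximations satisfying \<open>P\<close>; it does not claim
  \<open>P\<close> for the limits.\<close>

lemma dependent_limit:
  fixes P :: "nat \<Rightarrow> 'a::ab_group_add fps2 \<Rightarrow> 'a fps2 \<Rightarrow> bool"
  assumes start: "P k0 a b"
    and step: "\<And>k a b. k \<ge> k0 \<Longrightarrow> P k a b \<Longrightarrow> \<exists>K h. W (k + c) K \<and> W (k + c) h \<and> P (Suc k) (a + K) (b + h)"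
  obtains a' b' where "W (k0 + c) (a' - a)" "W (k0 + c) (b' - b)"
    "\<And>k. k \<ge> k0 \<Longrightarrow> \<exists>a b. P k a b \<and> W (k + c) (a' - a) \<and> W (k + c) (b' - b)"
proof -
  have "\<exists>s. \<forall>m. (P (k0 + m) (fst (s m)) (snd (s m)) \<and> (m = 0 \<longrightarrow> s m = (a, b))) \<and>
     (W (k0 + m + c) (fst (s (Suc m)) - fst (s m)) \<and> W (k0 + m + c) (snd (s (Suc m)) - snd (s m)))"
  proof (rule dependent_nat_choice)
    show "\<exists>x. P (k0 + 0) (fst x) (snd x) \<and> ((0::nat) = 0 \<longrightarrow> x = (a, b))"
      using start by auto
  next
    fix x m assume "P (k0 + m) (fst x) (snd x) \<and> (m = 0 \<longrightarrow> x = (a, b))"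
    then obtain K h where "W (k0 + m + c) K" "W (k0 + m + c) h" "P (Suc (k0 + m)) (fst x + K) (snd x + h)"
      using step[of "k0 + m" "fst x" "snd x"] by auto
    then show "\<exists>y. (P (k0 + Suc m) (fst y) (snd y) \<and> (Suc m = 0 \<longrightarrow> y = (a, b))) \<and>
      W (k0 + m + c) (fst y - fst x) \<and> W (k0 + m + c) (snd y - snd x)"
      by (intro exI[of _ "(fst x + K, snd x + h)"]) simp
  qed
  then obtain s where P: "\<And>m. P (k0 + m) (fst (s m)) (snd (s m))" and s0: "s 0 = (a, b)"
    and d: "\<And>m. W (k0 + m + c) (fst (s (Suc m)) - fst (s m))" "\<And>m. W (k0 + m + c) (snd (s (Suc m)) - snd (s m))"
    by metis
  have *: "\<exists>u'. \<forall>m. W (k0 + m + c) (u' - u m)"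
    if d: "\<And>m. W (k0 + m + c) (u (Suc m) - u m)" for u :: "nat \<Rightarrow> 'a fps2"
  proof -
    have dd: "W (k0 + m + c) (u (m + l) - u m)" for m l
    proof (induction l)
      case (Suc l)
      have "W (k0 + m + c) (u (Suc (m + l)) - u (m + l))"
        using d[of "m + l"] by (rule W_mono) simp
      from W_add[OF this Suc] show ?case by simp
    qed simp
    \<comment> \<open>Weight bounds the degree from below, so the coefficient at \<open>i, j\<close>
      no longer changes from index \<open>Suc (i + j)\<close> on.\<close>
    define u' where "u' = Abs_fps2 (\<lambda>i j. coeff2 (u (Suc (i + j))) i j)"
    have "W (k0 + m + c) (u' - u m)" for m
      unfolding W_def
    proof (intro allI impI)
      fix i j assume ne: "coeff2 (u' - u m) i j \<noteq> 0"
      show "S (k0 + m + c) i j"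
      proof (cases "m \<ge> Suc (i + j)")
        case True
        then have "vord (k0 + Suc (i + j) + c) (u m - u (Suc (i + j)))"
          using W_vord[OF dd[of "Suc (i + j)" "m - Suc (i + j)"]] by simp
        then have "coeff2 (u m - u (Suc (i + j))) i j = 0"
          by (rule vordD) simp
        with ne show ?thesis by (simp add: u'_def)
      next
        case False
        then have "W (k0 + m + c) (u (Suc (i + j)) - u m)"
          using dd[of m "Suc (i + j) - m"] by simp
        with ne show ?thesis by (simp add: W_def u'_def)
      qed
    qed
    then show ?thesis by blast
  qed
  obtain a' where a': "\<And>m. W (k0 + m + c) (a' - fst (s m))" using *[OF d(1)] by blast
  obtain b' where b': "\<And>m. W (k0 + m + c) (b' - snd (s m))" using *[OF d(2)] by blast
  show thesis
  proof
    show "W (k0 + c) (a' - a)" "W (k0 + c) (b' - b)" using a'[of 0] b'[of 0] s0 by auto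
    fix k assume "k \<ge> k0"
    then show "\<exists>a b. P k a b \<and> W (k + c) (a' - a) \<and> W (k + c) (b' - b)"
      using P[of "k - k0"] a'[of "k - k0"] b'[of "k - k0"] by auto
  qed
qed

end

interpretation deg: filt "\<lambda>N i j. N \<le> i + j" 2
  by unfold_locales auto

lemma deg_W [simp]: "deg.W N f \<longleftrightarrow> vord N f"
  by (force simp: deg.W_def vord_def)

lemma vord_3_perturb:
  assumes "vord 3 H" "vord (b + 2) K" "b \<ge> 1" "vord a f"
  shows "vord (a + b + 1) (pexp (H + K) f - pexp H f - pb f K)"
  using deg.W_pexp_perturb[of H b K a f] assms by (simp add: numeral_3_eq_3)

lemma vord_Suc_from_derivs:
  assumes "vord m (dx2 K)" "vord m (dy2 K)" "vord 1 K"
  shows "vord (Suc m) (K :: 'a::field_char_0 fps2)"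
  unfolding vord_def
proof (intro allI impI)
  fix i j assume ij: "i + j < Suc m"
  show "coeff2 K i j = 0"
  proof (cases i)
    case (Suc i')
    then have "coeff2 (dx2 K) i' j = 0" using assms(1) ij by (simp add: vord_def del: coeff2_dx2)
    then show ?thesis by (simp add: Suc del: of_nat_Suc)
  next
    case i: 0
    show ?thesis
    proof (cases j)
      case (Suc j')
      then have "coeff2 (dy2 K) i j' = 0" using assms(2) ij i by (simp add: vord_def del: coeff2_dy2)
      then show ?thesis by (simp add: Suc del: of_nat_Suc)
    qed (use assms(3) i in \<open>simp add: vord_def\<close>)
  qed
qed

text \<open>If \<open>H' - H\<close> has order \<open>m\<close>, the two exponentials differ on a
  variable by its bracket with \<open>H' - H\<close>, up to terms of order \<open>m\<close>. Hence
  both partial derivatives of the difference have order \<open>m\<close>, and the difference itself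
  has order \<open>m + 1\<close>.\<close>

lemma pexp_inj:
  assumes H: "vord 3 H" "vord 3 H'"
    and X: "vord N (pexp H' X2 - pexp H X2)" and Y: "vord N (pexp H' Y2 - pexp H Y2)" and N: "N \<ge> 2"
  shows "vord (Suc N) (H' - H)"
proof -
  have "vord m (H' - H)" if "3 \<le> m" "m \<le> Suc N" for m
    using that
  proof (induction m rule: dec_induct)
    case base
    show ?case using H by (simp add: vord_diff)
  next
    case (step m)
    have e: "m - 2 + 2 = m" using step.hyps by linarith
    have K: "vord (m - 2 + 2) (H' - H)" unfolding e using step by simp
    have *: "vord m (pexp H' f - pexp H f - pb f (H' - H))" if "vord 1 f" for f
    proof -
      have "vord (1 + (m - 2) + 1) (pexp H' f - pexp H f - pb f (H' - H))"
        using vord_3_perturb[OF H(1) K _ that] step.hyps by (simp del: add_2_eq_Suc')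
      moreover have "1 + (m - 2) + 1 = m" using step.hyps by linarith
      ultimately show ?thesis by simp
    qed
    have **: "vord m (pb f (H' - H))" if "vord 1 f" "vord N (pexp H' f - pexp H f)" for f
    proof -
      have "vord m (pexp H' f - pexp H f)" using that(2) step.prems by (auto elim: vord_mono)
      from vord_diff[OF this *[OF that(1)]] show ?thesis by simp
    qed
    have "vord m (dy2 (H' - H))" "vord m (dx2 (H' - H))"
      using **[of X2] **[of Y2] X Y by (simp_all add: pb_X2_left pb_Y2_left del: dx2_diff dy2_diff)
    then show ?case using K step.hyps
      by (intro vord_Suc_from_derivs) (auto elim: vord_mono)
  qed
  then show ?thesis using N by simp
qed

lemma pexp_inj_eq:
  assumes H: "vord 3 H" "vord 3 H'" and "pexp H' X2 = pexp H X2" "pexp H' Y2 = pexp H Y2"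
  shows "H' = H"
proof (rule vord_eqI)
  fix N
  have "vord (Suc (N + 2)) (H' - H)"
    by (rule pexp_inj) (use assms in auto)
  then show "vord N (H' - H)" by (rule vord_mono) simp
qed

lemma vord_power_diff:
  fixes G :: "'a::comm_ring_1 fps2"
  assumes "vord 1 G" "vord 1 G'" "vord d (G - G')"
  shows "vord (d + i) (G ^ Suc i - G' ^ Suc i)"
proof (induction i)
  case (Suc i)
  have eq: "G ^ Suc (Suc i) - G' ^ Suc (Suc i) = G * (G ^ Suc i - G' ^ Suc i) + (G - G') * G' ^ Suc i"
    by (simp add: algebra_simps)
  have "vord (1 + (d + i)) (G * (G ^ Suc i - G' ^ Suc i))"
    by (rule vord_mult[OF assms(1) Suc])
  moreover have "vord (d + Suc i) ((G - G') * G' ^ Suc i)"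
    using vord_mult[OF assms(3) vord_power[OF assms(2), of "Suc i"]] by simp
  ultimately show ?case unfolding eq by (simp add: vord_add)
qed (use assms in simp)

lemma vord_monom_diff:
  fixes G1 :: "'a::comm_ring_1 fps2"
  assumes "vord 1 G1" "vord 1 G2" "vord 1 G1'" "vord 1 G2'"
    and "vord d (G1 - G1')" "vord d (G2 - G2')"
  shows "vord (d + (i + j) - 1) (G1 ^ i * G2 ^ j - G1' ^ i * G2' ^ j)"
proof -
  have eq: "G1 ^ i * G2 ^ j - G1' ^ i * G2' ^ j = G1 ^ i * (G2 ^ j - G2' ^ j) + (G1 ^ i - G1' ^ i) * G2' ^ j"
    by (simp add: algebra_simps)
  have "vord (d + (i + j) - 1) (G1 ^ i * (G2 ^ j - G2' ^ j))"
  proof (cases j)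
    case (Suc j')
    from vord_mult[OF vord_power[OF assms(1), of i] vord_power_diff[OF assms(2,4,6), of j']]
    show ?thesis by (simp add: Suc algebra_simps)
  qed simp
  moreover have "vord (d + (i + j) - 1) ((G1 ^ i - G1' ^ i) * G2' ^ j)"
  proof (cases i)
    case (Suc i')
    from vord_mult[OF vord_power_diff[OF assms(1,3,5), of i'] vord_power[OF assms(4), of j]]
    show ?thesis by (simp add: Suc algebra_simps)
  qed simp
  ultimately show ?thesis unfolding eq by (rule vord_add)
qed

text \<open>A monomial changes only by terms of higher degree when each variable is changed by terms
  of order two.\<close>

lemma fhom_tangent_vord:
  fixes \<sigma> :: "'a::comm_ring_1 fps2 \<Rightarrow> 'a fps2"
  assumes \<sigma>: "fhom (\<lambda>c. c) \<sigma>" and t: "vord 2 (\<sigma> X2 - X2)" "vord 2 (\<sigma> Y2 - Y2)" and g: "vord k g"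
  shows "vord (Suc k) (\<sigma> g - g)"
proof -
  let ?T = "trunc2 (Suc k) g"
  have "vord (Suc k) (const2 (coeff2 g i j) * (\<sigma> X2 ^ i * \<sigma> Y2 ^ j - X2 ^ i * Y2 ^ j))" for i j
  proof (cases "i + j < k")
    case True
    then show ?thesis using g by (simp add: vordD const2_simps)
  next
    case False
    have "vord (2 + (i + j) - 1) (\<sigma> X2 ^ i * \<sigma> Y2 ^ j - X2 ^ i * Y2 ^ j)"
      using fhom_vord_X2[OF \<sigma>] fhom_vord_Y2[OF \<sigma>] t by (intro vord_monom_diff) auto
    then have "vord (Suc k) (\<sigma> X2 ^ i * \<sigma> Y2 ^ j - X2 ^ i * Y2 ^ j)"
      by (rule vord_mono) (use False in simp)
    then show ?thesis by (rule vord_mult_right)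
  qed
  then have "vord (Suc k) (\<Sum>i<Suc k. \<Sum>j<Suc k. const2 (coeff2 g i j) * (\<sigma> X2 ^ i * \<sigma> Y2 ^ j - X2 ^ i * Y2 ^ j))"
    by (intro vord_sum)
  also have "(\<Sum>i<Suc k. \<Sum>j<Suc k. const2 (coeff2 g i j) * (\<sigma> X2 ^ i * \<sigma> Y2 ^ j - X2 ^ i * Y2 ^ j)) = \<sigma> ?T - ?T"
    by (simp add: trunc2_def fhom_sum[OF \<sigma>] fhom_mult[OF \<sigma>] fhom_const2[OF \<sigma>] fhom_power[OF \<sigma>]
        sum_subtractf right_diff_distrib del: sum.lessThan_Suc)
  finally have T: "vord (Suc k) (\<sigma> ?T - ?T)" .
  have r: "vord (Suc k) (g - ?T)" by (rule vord_trunc2)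
  have "vord (Suc k) ((\<sigma> g - \<sigma> ?T) + (\<sigma> ?T - ?T) - (g - ?T))"
    by (rule vord_diff[OF vord_add[OF fhom_vord_diff[OF \<sigma> r] T] r])
  then show ?thesis by simp
qed

lemma pexp_tangent:
  assumes "vord 3 H" "vord k f"
  shows "vord (Suc k) (pexp H f - f)"
proof -
  have "vord 2 (pexp H g - g)" if "vord 1 g" for g
  proof -
    have "vord (1 + 1) (pb g H)" using vord_pb[OF that, of 1 H] assms(1) by (simp add: numeral_3_eq_3)
    moreover have "vord 3 (pexp H g - g - pb g H)"
      using vord_3_perturb[of 0 1 H 1 g] assms(1) that by (simp add: numeral_3_eq_3 pexp_0)
    ultimately have "vord 2 ((pexp H g - g - pb g H) + pb g H)"
      by (intro vord_add) (auto elim: vord_mono simp: numeral_2_eq_2)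
    then show ?thesis by simp
  qed
  then show ?thesis
    by (intro fhom_tangent_vord[OF fhom_pexp]) (use assms in auto)
qed

subsection \<open>Formal Hamiltonian flows\<close>

lemma no_constant_term_vord: "no_constant_term F \<longleftrightarrow> vord (Suc 0) (fst F) \<and> vord (Suc 0) (snd F)"
  by (auto simp: no_constant_term_def vord_def)

text \<open>Each monomial of \<open>f\<close> contains, besides the factor in which the
  substitutions differ, at least one more factor of order one; hence the gain of one order.\<close>

lemma vord_subst2_cong:
  fixes f :: "'a::comm_ring_1 fps2"
  assumes f: "vord 2 f"
    and v: "vord 1 (fst G)" "vord 1 (snd G)" "vord 1 (fst G')" "vord 1 (snd G')"
    and d: "vord d (fst G - fst G')" "vord d (snd G - snd G')"
  shows "vord (Suc d) (subst2 f G - subst2 f G')"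
  unfolding vord_diff_iff
proof (intro allI impI)
  fix p q assume pq: "p + q < Suc d"
  have "coeff2 f i j * coeff2 (fst G ^ i * snd G ^ j) p q = coeff2 f i j * coeff2 (fst G' ^ i * snd G' ^ j) p q" for i j
  proof (cases "i + j < 2")
    case False
    have "vord (d + (i + j) - 1) (fst G ^ i * snd G ^ j - fst G' ^ i * snd G' ^ j)"
      by (intro vord_monom_diff v d)
    then have "coeff2 (fst G ^ i * snd G ^ j - fst G' ^ i * snd G' ^ j) p q = 0"
      by (rule vordD) (use False pq in simp)
    then show ?thesis by simp
  qed (use f in \<open>simp add: vordD\<close>)
  then show "coeff2 (subst2 f G) p q = coeff2 (subst2 f G') p q"
    by (simp add: subst2_def)
qed

lemma subst2_pexp:
  assumes "vord 3 H"
  shows "subst2 f (pexp H X2, pexp H Y2) = pexp H f"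
  using subst2_fhom[OF fhom_pexp[OF assms]] .

lemma coeff2_pexp_deriv:
  fixes H :: "real fps2"
  assumes H: "vord 3 H"
  shows "((\<lambda>s. coeff2 (pexp (const2 s * H) f) p q) has_real_derivative
     coeff2 (pexp (const2 t * H) (pb f H)) p q) (at t)"
proof -
  define c where "c k = coeff2 (adp H k f) p q" for k
  have 1: "coeff2 (pexp (const2 s * H) f) p q = (\<Sum>k\<le>p + q. s ^ k * c k / fact k)" for s
    by (simp add: pexp_def adp_scale_H c_def)
  have 2: "coeff2 (pexp (const2 t * H) (pb f H)) p q = (\<Sum>k\<le>p + q. t ^ k * c (Suc k) / fact k)"
    by (simp add: pexp_def adp_scale_H c_def adp_Suc2)
  have "((\<lambda>s. \<Sum>k\<le>p + q. s ^ k * c k / fact k) has_real_derivative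
     (\<Sum>k\<le>p + q. of_nat k * t ^ (k - 1) * c k / fact k)) (at t)"
    by (auto intro!: derivative_eq_intros sum.cong)
  also have "(\<Sum>k\<le>p + q. of_nat k * t ^ (k - 1) * c k / fact k) = (\<Sum>k<p + q. t ^ k * c (Suc k) / fact k)"
  proof (cases "p + q")
    case (Suc m)
    have "(\<Sum>k\<le>Suc m. of_nat k * t ^ (k - 1) * c k / fact k) = (\<Sum>k\<le>m. of_nat (Suc k) * t ^ k * c (Suc k) / fact (Suc k))"
      by (simp add: sum.atMost_Suc_shift del: sum.atMost_Suc of_nat_Suc fact_Suc)
    also have "\<dots> = (\<Sum>k\<le>m. t ^ k * c (Suc k) / fact k)"
      by (intro sum.cong refl) (simp add: fact_Suc del: of_nat_Suc)
    finally show ?thesis unfolding Suc lessThan_Suc_atMost .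
  qed simp
  also have "\<dots> = (\<Sum>k\<le>p + q. t ^ k * c (Suc k) / fact k)"
  proof -
    have "c (Suc (p + q)) = 0"
      unfolding c_def using vord_adp_3[OF H] by (rule vordD) simp
    then show ?thesis by (simp add: atMost_Suc_eq_insert_0 lessThan_Suc_atMost[symmetric])
  qed
  finally show ?thesis unfolding 1 2 .
qed

lemma formal_hamiltonian_flow_pexp:
  assumes H: "vord 3 H"
  shows "formal_hamiltonian_flow H (\<lambda>t. (pexp (const2 t * H) X2, pexp (const2 t * H) Y2))"
  unfolding formal_hamiltonian_flow_def no_constant_term_vord fst_conv snd_conv
    subst2_pexp[OF vord_const2_mult[OF H]]
  using coeff2_pexp_deriv[OF H, of X2] coeff2_pexp_deriv[OF H, of Y2]
  by (auto simp: fm_id_def const2_simps pexp_0 pb_X2_left pb_Y2_left pexp_vord[OF vord_const2_mult[OF H]])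

text \<open>The vector field has order two, so by \<open>vord_subst2_cong\<close> agreement of the
  flows to order \<open>d\<close> makes their velocities agree to order \<open>d + 1\<close>. The
  coefficients of degree \<open>d\<close> then have equal derivatives and equal initial
  values.\<close>

lemma formal_hamiltonian_flow_unique:
  assumes H: "vord 3 H" and F: "formal_hamiltonian_flow H \<Phi>" and G: "formal_hamiltonian_flow H \<Psi>"
  shows "\<Phi> t = \<Psi> t"
proof -
  have v: "vord 1 (fst (\<Phi> t))" "vord 1 (snd (\<Phi> t))" "vord 1 (fst (\<Psi> t))" "vord 1 (snd (\<Psi> t))" for t
    using F G by (auto simp: formal_hamiltonian_flow_def no_constant_term_vord)
  have H2: "vord 2 (dy2 H)" "vord 2 (- dx2 H)"
    using H vord_dx2[of 2 H] vord_dy2[of 2 H] by (auto simp: numeral_3_eq_3 numeral_2_eq_2)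
  have "\<forall>t. vord d (fst (\<Phi> t) - fst (\<Psi> t)) \<and> vord d (snd (\<Phi> t) - snd (\<Psi> t))" for d
  proof (induction d)
    case (Suc d)
    have A: "coeff2 (subst2 f (\<Phi> t)) i j - coeff2 (subst2 f (\<Psi> t)) i j = 0"
      if "vord 2 f" "i + j < Suc d" for f i j t
      using vordD[OF vord_subst2_cong[OF that(1) v(1,2)[of t] v(3,4)[of t], of d] that(2)] Suc by simp
    have B: "((\<lambda>s. coeff2 (fst (\<Phi> s)) i j - coeff2 (fst (\<Psi> s)) i j) has_real_derivative 0) (at t)"
      "((\<lambda>s. coeff2 (snd (\<Phi> s)) i j - coeff2 (snd (\<Psi> s)) i j) has_real_derivative 0) (at t)"
      if "i + j < Suc d" for i j t
    proof -
      have D: "((\<lambda>s. coeff2 (fst (\<Phi> s)) i j) has_real_derivative coeff2 (subst2 (dy2 H) (\<Phi> t)) i j) (at t)"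
        "((\<lambda>s. coeff2 (snd (\<Phi> s)) i j) has_real_derivative coeff2 (subst2 (- dx2 H) (\<Phi> t)) i j) (at t)"
        "((\<lambda>s. coeff2 (fst (\<Psi> s)) i j) has_real_derivative coeff2 (subst2 (dy2 H) (\<Psi> t)) i j) (at t)"
        "((\<lambda>s. coeff2 (snd (\<Psi> s)) i j) has_real_derivative coeff2 (subst2 (- dx2 H) (\<Psi> t)) i j) (at t)"
        using F G unfolding formal_hamiltonian_flow_def by blast+
      show "((\<lambda>s. coeff2 (fst (\<Phi> s)) i j - coeff2 (fst (\<Psi> s)) i j) has_real_derivative 0) (at t)"
        using DERIV_diff[OF D(1,3)] unfolding A[OF H2(1) that] .
      show "((\<lambda>s. coeff2 (snd (\<Phi> s)) i j - coeff2 (snd (\<Psi> s)) i j) has_real_derivative 0) (at t)"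
        using DERIV_diff[OF D(2,4)] unfolding A[OF H2(2) that] .
    qed
    have C: "coeff2 (fst (\<Phi> t)) i j - coeff2 (fst (\<Psi> t)) i j = 0"
      "coeff2 (snd (\<Phi> t)) i j - coeff2 (snd (\<Psi> t)) i j = 0" if "i + j < Suc d" for i j t
    proof -
      have "\<Phi> 0 = \<Psi> 0" using F G by (simp add: formal_hamiltonian_flow_def)
      then show "coeff2 (fst (\<Phi> t)) i j - coeff2 (fst (\<Psi> t)) i j = 0"
        "coeff2 (snd (\<Phi> t)) i j - coeff2 (snd (\<Psi> t)) i j = 0"
        using DERIV_isconst_all[of "\<lambda>s. coeff2 (fst (\<Phi> s)) i j - coeff2 (fst (\<Psi> s)) i j" t 0]
          DERIV_isconst_all[of "\<lambda>s. coeff2 (snd (\<Phi> s)) i j - coeff2 (snd (\<Psi> s)) i j" t 0] B[OF that]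
        by auto
    qed
    then show ?case by (auto simp: vord_def)
  qed simp
  then show ?thesis
    by (intro prod_eqI vord_eqI) auto
qed

lemma formal_hamiltonian_flow_iff:
  assumes H: "vord 3 H"
  shows "formal_hamiltonian_flow H \<Phi> \<longleftrightarrow> \<Phi> = (\<lambda>t. (pexp (const2 t * H) X2, pexp (const2 t * H) Y2))"
  using formal_hamiltonian_flow_pexp[OF H] formal_hamiltonian_flow_unique[OF H] by blast

section \<open>Formal interpolation by Hamiltonian flows\<close>

text \<open>The Poincare lemma in leading degree: the field need be divergence free only in degree
  \<open>k\<close>, and the Hamiltonian reproduces it there.\<close>

lemma divergence_free_hamiltonian:
  fixes u v :: "'a::field_char_0 fps2"
  assumes uv: "vord k u" "vord k v" and div: "vord k (dx2 u + dy2 v)"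
  obtains K where "vord (Suc k) K" "vord (Suc k) (u - dy2 K)" "vord (Suc k) (v + dx2 K)"
proof
  \<comment> \<open>Integrates \<open>u\<close> in the second variable and adds the integral of
    \<open>- v\<close> along the axis where this variable vanishes; division by zero yields the
    constant term zero.\<close>
  define K where "K = Abs_fps2 (\<lambda>p q. if q = 0 then - coeff2 v (p - 1) 0 / of_nat p else coeff2 u p (q - 1) / of_nat q)"
  show "vord (Suc k) K"
    unfolding vord_def K_def
  proof (intro allI impI)
    fix i j assume "i + j < Suc k"
    then show "coeff2 (Abs_fps2 (\<lambda>p q. if q = 0 then - coeff2 v (p - 1) 0 / of_nat p else coeff2 u p (q - 1) / of_nat q)) i j = 0"
      using vordD[OF uv(1), of i "j - 1"] vordD[OF uv(2), of "i - 1" 0] by (cases "i = 0") auto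
  qed
  show "vord (Suc k) (u - dy2 K)"
    by (auto simp: vord_def K_def simp del: of_nat_Suc)
  show "vord (Suc k) (v + dx2 K)"
    unfolding vord_def
  proof (intro allI impI)
    fix i j assume ij: "i + j < Suc k"
    show "coeff2 (v + dx2 K) i j = 0"
    proof (cases j)
      case (Suc j')
      have "coeff2 (dx2 u + dy2 v) i j' = 0"
        using div by (rule vordD) (use ij Suc in simp)
      then show ?thesis by (simp add: K_def Suc field_simps del: of_nat_Suc)
    qed (simp add: K_def del: of_nat_Suc)
  qed
qed

section \<open>Averaging over a cyclic group\<close>

context
  fixes \<rho> :: "'a::field_char_0 fps2 \<Rightarrow> 'a fps2" and n :: nat
  assumes \<rho>: "fhom (\<lambda>c. c) \<rho>" and n: "n \<ge> 1" and period: "\<And>f. (\<rho> ^^ n) f = f"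
begin

lemma vord_funpow: "vord N f \<Longrightarrow> vord N ((\<rho> ^^ j) f)"
  by (induction j) (auto intro: fhom_vord[OF \<rho>])

definition average :: "'a fps2 \<Rightarrow> 'a fps2" where
  "average K = const2 (1 / of_nat n) * (\<Sum>j<n. (\<rho> ^^ j) K)"

lemma average_shift: "(\<Sum>j<n. (\<rho> ^^ Suc j) K) = (\<Sum>j<n. (\<rho> ^^ j) K)"
proof -
  have "(\<Sum>j<n. (\<rho> ^^ Suc j) K) + (\<rho> ^^ 0) K = (\<Sum>j<Suc n. (\<rho> ^^ j) K)"
    by (simp add: sum.lessThan_Suc_shift del: sum.lessThan_Suc)
  then show ?thesis by (simp add: period)
qed

lemma average_invariant: "\<rho> (average K) = average K"
  using average_shift[of K]
  by (simp add: average_def fhom_mult[OF \<rho>] fhom_const2[OF \<rho>] fhom_sum[OF \<rho>])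

lemma vord_average: "vord N K \<Longrightarrow> vord N (average K)"
  unfolding average_def by (intro vord_const2_mult vord_sum vord_funpow)

lemma average_diff: "average (f - g) = average f - average g"
proof -
  have "(\<rho> ^^ j) (f - g) = (\<rho> ^^ j) f - (\<rho> ^^ j) g" for j
    by (induction j) (simp_all add: fhom_diff[OF \<rho>])
  then show ?thesis by (simp add: average_def sum_subtractf right_diff_distrib)
qed

lemma of_nat_const2: "const2 (1 / of_nat n) * (of_nat n * f) = f" for f :: "'a fps2"
proof -
  have e: "of_nat m = (const2 (of_nat m) :: 'a fps2)" for m
    by (induction m) (simp_all add: const2_simps)
  show ?thesis using n
    by (simp add: e[of n] mult.assoc[symmetric] const2_simps(2)[symmetric] const2_simps(4))
qed

lemma average_eq:
  assumes "\<rho> K = K"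
  shows "average K = K"
proof -
  have "(\<rho> ^^ j) K = K" for j by (induction j) (simp_all add: assms)
  then show ?thesis by (simp add: average_def of_nat_const2)
qed

lemma vord_average_diff:
  assumes "vord N (\<rho> K - K)"
  shows "vord N (average K - K)"
proof -
  have d: "vord N ((\<rho> ^^ j) K - K)" for j
  proof (induction j)
    case (Suc j)
    from vord_trans[OF fhom_vord_diff[OF \<rho> Suc] assms] show ?case by simp
  qed simp
  have "average K - K = const2 (1 / of_nat n) * (\<Sum>j<n. (\<rho> ^^ j) K - K)"
    by (simp add: average_def sum_subtractf right_diff_distrib of_nat_const2)
  also have "vord N \<dots>" by (intro vord_const2_mult vord_sum d)
  finally show ?thesis .
qed

text \<open>Summation by parts: since the translates of \<open>K0\<close> under
  \<open>\<rho>\<close> add up to zero, the weighted sum \<open>s\<close> changes by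
  \<open>of_nat n * K0\<close> under \<open>\<rho>\<close>. This inverts \<open>\<rho>\<close> minus
  the identity on series of average zero without diagonalising \<open>\<rho>\<close>.\<close>

lemma homological_equation:
  assumes "vord N K"
  obtains \<xi> where "vord N \<xi>" "average K = K + \<rho> \<xi> - \<xi>"
proof
  define K0 where "K0 = K - average K"
  define s where "s = (\<Sum>j<n. of_nat j * (\<rho> ^^ j) K0)"
  define \<xi> where "\<xi> = - (const2 (1 / of_nat n) * s)"
  have K0: "vord N K0" using assms vord_average by (simp add: K0_def vord_diff)
  show "vord N \<xi>"
    unfolding \<xi>_def s_def vord_uminus
    by (intro vord_const2_mult vord_sum vord_mult_right vord_funpow K0)
  have "average K0 = 0"
    by (simp add: K0_def average_diff average_eq[OF average_invariant])
  then have "const2 (of_nat n) * average K0 = 0" by simp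
  then have z: "(\<Sum>j<n. (\<rho> ^^ j) K0) = 0"
    using n by (simp add: average_def mult.assoc[symmetric] const2_simps(2)[symmetric] const2_simps(4))
  have on: "\<rho> (of_nat j) = of_nat j" for j
    by (induction j) (simp_all add: fhom_0[OF \<rho>] fhom_add[OF \<rho>] fhom_1[OF \<rho>])
  have "\<rho> s = (\<Sum>j<n. of_nat j * (\<rho> ^^ Suc j) K0)"
    by (simp add: s_def fhom_sum[OF \<rho>] fhom_mult[OF \<rho>] on)
  also have "\<dots> = (\<Sum>j<n. of_nat (Suc j) * (\<rho> ^^ Suc j) K0) - (\<Sum>j<n. (\<rho> ^^ Suc j) K0)"
    by (simp add: sum_subtractf[symmetric] algebra_simps)
  also have "(\<Sum>j<n. (\<rho> ^^ Suc j) K0) = 0" by (simp only: average_shift z)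
  also have "(\<Sum>j<n. of_nat (Suc j) * (\<rho> ^^ Suc j) K0) = (\<Sum>j<Suc n. of_nat j * (\<rho> ^^ j) K0)"
    by (simp add: sum.lessThan_Suc_shift del: sum.lessThan_Suc of_nat_Suc)
  also have "\<dots> = s + of_nat n * K0" by (simp add: s_def period)
  finally have "\<rho> s = s + of_nat n * K0" by simp
  then have "\<rho> \<xi> - \<xi> = - (const2 (1 / of_nat n) * (of_nat n * K0))"
    by (simp add: \<xi>_def fhom_uminus[OF \<rho>] fhom_mult[OF \<rho>] fhom_const2[OF \<rho>] algebra_simps)
  then show "average K = K + \<rho> \<xi> - \<xi>"
    by (simp add: of_nat_const2 K0_def add_diff_eq[symmetric])
qed

text \<open>Here \<open>t\<close> is the map with its linear part removed. Moving the rotation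
  across the conjugating exponential replaces \<open>\<xi>\<close> by \<open>\<rho> \<xi>\<close>,
  which is why the two sides carry different generators. The estimate on \<open>H - H0\<close> keeps
  control of the low-order coefficients of the invariant Hamiltonian through an approximation known
  beforehand.\<close>

theorem takens_normal_form:
  fixes t :: "'a fps2 \<Rightarrow> 'a fps2"
  assumes \<rho>pb: "\<And>f g. \<rho> (pb f g) = pb (\<rho> f) (\<rho> g)"
    and t: "fhom (\<lambda>c. c) t" "pb (t X2) (t Y2) = 1"
    and H0: "vord 3 H0" "\<rho> H0 = H0" and k0: "k0 \<ge> 2"
    and start: "vord k0 (t X2 - pexp H0 X2)" "vord k0 (t Y2 - pexp H0 Y2)"
  obtains \<xi> H where "vord (Suc k0) \<xi>" "vord (Suc k0) (H - H0)" "vord 3 H" "\<rho> H = H"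
    "\<And>f. t (pexp (\<rho> \<xi>) f) = pexp \<xi> (pexp H f)"
proof -
  define err where "err \<xi> H f = t (pexp (\<rho> \<xi>) f) - pexp \<xi> (pexp H f)" for \<xi> H f
  define P where "P k \<xi> H \<longleftrightarrow> vord 3 \<xi> \<and> \<rho> H = H \<and> vord 3 H \<and>
     vord k (err \<xi> H X2) \<and> vord k (err \<xi> H Y2)" for k \<xi> H
  have tpb: "t (pb f g) = pb (t f) (t g)" for f g
    using fhom_pb[OF t(1), of f g] t(2) by simp
  have tt: "vord 2 (t X2 - X2)" "vord 2 (t Y2 - Y2)"
  proof -
    have "vord 2 (pexp H0 X2 - X2)" "vord 2 (pexp H0 Y2 - Y2)"
      using pexp_tangent[OF H0(1), of 1 X2] pexp_tangent[OF H0(1), of 1 Y2] by (simp_all add: numeral_2_eq_2)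
    moreover have "vord 2 (t X2 - pexp H0 X2)" "vord 2 (t Y2 - pexp H0 Y2)"
      using start k0 by (auto elim: vord_mono)
    ultimately show "vord 2 (t X2 - X2)" "vord 2 (t Y2 - Y2)"
      by (auto intro: vord_trans)
  qed
  have t_shift: "vord (Suc k) (t g - g)" if "vord k g" for k g
    by (rule fhom_tangent_vord[OF t(1) tt that])
  have pert: "vord (Suc k) (pexp (H + K) f - pexp H f - pb f K)" "vord k (pb f K)"
    "vord k (pexp (H + K) f - pexp H f)"
    if "vord 3 H" "vord (Suc k) K" "k \<ge> 2" "vord 1 f" for H K f k
  proof -
    have K: "vord (k - 1 + 2) K" using that by (simp add: Suc_diff_le)
    show 1: "vord (Suc k) (pexp (H + K) f - pexp H f - pb f K)"
      using vord_3_perturb[OF that(1) K _ that(4)] that(3) by simp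
    show 2: "vord k (pb f K)"
      using vord_pb[OF that(4) K] that(3) by simp
    have "vord k (pexp (H + K) f - pexp H f - pb f K)" using 1 by (rule vord_mono) simp
    from vord_add[OF this 2] show "vord k (pexp (H + K) f - pexp H f)" by simp
  qed
  have errdiff: "vord k (err (\<xi> + K) (H + h) f - err \<xi> H f)"
    if \<xi>: "vord 3 \<xi>" and H: "vord 3 H" and K: "vord (Suc k) K" and h: "vord (Suc k) h" and k: "k \<ge> 2" and f: "vord 1 f"
    for \<xi> K H h k f
  proof -
    have \<xi>K: "vord 3 (\<xi> + K)" using \<xi> K k by (auto intro!: vord_add elim: vord_mono)
    have 1: "vord k (t (pexp (\<rho> (\<xi> + K)) f) - t (pexp (\<rho> \<xi>) f))"
      unfolding fhom_add[OF \<rho>]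
      by (intro fhom_vord_diff[OF t(1)] pert(3) fhom_vord[OF \<rho>] \<xi> K k f)
    have 2: "vord k (pexp (\<xi> + K) (pexp (H + h) f) - pexp (\<xi> + K) (pexp H f))"
      by (intro fhom_vord_diff[OF fhom_pexp[OF \<xi>K]] pert(3) H h k f)
    have 3: "vord k (pexp (\<xi> + K) (pexp H f) - pexp \<xi> (pexp H f))"
      by (intro pert(3) \<xi> K k pexp_vord H f)
    have "err (\<xi> + K) (H + h) f - err \<xi> H f = (t (pexp (\<rho> (\<xi> + K)) f) - t (pexp (\<rho> \<xi>) f)) -
      ((pexp (\<xi> + K) (pexp (H + h) f) - pexp (\<xi> + K) (pexp H f)) + (pexp (\<xi> + K) (pexp H f) - pexp \<xi> (pexp H f)))"
      by (simp add: err_def)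
    then show ?thesis using 1 2 3 by (simp only: vord_diff vord_add)
  qed
  \<comment> \<open>Linearisation of the error: all the maps involved are tangent to the identity,
    so to leading order the corrections enter only through the bracket with
    \<open>\<rho> K - K - h\<close>.\<close>
  have errdiff2: "vord (Suc k) (err (\<xi> + K) (H + h) f - (err \<xi> H f + pb f (\<rho> K - K - h)))"
    if \<xi>: "vord 3 \<xi>" and H: "vord 3 H" and K: "vord (Suc k) K" and h: "vord (Suc k) h" and k: "k \<ge> 2" and f: "vord 1 f"
    for \<xi> K H h k f
  proof -
    note \<rho>K = fhom_vord[OF \<rho> K]
    have Hh: "vord 3 (H + h)" using H h k by (auto intro!: vord_add elim: vord_mono)
    have a: "vord (Suc k) (t (pexp (\<rho> \<xi> + \<rho> K) f) - t (pexp (\<rho> \<xi>) f + pb f (\<rho> K)))"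
      using pert(1)[OF fhom_vord[OF \<rho> \<xi>] \<rho>K k f]
      by (intro fhom_vord_diff[OF t(1)]) (simp add: algebra_simps)
    have b: "vord (Suc k) (t (pb f (\<rho> K)) - pb f (\<rho> K))"
      by (intro t_shift pert(2)[OF H \<rho>K k f])
    define g where "g = pexp (H + h) f"
    have g: "vord 1 g" unfolding g_def by (intro pexp_vord Hh f)
    have gf: "vord 2 (g - f)" unfolding g_def using pexp_tangent[OF Hh f] by (simp add: numeral_2_eq_2)
    have c: "vord (Suc k) (pexp (\<xi> + K) g - pexp \<xi> g - pb g K)"
      by (rule pert(1)[OF \<xi> K k g])
    have d: "vord (Suc k) (pb (g - f) K)"
      using vord_pb'[OF gf K] by simp
    have e: "vord (Suc k) (pexp \<xi> g - pexp \<xi> (pexp H f + pb f h))"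
      unfolding g_def using pert(1)[OF H h k f]
      by (intro fhom_vord_diff[OF fhom_pexp[OF \<xi>]]) (simp add: algebra_simps)
    have e': "vord (Suc k) (pexp \<xi> (pb f h) - pb f h)"
      by (intro pexp_tangent \<xi> pert(2)[OF H h k f])
    have "err (\<xi> + K) (H + h) f - (err \<xi> H f + pb f (\<rho> K - K - h)) =
       (t (pexp (\<rho> \<xi> + \<rho> K) f) - t (pexp (\<rho> \<xi>) f + pb f (\<rho> K))) + (t (pb f (\<rho> K)) - pb f (\<rho> K))
       - ((pexp (\<xi> + K) g - pexp \<xi> g - pb g K) + pb (g - f) K + (pexp \<xi> g - pexp \<xi> (pexp H f + pb f h))
          + (pexp \<xi> (pb f h) - pb f h))"
      by (simp add: err_def fhom_add[OF \<rho>] fhom_add[OF t(1)] pb_diff_right pb_diff_left pb_add_right pexp_plus g_def algebra_simps)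
    also have "vord (Suc k) \<dots>"
      by (intro vord_diff[OF vord_add vord_add[OF vord_add[OF vord_add]]] a b c d e e')
    finally show ?thesis .
  qed
  have step: "\<exists>K h. vord (Suc k) K \<and> vord (Suc k) h \<and> P (Suc k) (\<xi> + K) (H' + h)"
    if k: "k \<ge> k0" and P: "P k \<xi> H'" for k \<xi> H'
  proof -
    have k2: "k \<ge> 2" using k k0 by simp
    from P have \<xi>: "vord 3 \<xi>" and \<rho>H': "\<rho> H' = H'" and H': "vord 3 H'"
      and e: "vord k (err \<xi> H' X2)" "vord k (err \<xi> H' Y2)" unfolding P_def by blast+
    define u v where "u = err \<xi> H' X2" and "v = err \<xi> H' Y2"
    define GX GY where "GX = pexp \<xi> (pexp H' X2)" and "GY = pexp \<xi> (pexp H' Y2)"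
    \<comment> \<open>Both sides of the conjugacy preserve area, so the leading part of the error is
      divergence free and therefore a Hamiltonian vector field.\<close>
    have "pb X2 Y2 = (1 :: 'a fps2)" by (simp add: pb_def)
    then have G1: "pb GX GY = 1"
      by (simp add: GX_def GY_def pexp_pb[OF \<xi>, symmetric] pexp_pb[OF H', symmetric] fhom_1[OF fhom_pexp] \<xi> H')
    have F1: "pb (GX + u) (GY + v) = 1"
    proof -
      have "pb (t (pexp (\<rho> \<xi>) X2)) (t (pexp (\<rho> \<xi>) Y2)) = 1"
        using \<open>pb X2 Y2 = 1\<close> fhom_vord[OF \<rho> \<xi>]
        by (simp add: tpb[symmetric] pexp_pb[symmetric] fhom_1[OF fhom_pexp] fhom_1[OF t(1)])
      then show ?thesis by (simp add: GX_def GY_def u_def v_def err_def)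
    qed
    have G2: "vord 2 (GX - X2)" "vord 2 (GY - Y2)"
    proof -
      have "vord 2 (pexp \<xi> (pexp H' f) - f)" if "vord 1 f" for f
        using vord_trans[OF pexp_tangent[OF \<xi> pexp_vord[OF H' that]] pexp_tangent[OF H' that]]
        by (simp add: numeral_2_eq_2)
      then show "vord 2 (GX - X2)" "vord 2 (GY - Y2)" by (simp_all add: GX_def GY_def)
    qed
    have uv: "vord k u" "vord k v" using e by (simp_all add: u_def v_def)
    have "dx2 u + dy2 v = - (pb u (GY - Y2) + pb (GX - X2) v + pb u v)"
    proof -
      have "pb u GY + pb GX v + pb u v = 0"
        using F1 G1 by (simp add: pb_add_left pb_add_right add.assoc)
      then show ?thesis
        by (simp add: pb_diff_left pb_diff_right pb_X2_left pb_commute[of u Y2] pb_Y2_left algebra_simps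
            add_eq_0_iff)
    qed
    moreover have "vord k (pb u (GY - Y2))" "vord k (pb (GX - X2) v)" "vord k (pb u v)"
      using vord_pb'[OF uv(1) G2(2)] vord_pb'[OF G2(1) uv(2)] vord_pb'[OF uv] k2
      by (auto elim: vord_mono)
    ultimately have "vord k (dx2 u + dy2 v)"
      by (metis vord_add vord_uminus)
    from divergence_free_hamiltonian[OF uv this]
    obtain K0 where K0: "vord (Suc k) K0" "vord (Suc k) (u - dy2 K0)" "vord (Suc k) (v + dx2 K0)" .
    from homological_equation[OF K0(1)] obtain K where K: "vord (Suc k) K" "average K0 = K0 + \<rho> K - K" .
    define h where "h = average K0"
    have h: "vord (Suc k) h" "\<rho> h = h"
      using vord_average[OF K0(1)] average_invariant by (simp_all add: h_def)
    \<comment> \<open>The invariant average \<open>h\<close> absorbs what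
      \<open>\<rho> K - K\<close> cannot produce; together they cancel the error in degree
      \<open>k\<close>.\<close>
    have hK: "\<rho> K - K - h = - K0" using K(2) by (simp add: h_def)
    have new: "vord (Suc k) (err (\<xi> + K) (H' + h) X2)" "vord (Suc k) (err (\<xi> + K) (H' + h) Y2)"
      using vord_add[OF errdiff2[OF \<xi> H' K(1) h(1) k2, of X2] K0(2)]
        vord_add[OF errdiff2[OF \<xi> H' K(1) h(1) k2, of Y2] K0(3)]
      unfolding hK by (simp_all add: pb_X2_left pb_Y2_left u_def v_def)
    have "P (Suc k) (\<xi> + K) (H' + h)"
      unfolding P_def
      using new \<rho>H' h H' \<xi> K(1) k2
      by (auto intro!: vord_add simp: fhom_add[OF \<rho>] elim: vord_mono)
    then show ?thesis using K(1) h(1) by blast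
  qed
  have P0: "P k0 0 H0"
    using start H0 by (auto simp: P_def err_def fhom_0[OF \<rho>] pexp_0)
  obtain \<xi> H where \<xi>: "vord (Suc k0) (\<xi> - 0)" and H: "vord (Suc k0) (H - H0)"
    and lim: "\<And>k. k \<ge> k0 \<Longrightarrow> \<exists>\<xi>' H'. P k \<xi>' H' \<and> vord (Suc k) (\<xi> - \<xi>') \<and> vord (Suc k) (H - H')"
  proof (rule deg.dependent_limit[where P = P and c = 1 and ?k0.0 = k0 and a = 0 and b = H0, unfolded deg_W, OF P0])
    fix k \<xi> H assume "k0 \<le> k" "P k \<xi> H"
    then show "\<exists>K h. vord (k + 1) K \<and> vord (k + 1) h \<and> P (Suc k) (\<xi> + K) (H + h)"
      using step by simp
  qed simp
  have \<rho>H: "\<rho> H = H"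
  proof (rule vord_eqI)
    fix N
    obtain H' where H': "vord (Suc (N + k0)) (H - H')" "\<rho> H' = H'" using lim[of "N + k0"] by (auto simp: P_def)
    have "vord (Suc (N + k0)) (\<rho> H - H')" using fhom_vord_diff[OF \<rho> H'(1)] H'(2) by simp
    from vord_diff[OF this H'(1)] show "vord N (\<rho> H - H)" by (auto elim: vord_mono)
  qed
  have \<xi>3: "vord 3 \<xi>" using \<xi> k0 by (auto elim: vord_mono)
  have "vord 3 (H - H0)" using H k0 by (auto elim: vord_mono)
  from vord_add[OF this H0(1)] have H3: "vord 3 H" by simp
  have E: "t (pexp (\<rho> \<xi>) f) = pexp \<xi> (pexp H f)" if f: "f = X2 \<or> f = Y2" for f
  proof (rule vord_eqI)
    fix N
    define k where "k = N + k0"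
    obtain \<xi>' H' where P: "P k \<xi>' H'" and d: "vord (Suc k) (\<xi> - \<xi>')" "vord (Suc k) (H - H')"
      using lim[of k] by (auto simp: k_def)
    have "vord k (err (\<xi>' + (\<xi> - \<xi>')) (H' + (H - H')) f - err \<xi>' H' f)"
      by (intro errdiff d) (use P f k0 in \<open>auto simp: P_def k_def\<close>)
    moreover have "vord k (err \<xi>' H' f)" using P f by (auto simp: P_def)
    ultimately have "vord k (err (\<xi>' + (\<xi> - \<xi>')) (H' + (H - H')) f - err \<xi>' H' f + err \<xi>' H' f)"
      by (rule vord_add)
    then show "vord N (t (pexp (\<rho> \<xi>) f) - pexp \<xi> (pexp H f))"
      by (auto simp: err_def k_def elim: vord_mono)
  qed
  have "t (pexp (\<rho> \<xi>) f) = pexp \<xi> (pexp H f)" for f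
  proof (rule fhom_ext[where \<kappa> = "\<lambda>c. c" and \<sigma> = "\<lambda>f. t (pexp (\<rho> \<xi>) f)" and \<tau> = "\<lambda>f. pexp \<xi> (pexp H f)"])
    show "fhom (\<lambda>c. c) (\<lambda>f. t (pexp (\<rho> \<xi>) f))"
      using fhom_comp[OF fhom_pexp[OF fhom_vord[OF \<rho> \<xi>3]] t(1)] .
    show "fhom (\<lambda>c. c) (\<lambda>f. pexp \<xi> (pexp H f))"
      using fhom_comp[OF fhom_pexp[OF H3] fhom_pexp[OF \<xi>3]] .
    show "t (pexp (\<rho> \<xi>) X2) = pexp \<xi> (pexp H X2)" "t (pexp (\<rho> \<xi>) Y2) = pexp \<xi> (pexp H Y2)"
      by (intro E; simp)+
  qed
  with that[of \<xi> H] \<xi> H H3 \<rho>H show thesis by simp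
qed

end

lemma pexp_conj:
  assumes "vord 3 \<xi>" "vord 3 H"
  shows "pexp \<xi> (pexp H f) = pexp (pexp \<xi> H) (pexp \<xi> f)"
  by (rule fhom_pexp_conj[OF fhom_pexp]) (use assms in \<open>auto simp: pexp_vord pexp_pb\<close>)

text \<open>With the trivial group, \<open>t\<close> becomes conjugate to a time-one map; a
  conjugate of a time-one map is again one, namely that of the transformed Hamiltonian.\<close>

lemma tangent_symplectic_is_pexp:
  fixes t :: "'a::field_char_0 fps2 \<Rightarrow> 'a fps2"
  assumes t: "fhom (\<lambda>c. c) t" "pb (t X2) (t Y2) = 1" "vord 2 (t X2 - X2)" "vord 2 (t Y2 - Y2)"
  obtains H where "vord 3 H" "\<And>f. t f = pexp H f"
proof -
  obtain \<xi> H where \<xi>: "vord 3 \<xi>" and H: "vord 3 H" and eq: "\<And>f. t (pexp \<xi> f) = pexp \<xi> (pexp H f)"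
    by (rule takens_normal_form[where \<rho> = "\<lambda>f. f" and n = 1 and t = t and ?H0.0 = 0 and ?k0.0 = 2, OF fhom_id])
      (use t in \<open>auto simp: pexp_0 numeral_3_eq_3 numeral_2_eq_2\<close>)
  have "t f = pexp (pexp \<xi> H) f" for f
    using eq[of "pexp (- \<xi>) f"] pexp_conj[OF \<xi> H, of "pexp (- \<xi>) f"]
    by (simp add: pexp_uminus_cancel[OF \<xi>])
  with that pexp_vord[OF \<xi> H] show thesis by blast
qed

section \<open>Complex coordinates\<close>

definition cmap2 :: "real fps2 \<Rightarrow> complex fps2" where
  "cmap2 f = Abs_fps2 (\<lambda>i j. of_real (coeff2 f i j))"

definition cnj2 :: "complex fps2 \<Rightarrow> complex fps2" where
  "cnj2 f = Abs_fps2 (\<lambda>i j. cnj (coeff2 f i j))"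

text \<open>Complex conjugation of a series in z and its conjugate: the variables are exchanged as
  well. The fixed points are the series that are real in the coordinates (x, y).\<close>

definition star2 :: "complex fps2 \<Rightarrow> complex fps2" where
  "star2 f = Abs_fps2 (\<lambda>i j. cnj (coeff2 f j i))"

text \<open>Pull-back under multiplication of z by \<open>\<mu>\<close>.\<close>

definition dil2 :: "complex \<Rightarrow> complex fps2 \<Rightarrow> complex fps2" where
  "dil2 \<mu> f = Abs_fps2 (\<lambda>i j. \<mu> ^ i * cnj \<mu> ^ j * coeff2 f i j)"

lemma coeff2_cmap2 [simp]: "coeff2 (cmap2 f) i j = of_real (coeff2 f i j)"
  and coeff2_cnj2 [simp]: "coeff2 (cnj2 g) i j = cnj (coeff2 g i j)"
  and coeff2_star2 [simp]: "coeff2 (star2 g) i j = cnj (coeff2 g j i)"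
  and coeff2_dil2 [simp]: "coeff2 (dil2 \<mu> g) i j = \<mu> ^ i * cnj \<mu> ^ j * coeff2 g i j"
  by (simp_all add: cmap2_def cnj2_def star2_def dil2_def)

lemma fhom_cmap2: "fhom of_real cmap2"
  unfolding fhom_def
  by (auto intro!: fps2_eqI simp: coeff2_mult coeff2_const2 vord_def)

lemma fhom_cnj2: "fhom cnj cnj2"
  unfolding fhom_def
  by (auto intro!: fps2_eqI simp: coeff2_mult coeff2_const2 vord_def cnj_sum)

lemma fhom_star2: "fhom cnj star2"
  unfolding fhom_def
proof (intro conjI allI impI)
  fix f g show "star2 (f * g) = star2 f * star2 g"
    by (rule fps2_eqI) (simp add: coeff2_mult cnj_sum, rule sum.swap)
qed (auto intro!: fps2_eqI simp: coeff2_const2 vord_def)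

lemma fhom_dil2: "fhom (\<lambda>c. c) (dil2 \<mu>)"
  unfolding fhom_def
proof (intro conjI allI impI)
  fix f g
  have eq: "\<mu> ^ p * cnj \<mu> ^ q * (coeff2 f i j * coeff2 g (p - i) (q - j)) =
    \<mu> ^ i * cnj \<mu> ^ j * coeff2 f i j * (\<mu> ^ (p - i) * cnj \<mu> ^ (q - j) * coeff2 g (p - i) (q - j))"
    if "i \<le> p" "j \<le> q" for i j p q
  proof -
    have "\<mu> ^ p = \<mu> ^ i * \<mu> ^ (p - i)" "cnj \<mu> ^ q = cnj \<mu> ^ j * cnj \<mu> ^ (q - j)"
      using that by (simp_all flip: power_add)
    then show ?thesis by simp
  qed
  show "dil2 \<mu> (f * g) = dil2 \<mu> f * dil2 \<mu> g"
    by (rule fps2_eqI) (auto simp only: coeff2_mult coeff2_dil2 sum_distrib_left atMost_iff intro!: sum.cong eq)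
qed (auto intro!: fps2_eqI simp: coeff2_const2 vord_def algebra_simps)

text \<open>In the image of \<open>zmap\<close> the variables \<^term>\<open>X2\<close> and \<^term>\<open>Y2\<close> stand for \<open>z\<close> and \<open>\<zeta>\<close>.\<close>

definition zmap :: "complex fps2 \<Rightarrow> complex fps2" where
  "zmap f = subst2 f (const2 (1/2) * (X2 + Y2), const2 (- \<i> / 2) * (X2 - Y2))"

definition xymap :: "complex fps2 \<Rightarrow> complex fps2" where
  "xymap f = subst2 f (X2 + const2 \<i> * Y2, X2 - const2 \<i> * Y2)"

definition toz :: "real fps2 \<Rightarrow> complex fps2" where
  "toz f = zmap (cmap2 f)"

lemma fhom_zmap: "fhom (\<lambda>c. c) zmap"
  and zmap_X2: "zmap X2 = const2 (1/2) * (X2 + Y2)"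
  and zmap_Y2: "zmap Y2 = const2 (- \<i> / 2) * (X2 - Y2)"
  unfolding zmap_def
  by (rule fhom_subst2 subst2_X2[THEN trans];
     simp add: vord_const2_mult vord_add vord_diff del: One_nat_def)+

lemma fhom_xymap: "fhom (\<lambda>c. c) xymap"
  and xymap_X2: "xymap X2 = X2 + const2 \<i> * Y2"
  and xymap_Y2: "xymap Y2 = X2 - const2 \<i> * Y2"
  unfolding xymap_def
  by (rule fhom_subst2 subst2_X2[THEN trans];
     simp add: vord_const2_mult vord_add vord_diff)+

lemma const2_collect: "const2 a * (const2 b * f) = const2 (a * b) * f" "const2 a * const2 b = const2 (a * b)"
  "const2 a + const2 b = const2 (a + b)"
  "const2 a * f + const2 b * f = const2 (a + b) * f"
  "const2 a * f - const2 b * f = const2 (a - b) * f"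
  by (simp_all add: const2_simps algebra_simps)

lemma fps2_linear_eqI:
  assumes "coeff2 f 1 0 = coeff2 g 1 0" "coeff2 f 0 1 = coeff2 g 0 1"
    "\<And>i j. (i, j) \<noteq> (1, 0) \<Longrightarrow> (i, j) \<noteq> (0, 1) \<Longrightarrow> coeff2 f i j = coeff2 g i j"
  shows "f = g"
  using assms by (intro fps2_eqI) (metis prod.inject)

lemma zmap_xymap: "zmap (xymap f) = f"
proof (rule fhom_ext[OF fhom_comp[OF fhom_xymap fhom_zmap] fhom_id])
  show "zmap (xymap X2) = X2" "zmap (xymap Y2) = Y2"
    unfolding xymap_X2 xymap_Y2 fhom_add[OF fhom_zmap] fhom_diff[OF fhom_zmap] fhom_mult[OF fhom_zmap]
      fhom_const2[OF fhom_zmap] zmap_X2 zmap_Y2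
    by (rule fps2_eqI; simp only: coeff2_add coeff2_diff coeff2_const2_mult coeff2_X2 coeff2_Y2; auto)+
qed

lemma xymap_zmap: "xymap (zmap f) = f"
proof (rule fhom_ext[OF fhom_comp[OF fhom_zmap fhom_xymap] fhom_id])
  show "xymap (zmap X2) = X2" "xymap (zmap Y2) = Y2"
    unfolding xymap_X2 xymap_Y2 fhom_add[OF fhom_xymap] fhom_diff[OF fhom_xymap] fhom_mult[OF fhom_xymap]
      fhom_const2[OF fhom_xymap] zmap_X2 zmap_Y2
    by (rule fps2_eqI; simp only: coeff2_add coeff2_diff coeff2_const2_mult coeff2_X2 coeff2_Y2; auto)+
qed

lemma cmap2_X2 [simp]: "cmap2 X2 = X2" and cmap2_Y2 [simp]: "cmap2 Y2 = Y2"
  by (rule fps2_eqI; simp add: coeff2_X2 coeff2_Y2)+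

lemma fhom_toz: "fhom of_real toz"
  unfolding toz_def using fhom_comp[OF fhom_cmap2 fhom_zmap] .

lemma toz_X2: "toz X2 = const2 (1/2) * (X2 + Y2)" and toz_Y2: "toz Y2 = const2 (- \<i> / 2) * (X2 - Y2)"
  by (simp_all add: toz_def zmap_X2 zmap_Y2)

lemma toz_inject: "toz f = toz g \<longleftrightarrow> f = g"
proof
  assume "toz f = toz g"
  then have "cmap2 f = cmap2 g" by (metis toz_def xymap_zmap)
  then have "of_real (coeff2 f i j) = (of_real (coeff2 g i j) :: complex)" for i j
    by (metis coeff2_cmap2)
  then show "f = g" by (intro fps2_eqI) simp
qed simp

lemma star2_toz: "star2 (toz f) = toz f"
proof (rule fhom_ext[where \<sigma> = "\<lambda>f. star2 (toz f)" and \<tau> = toz])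
  show "fhom complex_of_real (\<lambda>f. star2 (toz f))"
    using fhom_comp[OF fhom_toz fhom_star2] by simp
  show "star2 (toz X2) = toz X2" "star2 (toz Y2) = toz Y2"
    unfolding toz_X2 toz_Y2 by (rule fps2_eqI; auto simp: coeff2_X2 coeff2_Y2)+
qed (rule fhom_toz)

text \<open>Back in the coordinates (x, y), \<open>star2\<close> becomes conjugation of the
  coefficients, so a fixed point has real coefficients there.\<close>

lemma toz_surj:
  assumes "star2 g = g"
  obtains f where "toz f = g"
proof
  have "cnj2 (xymap g) = xymap (star2 g)"
  proof (rule fhom_ext[OF fhom_comp[OF fhom_xymap fhom_cnj2]])
    show "fhom cnj (\<lambda>f. xymap (star2 f))" by (rule fhom_comp[OF fhom_star2 fhom_xymap])
    have "star2 X2 = Y2" "star2 Y2 = X2"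
      by (rule fps2_eqI; auto simp: coeff2_X2 coeff2_Y2)+
    then show "cnj2 (xymap X2) = xymap (star2 X2)" "cnj2 (xymap Y2) = xymap (star2 Y2)"
      by (auto simp: xymap_X2 xymap_Y2 coeff2_X2 coeff2_Y2 intro!: fps2_eqI)
  qed
  then have c: "cnj (coeff2 (xymap g) i j) = coeff2 (xymap g) i j" for i j
    by (metis assms coeff2_cnj2)
  define f where "f = Abs_fps2 (\<lambda>i j. Re (coeff2 (xymap g) i j))"
  have "cmap2 f = xymap g"
    using c by (intro fps2_eqI) (simp add: f_def complex_eq_iff)
  then show "toz f = g" by (simp add: toz_def zmap_xymap)
qed

text \<open>The factor is the bracket of z and its conjugate in the original coordinates.\<close>

lemma toz_pb: "toz (pb f g) = const2 (- 2 * \<i>) * pb (toz f) (toz g)"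
proof -
  have "pb (toz X2) (toz Y2) = const2 (\<i> / 2)"
    unfolding toz_X2 toz_Y2
    by (simp add: pb_def const2_simps(2)[symmetric] const2_simps(5)[symmetric] const2_simps(6)[symmetric])
  then have "const2 (- 2 * \<i>) * pb (toz f) (toz g) = const2 (- 2 * \<i> * (\<i> / 2)) * toz (pb f g)"
    unfolding const2_simps(2) using fhom_pb[OF fhom_toz, of f g] by (simp only: mult_ac)
  also have "- 2 * \<i> * (\<i> / 2) = 1" by simp
  finally show ?thesis by (simp add: const2_simps(4))
qed

lemma toz_vord: "vord N f \<Longrightarrow> vord N (toz f)"
  by (rule fhom_vord[OF fhom_toz])

lemma toz_vord_iff: "vord N (toz f) \<longleftrightarrow> vord N f"
proof
  assume "vord N (toz f)"
  then have "vord N (cmap2 f)"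
    using fhom_vord[OF fhom_xymap, of N "toz f"] by (simp add: toz_def xymap_zmap)
  then show "vord N f" by (auto simp: vord_def)
qed (rule toz_vord)

text \<open>Complex form of the real exponential, with the factor of \<open>toz_pb\<close> built
  in.\<close>

abbreviation zexp :: "complex fps2 \<Rightarrow> complex fps2 \<Rightarrow> complex fps2" where
  "zexp \<xi> \<equiv> pexp (const2 (- 2 * \<i>) * \<xi>)"

lemma toz_pexp:
  assumes "vord 3 \<xi>"
  shows "toz (pexp \<xi> f) = zexp (toz \<xi>) (toz f)"
  by (rule fhom_pexp_conj[OF fhom_toz])
    (use assms in \<open>auto simp: toz_pb pb_scale_right toz_vord intro: vord_const2_mult\<close>)

lemma zmap_complex: "zmap (X2 + const2 \<i> * Y2) = X2" "zmap (X2 - const2 \<i> * Y2) = Y2"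
  using zmap_xymap[of X2] zmap_xymap[of Y2] by (simp_all add: xymap_X2 xymap_Y2)

lemma toz_complex: "toz X2 + const2 \<i> * toz Y2 = X2"
  using zmap_complex(1) by (simp add: toz_def fhom_add[OF fhom_zmap] fhom_mult[OF fhom_zmap] fhom_const2[OF fhom_zmap])

subsection \<open>Rotations\<close>

definition rot :: "real \<Rightarrow> real fps2 \<Rightarrow> real fps2" where
  "rot \<theta> f = subst2 f (fm_linear (plane_rotation \<theta>))"

lemma fm_linear_rotation:
  "fm_linear (plane_rotation \<theta>) =
    (const2 (cos \<theta>) * X2 + const2 (- sin \<theta>) * Y2, const2 (sin \<theta>) * X2 + const2 (cos \<theta>) * Y2)"
  by (simp add: fm_linear_def plane_rotation_def)

lemma fhom_rot: "fhom (\<lambda>c. c) (rot \<theta>)"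
  and rot_X2: "rot \<theta> X2 = const2 (cos \<theta>) * X2 + const2 (- sin \<theta>) * Y2"
  and rot_Y2: "rot \<theta> Y2 = const2 (sin \<theta>) * X2 + const2 (cos \<theta>) * Y2"
  unfolding rot_def fm_linear_rotation
  by (rule fhom_subst2 subst2_X2[THEN trans];
     simp add: vord_const2_mult vord_add vord_diff)+

lemma toz_rot: "toz (rot \<theta> f) = dil2 (cis \<theta>) (toz f)"
proof (rule fhom_ext[OF fhom_comp[OF fhom_rot fhom_toz]])
  show "fhom complex_of_real (\<lambda>f. dil2 (cis \<theta>) (toz f))" by (rule fhom_comp[OF fhom_toz fhom_dil2])
  show "toz (rot \<theta> X2) = dil2 (cis \<theta>) (toz X2)" "toz (rot \<theta> Y2) = dil2 (cis \<theta>) (toz Y2)"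
    unfolding rot_X2 rot_Y2 fhom_add[OF fhom_toz] fhom_mult[OF fhom_toz] fhom_const2[OF fhom_toz] toz_X2 toz_Y2
    by (rule fps2_linear_eqI; auto simp: coeff2_X2 coeff2_Y2 complex_eq_iff)+
qed

lemma dil2_dil2: "dil2 \<mu> (dil2 \<nu> f) = dil2 (\<mu> * \<nu>) f"
  by (rule fps2_eqI) (simp add: power_mult_distrib)

lemma dil2_1 [simp]: "dil2 1 f = f"
  by (rule fps2_eqI) simp

lemma rot_rot: "rot \<theta> (rot \<eta> f) = rot (\<theta> + \<eta>) f"
  by (subst toz_inject[symmetric]) (simp add: toz_rot dil2_dil2 cis_mult)

lemma rot_cancel: "rot \<theta> (rot (- \<theta>) f) = f" "rot (- \<theta>) (rot \<theta> f) = f"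
  by (simp_all add: rot_rot toz_rot toz_inject[symmetric, of _ f])

lemma toz_rot_funpow: "toz ((rot \<theta> ^^ k) f) = dil2 (cis \<theta> ^ k) (toz f)"
  by (induction k) (simp_all add: toz_rot dil2_dil2)

lemma rot_period:
  assumes "cis \<theta> ^ n = 1"
  shows "(rot \<theta> ^^ n) f = f"
  by (subst toz_inject[symmetric]) (simp add: toz_rot_funpow assms)

lemma rot_pb: "rot \<theta> (pb f g) = pb (rot \<theta> f) (rot \<theta> g)"
proof -
  have "pb (rot \<theta> X2) (rot \<theta> Y2) = const2 (cos \<theta>) * const2 (cos \<theta>) + const2 (sin \<theta>) * const2 (sin \<theta>)"
    unfolding rot_X2 rot_Y2 by (simp add: pb_def const2_simps(5))
  also have "\<dots> = const2 1"
    unfolding const2_simps(1)[symmetric] const2_simps(2)[symmetric] by (simp add: sin_cos_squared_add3)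
  finally show ?thesis using fhom_pb[OF fhom_rot, of \<theta> f g] by (simp add: const2_simps)
qed

lemma dil2_pb:
  assumes "cmod \<mu> = 1"
  shows "dil2 \<mu> (pb f g) = pb (dil2 \<mu> f) (dil2 \<mu> g)"
proof -
  have "dil2 \<mu> X2 = const2 \<mu> * X2" "dil2 \<mu> Y2 = const2 (cnj \<mu>) * Y2"
    by (rule fps2_eqI; auto simp: coeff2_X2 coeff2_Y2)+
  then have "pb (dil2 \<mu> X2) (dil2 \<mu> Y2) = const2 (\<mu> * cnj \<mu>)"
    by (simp add: pb_def const2_simps)
  moreover have "\<mu> * cnj \<mu> = 1" using assms by (simp add: complex_norm_square[symmetric])
  ultimately show ?thesis using fhom_pb[OF fhom_dil2, of \<mu> f g] by (simp add: const2_simps)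
qed

subsection \<open>Normal form Hamiltonians in complex coordinates\<close>

lemma coeff2_monom_mult:
  "coeff2 (X2 ^ a * Y2 ^ b * f) i j = (if a \<le> i \<and> b \<le> j then coeff2 f (i - a) (j - b) else 0)"
proof -
  have "coeff2 (X2 ^ a * Y2 ^ b * f) i j =
      (\<Sum>k\<le>i. if k = a then \<Sum>l\<le>j. if l = b then coeff2 f (i - a) (j - b) else 0 else 0)"
  proof (subst coeff2_mult, intro sum.cong refl)
    fix k
    have "(\<Sum>l\<le>j. coeff2 (X2 ^ a * Y2 ^ b) k l * coeff2 f (i - k) (j - l)) =
        (\<Sum>l\<le>j. if k = a \<and> l = b then coeff2 f (i - a) (j - b) else 0)"
      by (intro sum.cong) (auto simp: coeff2_monom)
    then show "(\<Sum>l\<le>j. coeff2 (X2 ^ a * Y2 ^ b) k l * coeff2 f (i - k) (j - l)) =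
        (if k = a then \<Sum>l\<le>j. if l = b then coeff2 f (i - a) (j - b) else 0 else 0)"
      by auto
  qed
  then show ?thesis by simp
qed

lemma toz_action_I: "toz action_I = const2 (1/2) * (X2 * Y2)"
proof -
  have "toz action_I = const2 (1/2) * ((const2 (1/2) * (X2 + Y2)) ^ 2 + (const2 (- \<i> / 2) * (X2 - Y2)) ^ 2)"
    using fhom_const2[OF fhom_toz, of "1/2"]
    by (simp add: action_I_def fhom_add[OF fhom_toz] fhom_mult[OF fhom_toz] fhom_power[OF fhom_toz] toz_X2 toz_Y2)
  also have "(const2 (1/2) * (X2 + Y2)) ^ 2 + (const2 (- \<i> / 2) * (X2 - Y2)) ^ 2 =
      const2 ((1/2)^2) * (X2 + Y2)^2 + const2 ((- \<i> / 2)^2) * (X2 - Y2)^2"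
    by (simp only: power_mult_distrib const2_power)
  also have "\<dots> = const2 (1/4) * ((X2 + Y2)^2 - (X2 - Y2)^2)"
    by (simp add: power_divide const2_simps algebra_simps)
  also have "(X2 + Y2)^2 - (X2 - Y2)^2 = const2 4 * (X2 * Y2 :: complex fps2)"
  proof -
    have "const2 4 = (4 :: complex fps2)"
      using const2_simps(1)[of "2::complex" 2] const2_simps(1)[of "1::complex" 1] by (simp add: const2_simps(4))
    then show ?thesis by (simp add: power2_eq_square algebra_simps)
  qed
  finally show ?thesis by (simp add: const2_collect const2_simps(4))
qed

lemma toz_resonant_term:
  "toz (resonant_term n) = const2 (of_real (2 powr (- real n / 2)) / 2) * (X2 ^ n + Y2 ^ n)"
proof -
  define Z where "Z = X2 + const2 \<i> * Y2"
  have cZ: "cnj2 Z = X2 - const2 \<i> * Y2"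
    by (rule fps2_eqI) (auto simp: Z_def coeff2_X2 coeff2_Y2)
  have "cmap2 (Abs_fps2 (\<lambda>i j. Re (coeff2 (Z ^ n) i j))) = const2 (1/2) * (Z ^ n + cnj2 (Z ^ n))"
    by (rule fps2_eqI) (simp add: complex_eq_iff)
  also have "zmap \<dots> = const2 (1/2) * (X2 ^ n + Y2 ^ n)"
    unfolding fhom_mult[OF fhom_zmap] fhom_add[OF fhom_zmap] fhom_power[OF fhom_zmap] fhom_const2[OF fhom_zmap]
      fhom_power[OF fhom_cnj2] cZ unfolding Z_def zmap_complex ..
  finally show ?thesis
    unfolding resonant_term_def Z_def[symmetric] fhom_mult[OF fhom_toz] fhom_const2[OF fhom_toz]
    by (simp add: toz_def const2_collect)
qed

lemma vord_subst1:
  assumes "vord 1 g"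
  shows "vord N (subst1 A g - (\<Sum>k<N. const2 (fps_nth A k) * g ^ k))"
  unfolding vord_diff_iff
proof (intro allI impI)
  fix p q assume pq: "p + q < N"
  have "coeff2 (g ^ k) p q = 0" if "p + q < k" for k
    using vordD[OF vord_power[OF assms, of k], of p q] that by simp
  then have "(\<Sum>k<N. fps_nth A k * coeff2 (g ^ k) p q) = (\<Sum>k\<le>p + q. fps_nth A k * coeff2 (g ^ k) p q)"
    using pq by (intro sum.mono_neutral_right) auto
  then show "coeff2 (subst1 A g) p q = coeff2 (\<Sum>k<N. const2 (fps_nth A k) * g ^ k) p q"
    by (simp add: subst1_def coeff2_sum)
qed

lemma vord_action_I: "vord 1 action_I"
  unfolding action_I_def
  by (intro vord_const2_mult vord_add vord_mono[OF vord_power[of 1]]) auto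

lemma coeff2_toz_subst1:
  "coeff2 (toz (subst1 A action_I)) i j = (if i = j then of_real (fps_nth A i) / 2 ^ i else 0)"
proof -
  define N where "N = Suc (i + j)"
  have "coeff2 (toz (subst1 A action_I)) i j = coeff2 (toz (\<Sum>k<N. const2 (fps_nth A k) * action_I ^ k)) i j"
    using fhom_vord_diff[OF fhom_toz vord_subst1[OF vord_action_I, of N A]]
    by (simp add: vord_diff_iff N_def)
  also have "toz (\<Sum>k<N. const2 (fps_nth A k) * action_I ^ k) =
      (\<Sum>k<N. const2 (of_real (fps_nth A k) / 2 ^ k) * (X2 ^ k * Y2 ^ k))"
  proof -
    have "toz (const2 (fps_nth A k) * action_I ^ k) = const2 (of_real (fps_nth A k) / 2 ^ k) * (X2 ^ k * Y2 ^ k)" for k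
      unfolding fhom_mult[OF fhom_toz] fhom_const2[OF fhom_toz] fhom_power[OF fhom_toz] toz_action_I
        power_mult_distrib const2_power[symmetric] const2_collect
      by (simp add: power_divide)
    then show ?thesis by (simp add: fhom_sum[OF fhom_toz])
  qed
  also have "coeff2 \<dots> i j = (\<Sum>k<N. if k = i then if i = j then of_real (fps_nth A i) / 2 ^ i else 0 else 0)"
    unfolding coeff2_sum by (intro sum.cong) (auto simp: coeff2_monom)
  also have "\<dots> = (if i = j then of_real (fps_nth A i) / 2 ^ i else 0)"
    by (simp add: N_def)
  finally show ?thesis .
qed

text \<open>The powers of two arise because I is half of z \<zeta> and the cosine term contributes
  2^(-n/2) times half of z^n + \<zeta>^n. The shift by three on the diagonal comes from the factor
  I^3.\<close>

definition nf_coeff :: "nat \<Rightarrow> real fps \<Rightarrow> real fps \<Rightarrow> nat \<Rightarrow> nat \<Rightarrow> real" where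
  "nf_coeff n A B i j =
    (if i = j then if 3 \<le> i then fps_nth A (i - 3) / 2 ^ i else 0
     else if i = j + n then 2 powr (- real n / 2) / 2 * (fps_nth B j / 2 ^ j)
     else if j = i + n then 2 powr (- real n / 2) / 2 * (fps_nth B i / 2 ^ i) else 0)"

lemma coeff2_toz_normal_form:
  assumes n: "n \<ge> 1"
  shows "coeff2 (toz (normal_form_hamiltonian n A B)) i j = of_real (nf_coeff n A B i j)"
proof -
  define c where "c = complex_of_real (2 powr (- real n / 2)) / 2"
  have "toz (normal_form_hamiltonian n A B) = const2 ((1/2)^3) * (X2 ^ 3 * Y2 ^ 3 * toz (subst1 A action_I)) +
      const2 c * (X2 ^ n * Y2 ^ 0 * toz (subst1 B action_I) + X2 ^ 0 * Y2 ^ n * toz (subst1 B action_I))"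
    unfolding normal_form_hamiltonian_def fhom_add[OF fhom_toz] fhom_mult[OF fhom_toz] fhom_power[OF fhom_toz]
      toz_action_I toz_resonant_term c_def[symmetric]
    by (simp add: power_mult_distrib const2_power algebra_simps)
  then have "coeff2 (toz (normal_form_hamiltonian n A B)) i j =
     (1/2)^3 * (if 3 \<le> i \<and> 3 \<le> j then coeff2 (toz (subst1 A action_I)) (i - 3) (j - 3) else 0) +
     c * ((if n \<le> i then coeff2 (toz (subst1 B action_I)) (i - n) j else 0) +
          (if n \<le> j then coeff2 (toz (subst1 B action_I)) i (j - n) else 0))"
    by (simp only: coeff2_add coeff2_const2_mult coeff2_monom_mult) simp
  also have "(if 3 \<le> i \<and> 3 \<le> j then coeff2 (toz (subst1 A action_I)) (i - 3) (j - 3) else 0) =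
      (if i = j \<and> 3 \<le> i then of_real (fps_nth A (i - 3)) / 2 ^ (i - 3) else 0)"
    by (auto simp: coeff2_toz_subst1)
  also have "(if n \<le> i then coeff2 (toz (subst1 B action_I)) (i - n) j else 0) =
      (if i = j + n then of_real (fps_nth B j) / 2 ^ j else 0)"
    by (auto simp: coeff2_toz_subst1)
  also have "(if n \<le> j then coeff2 (toz (subst1 B action_I)) i (j - n) else 0) =
      (if j = i + n then of_real (fps_nth B i) / 2 ^ i else 0)"
    by (auto simp: coeff2_toz_subst1)
  also have "(1/2)^3 * (if i = j \<and> 3 \<le> i then complex_of_real (fps_nth A (i - 3)) / 2 ^ (i - 3) else 0) =
      (if i = j \<and> 3 \<le> i then of_real (fps_nth A (i - 3)) / 2 ^ i else 0)"
  proof (cases "3 \<le> i")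
    case True
    then have "(2::complex) ^ i = 2 ^ 3 * 2 ^ (i - 3)" by (subst power_add[symmetric]) simp
    then show ?thesis by (cases "i = j") (simp_all only: if_True if_False True simp_thms, simp_all add: power_divide)
  qed simp
  also have "(if i = j \<and> 3 \<le> i then of_real (fps_nth A (i - 3)) / 2 ^ i else 0) +
     c * ((if i = j + n then of_real (fps_nth B j) / 2 ^ j else 0) + (if j = i + n then of_real (fps_nth B i) / 2 ^ i else 0))
    = of_real (nf_coeff n A B i j)"
    using n by (simp add: nf_coeff_def c_def)
  finally show ?thesis .
qed

section \<open>The weight filtration of resonant series\<close>

text \<open>For \<open>n \<ge> 6\<close> the weights give (z \<zeta>)^3 and z^n the common value
  three. For \<open>n = 5\<close> they are the ordinary degrees, where z^5 precedes (z
  \<zeta>)^3.\<close>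

definition sig :: "nat \<Rightarrow> nat" where "sig n = (if n = 5 then 2 else 1)"

definition tau :: "nat \<Rightarrow> nat" where "tau n = (if n = 5 then 5 else 3)"

text \<open>
  \<open>u = z \<zeta>\<close> has weight \<open>sig n\<close>, both \<open>z\<^sup>n\<close> and \<open>\<zeta>\<^sup>n\<close> have weight \<open>tau n\<close>; the relation
  \<open>z\<^sup>n \<zeta>\<^sup>n = u\<^sup>n\<close> does not lower weights because \<open>2 tau n \<le> n sig n\<close>.
\<close>

definition resonant_weight :: "nat \<Rightarrow> nat \<Rightarrow> nat \<Rightarrow> nat \<Rightarrow> bool" where
  "resonant_weight n q j k \<longleftrightarrow>
     (\<exists>p m. (j = p + n * m \<and> k = p \<or> j = p \<and> k = p + n * m) \<and> q \<le> sig n * p + tau n * m)"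

locale resonance =
  fixes n :: nat
  assumes n5: "5 \<le> n"
begin

abbreviation "\<sigma> \<equiv> sig n"
abbreviation "\<tau> \<equiv> tau n"
abbreviation "rweight \<equiv> resonant_weight n"

lemma params: "n = 5 \<and> \<sigma> = 2 \<and> \<tau> = 5 \<or> 6 \<le> n \<and> \<sigma> = 1 \<and> \<tau> = 3"
  using n5 by (auto simp: sig_def tau_def)

lemma tau_sig: "2 * (\<tau> * m) \<le> \<sigma> * (n * m)"
  using params by auto

lemma rweight_pm: "rweight q (p + n * m) p \<longleftrightarrow> q \<le> \<sigma> * p + \<tau> * m" (is ?A)
  and rweight_pm': "rweight q p (p + n * m) \<longleftrightarrow> q \<le> \<sigma> * p + \<tau> * m" (is ?B)
proof -
  have *: "m = m' \<and> p = p'" if "p + n * m = p' + n * m' \<and> p = p' \<or> p + n * m = p' \<and> p = p' + n * m'" for p' m'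
    using that n5 by auto
  show ?A
  proof
    assume "rweight q (p + n * m) p"
    then obtain p' m' where "p + n * m = p' + n * m' \<and> p = p' \<or> p + n * m = p' \<and> p = p' + n * m'"
      and le: "q \<le> \<sigma> * p' + \<tau> * m'" unfolding resonant_weight_def by blast
    from *[OF this(1)] le show "q \<le> \<sigma> * p + \<tau> * m" by simp
  qed (unfold resonant_weight_def, blast)
  show ?B
  proof
    assume "rweight q p (p + n * m)"
    then obtain p' m' where "p + n * m = p' + n * m' \<and> p = p' \<or> p + n * m = p' \<and> p = p' + n * m'"
      and le: "q \<le> \<sigma> * p' + \<tau> * m'" unfolding resonant_weight_def by blast
    from *[OF this(1)] le show "q \<le> \<sigma> * p + \<tau> * m" by simp
  qed (unfold resonant_weight_def, blast)
qed

text \<open>The bracket removes one factor z \<zeta>, hence the loss of \<open>\<sigma>\<close>.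
  Harmonics of the same sign add up; those of opposite sign partly cancel into powers of z
  \<zeta>.\<close>

sublocale filt rweight \<sigma>
proof
  show "rweight M i j" if "rweight N i j" "M \<le> N" for N M i j
  proof -
    obtain p m where "i = p + n * m \<and> j = p \<or> i = p \<and> j = p + n * m" and "N \<le> \<sigma> * p + \<tau> * m"
      using \<open>rweight N i j\<close> unfolding resonant_weight_def by blast
    moreover from this(2) have "M \<le> \<sigma> * p + \<tau> * m" using \<open>M \<le> N\<close> by simp
    ultimately show ?thesis unfolding resonant_weight_def by blast
  qed
  show "N \<le> i + j" if "rweight N i j" for N i j
  proof -
    obtain p m where pm: "i = p + n * m \<and> j = p \<or> i = p \<and> j = p + n * m" "N \<le> \<sigma> * p + \<tau> * m"
      using \<open>rweight N i j\<close> unfolding resonant_weight_def by blast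
    have "\<sigma> * p \<le> 2 * p" "\<tau> * m \<le> n * m" using params by auto
    then have "N \<le> 2 * p + n * m" using pm(2) by linarith
    with pm(1) show ?thesis by auto
  qed
  show "rweight (a + b) P Q"
    if A: "rweight a i j" and B: "rweight (b + \<sigma>) k l" and ne: "i * l \<noteq> j * k" and P: "Suc P = i + k" and Q: "Suc Q = j + l" for a b i j k l P Q
  proof -
    have swap: "rweight q x y \<longleftrightarrow> rweight q y x" for q x y unfolding resonant_weight_def by blast
    have same: "rweight (a + b) P Q"
      if "i = p + n * m" "j = p" "a \<le> \<sigma> * p + \<tau> * m" "k = r + n * s" "l = r" "b + \<sigma> \<le> \<sigma> * r + \<tau> * s"
        "i * l \<noteq> j * k" "Suc P = i + k" "Suc Q = j + l" for p m r s i j k l P Q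
    proof -
      have "P = Q + n * (m + s)" using that by (simp add: algebra_simps)
      moreover have "a + b \<le> \<sigma> * Q + \<tau> * (m + s)"
        using that params by (auto simp: algebra_simps)
      ultimately show ?thesis by (simp add: rweight_pm)
    qed
    \<comment> \<open>The common part of z^(nm) and \<zeta>^(ns) turns into a power of z \<zeta>; by
      \<open>tau_sig\<close> this conversion does not lower the weight.\<close>
    have opp: "rweight (a + b) P Q"
      if "i = p + n * m" "j = p" "a \<le> \<sigma> * p + \<tau> * m" "k = r" "l = r + n * s" "b + \<sigma> \<le> \<sigma> * r + \<tau> * s"
        "Suc P = i + k" "Suc Q = j + l" for p m r s i j k l P Q
    proof (cases "s \<le> m")
      case True
      have "n * m = n * (m - s) + n * s" using True by (simp flip: distrib_left)
      then have "P = Q + n * (m - s)" using that by simp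
      moreover have "a + b \<le> \<sigma> * Q + \<tau> * (m - s)"
      proof -
        have "\<tau> * m = \<tau> * (m - s) + \<tau> * s" using True by (simp flip: distrib_left)
        moreover have "\<sigma> * Suc Q = \<sigma> * p + \<sigma> * r + \<sigma> * (n * s)" using that by (simp add: algebra_simps)
        then have "\<sigma> * Q + \<sigma> = \<sigma> * p + \<sigma> * r + \<sigma> * (n * s)" by simp
        ultimately show ?thesis using that(3,6) tau_sig[of s] by linarith
      qed
      ultimately show ?thesis by (simp add: rweight_pm)
    next
      case False
      have "n * s = n * (s - m) + n * m" using False by (simp flip: distrib_left)
      then have "Q = P + n * (s - m)" using that by simp
      moreover have "a + b \<le> \<sigma> * P + \<tau> * (s - m)"
      proof -
        have "\<tau> * s = \<tau> * (s - m) + \<tau> * m" using False by (simp flip: distrib_left)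
        moreover have "\<sigma> * Suc P = \<sigma> * p + \<sigma> * r + \<sigma> * (n * m)" using that by (simp add: algebra_simps)
        then have "\<sigma> * P + \<sigma> = \<sigma> * p + \<sigma> * r + \<sigma> * (n * m)" by simp
        ultimately show ?thesis using that(3,6) tau_sig[of m] by linarith
      qed
      ultimately show ?thesis by (simp add: rweight_pm')
    qed
    obtain p m where pm: "i = p + n * m \<and> j = p \<or> i = p \<and> j = p + n * m" "a \<le> \<sigma> * p + \<tau> * m"
      using A unfolding resonant_weight_def by blast
    obtain r s where rs: "k = r + n * s \<and> l = r \<or> k = r \<and> l = r + n * s" "b + \<sigma> \<le> \<sigma> * r + \<tau> * s"
      using B unfolding resonant_weight_def by blast
    from pm(1) rs(1) show ?thesis
    proof (elim disjE conjE)
      assume "i = p + n * m" "j = p" "k = r + n * s" "l = r"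
      from same[OF this(1,2) pm(2) this(3,4) rs(2) ne P Q] show ?thesis .
    next
      assume "i = p + n * m" "j = p" "k = r" "l = r + n * s"
      from opp[OF this(1,2) pm(2) this(3,4) rs(2) P Q] show ?thesis .
    next
      assume "i = p" "j = p + n * m" "k = r + n * s" "l = r"
      from opp[OF this(2,1) pm(2) this(4,3) rs(2) Q P] show ?thesis by (simp only: swap)
    next
      assume "i = p" "j = p + n * m" "k = r" "l = r + n * s"
      from same[OF this(2,1) pm(2) this(4,3) rs(2) ne[symmetric] Q P] show ?thesis by (simp only: swap)
    qed
  qed
qed

lemma W_coeff_pm: "W q f \<Longrightarrow> \<sigma> * p + \<tau> * m < q \<Longrightarrow> coeff2 f (p + n * m) p = 0"
  using rweight_pm[of q p m] by (auto simp: W_def)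

lemma W_ww_0: "W q f \<Longrightarrow> coeff2 f i j \<noteq> 0 \<Longrightarrow> rweight 0 i j"
  by (meson W_def W_mono zero_le)

text \<open>Reality ties the coefficients of opposite harmonics together, so weights need be
  examined only where z dominates.\<close>

lemma W_iff_star:
  assumes "star2 f = f"
  shows "W q f \<longleftrightarrow> (\<forall>i j. coeff2 f i j \<noteq> 0 \<longrightarrow> rweight 0 i j) \<and>
    (\<forall>p m. \<sigma> * p + \<tau> * m < q \<longrightarrow> coeff2 f (p + n * m) p = 0)" (is "_ \<longleftrightarrow> ?A \<and> ?B")
proof
  assume "W q f"
  then show "?A \<and> ?B" using W_coeff_pm W_ww_0 by blast
next
  assume AB: "?A \<and> ?B"
  show "W q f"
    unfolding W_def
  proof (intro allI impI)
    fix i j assume ne: "coeff2 f i j \<noteq> 0"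
    then obtain p m where pm: "i = p + n * m \<and> j = p \<or> i = p \<and> j = p + n * m"
      using AB unfolding resonant_weight_def by blast
    have "coeff2 f (p + n * m) p = cnj (coeff2 f p (p + n * m))"
      by (metis assms coeff2_star2)
    then have "coeff2 f (p + n * m) p \<noteq> 0" using ne pm by auto
    then have "\<not> \<sigma> * p + \<tau> * m < q" using AB by blast
    then show "rweight q i j" using pm by (auto simp: rweight_pm rweight_pm')
  qed
qed

lemma W_mult:
  assumes "W a f" "W b g"
  shows "W (a + b) (f * g :: 'a::comm_ring_1 fps2)"
  unfolding W_def
proof (intro allI impI)
  fix P Q assume "coeff2 (f * g) P Q \<noteq> 0"
  then obtain i j where ij: "i \<le> P" "j \<le> Q" and n0: "coeff2 f i j * coeff2 g (P - i) (Q - j) \<noteq> 0"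
    unfolding coeff2_mult by (meson atMost_iff sum.not_neutral_contains_not_neutral)
  then have A: "rweight a i j" and B: "rweight b (P - i) (Q - j)"
    using assms unfolding W_def by (metis mult_zero_left mult_zero_right)+
  define k l where "k = P - i" and "l = Q - j"
  have PQ: "P = i + k" "Q = j + l" using ij by (simp_all add: k_def l_def)
  have swap: "rweight q x y \<longleftrightarrow> rweight q y x" for q x y unfolding resonant_weight_def by blast
  have same: "rweight (a + b) (i + k) (j + l)"
    if "i = p + n * m" "j = p" "a \<le> \<sigma> * p + \<tau> * m" "k = r + n * s" "l = r" "b \<le> \<sigma> * r + \<tau> * s" for p m r s i j k l
  proof -
    have "i + k = (p + r) + n * (m + s)" "j + l = p + r" using that by (simp_all add: algebra_simps)
    moreover have "a + b \<le> \<sigma> * (p + r) + \<tau> * (m + s)"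
      using that by (simp add: algebra_simps)
    ultimately show ?thesis by (simp only: rweight_pm)
  qed
  have opp: "rweight (a + b) (i + k) (j + l)"
    if "i = p + n * m" "j = p" "a \<le> \<sigma> * p + \<tau> * m" "k = r" "l = r + n * s" "b \<le> \<sigma> * r + \<tau> * s" for p m r s i j k l
  proof (cases "s \<le> m")
    case True
    have "n * m = n * (m - s) + n * s" "\<tau> * m = \<tau> * (m - s) + \<tau> * s" using True by (simp_all flip: distrib_left)
    moreover have "\<sigma> * (p + r + n * s) = \<sigma> * p + \<sigma> * r + \<sigma> * (n * s)" by (simp add: algebra_simps)
    ultimately have "i + k = (p + r + n * s) + n * (m - s)" "j + l = p + r + n * s" "a + b \<le> \<sigma> * (p + r + n * s) + \<tau> * (m - s)"
      using that tau_sig[of s] by linarith+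
    then show ?thesis by (simp only: rweight_pm)
  next
    case False
    have "n * s = n * (s - m) + n * m" "\<tau> * s = \<tau> * (s - m) + \<tau> * m" using False by (simp_all flip: distrib_left)
    moreover have "\<sigma> * (p + r + n * m) = \<sigma> * p + \<sigma> * r + \<sigma> * (n * m)" by (simp add: algebra_simps)
    ultimately have "j + l = (p + r + n * m) + n * (s - m)" "i + k = p + r + n * m" "a + b \<le> \<sigma> * (p + r + n * m) + \<tau> * (s - m)"
      using that tau_sig[of m] by linarith+
    then show ?thesis by (simp only: rweight_pm')
  qed
  obtain p m where pm: "i = p + n * m \<and> j = p \<or> i = p \<and> j = p + n * m" "a \<le> \<sigma> * p + \<tau> * m"
    using A unfolding resonant_weight_def by blast
  obtain r s where rs: "k = r + n * s \<and> l = r \<or> k = r \<and> l = r + n * s" "b \<le> \<sigma> * r + \<tau> * s"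
    using B unfolding resonant_weight_def k_def l_def by blast
  from pm(1) rs(1) show "rweight (a + b) P Q"
    unfolding PQ
  proof (elim disjE conjE)
    assume "i = p + n * m" "j = p" "k = r + n * s" "l = r"
    from same[OF this(1,2) pm(2) this(3,4) rs(2)] show "rweight (a + b) (i + k) (j + l)" .
  next
    assume "i = p + n * m" "j = p" "k = r" "l = r + n * s"
    from opp[OF this(1,2) pm(2) this(3,4) rs(2)] show "rweight (a + b) (i + k) (j + l)" .
  next
    assume "i = p" "j = p + n * m" "k = r + n * s" "l = r"
    from opp[OF this(2,1) pm(2) this(4,3) rs(2)] show "rweight (a + b) (i + k) (j + l)" by (simp only: swap)
  next
    assume "i = p" "j = p + n * m" "k = r" "l = r + n * s"
    from same[OF this(2,1) pm(2) this(4,3) rs(2)] show "rweight (a + b) (i + k) (j + l)" by (simp only: swap)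
  qed
qed

lemma W_power: "W a f \<Longrightarrow> W (k * a) (f ^ k)" if "k \<ge> 1" for f :: "'a::comm_ring_1 fps2"
  using that
proof (induction k rule: nat_induct_at_least)
  case (Suc k)
  then show ?case using W_mult[of a f "k * a" "f ^ k"] by simp
qed simp

end

lemma star2_pb: "star2 (pb f g) = - pb (star2 f) (star2 g)"
proof -
  have "star2 X2 = Y2" "star2 Y2 = X2"
    by (rule fps2_eqI; auto simp: coeff2_X2 coeff2_Y2)+
  then have "pb (star2 X2) (star2 Y2) = - 1" by (simp add: pb_def)
  then show ?thesis using fhom_pb[OF fhom_star2, of f g] by simp
qed

text \<open>\<open>star2\<close> exchanges the two variables and so reverses the bracket; the sign
  is compensated by the conjugation of the factor \<open>- 2 * \<i>\<close>.\<close>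

lemma star2_zexp:
  assumes "star2 \<xi> = \<xi>" "star2 f = f" "vord 3 \<xi>"
  shows "star2 (zexp \<xi> f) = zexp \<xi> f"
proof -
  have "star2 (zexp \<xi> f) = zexp \<xi> (star2 f)"
  proof (rule fhom_pexp_conj[OF fhom_star2])
    show "star2 (pb f (const2 (- 2 * \<i>) * \<xi>)) = pb (star2 f) (const2 (- 2 * \<i>) * \<xi>)" for f
      by (simp add: star2_pb fhom_mult[OF fhom_star2] fhom_const2[OF fhom_star2] assms(1) pb_scale_right)
        (simp add: const2_simps)
  qed (use assms(3) in \<open>auto intro: vord_const2_mult\<close>)
  then show ?thesis by (simp add: assms(2))
qed

lemma coeff2_pb_monom:
  "coeff2 (pb (X2 ^ a * Y2 ^ b) K) J L = (if a \<le> Suc J \<and> b \<le> Suc L then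
     (of_nat a * of_nat (Suc L - b) - of_nat b * of_nat (Suc J - a)) * coeff2 K (Suc J - a) (Suc L - b) else 0)"
proof -
  have "coeff2 (pb (X2 ^ a * Y2 ^ b) K) J L = (\<Sum>i\<le>Suc J. if i = a then \<Sum>j\<le>Suc L. if j = b then
     (of_nat a * of_nat (Suc L - b) - of_nat b * of_nat (Suc J - a)) * coeff2 K (Suc J - a) (Suc L - b) else 0 else 0)"
    unfolding coeff2_pb
  proof (intro sum.cong refl)
    fix i
    have "(\<Sum>j\<le>Suc L. (of_nat i * of_nat (Suc L - j) - of_nat j * of_nat (Suc J - i)) *
          (coeff2 (X2 ^ a * Y2 ^ b) i j * coeff2 K (Suc J - i) (Suc L - j))) =
      (\<Sum>j\<le>Suc L. if i = a \<and> j = b then (of_nat a * of_nat (Suc L - b) - of_nat b * of_nat (Suc J - a)) * coeff2 K (Suc J - a) (Suc L - b) else 0)"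
      by (intro sum.cong) (auto simp: coeff2_monom)
    then show "(\<Sum>j\<le>Suc L. (of_nat i * of_nat (Suc L - j) - of_nat j * of_nat (Suc J - i)) *
          (coeff2 (X2 ^ a * Y2 ^ b) i j * coeff2 K (Suc J - i) (Suc L - j))) =
      (if i = a then \<Sum>j\<le>Suc L. if j = b then
     (of_nat a * of_nat (Suc L - b) - of_nat b * of_nat (Suc J - a)) * coeff2 K (Suc J - a) (Suc L - b) else 0 else 0)"
      by (auto simp del: sum.atMost_Suc)
  qed
  then show ?thesis by (simp del: sum.atMost_Suc of_nat_Suc)
qed

section \<open>The leading part of the homological operator\<close>

locale resonant_hamiltonian = resonance +
  fixes G :: "complex fps2" and \<beta> :: real
  assumes G_star: "star2 G = G" and G_W: "W \<tau> G"
    and lead_pos: "coeff2 G n 0 = of_real \<beta>" "\<beta> > 0"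
    and lead_I3: "n \<noteq> 5 \<Longrightarrow> coeff2 G 3 3 \<noteq> 0"
begin

text \<open>Zero for \<open>n = 5\<close>, where (z \<zeta>)^3 lies above the leading weight; the
  recursion formulas then cover both cases.\<close>

definition \<alpha> :: real where "\<alpha> = (if n = 5 then 0 else Re (coeff2 G 3 3))"

lemma alpha: "n \<noteq> 5 \<Longrightarrow> coeff2 G 3 3 = of_real \<alpha>" "n \<noteq> 5 \<Longrightarrow> \<alpha> \<noteq> 0" "n = 5 \<Longrightarrow> \<alpha> = 0"
proof -
  have "coeff2 G 3 3 = cnj (coeff2 G 3 3)" by (metis G_star coeff2_star2)
  then show "n \<noteq> 5 \<Longrightarrow> coeff2 G 3 3 = of_real \<alpha>" by (simp add: \<alpha>_def complex_eq_iff)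
  then show "n \<noteq> 5 \<Longrightarrow> \<alpha> \<noteq> 0" using lead_I3 by auto
  show "n = 5 \<Longrightarrow> \<alpha> = 0" unfolding \<alpha>_def by simp
qed

definition leading :: "complex fps2" where
  "leading = const2 (of_real \<alpha>) * (X2 ^ 3 * Y2 ^ 3) + const2 (of_real \<beta>) * (X2 ^ n * Y2 ^ 0 + X2 ^ 0 * Y2 ^ n)"

lemma W_G_leading: "W (Suc \<tau>) (G - leading)"
proof -
  have st: "star2 (G - leading) = G - leading"
  proof -
    have "star2 X2 = Y2" "star2 Y2 = X2"
      by (rule fps2_eqI; auto simp: coeff2_X2 coeff2_Y2)+
    then show ?thesis
      by (simp add: fhom_diff[OF fhom_star2] G_star leading_def fhom_add[OF fhom_star2] fhom_mult[OF fhom_star2]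
        fhom_const2[OF fhom_star2] fhom_power[OF fhom_star2] fhom_1[OF fhom_star2] algebra_simps)
  qed
  have c: "coeff2 leading i j = (if i = 3 \<and> j = 3 then of_real \<alpha> else 0) +
      of_real \<beta> * ((if i = n \<and> j = 0 then 1 else 0) + (if i = 0 \<and> j = n then 1 else 0))" for i j
    unfolding leading_def coeff2_add coeff2_const2_mult coeff2_monom by simp
  show ?thesis
    unfolding W_iff_star[OF st]
  proof (intro conjI allI impI)
    fix i j assume "coeff2 (G - leading) i j \<noteq> 0"
    then have "coeff2 G i j \<noteq> 0 \<or> i = 3 \<and> j = 3 \<or> i = n \<and> j = 0 \<or> i = 0 \<and> j = n"
      by (auto simp: c split: if_splits)
    moreover have "rweight 0 i j" if "coeff2 G i j \<noteq> 0" using W_ww_0[OF G_W that] .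
    moreover have "rweight 0 3 3" "rweight 0 n 0" "rweight 0 0 n"
      using rweight_pm[of 0 3 0] rweight_pm[of 0 0 1] rweight_pm'[of 0 0 1] by simp_all
    ultimately show "rweight 0 i j" by auto
  next
    fix p m assume "\<sigma> * p + \<tau> * m < Suc \<tau>"
    \<comment> \<open>Besides weights below \<open>\<tau>\<close>, only the exponents of the leading
      monomials themselves remain.\<close>
    then consider "\<sigma> * p + \<tau> * m < \<tau>" | "m = 0" "p = 3" "n \<noteq> 5" | "m = 1" "p = 0"
      using params by (cases m; cases "p = 3") auto
    then show "coeff2 (G - leading) (p + n * m) p = 0"
    proof cases
      case 1
      then have "coeff2 G (p + n * m) p = 0" by (rule W_coeff_pm[OF G_W])
      moreover have "\<not> (p + n * m = 3 \<and> p = 3) \<or> \<alpha> = 0"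
        using 1 params alpha(3) by (cases m) auto
      moreover have "\<not> (p + n * m = n \<and> p = 0)" using 1 n5 by (cases m) auto
      moreover have "\<not> (p + n * m = 0 \<and> p = n)" using n5 by auto
      ultimately show ?thesis by (auto simp: c)
    next
      case 2
      then show ?thesis using alpha(1) n5 by (auto simp: c)
    next
      case 3
      then show ?thesis using lead_pos(1) n5 by (auto simp: c)
    qed
  qed
qed

text \<open>The exponent \<open>p\<close> is determined by weight and harmonic. The value zero where
  no such \<open>p\<close> exists (for \<open>\<tau> * m > q\<close>, or for \<open>n = 5\<close>
  when \<open>q - 5 * m\<close> is odd) lets the recursions run over all \<open>m\<close>.\<close>

definition harmonic_coeff :: "nat \<Rightarrow> complex fps2 \<Rightarrow> nat \<Rightarrow> complex" where
  "harmonic_coeff q K m = (if \<exists>p. \<sigma> * p + \<tau> * m = q then coeff2 K ((q - \<tau> * m) div \<sigma> + n * m) ((q - \<tau> * m) div \<sigma>) else 0)"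

lemma harmonic_coeff_eq: "\<sigma> * p + \<tau> * m = q \<Longrightarrow> harmonic_coeff q K m = coeff2 K (p + n * m) p"
proof -
  assume a: "\<sigma> * p + \<tau> * m = q"
  then have "(q - \<tau> * m) div \<sigma> = p" using params by auto
  then show ?thesis using a by (auto simp: harmonic_coeff_def)
qed

lemma harmonic_coeff_none: "(\<And>p. \<sigma> * p + \<tau> * m \<noteq> q) \<Longrightarrow> harmonic_coeff q K m = 0"
  by (auto simp: harmonic_coeff_def)

text \<open>The bracket of the harmonics \<open>z\<^sup>n\<close> and \<open>\<zeta>\<^sup>n\<close> has leading weight only if \<open>2 \<tau> = n \<sigma>\<close>, i.e. \<open>n \<le> 6\<close>.\<close>

definition \<epsilon> :: real where "\<epsilon> = (if n \<le> 6 then 1 else 0)"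

lemma coeff_pb_leading:
  assumes K: "W (b + \<sigma>) K" and pm: "\<sigma> * p + \<tau> * m = b + \<tau>"
  shows "coeff2 (pb G K) (p + n * m) p = coeff2 (pb leading K) (p + n * m) p"
proof -
  have "W (Suc \<tau> + b) (pb (G - leading) K)" by (rule W_pb[OF W_G_leading K])
  then have "coeff2 (pb (G - leading) K) (p + n * m) p = 0"
    by (rule W_coeff_pm) (simp add: pm)
  then show ?thesis by (simp add: pb_diff_left)
qed

text \<open>Bracketing with z^n raises the harmonic by one, with (z \<zeta>)^3 keeps it and with
  \<zeta>^n lowers it; so harmonic \<open>m\<close> of the result sees the harmonics
  \<open>m - 1\<close>, \<open>m\<close> and \<open>m + 1\<close> of \<open>K\<close>.\<close>

lemma row_pos:
  assumes K: "W (b + \<sigma>) K" and pm: "\<sigma> * p + \<tau> * m = b + \<tau>" and m: "m \<ge> 1"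
  shows "coeff2 (pb G K) (p + n * m) p =
     of_real (\<beta> * n * real (p + 1)) * harmonic_coeff (b + \<sigma>) K (m - 1) - of_real (3 * \<alpha> * n * m) * harmonic_coeff (b + \<sigma>) K m
     - of_real (\<epsilon> * \<beta> * n * real (p + n * m + 1)) * harmonic_coeff (b + \<sigma>) K (m + 1)"
proof -
  let ?q = "b + \<sigma>"
  have c1: "coeff2 (pb (X2 ^ n * Y2 ^ 0) K) (p + n * m) p = of_nat n * of_nat (p + 1) * harmonic_coeff ?q K (m - 1)"
  proof -
    obtain m' where m': "m = Suc m'" using m by (cases m) auto
    have "\<sigma> * (p + 1) + \<tau> * m' = ?q" using pm by (simp add: m')
    then have "harmonic_coeff ?q K m' = coeff2 K (p + 1 + n * m') (p + 1)" by (rule harmonic_coeff_eq)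
    moreover have "Suc (p + n * m) - n = p + 1 + n * m'" "n \<le> Suc (p + n * m)" by (simp_all add: m')
    ultimately show ?thesis by (simp only: coeff2_pb_monom) (simp add: m')
  qed
  have c2: "coeff2 (pb (X2 ^ 0 * Y2 ^ n) K) (p + n * m) p = - of_real (\<epsilon> * n * real (p + n * m + 1)) * harmonic_coeff ?q K (m + 1)"
  proof (cases "n \<le> Suc p")
    case True
    then obtain r where r: "Suc p = n + r" by (metis le_Suc_ex)
    have J: "Suc (p + n * m) = r + n * (m + 1)" using r by simp
    have "\<sigma> * Suc p = \<sigma> * n + \<sigma> * r" unfolding r by (simp add: algebra_simps)
    then have wt: "\<sigma> * r + \<tau> * (m + 1) + \<sigma> * n = ?q + 2 * \<tau>" using pm by (simp add: algebra_simps)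
    have harmonic_coeff: "of_real \<epsilon> * harmonic_coeff ?q K (m + 1) = coeff2 K (r + n * (m + 1)) r"
    proof (cases "n \<le> 6")
      case True
      then have "\<sigma> * n = 2 * \<tau>" using params by auto
      then have "harmonic_coeff ?q K (m + 1) = coeff2 K (r + n * (m + 1)) r" using wt by (intro harmonic_coeff_eq) simp
      then show ?thesis using True by (simp add: \<epsilon>_def)
    next
      case False
      \<comment> \<open>The monomial of \<open>K\<close> concerned has weight below
        \<open>b + \<sigma>\<close>, so its coefficient vanishes.\<close>
      then have "\<sigma> * n > 2 * \<tau>" using params by auto
      then have "coeff2 K (r + n * (m + 1)) r = 0" using wt by (intro W_coeff_pm[OF K]) simp
      then show ?thesis using False by (simp add: \<epsilon>_def)
    qed
    have "coeff2 K (Suc (p + n * m)) (Suc p - n) = of_real \<epsilon> * harmonic_coeff ?q K (m + 1)"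
    proof -
      have "Suc p - n = r" using r by simp
      then show ?thesis by (simp only: J harmonic_coeff)
    qed
    moreover have "coeff2 (pb (X2 ^ 0 * Y2 ^ n) K) (p + n * m) p =
        - (of_nat n * of_nat (Suc (p + n * m))) * coeff2 K (Suc (p + n * m)) (Suc p - n)"
      using True by (simp only: coeff2_pb_monom) simp
    ultimately show ?thesis by simp
  next
    case False
    have "\<epsilon> = 0 \<or> harmonic_coeff ?q K (m + 1) = 0"
    proof (cases "n \<le> 6")
      case True
      have "harmonic_coeff ?q K (m + 1) = 0"
      proof (rule harmonic_coeff_none)
        fix r show "\<sigma> * r + \<tau> * (m + 1) \<noteq> ?q"
        proof
          assume "\<sigma> * r + \<tau> * (m + 1) = ?q"
          with pm have "\<sigma> * p + \<sigma> = \<sigma> * r + 2 * \<tau>" by (simp add: algebra_simps)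
          moreover have "2 * \<tau> = \<sigma> * n" using True params by auto
          ultimately have "\<sigma> * (p + 1) = \<sigma> * (r + n)" by (simp add: algebra_simps)
          then have "p + 1 = r + n" using params by auto
          with False show False by simp
        qed
      qed
      then show ?thesis ..
    qed (simp add: \<epsilon>_def)
    then show ?thesis using False by (auto simp only: coeff2_pb_monom; simp)
  qed
  have c3: "of_real \<alpha> * coeff2 (pb (X2 ^ 3 * Y2 ^ 3) K) (p + n * m) p = - of_real (3 * \<alpha> * n * m) * harmonic_coeff ?q K m"
  proof (cases "n = 5")
    case True
    then show ?thesis using alpha(3) by simp
  next
    case n: False
    then have st: "\<sigma> = 1" "\<tau> = 3" using params by auto
    show ?thesis
    proof (cases "2 \<le> p")
      case True
      then obtain r where r: "p = r + 2" by (metis add.commute le_Suc_ex)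
      have "harmonic_coeff ?q K m = coeff2 K (r + n * m) r" using pm st r by (intro harmonic_coeff_eq) simp
      then show ?thesis unfolding coeff2_pb_monom r
        by (simp add: algebra_simps)
    next
      case False
      have "harmonic_coeff ?q K m = 0" using pm st False by (intro harmonic_coeff_none) auto
      then show ?thesis using False by (simp only: coeff2_pb_monom) simp
    qed
  qed
  have "coeff2 (pb leading K) (p + n * m) p = of_real \<alpha> * coeff2 (pb (X2 ^ 3 * Y2 ^ 3) K) (p + n * m) p +
     of_real \<beta> * (coeff2 (pb (X2 ^ n * Y2 ^ 0) K) (p + n * m) p + coeff2 (pb (X2 ^ 0 * Y2 ^ n) K) (p + n * m) p)"
    by (simp only: leading_def pb_add_left pb_scale_left coeff2_add coeff2_const2_mult)
  then show ?thesis
    unfolding coeff_pb_leading[OF K pm] c1 c2 c3 by (simp add: algebra_simps)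
qed

text \<open>For the zeroth harmonic the neighbours are the harmonics one and minus one, and the
  latter is the conjugate of the former; so only the imaginary part of harmonic one is seen.\<close>

lemma row_zero:
  assumes K: "W (b + \<sigma>) K" "star2 K = K" and n: "n = 5" and p: "2 * p = b + 5"
  shows "coeff2 (pb G K) p p = of_real (\<beta> * n * real (p + 1)) * (cnj (harmonic_coeff (b + \<sigma>) K 1) - harmonic_coeff (b + \<sigma>) K 1)"
proof -
  have st: "\<sigma> = 2" "\<tau> = 5" using params n by auto
  have cp: "coeff2 (pb (X2 ^ n * Y2 ^ 0) K) p p = of_nat n * of_nat (p + 1) * cnj (harmonic_coeff (b + \<sigma>) K 1)"
    "coeff2 (pb (X2 ^ 0 * Y2 ^ n) K) p p = - of_nat n * of_nat (p + 1) * harmonic_coeff (b + \<sigma>) K 1"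
  proof -
    have "coeff2 (pb (X2 ^ n * Y2 ^ 0) K) p p = of_nat n * of_nat (p + 1) * cnj (harmonic_coeff (b + \<sigma>) K 1) \<and>
    coeff2 (pb (X2 ^ 0 * Y2 ^ n) K) p p = - of_nat n * of_nat (p + 1) * harmonic_coeff (b + \<sigma>) K 1"
    proof (cases "4 \<le> p")
      case True
      then obtain r where r: "p = r + 4" by (metis add.commute le_Suc_ex)
      have "harmonic_coeff (b + \<sigma>) K 1 = coeff2 K (r + n * 1) r" using p st r by (intro harmonic_coeff_eq) simp
      moreover have "coeff2 K r (r + n * 1) = cnj (coeff2 K (r + n * 1) r)" by (metis K(2) coeff2_star2)
      ultimately show ?thesis unfolding coeff2_pb_monom r n by (simp add: algebra_simps)
    next
      case False
      have "harmonic_coeff (b + \<sigma>) K 1 = 0" using p st False by (intro harmonic_coeff_none) auto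
      then show ?thesis unfolding coeff2_pb_monom n using False by simp
    qed
    then show "coeff2 (pb (X2 ^ n * Y2 ^ 0) K) p p = of_nat n * of_nat (p + 1) * cnj (harmonic_coeff (b + \<sigma>) K 1)"
    "coeff2 (pb (X2 ^ 0 * Y2 ^ n) K) p p = - of_nat n * of_nat (p + 1) * harmonic_coeff (b + \<sigma>) K 1" by blast+
  qed
  have "coeff2 (pb leading K) p p = of_real \<alpha> * coeff2 (pb (X2 ^ 3 * Y2 ^ 3) K) p p +
     of_real \<beta> * (coeff2 (pb (X2 ^ n * Y2 ^ 0) K) p p + coeff2 (pb (X2 ^ 0 * Y2 ^ n) K) p p)"
    by (simp only: leading_def pb_add_left pb_scale_left coeff2_add coeff2_const2_mult)
  then show ?thesis
    using coeff_pb_leading[OF K(1), of p 0] p st alpha(3)[OF n] unfolding cp by (simp add: algebra_simps)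
qed

end

section \<open>The normal form within resonant series\<close>

lemma downward_recursion:
  fixes A B D :: "nat \<Rightarrow> 'a::comm_ring_1"
  obtains k where "\<And>m. m > M \<Longrightarrow> k m = 0" "\<And>m. m \<le> M \<Longrightarrow> k m = A m * k (m + 1) + B m * k (m + 2) + D m"
proof -
  have "\<exists>k. (\<forall>m>M. k m = 0) \<and> (\<forall>m\<le>M. m + j > M \<longrightarrow> k m = A m * k (m + 1) + B m * k (m + 2) + D m)"
    if "j \<le> Suc M" for j
    using that
  proof (induction j)
    case 0
    show ?case by (rule exI[of _ "\<lambda>m. 0"]) simp
  next
    case (Suc j)
    then obtain k where k: "\<forall>m>M. k m = 0" "\<forall>m\<le>M. m + j > M \<longrightarrow> k m = A m * k (m + 1) + B m * k (m + 2) + D m"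
      by auto
    define m0 where "m0 = M - j"
    have m0: "m0 + j = M" using Suc.prems by (simp add: m0_def)
    show ?case
      by (rule exI[of _ "k(m0 := A m0 * k (m0 + 1) + B m0 * k (m0 + 2) + D m0)"])
        (use k m0 in auto)
  qed
  from this[of "Suc M"] that show thesis by auto
qed

context resonance
begin

text \<open>Here \<open>c\<close> is the coefficient of \<open>z\<^bsup>p + n m\<^esup> \<zeta>\<^sup>p\<close>; the factor \<open>I\<^sup>3\<close> shifts the index \<open>k\<close> of \<open>a\<^sub>k\<close> to \<open>p = k + 3\<close>.\<close>

definition nf_cond :: "nat \<Rightarrow> nat \<Rightarrow> complex \<Rightarrow> bool" where
  "nf_cond p m c \<longleftrightarrow> (m \<ge> 2 \<longrightarrow> c = 0) \<and> (m = 1 \<longrightarrow> Im c = 0) \<and>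
     (n \<ge> 6 \<and> m = 1 \<and> p mod 3 = 2 \<longrightarrow> c = 0) \<and> (n = 5 \<and> m \<le> 1 \<and> p mod 5 = 4 \<longrightarrow> c = 0)"

definition nf :: "complex fps2 \<Rightarrow> bool" where
  "nf f \<longleftrightarrow> (\<forall>p m. nf_cond p m (coeff2 f (p + n * m) p))"

lemma nf_cond_diff: "nf_cond p m c \<Longrightarrow> nf_cond p m d \<Longrightarrow> nf_cond p m (c - d)"
  by (auto simp: nf_cond_def)

lemma nf_cond_0 [simp]: "nf_cond p m 0"
  by (simp add: nf_cond_def)

text \<open>A series of pure weight \<open>q\<close> with prescribed nonnegative harmonics, the
  negative ones being the conjugates; it is real once \<open>k 0\<close> is.\<close>

definition of_harmonics :: "nat \<Rightarrow> (nat \<Rightarrow> complex) \<Rightarrow> complex fps2" where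
  "of_harmonics q k = Abs_fps2 (\<lambda>i j.
     if j \<le> i \<and> n dvd (i - j) \<and> \<sigma> * j + \<tau> * ((i - j) div n) = q then k ((i - j) div n)
     else if i < j \<and> n dvd (j - i) \<and> \<sigma> * i + \<tau> * ((j - i) div n) = q then cnj (k ((j - i) div n)) else 0)"

lemma coeff2_of_harmonics: "coeff2 (of_harmonics q k) (p + n * m) p = (if \<sigma> * p + \<tau> * m = q then k m else 0)"
  using n5 by (simp add: of_harmonics_def)

lemma star2_of_harmonics: "Im (k 0) = 0 \<Longrightarrow> star2 (of_harmonics q k) = of_harmonics q k"
  by (rule fps2_eqI) (auto simp: of_harmonics_def complex_eq_iff)

lemma W_of_harmonics: 
  assumes "Im (k 0) = 0"
  shows "W q (of_harmonics q k)"
  unfolding W_iff_star[OF star2_of_harmonics[of k q, OF assms]]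
proof (intro conjI allI impI)
  fix i j assume "coeff2 (of_harmonics q k) i j \<noteq> 0"
  then have "j \<le> i \<and> n dvd (i - j) \<or> i < j \<and> n dvd (j - i)"
    by (auto simp: of_harmonics_def split: if_splits)
  then show "rweight 0 i j"
  proof (elim disjE conjE)
    assume "j \<le> i" "n dvd (i - j)"
    then obtain m where "i - j = n * m" by (elim dvdE)
    then have "i = j + n * m" using \<open>j \<le> i\<close> by simp
    then show ?thesis by (simp add: rweight_pm)
  next
    assume "i < j" "n dvd (j - i)"
    then obtain m where "j - i = n * m" by (elim dvdE)
    then have "j = i + n * m" using \<open>i < j\<close> by simp
    then show ?thesis by (simp add: rweight_pm')
  qed
qed (simp add: coeff2_of_harmonics)

lemma W_coeff_axis: "W q f \<Longrightarrow> coeff2 f i 0 \<noteq> 0 \<Longrightarrow> \<exists>m. i = n * m \<and> q \<le> \<tau> * m"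
proof -
  assume "W q f" "coeff2 f i 0 \<noteq> 0"
  then have "rweight q i 0" by (auto simp: W_def)
  then show ?thesis using n5 by (auto simp: resonant_weight_def)
qed

end

context resonant_hamiltonian
begin

section \<open>The three-term recursion and its distinguished solution\<close>

definition row_exp :: "nat \<Rightarrow> nat \<Rightarrow> nat" where "row_exp q m = (q - \<tau> * m) div \<sigma>"

text \<open>Together with \<open>rec2\<close>, the ratios of the coefficients in
  \<open>row_pos\<close>, taken at harmonic \<open>m + 1\<close> and exponent
  \<open>row_exp q m - 1\<close>.\<close>

definition rec1 :: "nat \<Rightarrow> nat \<Rightarrow> real" where "rec1 q m = 3 * \<alpha> * real (m + 1) / (\<beta> * real (row_exp q m))"

definition rec2 :: "nat \<Rightarrow> nat \<Rightarrow> real" where "rec2 q m = \<epsilon> * real (row_exp q m + n * (m + 1)) / real (row_exp q m)"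

lemma row_exp_eq: "\<sigma> * P + \<tau> * m = q \<Longrightarrow> row_exp q m = P"
  using params by (auto simp: row_exp_def)

lemma beta_pos: "\<beta> > 0" by (fact lead_pos)

text \<open>Read as an equation for the lowest harmonic involved, so that the rows are solved from
  the top down. \<open>P \<ge> 1\<close> says that the row exists; for \<open>P = 0\<close> harmonic
  \<open>m\<close> of \<open>K\<close> is a pure power of z, and no such equation determines
  it.\<close>

lemma row_solved:
  assumes K: "W (b + \<sigma>) K" and P: "\<sigma> * P + \<tau> * m = b + \<sigma>" "P \<ge> 1"
  shows "coeff2 (pb G K) ((P - 1) + n * (m + 1)) (P - 1) = of_real (\<beta> * n * P) *
    (harmonic_coeff (b + \<sigma>) K m - of_real (rec1 (b + \<sigma>) m) * harmonic_coeff (b + \<sigma>) K (m + 1) - of_real (rec2 (b + \<sigma>) m) * harmonic_coeff (b + \<sigma>) K (m + 2))"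
proof -
  obtain p where p: "P = Suc p" using P(2) by (cases P) auto
  have w: "\<sigma> * p + \<tau> * (m + 1) = b + \<tau>" using P(1) p by simp
  have "real P \<noteq> 0" using P(2) by simp
  then have e: "3 * \<alpha> * real n * real (m + 1) = \<beta> * real n * real P * rec1 (b + \<sigma>) m"
    "\<epsilon> * \<beta> * real n * real (p + n * (m + 1) + 1) = \<beta> * real n * real P * rec2 (b + \<sigma>) m"
    using row_exp_eq[OF P(1)] beta_pos by (simp_all add: rec1_def rec2_def p field_simps del: of_nat_Suc)
  have "coeff2 (pb G K) (p + n * (m + 1)) p = of_real (\<beta> * real n * real (p + 1)) * harmonic_coeff (b + \<sigma>) K m
     - of_real (3 * \<alpha> * real n * real (m + 1)) * harmonic_coeff (b + \<sigma>) K (m + 1)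
     - of_real (\<epsilon> * \<beta> * real n * real (p + n * (m + 1) + 1)) * harmonic_coeff (b + \<sigma>) K (m + 2)"
    using row_pos[OF K w] by simp
  then show ?thesis unfolding e by (simp add: p algebra_simps)
qed

text \<open>Normalised to one at the top index \<open>q div \<tau>\<close>. When
  \<open>\<tau>\<close> divides \<open>q\<close>, it describes, up to a factor, the leading
  harmonics of the power of \<open>G\<close> of that weight.\<close>

definition fundamental_row :: "nat \<Rightarrow> nat \<Rightarrow> real" where
  "fundamental_row q = (SOME y. (\<forall>m>q div \<tau>. y m = 0) \<and>
    (\<forall>m\<le>q div \<tau>. y m = rec1 q m * y (m + 1) + rec2 q m * y (m + 2) + (if m = q div \<tau> then 1 else 0)))"

lemma fundamental_row: "m > q div \<tau> \<Longrightarrow> fundamental_row q m = 0"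
  "m \<le> q div \<tau> \<Longrightarrow> fundamental_row q m = rec1 q m * fundamental_row q (m + 1) + rec2 q m * fundamental_row q (m + 2) + (if m = q div \<tau> then 1 else 0)"
proof -
  have "\<exists>y. (\<forall>m>q div \<tau>. y m = 0) \<and>
    (\<forall>m\<le>q div \<tau>. y m = rec1 q m * y (m + 1) + rec2 q m * y (m + 2) + (if m = q div \<tau> then 1 else 0))"
    by (rule downward_recursion[of "q div \<tau>" "rec1 q" "rec2 q" "\<lambda>m. if m = q div \<tau> then 1 else 0"]) blast
  from someI_ex[OF this] show "m > q div \<tau> \<Longrightarrow> fundamental_row q m = 0"
    "m \<le> q div \<tau> \<Longrightarrow> fundamental_row q m = rec1 q m * fundamental_row q (m + 1) + rec2 q m * fundamental_row q (m + 2) + (if m = q div \<tau> then 1 else 0)"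
    unfolding fundamental_row_def[symmetric] by blast+
qed

lemma fundamental_row_top: "fundamental_row q (q div \<tau>) = 1"
  using fundamental_row(2)[of "q div \<tau>" q] fundamental_row(1)[of q] by simp

text \<open>
  With \<open>s = sgn \<alpha>\<close>, the numbers \<open>s\<^sup>j fundamental_row (M - j)\<close> satisfy a recursion with positive
  coefficients, so they never vanish.
\<close>

lemma fundamental_row_nonzero_generic:
  assumes "n \<noteq> 5" "m \<le> q div \<tau>"
  shows "fundamental_row q m \<noteq> 0"
proof -
  have st: "\<sigma> = 1" "\<tau> = 3" using params assms(1) by auto
  define M where "M = q div \<tau>"
  define s where "s = sgn \<alpha>"
  have s: "s * s = 1" "s * \<alpha> > 0" "s \<noteq> 0" using alpha(2)[OF assms(1)] by (auto simp: s_def sgn_if)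
  have pw1: "row_exp q m \<ge> 1" if "m < M" for m using that st by (auto simp: M_def row_exp_def)
  have B0: "rec2 q m \<ge> 0" for m by (simp add: rec2_def \<epsilon>_def)
  have A0: "s * rec1 q m > 0" if "m < M" for m
  proof -
    have "s * rec1 q m = (s * \<alpha>) * (3 * real (m + 1) / (\<beta> * real (row_exp q m)))" by (simp add: rec1_def)
    also have "\<dots> > 0" using s(2) beta_pos pw1[OF that] by (intro mult_pos_pos[OF s(2)] divide_pos_pos mult_pos_pos) auto
    finally show ?thesis .
  qed
  have "s ^ j * fundamental_row q (M - j) > 0" if "j \<le> M" for j
    using that
  proof (induction j rule: less_induct)
    case (less j)
    consider "j = 0" | "j = 1" | i where "j = Suc (Suc i)" by (metis One_nat_def not0_implies_Suc)
    then show ?case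
    proof cases
      case 1
      then show ?thesis using fundamental_row_top by (simp add: M_def)
    next
      case 2
      have "fundamental_row q (M - 1) = rec1 q (M - 1) * fundamental_row q M"
        using fundamental_row(2)[of "M - 1" q] fundamental_row(1)[of q "M + 1"] less.prems 2 by (simp add: M_def[symmetric])
      then show ?thesis using A0[of "M - 1"] less.prems 2 fundamental_row_top by (simp add: M_def)
    next
      case 3
      define m where "m = M - j"
      have m: "m < M" "m + 1 = M - Suc i" "m + 2 = M - i" using less.prems 3 by (auto simp: m_def)
      have "fundamental_row q m = rec1 q m * fundamental_row q (m + 1) + rec2 q m * fundamental_row q (m + 2)"
        using fundamental_row(2)[of m q] m by (simp add: M_def[symmetric])
      then have "s ^ j * fundamental_row q m = (s * rec1 q m) * (s ^ Suc i * fundamental_row q (M - Suc i)) + rec2 q m * (s * s) * (s ^ i * fundamental_row q (M - i))"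
        unfolding m(2,3) 3 by (simp add: algebra_simps)
      moreover have "s ^ Suc i * fundamental_row q (M - Suc i) > 0" "s ^ i * fundamental_row q (M - i) > 0"
        using less.IH[of "Suc i"] less.IH[of i] less.prems 3 by auto
      ultimately show ?thesis using A0[OF m(1)] B0[of m] s(1) by (simp add: m_def add_pos_nonneg)
    qed
  qed
  from this[of "M - m"] assms(2) show ?thesis by (auto simp: M_def)
qed

text \<open>With \<open>rec1\<close> zero the recursion steps by two with positive factors, so the
  entries separate by parity.\<close>

lemma fundamental_row_5:
  assumes "n = 5" "m \<le> q div \<tau>"
  shows "even (q div \<tau> - m) \<Longrightarrow> fundamental_row q m > 0" "odd (q div \<tau> - m) \<Longrightarrow> fundamental_row q m = 0"
proof -
  have st: "\<sigma> = 2" "\<tau> = 5" using params assms(1) by auto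
  define M where "M = q div \<tau>"
  have A0: "rec1 q m = 0" for m using alpha(3)[OF assms(1)] by (simp add: rec1_def)
  have "(even j \<longrightarrow> fundamental_row q (M - j) > 0) \<and> (odd j \<longrightarrow> fundamental_row q (M - j) = 0)" if "j \<le> M" for j
    using that
  proof (induction j rule: less_induct)
    case (less j)
    consider "j = 0" | "j = 1" | i where "j = Suc (Suc i)" by (metis One_nat_def not0_implies_Suc)
    then show ?case
    proof cases
      case 1
      then show ?thesis using fundamental_row_top by (simp add: M_def)
    next
      case 2
      have "fundamental_row q (M - 1) = 0"
        using fundamental_row(2)[of "M - 1" q] fundamental_row(1)[of q "M + 1"] less.prems 2 by (simp add: M_def[symmetric] A0)
      then show ?thesis using 2 by simp
    next
      case 3
      define m where "m = M - j"
      have m: "m < M" "m + 2 = M - i" using less.prems 3 by (auto simp: m_def)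
      have "row_exp q m \<ge> 1" using less.prems 3 st by (auto simp: m_def M_def row_exp_def)
      then have "rec2 q m > 0" unfolding rec2_def \<epsilon>_def using assms(1) by auto
      moreover have "fundamental_row q m = rec2 q m * fundamental_row q (m + 2)"
        using fundamental_row(2)[of m q] m by (simp add: M_def[symmetric] A0)
      ultimately show ?thesis
        using less.IH[of i] less.prems 3 unfolding m(2) by (auto simp: m_def)
    qed
  qed
  from this[of "M - m"] assms(2) show "even (q div \<tau> - m) \<Longrightarrow> fundamental_row q m > 0" "odd (q div \<tau> - m) \<Longrightarrow> fundamental_row q m = 0"
    by (auto simp: M_def)
qed

lemma harmonic_coeff_beyond: "m > q div \<tau> \<Longrightarrow> harmonic_coeff q K m = 0"
proof (rule harmonic_coeff_none)
  fix p assume "m > q div \<tau>"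
  moreover have "0 < \<tau>" using params by auto
  ultimately have "q < \<tau> * m" by (simp add: div_less_iff_less_mult mult.commute)
  then show "\<sigma> * p + \<tau> * m \<noteq> q" by simp
qed

lemma harmonic_coeff_0_real: "star2 K = K \<Longrightarrow> Im (harmonic_coeff q K 0) = 0"
proof -
  assume K: "star2 K = K"
  have "coeff2 K p p = cnj (coeff2 K p p)" for p by (metis K coeff2_star2)
  then have "Im (coeff2 K p p) = 0" for p by (metis Reals_cnj_iff complex_is_Real_iff)
  then show ?thesis by (simp add: harmonic_coeff_def)
qed

lemma valid_5:
  assumes "n = 5" "q = \<tau> * M" "m \<le> M"
  shows "(\<exists>p. \<sigma> * p + \<tau> * m = q) \<longleftrightarrow> even (M - m)"
proof -
  have st: "\<sigma> = 2" "\<tau> = 5" using params assms(1) by auto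
  obtain d where d: "M = m + d" using assms(3) by (metis le_Suc_ex)
  have "q = 5 * d + 5 * m" using assms(2) d st by (simp add: algebra_simps)
  then have "(\<exists>p. \<sigma> * p + \<tau> * m = q) \<longleftrightarrow> (\<exists>p. 2 * p = 5 * d)" unfolding st by simp
  also have "\<dots> \<longleftrightarrow> even d" by presburger
  finally show ?thesis by (simp add: d)
qed

text \<open>Downwards from the top, every row of harmonic two or more forces the homogeneous
  recursion. If \<open>\<tau>\<close> does not divide the weight, the topmost unknown is itself
  governed by a row and everything vanishes, the diagonal coefficient with the help of reality.
  Otherwise the top unknown is a pure power of z, governed by no row; it is the free factor
  \<open>x\<close>, and the coefficient forbidden by the normal form in this weight makes
  \<open>x\<close> real.\<close>

lemma homological_kernel:
  assumes K: "W (b + \<sigma>) K" "star2 K = K" and b: "b \<ge> 1"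
    and nf: "\<And>p m. \<sigma> * p + \<tau> * m = b + \<tau> \<Longrightarrow> nf_cond p m (coeff2 (const2 (- 2 * \<i>) * pb G K) (p + n * m) p)"
  shows "\<exists>x. (\<not> \<tau> dvd b + \<sigma> \<longrightarrow> x = 0) \<and> (\<forall>m\<ge>1. harmonic_coeff (b + \<sigma>) K m = of_real x * of_real (fundamental_row (b + \<sigma>) m)) \<and>
    (harmonic_coeff (b + \<sigma>) K 0 = of_real x * of_real (fundamental_row (b + \<sigma>) 0) \<or> (\<forall>p. \<sigma> * p \<noteq> b + \<sigma>))"
proof -
  define q where "q = b + \<sigma>"
  define M where "M = q div \<tau>"
  define k where "k = harmonic_coeff q K"
  note K' = K(1)[folded q_def]
  have tau0: "\<tau> > 0" and sig0: "\<sigma> > 0" using params by auto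
  have beyond: "k m = 0" if "m > M" for m using harmonic_coeff_beyond that by (simp add: k_def M_def)
  have row: "coeff2 (const2 (- 2 * \<i>) * pb G K) ((P - 1) + n * (m + 1)) (P - 1) = (- 2 * \<i>) * of_real (\<beta> * n * P) *
     (k m - of_real (rec1 q m) * k (m + 1) - of_real (rec2 q m) * k (m + 2))"
    and nfrow: "nf_cond (P - 1) (m + 1) (coeff2 (const2 (- 2 * \<i>) * pb G K) ((P - 1) + n * (m + 1)) (P - 1))"
    if P: "\<sigma> * P + \<tau> * m = q" "P \<ge> 1" for P m
  proof -
    show "coeff2 (const2 (- 2 * \<i>) * pb G K) ((P - 1) + n * (m + 1)) (P - 1) = (- 2 * \<i>) * of_real (\<beta> * n * P) *
     (k m - of_real (rec1 q m) * k (m + 1) - of_real (rec2 q m) * k (m + 2))"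
      using row_solved[OF K(1) P[unfolded q_def]] by (simp add: k_def q_def)
    obtain p where "P = Suc p" using P(2) by (cases P) auto
    then show "nf_cond (P - 1) (m + 1) (coeff2 (const2 (- 2 * \<i>) * pb G K) ((P - 1) + n * (m + 1)) (P - 1))"
      using P by (intro nf) (simp add: q_def)
  qed
  have solve: "k m = of_real (rec1 q m) * k (m + 1) + of_real (rec2 q m) * k (m + 2)"
    if "\<sigma> * P + \<tau> * m = q" "P \<ge> 1" "m \<ge> 1 \<or> n \<ge> 6 \<and> (P - 1) mod 3 = 2 \<or> n = 5 \<and> (P - 1) mod 5 = 4" for P m
  proof -
    have "coeff2 (const2 (- 2 * \<i>) * pb G K) ((P - 1) + n * (m + 1)) (P - 1) = 0"
      using nfrow[OF that(1,2)] that(3) unfolding nf_cond_def by (cases "m \<ge> 1") auto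
    moreover have "(- 2 * \<i>) * of_real (\<beta> * n * P) \<noteq> (0 :: complex)" using that(2) beta_pos n5 by auto
    ultimately have "k m - of_real (rec1 q m) * k (m + 1) - of_real (rec2 q m) * k (m + 2) = 0"
      unfolding row[OF that(1,2)] by (simp only: mult_eq_0_iff) blast
    then show ?thesis by (simp add: algebra_simps)
  qed
  show ?thesis
  proof (cases "\<tau> dvd q")
    case False
    have k1: "k m = 0" if "m \<ge> 1" for m
      using that
    proof (induction "M - m" arbitrary: m rule: less_induct)
      case less
      show ?case
      proof (cases "m > M \<or> (\<forall>p. \<sigma> * p + \<tau> * m \<noteq> q)")
        case True
        then show ?thesis using beyond harmonic_coeff_none by (auto simp: k_def)
      next
        case F: False
        then obtain P where P: "\<sigma> * P + \<tau> * m = q" by auto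
        have P1: "P \<ge> 1" using False P by (cases P) auto
        have "k (m + 1) = 0" "k (m + 2) = 0"
          using less.hyps[of "m + 1"] less.hyps[of "m + 2"] beyond[of "m + 1"] beyond[of "m + 2"] F by force+
        then show ?thesis using solve[OF P P1] less.prems by simp
      qed
    qed
    \<comment> \<open>The row of harmonic one is only required to be real, which kills the real part
      of \<open>k 0\<close>; the imaginary part vanishes because \<open>K\<close> is real.\<close>
    have k0: "k 0 = 0"
    proof (cases "\<exists>p. \<sigma> * p + \<tau> * 0 = q")
      case True
      then obtain P where P: "\<sigma> * P + \<tau> * 0 = q" by blast
      have P1: "P \<ge> 1" using False P by (cases P) auto
      have "Im ((- 2 * \<i>) * of_real (\<beta> * n * P) * k 0) = 0"
        using nfrow[OF P P1] unfolding row[OF P P1] nf_cond_def by (simp add: k1)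
      then have "Re (k 0) = 0" using P1 beta_pos n5 by simp
      moreover have "Im (k 0) = 0" using harmonic_coeff_0_real[OF K(2)] by (simp add: k_def)
      ultimately show ?thesis by (simp add: complex_eq_iff)
    next
      case False
      then show ?thesis unfolding k_def by (intro harmonic_coeff_none) auto
    qed
    show ?thesis using k1 k0 by (intro exI[of _ 0]) (auto simp: k_def q_def)
  next
    case True
    then have qM: "q = \<tau> * M" by (simp add: M_def)
    have qge: "q \<ge> 1" using b by (simp add: q_def)
    then have M1: "M \<ge> 1" using qM by (cases M) auto
    have y_invalid: "fundamental_row q m = 0" if "\<forall>p. \<sigma> * p + \<tau> * m \<noteq> q" "m \<le> M" for m
    proof (cases "n = 5")
      case True
      then show ?thesis using valid_5[OF True qM that(2)] that fundamental_row_5(2)[OF True, of m q] by (auto simp: M_def)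
    next
      case False
      then have "\<sigma> * (\<tau> * (M - m)) + \<tau> * m = q"
        using that(2) qM params by (auto simp flip: distrib_left)
      with that(1) show ?thesis by blast
    qed
    define x where "x = k M"
    have kx: "k m = x * of_real (fundamental_row q m)" if "m \<ge> 1 \<or> n \<ge> 6 \<or> even M" for m
      using that
    proof (induction "M - m" arbitrary: m rule: less_induct)
      case less
      consider "m > M" | "m = M" | "m < M" "\<forall>p. \<sigma> * p + \<tau> * m \<noteq> q" | P where "m < M" "\<sigma> * P + \<tau> * m = q"
        by force
      then show ?case
      proof cases
        case 1
        then show ?thesis using beyond fundamental_row(1)[of q m] by (simp add: M_def)
      next
        case 2
        then show ?thesis using fundamental_row_top[of q] by (simp add: x_def M_def)
      next
        case 3
        then show ?thesis using y_invalid harmonic_coeff_none by (simp add: k_def)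
      next
        case 4
        have P1: "P \<ge> 1" using 4 qM tau0 by (cases P) auto
        \<comment> \<open>At \<open>m = 0\<close> the recursion rests on the extra vanishing in
          \<open>nf_cond\<close>: the weight \<open>\<tau> * M\<close> gives
          \<open>P = 3 * M\<close> for \<open>n \<ge> 6\<close> and \<open>2 * P = 5 * M\<close> for
          \<open>n = 5\<close>, so \<open>P - 1\<close> lies in the excluded residue class.\<close>
        have vac: "m \<ge> 1 \<or> n \<ge> 6 \<and> (P - 1) mod 3 = 2 \<or> n = 5 \<and> (P - 1) mod 5 = 4"
        proof (cases "m \<ge> 1")
          case False
          then have m0: "m = 0" by simp
          show ?thesis
          proof (cases "n = 5")
            case True
            then have "even M" using less.prems m0 by auto
            then obtain j where j: "M = 2 * j" by auto
            have st: "\<sigma> = 2" "\<tau> = 5" using params True by auto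
            have "2 * P = 5 * M" using 4(2) m0 qM st by simp
            then have "P = 5 * j" using j by simp
            then have "(P - 1) mod 5 = 4" using P1 by (cases j) simp_all
            then show ?thesis using True by simp
          next
            case False
            then have st: "\<sigma> = 1" "\<tau> = 3" "n \<ge> 6" using params by auto
            then have "P = 3 * M" "n \<ge> 6" using 4(2) m0 qM by simp_all
            obtain i where "M = Suc i" using M1 by (cases M) auto
            then have "P - 1 = 2 + 3 * i" using \<open>P = 3 * M\<close> by simp
            then have "(P - 1) mod 3 = 2" by (simp only: mod_mult_self2) simp
            then show ?thesis using \<open>n \<ge> 6\<close> by simp
          qed
        qed simp
        have IH: "k (m + 1) = x * of_real (fundamental_row q (m + 1))" "k (m + 2) = x * of_real (fundamental_row q (m + 2))"
          using less.hyps[of "m + 1"] less.hyps[of "m + 2"] beyond[of "m + 2"] fundamental_row(1)[of q "m + 2"] 4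
          by (force simp: M_def)+
        have "fundamental_row q m = rec1 q m * fundamental_row q (m + 1) + rec2 q m * fundamental_row q (m + 2)"
          using fundamental_row(2)[of m q] 4 by (simp add: M_def)
        then show ?thesis
          using solve[OF 4(2) P1 vac] IH by (simp add: algebra_simps)
      qed
    qed
    \<comment> \<open>\<open>k 0\<close> is real and \<open>fundamental_row q 0\<close> does not
      vanish. For \<open>n = 5\<close> and odd \<open>M\<close> there is no diagonal term in this
      weight, and the forbidden coefficient of a power of z \<zeta> makes \<open>k 1\<close> real
      instead.\<close>
    have xr: "Im x = 0"
    proof (cases "n \<ge> 6 \<or> even M")
      case True
      have "Im (x * of_real (fundamental_row q 0)) = 0"
        using kx[of 0] True harmonic_coeff_0_real[OF K(2), of q] by (simp add: k_def)
      moreover have "fundamental_row q 0 \<noteq> 0"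
      proof (cases "n = 5")
        case n: True
        then have "even M" using True by simp
        then show ?thesis using fundamental_row_5(1)[OF n, of 0 q] by (simp add: M_def)
      qed (use fundamental_row_nonzero_generic[of 0 q] in simp)
      ultimately show ?thesis by simp
    next
      case False
      then have n: "n = 5" and oM: "odd M" using n5 by auto
      have st: "\<sigma> = 2" "\<tau> = 5" using params n by auto
      obtain j where j: "M = 2 * j + 1" using oM by (elim oddE)
      define p where "p = 5 * j + 4"
      have p: "2 * p = b + 5" using qM j st by (simp add: q_def p_def)
      have "nf_cond p 0 (coeff2 (const2 (- 2 * \<i>) * pb G K) (p + n * 0) p)"
        using p st by (intro nf) simp
      moreover have "p mod 5 = 4" by (simp add: p_def)
      ultimately have "coeff2 (pb G K) p p = 0" using n unfolding nf_cond_def by simp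
      then have "of_real (\<beta> * n * real (p + 1)) * (cnj (k 1) - k 1) = 0"
        unfolding row_zero[OF K n p] by (simp only: k_def q_def)
      moreover have "of_real (\<beta> * n * real (p + 1)) \<noteq> (0 :: complex)"
        using beta_pos n5 unfolding of_real_eq_0_iff by simp
      ultimately have "cnj (k 1) = k 1" by (simp only: mult_eq_0_iff right_minus_eq) blast
      then have "Im (k 1) = 0" by (metis Reals_cnj_iff complex_is_Real_iff)
      moreover have "fundamental_row q 1 \<noteq> 0" using fundamental_row_5(1)[OF n, of 1 q] M1 oM by (simp add: M_def)
      ultimately show ?thesis using kx[of 1] by simp
    qed
    then have xe: "x = of_real (Re x)" by (simp add: complex_eq_iff)
    have z0: "(\<forall>p. \<sigma> * p \<noteq> q)" if "\<not> (n \<ge> 6 \<or> even M)"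
    proof -
      have n: "n = 5" "odd M" using that n5 by auto
      from valid_5[OF n(1) qM, of 0] n(2) show ?thesis by simp
    qed
    show ?thesis
      unfolding q_def[symmetric] k_def[symmetric]
    proof (intro exI[of _ "Re x"] conjI impI allI)
      show "k m = of_real (Re x) * of_real (fundamental_row q m)" if "1 \<le> m" for m
        unfolding xe[symmetric] using kx[of m] that by simp
      show "k 0 = of_real (Re x) * of_real (fundamental_row q 0) \<or> (\<forall>p. \<sigma> * p \<noteq> q)"
        unfolding xe[symmetric] using kx[of 0] z0 by blast
    qed (use True in simp)
  qed
qed

lemma W_Suc_from_kc:
  assumes "W q K" "star2 K = K" "\<And>m. harmonic_coeff q K m = 0"
  shows "W (Suc q) K"
  unfolding W_iff_star[OF assms(2)]
proof (intro conjI allI impI)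
  fix i j assume "coeff2 K i j \<noteq> 0"
  then show "rweight 0 i j" by (rule W_ww_0[OF assms(1)])
next
  fix p m assume "\<sigma> * p + \<tau> * m < Suc q"
  then consider "\<sigma> * p + \<tau> * m < q" | "\<sigma> * p + \<tau> * m = q" by linarith
  then show "coeff2 K (p + n * m) p = 0"
    using W_coeff_pm[OF assms(1)] harmonic_coeff_eq[of p m q K] assms(3)[of m] by cases auto
qed

text \<open>The rows of harmonic two and more are made to vanish. In the row of harmonic one the
  unknown \<open>k 0\<close> must be real, so it removes only the imaginary part of the coefficient;
  what remains is the real multiple of z^n + \<zeta>^n kept in the normal form. In weights divisible
  by \<open>\<tau>\<close> the parameter \<open>s\<close> removes one more coefficient.\<close>

lemma homological_solvable:
  assumes b: "b \<ge> 1" and t: "star2 t = t"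
  obtains K where "W (b + \<sigma>) K" "star2 K = K"
    "\<forall>p m. \<sigma> * p + \<tau> * m = b + \<tau> \<longrightarrow> nf_cond p m (coeff2 (t + const2 (- 2 * \<i>) * pb G K) (p + n * m) p)"
proof -
  define q where "q = b + \<sigma>"
  define M where "M = q div \<tau>"
  have tau0: "\<tau> > 0" and sig0: "\<sigma> > 0" using params by auto
  \<comment> \<open>The inhomogeneity: the coefficient of \<open>t\<close> in the row that
    determines harmonic \<open>m\<close>, divided by the factor of that unknown; zero where there is
    no row.\<close>
  define D where "D m = (if \<exists>P\<ge>1. \<sigma> * P + \<tau> * m = q
     then coeff2 t ((row_exp q m - 1) + n * (m + 1)) (row_exp q m - 1) / (2 * \<i> * of_real (\<beta> * n * row_exp q m)) else 0)" for m
  obtain d where d: "\<And>m. m > M \<Longrightarrow> d m = 0"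
     "\<And>m. m \<le> M \<Longrightarrow> d m = of_real (rec1 q m) * d (m + 1) + of_real (rec2 q m) * d (m + 2) + D m"
    by (rule downward_recursion[of M "\<lambda>m. of_real (rec1 q m)" "\<lambda>m. of_real (rec2 q m)" D]) blast
  \<comment> \<open>Makes \<open>Im (e 0)\<close> vanish or, for \<open>n = 5\<close> and odd
    \<open>M\<close>, gives \<open>Im (k 1)\<close> the value that cancels the diagonal coefficient
    of \<open>t\<close>. The 4 combines the 2 from the bracket with the 2 from the difference of a
    number and its conjugate.\<close>
  define s where "s = (if \<not> \<tau> dvd q then 0 else if n \<ge> 6 \<or> even M then - Im (d 0) / fundamental_row q 0
     else (let p = (b + 5) div 2 in Re (coeff2 t p p) / (4 * \<beta> * n * (p + 1)) - Im (d 1)) / fundamental_row q 1)"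
  \<comment> \<open>An imaginary multiple of the homogeneous solution is added; a real one would
    have no effect in this weight, as it represents a power of \<open>G\<close>.\<close>
  define e where "e m = d m + \<i> * of_real (s * fundamental_row q m)" for m
  \<comment> \<open>Only harmonic zero is altered, to meet reality; the rows of harmonic two and
    more do not involve it.\<close>
  define k where "k m = (if m = 0 then of_real (Re (e 0)) else e m)" for m
  define K where "K = of_harmonics q k"
  have k0: "Im (k 0) = 0" by (simp add: k_def)
  have KW: "W (b + \<sigma>) K" and Kst: "star2 K = K"
    using W_of_harmonics[of k q, OF k0] star2_of_harmonics[of k q, OF k0] by (simp_all add: K_def q_def)
  have kcK: "harmonic_coeff q K m = k m" if "\<sigma> * P + \<tau> * m = q" for P m
    using harmonic_coeff_eq[OF that, of K] that by (simp add: K_def coeff2_of_harmonics)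
  have e_beyond: "e m = 0" if "m > M" for m
    using that d(1) fundamental_row(1)[of q m] by (simp add: e_def M_def)
  have e_rec: "e m = of_real (rec1 q m) * e (m + 1) + of_real (rec2 q m) * e (m + 2) + D m"
    if "\<sigma> * P + \<tau> * m = q" "P \<ge> 1" for P m
  proof -
    have "\<tau> * m \<le> q" using that by simp
    then have mM: "m \<le> M" using tau0 by (simp add: M_def less_eq_div_iff_mult_less_eq mult.commute)
    have "s * fundamental_row q m = s * (rec1 q m * fundamental_row q (m + 1) + rec2 q m * fundamental_row q (m + 2))"
    proof (cases "\<tau> dvd q")
      case True
      then have "q = \<tau> * M" by (simp add: M_def)
      then have "m \<noteq> M" using that sig0 by auto
      then show ?thesis using fundamental_row(2)[of m q] mM by (simp add: M_def)
    qed (simp add: s_def)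
    then have "\<i> * of_real (s * fundamental_row q m) = of_real (rec1 q m) * (\<i> * of_real (s * fundamental_row q (m + 1))) + of_real (rec2 q m) * (\<i> * of_real (s * fundamental_row q (m + 2)))"
      by (simp add: algebra_simps)
    then show ?thesis using d(2)[OF mM] by (simp add: e_def algebra_simps)
  qed
  have rowval: "coeff2 (t + const2 (- 2 * \<i>) * pb G K) ((P - 1) + n * (m + 1)) (P - 1) =
      (- 2 * \<i>) * of_real (\<beta> * n * P) * (k m - e m)"
    if P: "\<sigma> * P + \<tau> * m = q" "P \<ge> 1" for P m
  proof -
    \<comment> \<open>The positive harmonics of \<open>K\<close> agree with \<open>e\<close>
      wherever they have an admissible exponent; where parity forbids one, \<open>rec1\<close> is
      zero.\<close>
    have 1: "of_real (rec1 q m) * harmonic_coeff q K (m + 1) = of_real (rec1 q m) * e (m + 1)"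
    proof (cases "n = 5")
      case True
      show ?thesis using alpha(3)[OF True] unfolding rec1_def by simp
    next
      case False
      then have st: "\<sigma> = 1" "\<tau> = 3" using params by auto
      show ?thesis
      proof (cases "m + 1 \<le> M")
        case True
        then have "\<sigma> * (q - 3 * (m + 1)) + \<tau> * (m + 1) = q" using st by (simp add: M_def)
        from kcK[OF this] show ?thesis by (simp add: k_def)
      next
        case False
        then show ?thesis using e_beyond[of "m + 1"] harmonic_coeff_beyond[of q "m + 1" K] by (simp add: M_def)
      qed
    qed
    have 2: "of_real (rec2 q m) * harmonic_coeff q K (m + 2) = of_real (rec2 q m) * e (m + 2)"
    proof (cases "m + 2 \<le> M")
      case False
      then show ?thesis using e_beyond[of "m + 2"] harmonic_coeff_beyond[of q "m + 2" K] by (simp add: M_def)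
    next
      case True
      then have le: "\<tau> * (m + 2) \<le> q" using tau0 by (simp add: M_def less_eq_div_iff_mult_less_eq mult.commute)
      show ?thesis
      proof (cases "n \<le> 6")
        case True
        have "\<exists>r. \<sigma> * r + \<tau> * (m + 2) = q"
        proof (cases "n = 5")
          case True
          then have st: "\<sigma> = 2" "\<tau> = 5" using params by auto
          then have "2 * (P - 5) + 5 * (m + 2) = q" using P le by simp
          then show ?thesis unfolding st by blast
        next
          case False
          then have st: "\<sigma> = 1" "\<tau> = 3" using params by auto
          then have "1 * (P - 6) + 3 * (m + 2) = q" using P le by simp
          then show ?thesis unfolding st by blast
        qed
        then obtain r where "\<sigma> * r + \<tau> * (m + 2) = q" by blast
        from kcK[OF this] show ?thesis by (simp add: k_def)
      qed (simp add: rec2_def \<epsilon>_def)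
    qed
    have pwP: "row_exp q m = P" by (rule row_exp_eq[OF P(1)])
    have nz: "of_real (\<beta> * n * P) \<noteq> (0 :: complex)" using P(2) beta_pos n5 by auto
    have "\<exists>P\<ge>1. \<sigma> * P + \<tau> * m = q" using P by blast
    then have Dm: "2 * \<i> * of_real (\<beta> * n * P) * D m = coeff2 t ((P - 1) + n * (m + 1)) (P - 1)"
      unfolding D_def pwP using nz by simp
    have "coeff2 (pb G K) ((P - 1) + n * (m + 1)) (P - 1) = of_real (\<beta> * n * P) *
       (k m - of_real (rec1 q m) * harmonic_coeff q K (m + 1) - of_real (rec2 q m) * harmonic_coeff q K (m + 2))"
      using row_solved[OF KW P[unfolded q_def]] kcK[OF P(1)] by (simp only: q_def[symmetric])
    also have "\<dots> = of_real (\<beta> * n * P) * (k m - e m + D m)"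
      unfolding 1 2 using e_rec[OF P] by (simp add: algebra_simps)
    finally have val: "coeff2 (pb G K) ((P - 1) + n * (m + 1)) (P - 1) = of_real (\<beta> * n * P) * (k m - e m + D m)" .
    show ?thesis
      unfolding coeff2_add coeff2_const2_mult Dm[symmetric] val by (simp add: algebra_simps)
  qed
  have y0: "fundamental_row q 0 \<noteq> 0" if "\<tau> dvd q" "n \<ge> 6 \<or> even M"
  proof (cases "n = 5")
    case n: True
    then have "even M" using that by simp
    then show ?thesis using fundamental_row_5(1)[OF n, of 0 q] by (simp add: M_def)
  qed (use fundamental_row_nonzero_generic[of 0 q] in simp)
  show thesis
  proof (rule that[OF KW Kst], intro allI impI)
    fix p m assume pm: "\<sigma> * p + \<tau> * m = b + \<tau>"
    show "nf_cond p m (coeff2 (t + const2 (- 2 * \<i>) * pb G K) (p + n * m) p)"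
    proof (cases m)
      case (Suc m')
      then have P: "\<sigma> * (p + 1) + \<tau> * m' = q" "p + 1 \<ge> 1" using pm by (simp_all add: q_def)
      have val: "coeff2 (t + const2 (- 2 * \<i>) * pb G K) (p + n * m) p = (- 2 * \<i>) * of_real (\<beta> * n * (p + 1)) * (k m' - e m')"
        using rowval[OF P] by (simp add: Suc)
      show ?thesis
      proof (cases "m' = 0")
        case False
        then show ?thesis unfolding val by (simp add: k_def)
      next
        case m0: True
        have Imk: "k 0 - e 0 = - \<i> * of_real (Im (e 0))" by (simp add: k_def complex_eq_iff)
        have val': "coeff2 (t + const2 (- 2 * \<i>) * pb G K) (p + n * m) p = of_real (- 2 * (\<beta> * n * (p + 1)) * Im (e 0))"
          unfolding val m0 Imk by (simp add: complex_eq_iff)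
        have "Im (e 0) = 0" if "n \<ge> 6 \<and> p mod 3 = 2 \<or> n = 5 \<and> p mod 5 = 4"
        proof -
          have dv: "\<tau> dvd q" "n \<ge> 6 \<or> even M"
          proof -
            have "\<tau> dvd q \<and> (n \<ge> 6 \<or> even M)"
            proof (cases "n = 5")
              case True
              then have st: "\<sigma> = 2" "\<tau> = 5" and p5: "p mod 5 = 4" using params that by auto
              obtain j where j: "p + 1 = 5 * j" using p5 by (metis Suc_eq_plus1 add.commute dvd_def mod_Suc mod_eq_0_iff_dvd numeral_eq_Suc pred_numeral_simps)
              have "q = 5 * (2 * j)" using P(1) st m0 j by simp
              then show ?thesis using st by (simp add: M_def)
            next
              case False
              then have st: "\<sigma> = 1" "\<tau> = 3" and p3: "p mod 3 = 2" "n \<ge> 6" using params that by auto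
              have "q = p + 1" using P(1) st m0 by simp
              moreover have "3 dvd p + 1" using p3 by presburger
              ultimately show ?thesis using st p3 by simp
            qed
            then show "\<tau> dvd q" "n \<ge> 6 \<or> even M" by blast+
          qed
          then have "s * fundamental_row q 0 = - Im (d 0)" using y0[OF dv] by (simp add: s_def)
          then show ?thesis by (simp add: e_def)
        qed
        then show ?thesis unfolding val' using Suc m0 by (auto simp: nf_cond_def)
      qed
    next
      case 0
      have "coeff2 (t + const2 (- 2 * \<i>) * pb G K) p p = 0" if n: "n = 5" and p5: "p mod 5 = 4"
      proof -
        have st: "\<sigma> = 2" "\<tau> = 5" using params n by auto
        define j where "j = p div 5"
        have pj: "p = 5 * j + 4" using p5 by (simp add: j_def) presburger
        have bp: "2 * p = b + 5" using pm 0 st by simp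
        have q: "q = 5 * (2 * j + 1)" using bp pj st by (simp add: q_def)
        have M: "M = 2 * j + 1" using q st by (simp add: M_def)
        have dv: "\<tau> dvd q" "\<not> (n \<ge> 6 \<or> even M)" using q st n M by auto
        have y1: "fundamental_row q 1 \<noteq> 0" using fundamental_row_5(1)[OF n, of 1 q] M by (simp add: M_def)
        have "(b + 5) div 2 = p" using bp by simp
        then have "s * fundamental_row q 1 = Re (coeff2 t p p) / (4 * \<beta> * n * (p + 1)) - Im (d 1)"
          using dv y1 by (simp add: s_def Let_def)
        then have "Im (k 1) = Re (coeff2 t p p) / (4 * \<beta> * n * (p + 1))"
          by (simp add: k_def e_def)
        moreover have "4 * \<beta> * n * (p + 1) \<noteq> 0" using beta_pos n by auto
        moreover have "c * a = r" if "a = r / c" "c \<noteq> 0" for a r c :: real using that by simp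
        ultimately have Imk: "4 * \<beta> * n * (p + 1) * Im (k 1) = Re (coeff2 t p p)" by blast
        have "\<sigma> * (5 * j) + \<tau> * 1 = q" using q st by simp
        from kcK[OF this] have kc1: "harmonic_coeff (b + \<sigma>) K 1 = k 1" by (simp add: q_def)
        have "coeff2 t p p = cnj (coeff2 t p p)" by (metis t coeff2_star2)
        then have tr: "Im (coeff2 t p p) = 0" by (metis Reals_cnj_iff complex_is_Real_iff)
        show ?thesis
          unfolding coeff2_add coeff2_const2_mult row_zero[OF KW Kst n bp] kc1
          using Imk tr by (simp add: complex_eq_iff algebra_simps)
      qed
      then show ?thesis using 0 by (simp add: nf_cond_def)
    qed
  qed
qed

text \<open>Weight above \<open>\<sigma>\<close> excludes 1 and z \<zeta>, the only resonant
  monomials of degree below three.\<close>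

lemma W_vord_3:
  assumes "W (Suc \<sigma>) \<xi>"
  shows "vord 3 \<xi>"
  unfolding vord_def
proof (intro allI impI, rule ccontr)
  fix i j assume ij: "i + j < 3" and "coeff2 \<xi> i j \<noteq> 0"
  then have "rweight (Suc \<sigma>) i j" using assms by (simp add: W_def)
  then obtain p m where pm: "i = p + n * m \<and> j = p \<or> i = p \<and> j = p + n * m" "Suc \<sigma> \<le> \<sigma> * p + \<tau> * m"
    unfolding resonant_weight_def by blast
  have "m = 0" using pm(1) ij n5 by (cases m) auto
  then show False using pm ij params by auto
qed

text \<open>A pure power of z of this degree arises only by multiplying the terms z^n of all
  factors. The coefficient is the top harmonic of the power and so fixes its multiple of
  \<open>fundamental_row\<close>.\<close>

lemma coeff2_power_axis:
  assumes "k \<ge> 1"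
  shows "coeff2 (G ^ k) (n * k) 0 = of_real (\<beta> ^ k)"
  using assms
proof (induction k rule: nat_induct_at_least)
  case base
  show ?case using lead_pos(1) by simp
next
  case (Suc k)
  have z: "coeff2 G i 0 * coeff2 (G ^ k) (n * Suc k - i) 0 = 0" if "i \<le> n * Suc k" "i \<noteq> n" for i
  proof (rule ccontr)
    assume "\<not> ?thesis"
    then have ne: "coeff2 G i 0 \<noteq> 0" "coeff2 (G ^ k) (n * Suc k - i) 0 \<noteq> 0" by auto
    obtain m where m: "i = n * m" "\<tau> \<le> \<tau> * m" using W_coeff_axis[OF G_W ne(1)] by blast
    obtain m' where m': "n * Suc k - i = n * m'" "k * \<tau> \<le> \<tau> * m'"
      using W_coeff_axis[OF W_power[OF Suc.hyps G_W] ne(2)] by blast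
    have "0 < \<tau>" using params by auto
    then have "m \<ge> 1" "m' \<ge> k" using m(2) m'(2) by auto
    moreover have "n * Suc k = n * (m + m')" using m(1) m'(1) that(1) by (simp add: algebra_simps)
    then have "Suc k = m + m'" using n5 by (simp del: mult_Suc_right)
    ultimately have "m = 1" by simp
    with m(1) that(2) show False by simp
  qed
  have "coeff2 (G ^ Suc k) (n * Suc k) 0 = (\<Sum>i\<le>n * Suc k. coeff2 G i 0 * coeff2 (G ^ k) (n * Suc k - i) 0)"
    by (simp add: coeff2_mult del: mult_Suc_right)
  also have "\<dots> = (\<Sum>i\<in>{n}. coeff2 G i 0 * coeff2 (G ^ k) (n * Suc k - i) 0)"
    by (rule sum.mono_neutral_right) (use z in auto)
  also have "\<dots> = of_real (\<beta> ^ Suc k)" using Suc.IH lead_pos(1) by simp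
  finally show ?case .
qed

lemma pb_G_power: "pb G (G ^ k) = 0"
  by (induction k) (simp_all add: pb_mult_right const2_simps(4)[symmetric])

lemma star2_power: "star2 (G ^ k) = G ^ k"
  by (simp add: fhom_power[OF fhom_star2] G_star)

lemma zexp_perturb:
  assumes "W (Suc \<sigma>) \<xi>" "W (b + \<sigma>) K" "b \<ge> 1"
  shows "W (\<tau> + b + 1) (zexp (\<xi> + K) G - zexp \<xi> G - const2 (- 2 * \<i>) * pb G K)"
  using W_pexp_perturb[OF W_const2_mult[OF assms(1), of "- 2 * \<i>"] W_const2_mult[OF assms(2), of "- 2 * \<i>"] assms(3) G_W]
  by (simp add: distrib_left pb_scale_right)

text \<open>A correction of weight \<open>b + \<sigma>\<close> changes the transformed Hamiltonian
  first in weight \<open>b + \<tau>\<close>, by its bracket with \<open>G\<close> itself rather than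
  with the Hamiltonian transformed so far; hence the homological operator is the same at every
  step.\<close>

theorem resonant_normal_form:
  obtains \<xi> where "star2 \<xi> = \<xi>" "W (Suc \<sigma>) \<xi>" "nf (zexp \<xi> G)"
proof -
  \<comment> \<open>The argument \<open>z\<close> is a dummy, since \<open>dependent_limit\<close>
    works with pairs.\<close>
  define P where "P b \<xi> (z :: complex fps2) \<longleftrightarrow> star2 \<xi> = \<xi> \<and> W (Suc \<sigma>) \<xi> \<and>
     (\<forall>p m. \<sigma> * p + \<tau> * m < b + \<tau> \<longrightarrow> nf_cond p m (coeff2 (zexp \<xi> G) (p + n * m) p))" for b \<xi> z
  have P0: "P 1 0 0"
  proof -
    have "nf_cond p m (coeff2 G (p + n * m) p)" if "\<sigma> * p + \<tau> * m < 1 + \<tau>" for p m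
    proof (cases "\<sigma> * p + \<tau> * m < \<tau>")
      case True
      then show ?thesis using W_coeff_pm[OF G_W True] by simp
    next
      case False
      then have eq: "\<sigma> * p + \<tau> * m = \<tau>" using that by simp
      then consider "m = 0" | "m = 1" "p = 0" using params by (cases m; cases p) auto
      then show ?thesis
      proof cases
        case 1
        then show ?thesis using eq params by (auto simp: nf_cond_def)
      next
        case 2
        then show ?thesis using lead_pos(1) by (simp add: nf_cond_def)
      qed
    qed
    then show ?thesis by (simp add: P_def fhom_0[OF fhom_star2] pexp_0)
  qed
  have step: "\<exists>K h. W (b + \<sigma>) K \<and> W (b + \<sigma>) h \<and> P (Suc b) (\<xi> + K) (z + h)" if b: "1 \<le> b" and P: "P b \<xi> z" for b \<xi> z
  proof -
    have \<xi>: "star2 \<xi> = \<xi>" "W (Suc \<sigma>) \<xi>" using P by (auto simp: P_def)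
    have "star2 (zexp \<xi> G) = zexp \<xi> G" by (intro star2_zexp \<xi> G_star W_vord_3)
    then obtain K where K: "W (b + \<sigma>) K" "star2 K = K"
      and nf: "\<forall>p m. \<sigma> * p + \<tau> * m = b + \<tau> \<longrightarrow> nf_cond p m (coeff2 (zexp \<xi> G + const2 (- 2 * \<i>) * pb G K) (p + n * m) p)"
      by (rule homological_solvable[OF b])
    have pert: "W (\<tau> + b + 1) (zexp (\<xi> + K) G - zexp \<xi> G - const2 (- 2 * \<i>) * pb G K)"
      by (rule zexp_perturb[OF \<xi>(2) K(1) b])
    have "nf_cond p m (coeff2 (zexp (\<xi> + K) G) (p + n * m) p)" if "\<sigma> * p + \<tau> * m < Suc b + \<tau>" for p m
    proof -
      have c: "coeff2 (zexp (\<xi> + K) G) (p + n * m) p = coeff2 (zexp \<xi> G + const2 (- 2 * \<i>) * pb G K) (p + n * m) p"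
      proof -
        have "coeff2 (zexp (\<xi> + K) G - zexp \<xi> G - const2 (- 2 * \<i>) * pb G K) (p + n * m) p = 0"
          by (rule W_coeff_pm[OF pert]) (use that in simp)
        then show ?thesis by (simp only: coeff2_diff coeff2_add diff_diff_eq right_minus_eq)
      qed
      show ?thesis
      proof (cases "\<sigma> * p + \<tau> * m = b + \<tau>")
        case True
        then show ?thesis unfolding c using nf by blast
      next
        case False
        then have lt: "\<sigma> * p + \<tau> * m < b + \<tau>" using that by simp
        have "coeff2 (const2 (- 2 * \<i>) * pb G K) (p + n * m) p = 0"
          by (rule W_coeff_pm[OF W_const2_mult[OF W_pb[OF G_W K(1)]]]) (use lt in simp)
        then show ?thesis unfolding c using P lt by (simp add: P_def)
      qed
    qed
    moreover have "W (Suc \<sigma>) (\<xi> + K)" using \<xi>(2) K(1) b by (auto intro!: W_add elim: W_mono)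
    ultimately have "P (Suc b) (\<xi> + K) (z + 0)"
      using \<xi> K(2) by (simp add: P_def fhom_add[OF fhom_star2])
    then show ?thesis using K(1) by (metis W_0)
  qed
  obtain \<xi> where \<xi>0: "W (1 + \<sigma>) (\<xi> - 0)"
    and lim: "\<And>k. k \<ge> 1 \<Longrightarrow> \<exists>\<xi>' z'. P k \<xi>' z' \<and> W (k + \<sigma>) (\<xi> - \<xi>')"
    by (rule dependent_limit[of P, OF P0 step]) blast+
  have star: "star2 \<xi> = \<xi>"
  proof (rule vord_eqI)
    fix N
    obtain \<xi>' where \<xi>': "star2 \<xi>' = \<xi>'" "W (Suc N + \<sigma>) (\<xi> - \<xi>')" using lim[of "Suc N"] by (auto simp: P_def)
    have v: "vord N (\<xi> - \<xi>')" using W_vord[OF \<xi>'(2)] by (auto elim: vord_mono)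
    have "vord N (star2 \<xi> - \<xi>')" using fhom_vord_diff[OF fhom_star2 v] \<xi>'(1) by simp
    from vord_diff[OF this v] show "vord N (star2 \<xi> - \<xi>)" by simp
  qed
  have "nf_cond p m (coeff2 (zexp \<xi> G) (p + n * m) p)" for p m
  proof -
    define k where "k = Suc (\<sigma> * p + \<tau> * m)"
    obtain \<xi>' z' where \<xi>': "P k \<xi>' z'" "W (k + \<sigma>) (\<xi> - \<xi>')" using lim[of k] by (auto simp: k_def)
    have "W (\<tau> + k + 1) (zexp (\<xi>' + (\<xi> - \<xi>')) G - zexp \<xi>' G - const2 (- 2 * \<i>) * pb G (\<xi> - \<xi>'))"
      by (rule zexp_perturb) (use \<xi>' in \<open>auto simp: P_def k_def\<close>)
    moreover have "W (\<tau> + k) (const2 (- 2 * \<i>) * pb G (\<xi> - \<xi>'))"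
      by (rule W_const2_mult[OF W_pb[OF G_W \<xi>'(2)]])
    ultimately have "W (\<tau> + k) ((zexp \<xi> G - zexp \<xi>' G - const2 (- 2 * \<i>) * pb G (\<xi> - \<xi>')) + const2 (- 2 * \<i>) * pb G (\<xi> - \<xi>'))"
      by (intro W_add) (auto elim: W_mono)
    then have "W (\<tau> + k) (zexp \<xi> G - zexp \<xi>' G)" by simp
    then have "coeff2 (zexp \<xi> G - zexp \<xi>' G) (p + n * m) p = 0"
      by (rule W_coeff_pm) (simp add: k_def)
    then show ?thesis using \<xi>'(1) by (simp add: P_def k_def)
  qed
  then have "nf (zexp \<xi> G)" by (simp add: nf_def)
  with that star \<xi>0 show thesis by simp
qed

text \<open>\<open>\<xi>\<close> is approached, weight by weight, by series that commute with
  \<open>G\<close>: the leading part of the remainder lies in the kernel and is matched by a real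
  multiple of a power of \<open>G\<close>. So the bracket of \<open>G\<close> with
  \<open>\<xi>\<close> vanishes to every order.\<close>

theorem resonant_normal_form_unique:
  assumes nfG: "nf G" and \<xi>: "star2 \<xi> = \<xi>" "W (Suc \<sigma>) \<xi>" and nfG': "nf (zexp \<xi> G)"
  shows "zexp \<xi> G = G"
proof -
  \<comment> \<open>Subtracting a \<open>g\<close> that commutes with \<open>G\<close> does not
    change the bracket, so the first-order term is governed by the remainder \<open>K\<close> even
    where \<open>\<xi>\<close> itself has low weight.\<close>
  have first: "W (Suc (\<tau> + b)) (zexp \<xi> G - G - const2 (- 2 * \<i>) * pb G K)"
    if g: "pb G g = 0" and K: "K = \<xi> - g" "W (b + \<sigma>) K" for b g K
  proof -
    have pbK: "pb G \<xi> = pb G K" by (simp add: K(1) pb_diff_right g)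
    have "W (\<tau> + b) (pb G (const2 (- 2 * \<i>) * \<xi>))"
      unfolding pb_scale_right pbK by (rule W_const2_mult[OF W_pb[OF G_W K(2)]])
    from W_pexp_first[OF W_const2_mult[OF \<xi>(2)] this] show ?thesis
      using params by (auto simp: pb_scale_right pbK)
  qed
  have ex: "\<exists>g. pb G g = 0 \<and> star2 g = g \<and> W (b + \<sigma>) (\<xi> - g)" if "b \<ge> 1" for b
    using that
  proof (induction b rule: nat_induct_at_least)
    case base
    show ?case using \<xi> by (intro exI[of _ 0]) (simp add: fhom_0[OF fhom_star2])
  next
    case (Suc b)
    then obtain g where g: "pb G g = 0" "star2 g = g" "W (b + \<sigma>) (\<xi> - g)" by blast
    define K where "K = \<xi> - g"
    define q where "q = b + \<sigma>"
    have K: "W (b + \<sigma>) K" "star2 K = K" using g \<xi> by (simp_all add: K_def fhom_diff[OF fhom_star2])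
    have nfK: "nf_cond p m (coeff2 (const2 (- 2 * \<i>) * pb G K) (p + n * m) p)" if "\<sigma> * p + \<tau> * m = b + \<tau>" for p m
    proof -
      have "coeff2 (zexp \<xi> G - G - const2 (- 2 * \<i>) * pb G K) (p + n * m) p = 0"
        by (rule W_coeff_pm[OF first[OF g(1) K_def K(1)]]) (use that in simp)
      then have "coeff2 (const2 (- 2 * \<i>) * pb G K) (p + n * m) p = coeff2 (zexp \<xi> G) (p + n * m) p - coeff2 G (p + n * m) p"
        by (simp only: coeff2_diff right_minus_eq)
      then show ?thesis using nfG nfG' nf_cond_diff by (simp add: nf_def)
    qed
    from homological_kernel[OF K Suc.hyps nfK] obtain x where
      x0: "\<not> \<tau> dvd q \<Longrightarrow> x = 0" and x1: "\<And>m. m \<ge> 1 \<Longrightarrow> harmonic_coeff q K m = of_real x * of_real (fundamental_row q m)"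
      and x2: "harmonic_coeff q K 0 = of_real x * of_real (fundamental_row q 0) \<or> (\<forall>p. \<sigma> * p \<noteq> q)"
      unfolding q_def by blast
    have kcx: "harmonic_coeff q K m = of_real x * of_real (fundamental_row q m)" if "\<exists>p. \<sigma> * p + \<tau> * m = q" for m
      using that x1[of m] x2 by (cases "m = 0") auto
    show ?case
    proof (cases "\<tau> dvd q")
      case False
      have "harmonic_coeff q K m = 0" for m
        using kcx[of m] x0[OF False] harmonic_coeff_none[of m q K] by force
      then have "W (Suc q) K" using W_Suc_from_kc[of q K] K by (simp add: q_def)
      then show ?thesis using g(1,2) by (intro exI[of _ g]) (simp add: K_def q_def)
    next
      case True
      define M where "M = q div \<tau>"
      have qM: "q = \<tau> * M" using True by (simp add: M_def)
      have M1: "M \<ge> 1" using qM Suc.hyps by (cases M) (auto simp: q_def)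
      define L where "L = G ^ M"
      have L: "W (b + \<sigma>) L" "star2 L = L" "pb G L = 0"
        using W_power[OF M1 G_W] star2_power pb_G_power qM by (simp_all add: L_def q_def mult.commute)
      \<comment> \<open>Applied to the power of \<open>G\<close> itself, the kernel lemma shows that
        its leading harmonics are a multiple of the same row, without computing them.\<close>
      from homological_kernel[OF L(1,2) Suc.hyps] obtain x' where
        x1': "\<And>m. m \<ge> 1 \<Longrightarrow> harmonic_coeff q L m = of_real x' * of_real (fundamental_row q m)"
        and x2': "harmonic_coeff q L 0 = of_real x' * of_real (fundamental_row q 0) \<or> (\<forall>p. \<sigma> * p \<noteq> q)"
        unfolding q_def L(3) by auto
      have kcL: "harmonic_coeff q L m = of_real x' * of_real (fundamental_row q m)" if "\<exists>p. \<sigma> * p + \<tau> * m = q" for m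
        using that x1'[of m] x2' by (cases "m = 0") auto
      have "harmonic_coeff q L M = coeff2 L (0 + n * M) 0" by (rule harmonic_coeff_eq) (simp add: qM)
      then have x': "x' = \<beta> ^ M"
        using x1'[OF M1] coeff2_power_axis[OF M1] fundamental_row_top[of q] by (simp add: L_def M_def[symmetric] flip: of_real_power)
      have xb: "x' \<noteq> 0" using x' lead_pos(2) by simp
      define g' where "g' = g + const2 (of_real (x / x')) * L"
      have g': "pb G g' = 0" "star2 g' = g'"
        using g L by (simp_all add: g'_def pb_add_right pb_scale_right fhom_add[OF fhom_star2] fhom_mult[OF fhom_star2] fhom_const2[OF fhom_star2])
      have K': "\<xi> - g' = K - const2 (of_real (x / x')) * L" by (simp add: K_def g'_def)
      have st: "star2 (\<xi> - g') = \<xi> - g'" using \<xi> g' by (simp add: fhom_diff[OF fhom_star2])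
      have W: "W q (\<xi> - g')" unfolding K' q_def by (intro W_diff W_const2_mult K L)
      have "harmonic_coeff q (\<xi> - g') m = 0" for m
      proof (cases "\<exists>p. \<sigma> * p + \<tau> * m = q")
        case True
        then obtain p where p: "\<sigma> * p + \<tau> * m = q" by blast
        have "harmonic_coeff q (\<xi> - g') m = harmonic_coeff q K m - of_real (x / x') * harmonic_coeff q L m"
          unfolding harmonic_coeff_eq[OF p] K' by simp
        then show ?thesis using kcx[OF True] kcL[OF True] xb by simp
      qed (use harmonic_coeff_none in blast)
      then have "W (Suc q) (\<xi> - g')" by (intro W_Suc_from_kc W st)
      then show ?thesis using g' by (intro exI[of _ g']) (simp add: q_def)
    qed
  qed
  show ?thesis
  proof (rule vord_eqI)
    fix N
    obtain g where g: "pb G g = 0" "W (Suc N + \<sigma>) (\<xi> - g)" using ex[of "Suc N"] by auto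
    have "W N (zexp \<xi> G - G - const2 (- 2 * \<i>) * pb G (\<xi> - g))"
      using first[OF g(1) refl g(2)] by (rule W_mono) simp
    moreover have "W N (const2 (- 2 * \<i>) * pb G (\<xi> - g))"
      using W_const2_mult[OF W_pb[OF G_W g(2)]] by (rule W_mono) simp
    ultimately have "W N (zexp \<xi> G - G - const2 (- 2 * \<i>) * pb G (\<xi> - g) + const2 (- 2 * \<i>) * pb G (\<xi> - g))"
      by (rule W_add)
    then show "vord N (zexp \<xi> G - G)" using W_vord by fastforce
  qed
qed

end

section \<open>Normal form Hamiltonians as resonant series\<close>

definition nf_constraints :: "nat \<Rightarrow> real fps \<Rightarrow> real fps \<Rightarrow> bool" where
  "nf_constraints n A B \<longleftrightarrow>
     (n = 5 \<longrightarrow> (\<forall>k. (k mod 5 = 1 \<longrightarrow> fps_nth A k = 0) \<and> (k mod 5 = 4 \<longrightarrow> fps_nth B k = 0))) \<and>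
     (n \<ge> 6 \<longrightarrow> (\<forall>k. k mod 3 = 2 \<longrightarrow> fps_nth B k = 0))"

context resonance
begin

lemma nf_coeff_pm:
  "nf_coeff n A B (p + n * m) p =
    (if m = 0 then if 3 \<le> p then fps_nth A (p - 3) / 2 ^ p else 0
     else if m = 1 then 2 powr (- real n / 2) / 2 * (fps_nth B p / 2 ^ p) else 0)"
proof -
  consider "m = 0" | "m = 1" | i where "m = Suc (Suc i)" by (metis One_nat_def not0_implies_Suc)
  then show ?thesis using n5 by cases (auto simp: nf_coeff_def)
qed

lemma coeff2_toz_nf: "coeff2 (toz (normal_form_hamiltonian n A B)) i j = of_real (nf_coeff n A B i j)"
  using n5 by (intro coeff2_toz_normal_form) simp

lemma resonant_support_star:
  assumes "star2 f = f" "star2 g = g" "\<And>i j. coeff2 f i j \<noteq> 0 \<Longrightarrow> rweight 0 i j" "\<And>i j. coeff2 g i j \<noteq> 0 \<Longrightarrow> rweight 0 i j"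
    and "\<And>p m. coeff2 f (p + n * m) p = coeff2 g (p + n * m) p"
  shows "f = g"
proof (rule fps2_eqI)
  fix i j
  show "coeff2 f i j = coeff2 g i j"
  proof (cases "rweight 0 i j")
    case True
    then obtain p m where "i = p + n * m \<and> j = p \<or> i = p \<and> j = p + n * m" unfolding resonant_weight_def by blast
    then show ?thesis
    proof (elim disjE conjE)
      assume "i = p" "j = p + n * m"
      then show ?thesis by (metis assms(1,2,5) coeff2_star2)
    qed (simp add: assms(5))
  next
    case False
    then show ?thesis using assms(3,4) by metis
  qed
qed

lemma nf_support: "coeff2 (toz (normal_form_hamiltonian n A B)) i j \<noteq> 0 \<Longrightarrow> rweight 0 i j"
  using rweight_pm[of 0 j 0] rweight_pm[of 0 j 1] rweight_pm'[of 0 i 1]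
  by (auto simp: coeff2_toz_nf nf_coeff_def split: if_splits)

lemma W_normal_form: "W \<tau> (toz (normal_form_hamiltonian n A B))"
  unfolding W_iff_star[OF star2_toz]
proof (intro conjI allI impI)
  fix p m assume "\<sigma> * p + \<tau> * m < \<tau>"
  then have "m = 0" "p < 3" using params by (cases m; auto)+
  then show "coeff2 (toz (normal_form_hamiltonian n A B)) (p + n * m) p = 0"
    using nf_coeff_pm[of A B p m] by (simp add: coeff2_toz_nf)
qed (rule nf_support)

lemma nf_normal_form:
  assumes "nf_constraints n A B"
  shows "nf (toz (normal_form_hamiltonian n A B))"
  unfolding nf_def coeff2_toz_nf nf_coeff_pm
proof (intro allI)
  fix p m :: nat
  have "(p - 3) mod 5 = 1" if "p mod 5 = 4" "3 \<le> p"
  proof -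
    have "p = 4 + 5 * (p div 5)" using that(1) by (metis mod_mult_div_eq)
    then have "p - 3 = 1 + 5 * (p div 5)" by simp
    then show ?thesis by (simp only: mod_mult_self2) simp
  qed
  then show "nf_cond p m (complex_of_real (if m = 0 then if 3 \<le> p then fps_nth A (p - 3) / 2 ^ p else 0
     else if m = 1 then 2 powr (- real n / 2) / 2 * (fps_nth B p / 2 ^ p) else 0))"
    using assms by (auto simp: nf_cond_def nf_constraints_def)
qed

text \<open>Weight at least \<open>\<tau>\<close> supplies the vanishing of the diagonal
  coefficients below (z \<zeta>)^3, which the factor I^3 requires; the remaining shape is read off
  from \<open>nf\<close>.\<close>

lemma nf_imp_normal_form:
  assumes star: "star2 G = G" and W: "W \<tau> G" and nf: "nf G"
  obtains A B where "nf_constraints n A B" "toz (normal_form_hamiltonian n A B) = G"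
proof -
  define c where "c = 2 powr (- real n / 2) / 2"
  have c: "c > 0" by (simp add: c_def)
  define A where "A = Abs_fps (\<lambda>k. Re (coeff2 G (k + 3) (k + 3)) * 2 ^ (k + 3))"
  define B where "B = Abs_fps (\<lambda>k. Re (coeff2 G (k + n) k) * 2 ^ k / c)"
  have nfc: "nf_cond p m (coeff2 G (p + n * m) p)" for p m using nf by (simp add: nf_def)
  have real0: "Im (coeff2 G p p) = 0" for p
    by (metis star coeff2_star2 Reals_cnj_iff complex_is_Real_iff)
  have con: "nf_constraints n A B"
    unfolding nf_constraints_def
  proof (intro conjI impI allI)
    fix k :: nat assume "n = 5" "k mod 5 = 1"
    moreover have "(k + 3) mod 5 = 4" using \<open>k mod 5 = 1\<close> by presburger
    ultimately have "coeff2 G (k + 3) (k + 3) = 0" using nfc[of "k + 3" 0] unfolding nf_cond_def by simp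
    then show "fps_nth A k = 0" by (simp add: A_def)
  next
    fix k :: nat assume "n = 5" "k mod 5 = 4"
    then have "coeff2 G (k + n) k = 0" using nfc[of k 1] unfolding nf_cond_def by simp
    then show "fps_nth B k = 0" by (simp add: B_def)
  next
    fix k :: nat assume "n \<ge> 6" "k mod 3 = 2"
    then have "coeff2 G (k + n) k = 0" using nfc[of k 1] unfolding nf_cond_def by simp
    then show "fps_nth B k = 0" by (simp add: B_def)
  qed
  have "toz (normal_form_hamiltonian n A B) = G"
  proof (rule resonant_support_star[OF star2_toz star nf_support W_ww_0[OF W]])
    fix p m :: nat
    consider "m = 0" "p < 3" | "m = 0" "3 \<le> p" | "m = 1" | "m \<ge> 2" by linarith
    then show "coeff2 (toz (normal_form_hamiltonian n A B)) (p + n * m) p = coeff2 G (p + n * m) p"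
    proof cases
      case 1
      then have "\<sigma> * p + \<tau> * m < \<tau>" using params by auto
      then have "coeff2 G (p + n * m) p = 0" by (rule W_coeff_pm[OF W])
      then show ?thesis using 1 unfolding coeff2_toz_nf nf_coeff_pm by simp
    next
      case 2
      then show ?thesis unfolding coeff2_toz_nf nf_coeff_pm using real0[of p] by (simp add: A_def complex_eq_iff)
    next
      case 3
      have "Im (coeff2 G (p + n) p) = 0" using nfc[of p 1] by (simp add: nf_cond_def)
      then show ?thesis using 3 c unfolding coeff2_toz_nf nf_coeff_pm c_def[symmetric]
        by (simp add: B_def complex_eq_iff)
    next
      case 4
      then show ?thesis using nfc[of p m] unfolding coeff2_toz_nf nf_coeff_pm by (simp add: nf_cond_def)
    qed
  qed auto
  with con that show thesis by blast
qed

lemma normal_form_inject: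
  assumes "normal_form_hamiltonian n A B = normal_form_hamiltonian n A' B'"
  shows "A = A' \<and> B = B'"
proof -
  have "nf_coeff n A B i j = nf_coeff n A' B' i j" for i j
    using assms coeff2_toz_nf[of A B i j] coeff2_toz_nf[of A' B' i j] by simp
  then have e: "nf_coeff n A B (p + n * m) p = nf_coeff n A' B' (p + n * m) p" for p m by blast
  have "fps_nth A k = fps_nth A' k" for k using e[of "k + 3" 0] unfolding nf_coeff_pm by simp
  moreover have "fps_nth B k = fps_nth B' k" for k using e[of k 1] unfolding nf_coeff_pm by simp
  ultimately show ?thesis by (simp add: fps_eq_iff)
qed

text \<open>Passes from order to weight: a resonant monomial of weight at most
  \<open>\<sigma>\<close> is 1 or z \<zeta>.\<close>

lemma vord_3_resonant:
  assumes "star2 \<xi> = \<xi>" "vord 3 \<xi>" "\<And>i j. coeff2 \<xi> i j \<noteq> 0 \<Longrightarrow> rweight 0 i j"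
  shows "W (Suc \<sigma>) \<xi>"
  unfolding W_iff_star[OF assms(1)]
proof (intro conjI allI impI)
  fix p m assume "\<sigma> * p + \<tau> * m < Suc \<sigma>"
  then have "m = 0" "p < 2" using params by (cases m; auto)+
  then show "coeff2 \<xi> (p + n * m) p = 0" using assms(2) by (simp add: vordD)
qed (use assms in blast)

end

section \<open>Formal canonical maps as operators\<close>

text \<open>Operators standing for the pull-backs \<open>f \<mapsto> subst2 f F\<close> by formal canonical maps, so that composition is reversed.\<close>

definition symp :: "(real fps2 \<Rightarrow> real fps2) \<Rightarrow> bool" where
  "symp \<sigma> \<longleftrightarrow> fhom (\<lambda>c. c) \<sigma> \<and> pb (\<sigma> X2) (\<sigma> Y2) = 1"

lemma symp_fhom: "symp \<sigma> \<Longrightarrow> fhom (\<lambda>c. c) \<sigma>" by (simp add: symp_def)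

lemma symp_pb: "symp \<sigma> \<Longrightarrow> \<sigma> (pb f g) = pb (\<sigma> f) (\<sigma> g)"
  using fhom_pb[of "\<lambda>c. c" \<sigma> f g] by (simp add: symp_def)

lemma pb_X2_Y2: "pb X2 Y2 = 1" by (simp add: pb_def)

lemma symp_comp: "symp \<sigma> \<Longrightarrow> symp \<tau> \<Longrightarrow> symp (\<lambda>f. \<sigma> (\<tau> f))"
  using fhom_comp[of "\<lambda>c. c" \<tau> "\<lambda>c. c" \<sigma>] symp_pb[of \<sigma> "\<tau> X2" "\<tau> Y2"] fhom_1[of "\<lambda>c. c" \<sigma>]
  by (simp add: symp_def)

lemma symp_pexp: "vord 3 H \<Longrightarrow> symp (pexp H)"
  using pexp_pb[of H X2 Y2] fhom_1[OF fhom_pexp, of H] by (simp add: symp_def fhom_pexp pb_X2_Y2)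

lemma symp_rot: "symp (rot \<theta>)"
  using rot_pb[of \<theta> X2 Y2] fhom_1[OF fhom_rot] by (simp add: symp_def fhom_rot pb_X2_Y2)

lemma symp_pexp_conj:
  assumes "symp \<sigma>" "vord 3 H"
  shows "\<sigma> (pexp H f) = pexp (\<sigma> H) (\<sigma> f)"
  by (rule fhom_pexp_conj[OF symp_fhom[OF assms(1)] assms(2)])
    (use assms in \<open>auto simp: symp_pb fhom_vord[OF symp_fhom]\<close>)

lemma symp_inverse:
  assumes "symp \<sigma>" "fhom (\<lambda>c. c) \<sigma>'" "\<And>f. \<sigma> (\<sigma>' f) = f" "\<And>f. \<sigma>' (\<sigma> f) = f"
  shows "symp \<sigma>'"
proof -
  have "\<sigma> (pb (\<sigma>' X2) (\<sigma>' Y2)) = \<sigma> 1"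
    by (simp add: symp_pb[OF assms(1)] assms(3) pb_X2_Y2 fhom_1[OF symp_fhom[OF assms(1)]])
  then have "pb (\<sigma>' X2) (\<sigma>' Y2) = 1" by (metis assms(4))
  with assms(2) show ?thesis by (simp add: symp_def)
qed

lemma formal_canonical_of_symp:
  assumes "symp \<sigma>" "symp \<sigma>'" "\<And>f. \<sigma> (\<sigma>' f) = f" "\<And>f. \<sigma>' (\<sigma> f) = f"
  shows "formal_canonical (\<sigma> X2, \<sigma> Y2)"
proof -
  have s: "subst2 f (\<sigma> X2, \<sigma> Y2) = \<sigma> f" "subst2 f (\<sigma>' X2, \<sigma>' Y2) = \<sigma>' f" for f
    using subst2_fhom[OF symp_fhom] assms by auto
  have "no_constant_term (\<sigma> X2, \<sigma> Y2)" "no_constant_term (\<sigma>' X2, \<sigma>' Y2)"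
    using assms(1,2) by (auto simp: no_constant_term_vord fhom_vord[OF symp_fhom])
  moreover have "fm_invertible (\<sigma> X2, \<sigma> Y2)"
    unfolding fm_invertible_def
    by (rule exI[of _ "(\<sigma>' X2, \<sigma>' Y2)"]) (use calculation assms in \<open>simp add: fm_comp_def s fm_id_def\<close>)
  ultimately show ?thesis
    using assms(1) by (simp add: formal_canonical_def fm_jacobian_pb symp_def)
qed

lemma symp_subst2:
  assumes "no_constant_term F" "fm_jacobian F = 1"
  shows "symp (\<lambda>f. subst2 f F)"
  using assms by (simp add: symp_def fhom_subst2 no_constant_term_vord fm_jacobian_pb)

lemma symp_of_formal_canonical:
  assumes "formal_canonical F"
  obtains \<sigma>' where "symp (\<lambda>f. subst2 f F)" "symp \<sigma>'" "\<And>f. subst2 (\<sigma>' f) F = f" "\<And>f. \<sigma>' (subst2 f F) = f"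
proof -
  from assms obtain G where G: "no_constant_term G" "F \<circ>\<^sub>f G = fm_id" "G \<circ>\<^sub>f F = fm_id"
    and F: "no_constant_term F" "fm_jacobian F = 1"
    unfolding formal_canonical_def fm_invertible_def by blast
  have sF: "symp (\<lambda>f. subst2 f F)" by (rule symp_subst2[OF F])
  have vF: "vord (Suc 0) (fst F)" "vord (Suc 0) (snd F)" and vG: "vord (Suc 0) (fst G)" "vord (Suc 0) (snd G)"
    using F(1) G(1) by (auto simp: no_constant_term_vord)
  have hG: "fhom (\<lambda>c. c) (\<lambda>f. subst2 f G)" by (rule fhom_subst2[OF vG])
  have FG: "subst2 (subst2 f F) G = f" for f
    by (rule fhom_ext[OF fhom_comp[OF symp_fhom[OF sF] hG] fhom_id])
      (use G(2) vF vG in \<open>auto simp: fm_comp_def fm_id_def\<close>)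
  have GF: "subst2 (subst2 f G) F = f" for f
    by (rule fhom_ext[OF fhom_comp[OF hG symp_fhom[OF sF]] fhom_id])
      (use G(3) vF vG in \<open>auto simp: fm_comp_def fm_id_def\<close>)
  show thesis
    by (rule that[OF sF symp_inverse[OF sF hG] GF FG]) (use FG GF in auto)
qed

text \<open>Equality of formal maps is equality of their pull-backs on the two variables, which
  \<open>fhom_ext\<close> extends to all series.\<close>

lemma conjugacy_iff:
  assumes T: "no_constant_term T" and N: "vord 3 N" and F: "no_constant_term F"
  shows "(F \<circ>\<^sub>f T = (fm_linear (plane_rotation \<alpha>) \<circ>\<^sub>f (pexp N X2, pexp N Y2)) \<circ>\<^sub>f F) \<longleftrightarrow>
    (\<forall>f. subst2 (subst2 f F) T = subst2 (pexp N (rot \<alpha> f)) F)" (is "?L \<longleftrightarrow> ?R")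
proof -
  have vF: "vord (Suc 0) (fst F)" "vord (Suc 0) (snd F)" and vT: "vord (Suc 0) (fst T)" "vord (Suc 0) (snd T)"
    using F T by (auto simp: no_constant_term_vord)
  have h1: "fhom (\<lambda>c. c) (\<lambda>f. subst2 (subst2 f F) T)"
    by (rule fhom_comp[OF fhom_subst2[OF vF] fhom_subst2[OF vT]])
  have h2: "fhom (\<lambda>c. c) (\<lambda>f. subst2 (pexp N (rot \<alpha> f)) F)"
    by (rule fhom_comp[OF fhom_comp[OF fhom_rot fhom_pexp[OF N]] fhom_subst2[OF vF]])
  have lin: "fst (fm_linear (plane_rotation \<alpha>)) = rot \<alpha> X2" "snd (fm_linear (plane_rotation \<alpha>)) = rot \<alpha> Y2"
    by (simp_all add: fm_linear_rotation rot_X2 rot_Y2)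
  have "?L \<longleftrightarrow> subst2 (subst2 X2 F) T = subst2 (pexp N (rot \<alpha> X2)) F \<and>
     subst2 (subst2 Y2 F) T = subst2 (pexp N (rot \<alpha> Y2)) F"
    using vF by (simp add: fm_comp_def lin subst2_pexp[OF N])
  also have "\<dots> \<longleftrightarrow> ?R" using fhom_ext[OF h1 h2] by blast
  finally show ?thesis .
qed

subsection \<open>Splitting off the linear part\<close>

text \<open>The z-component of the map behind \<open>t\<close>, expressed in z and its conjugate; as
  \<open>t\<close> is real, it determines both components.\<close>

definition zcoord :: "(real fps2 \<Rightarrow> real fps2) \<Rightarrow> complex fps2" where
  "zcoord t = toz (t X2) + const2 \<i> * toz (t Y2)"

lemma vord_real_parts:
  assumes "vord N (toz u + const2 \<i> * toz v)"
  shows "vord N u" "vord N v"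
proof -
  have "vord N (star2 (toz u + const2 \<i> * toz v))" by (rule fhom_vord[OF fhom_star2 assms])
  then have *: "vord N (toz u - const2 \<i> * toz v)"
    by (simp add: fhom_add[OF fhom_star2] fhom_mult[OF fhom_star2] fhom_const2[OF fhom_star2] star2_toz const2_simps(5))
  have "vord N (const2 (1/2) * ((toz u + const2 \<i> * toz v) + (toz u - const2 \<i> * toz v)))"
    by (intro vord_const2_mult vord_add assms *)
  also have "const2 (1/2) * ((toz u + const2 \<i> * toz v) + (toz u - const2 \<i> * toz v)) = toz u"
    by (rule fps2_eqI) (simp only: coeff2_add coeff2_diff coeff2_const2_mult, simp)
  finally show "vord N u" by (simp add: toz_vord_iff)
  have "vord N (const2 (- \<i>/2) * ((toz u + const2 \<i> * toz v) - (toz u - const2 \<i> * toz v)))"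
    by (intro vord_const2_mult vord_diff assms *)
  also have "const2 (- \<i>/2) * ((toz u + const2 \<i> * toz v) - (toz u - const2 \<i> * toz v)) = toz v"
    by (rule fps2_eqI) (simp only: coeff2_add coeff2_diff coeff2_const2_mult, simp)
  finally show "vord N v" by (simp add: toz_vord_iff)
qed

lemma zcoord_rot:
  assumes "fhom (\<lambda>c. c) t"
  shows "zcoord (\<lambda>f. t (rot \<theta> f)) = const2 (cis \<theta>) * zcoord t"
  unfolding zcoord_def rot_X2 rot_Y2 fhom_add[OF assms] fhom_mult[OF assms] fhom_const2[OF assms]
    fhom_add[OF fhom_toz] fhom_mult[OF fhom_toz] fhom_const2[OF fhom_toz]
  by (rule fps2_eqI, simp only: coeff2_add coeff2_const2_mult) (simp add: complex_eq_iff algebra_simps)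

lemma zcoord_pexp: "vord 3 H \<Longrightarrow> zcoord (pexp H) = zexp (toz H) X2"
  unfolding zcoord_def toz_complex[symmetric]
  by (simp add: toz_pexp fhom_add[OF fhom_pexp] fhom_mult[OF fhom_pexp] fhom_const2[OF fhom_pexp]
      vord_const2_mult toz_vord)

lemma zcoord_id: "zcoord (\<lambda>f. f) = X2"
  by (simp add: zcoord_def toz_complex)

lemma zcoord_vord_diff:
  assumes "vord N (zcoord t - zcoord t')"
  shows "vord N (t X2 - t' X2)" "vord N (t Y2 - t' Y2)"
proof -
  have "zcoord t - zcoord t' = toz (t X2 - t' X2) + const2 \<i> * toz (t Y2 - t' Y2)"
    by (simp add: zcoord_def fhom_diff[OF fhom_toz] algebra_simps)
  with assms vord_real_parts[of N "t X2 - t' X2" "t Y2 - t' Y2"]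
  show "vord N (t X2 - t' X2)" "vord N (t Y2 - t' Y2)" by simp_all
qed

text \<open>The linear part is a rotation; composing with its inverse leaves a bracket-preserving
  map tangent to the identity, hence an exponential.\<close>

lemma symp_factor:
  assumes t: "symp t" and lin: "coeff2 (zcoord t) 1 0 = cis \<theta>" "coeff2 (zcoord t) 0 1 = 0"
  obtains H where "vord 3 H" "\<And>f. t f = pexp H (rot \<theta> f)"
    "zexp (toz H) X2 = const2 (cis (- \<theta>)) * zcoord t"
proof -
  define t' where "t' f = t (rot (- \<theta>) f)" for f
  have t': "symp t'" unfolding t'_def by (rule symp_comp[OF t symp_rot])
  have z': "zcoord t' = const2 (cis (- \<theta>)) * zcoord t"
    unfolding t'_def[abs_def] by (rule zcoord_rot[OF symp_fhom[OF t]])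
  have "vord 2 (zcoord t' - X2)"
    unfolding vord_diff_iff
  proof (intro allI impI)
    fix i j :: nat assume "i + j < 2"
    then consider "i = 0" "j = 0" | "i = 1" "j = 0" | "i = 0" "j = 1" by linarith
    then show "coeff2 (zcoord t') i j = coeff2 X2 i j"
    proof cases
      case 1
      have "vord 1 (toz (t X2))" "vord 1 (toz (t Y2))"
        by (simp_all add: toz_vord fhom_vord[OF symp_fhom[OF t]])
      then have "coeff2 (toz (t X2)) 0 0 = 0" "coeff2 (toz (t Y2)) 0 0 = 0"
        by (simp_all add: vord_def)
      then show ?thesis using 1 unfolding z' by (simp add: zcoord_def coeff2_X2)
    qed (use lin in \<open>simp_all add: z' coeff2_X2 cis_mult\<close>)
  qed
  then have tan: "vord 2 (t' X2 - X2)" "vord 2 (t' Y2 - Y2)"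
    using zcoord_vord_diff[of 2 t' "\<lambda>f. f"] by (simp_all add: zcoord_id)
  obtain H where H: "vord 3 H" "\<And>f. t' f = pexp H f"
    by (rule tangent_symplectic_is_pexp[of t']) (use t' tan in \<open>auto simp: symp_def\<close>)
  have "t f = pexp H (rot \<theta> f)" for f
    using H(2)[of "rot \<theta> f"] by (simp add: t'_def rot_cancel)
  moreover have "t' = pexp H" using H(2) by blast
  then have "zexp (toz H) X2 = const2 (cis (- \<theta>)) * zcoord t"
    using z' zcoord_pexp[OF H(1)] by simp
  ultimately show thesis using that H(1) by blast
qed

section \<open>Formal conjugacy to the normal form\<close>

text \<open>Two or more brackets raise the order by at least \<open>2 * b\<close>, so low
  coefficients of a time-one map are affine in the Hamiltonian.\<close>

lemma pexp_second_order:
  assumes K: "vord (b + 2) K" and f: "vord a f" and b: "b \<ge> 1"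
  shows "vord (a + 2 * b) (pexp K f - f - pb f K)"
  unfolding vord_def
proof (intro allI impI)
  fix p q assume pq: "p + q < a + 2 * b"
  have K3: "vord 3 K" using K b by (auto elim: vord_mono)
  have z: "coeff2 (adp K (Suc (Suc k)) f) p q = 0" for k
    by (rule vordD[OF vord_adp[OF K f]]) (use pq in \<open>simp add: algebra_simps\<close>)
  have "coeff2 (pexp K f) p q = (\<Sum>k<Suc (Suc (p + q)). coeff2 (adp K k f) p q / fact k)"
    by (rule coeff2_pexp[OF K3]) simp
  also have "\<dots> = coeff2 f p q + coeff2 (pb f K) p q"
    unfolding sum.lessThan_Suc_shift[of _ "Suc (p + q)"] sum.lessThan_Suc_shift[of _ "p + q"]
    by (simp add: z del: fact_Suc)
  finally show "coeff2 (pexp K f - f - pb f K) p q = 0" by simp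
qed

locale resonant_rotation = resonance +
  fixes \<alpha> :: real
  assumes root: "cis \<alpha> ^ n = 1" and primitive: "\<And>k. 1 \<le> k \<Longrightarrow> k < n \<Longrightarrow> cis \<alpha> ^ k \<noteq> 1"
begin

lemma cis_power_eq_1: "cis \<alpha> ^ d = 1 \<Longrightarrow> n dvd d"
proof (rule ccontr)
  assume d: "cis \<alpha> ^ d = 1" and nd: "\<not> n dvd d"
  have "cis \<alpha> ^ d = (cis \<alpha> ^ n) ^ (d div n) * cis \<alpha> ^ (d mod n)"
    by (simp flip: power_mult power_add)
  then have "cis \<alpha> ^ (d mod n) = 1" using d root by simp
  moreover have "1 \<le> d mod n" "d mod n < n" using nd n5 by (auto simp: mod_greater_zero_iff_not_dvd Suc_le_eq)
  ultimately show False using primitive by blast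
qed

lemma cis_cnj_power: "cis \<theta> ^ (p + d) * cnj (cis \<theta>) ^ p = cis \<theta> ^ d"
proof -
  have "(cis \<theta> * cnj (cis \<theta>)) ^ p = 1" by (simp add: cis_cnj cis_mult)
  then show ?thesis by (simp add: power_add power_mult_distrib algebra_simps)
qed

lemma cis_resonance:
  assumes "cis \<alpha> ^ i * cnj (cis \<alpha>) ^ j = 1"
  shows "rweight 0 i j"
proof (cases "j \<le> i")
  case True
  then obtain d where d: "i = j + d" by (metis le_Suc_ex)
  then have "cis \<alpha> ^ d = 1" using assms cis_cnj_power[of \<alpha> j d] by simp
  then have "n dvd d" by (rule cis_power_eq_1)
  then obtain m where "d = n * m" by (elim dvdE)
  then show ?thesis using rweight_pm[of 0 j m] d by simp
next
  case False
  then obtain d where d: "j = i + d" by (metis le_Suc_ex linear)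
  have "cnj (cis \<alpha> ^ i * cnj (cis \<alpha>) ^ j) = 1" using assms by simp
  then have "cis \<alpha> ^ d = 1" using cis_cnj_power[of \<alpha> i d] d by (simp add: mult.commute)
  then have "n dvd d" by (rule cis_power_eq_1)
  then obtain m where "d = n * m" by (elim dvdE)
  then show ?thesis using rweight_pm'[of 0 i m] d by simp
qed

lemma rot_invariant_support:
  assumes "rot \<alpha> f = f" "coeff2 (toz f) i j \<noteq> 0"
  shows "rweight 0 i j"
proof -
  have "dil2 (cis \<alpha>) (toz f) = toz f" using assms(1) by (simp flip: toz_rot)
  then have "cis \<alpha> ^ i * cnj (cis \<alpha>) ^ j * coeff2 (toz f) i j = coeff2 (toz f) i j"
    by (metis coeff2_dil2)
  then show ?thesis using assms(2) by (intro cis_resonance) simp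
qed

lemma dil2_invariant:
  assumes "\<And>i j. coeff2 f i j \<noteq> 0 \<Longrightarrow> rweight 0 i j" "cis \<theta> ^ n = 1"
  shows "dil2 (cis \<theta>) f = f"
proof (rule fps2_eqI)
  fix i j
  show "coeff2 (dil2 (cis \<theta>) f) i j = coeff2 f i j"
  proof (cases "coeff2 f i j = 0")
    case False
    then obtain p m where "i = p + n * m \<and> j = p \<or> i = p \<and> j = p + n * m"
      using assms(1) unfolding resonant_weight_def by blast
    moreover have "cis \<theta> ^ (p + n * m) * cnj (cis \<theta>) ^ p = 1"
      unfolding cis_cnj_power by (simp add: power_mult assms(2))
    moreover from this have "cnj (cis \<theta> ^ (p + n * m) * cnj (cis \<theta>) ^ p) = 1" by simp
    then have "cis \<theta> ^ p * cnj (cis \<theta>) ^ (p + n * m) = 1" by (simp add: mult.commute)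
    ultimately show ?thesis by auto
  qed simp
qed

lemma rot_invariant_iff: "rot \<alpha> f = f \<longleftrightarrow> (\<forall>i j. coeff2 (toz f) i j \<noteq> 0 \<longrightarrow> rweight 0 i j)"
  using rot_invariant_support dil2_invariant[of "toz f" \<alpha>] root by (metis toz_inject toz_rot)

lemma star2_dil2: "star2 f = f \<Longrightarrow> star2 (dil2 \<mu> f) = dil2 \<mu> f"
  by (rule fps2_eqI) (metis (no_types, lifting) coeff2_dil2 coeff2_star2 complex_cnj_cnj complex_cnj_mult complex_cnj_power mult.commute)

lemma W_dil2: "W q f \<Longrightarrow> W q (dil2 \<mu> f)"
  by (auto simp: W_def)

lemma rot_normal_form: "rot \<alpha> (normal_form_hamiltonian n A B) = normal_form_hamiltonian n A B"
  using rot_invariant_iff nf_support by blast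

lemma vord_normal_form: "vord 3 (normal_form_hamiltonian n A B)"
proof -
  have "vord \<tau> (toz (normal_form_hamiltonian n A B))" by (rule W_vord[OF W_normal_form])
  then have "vord 3 (toz (normal_form_hamiltonian n A B))" using params by (auto elim: vord_mono)
  then show ?thesis by (simp add: toz_vord_iff)
qed

lemma rot_pexp_commute:
  assumes "vord 3 H" "rot \<alpha> H = H"
  shows "rot \<alpha> (pexp H f) = pexp H (rot \<alpha> f)"
  using symp_pexp_conj[OF symp_rot assms(1), of \<alpha> f] assms(2) by simp

lemma rot_commute: "rot \<theta> (rot \<eta> f) = rot \<eta> (rot \<theta> f)"
  by (simp add: rot_rot add.commute)

definition conjugates :: "(real fps2 \<Rightarrow> real fps2) \<Rightarrow> (real fps2 \<Rightarrow> real fps2) \<Rightarrow> real fps2 \<Rightarrow> bool" where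
  "conjugates t \<phi> N \<longleftrightarrow> symp \<phi> \<and> (\<exists>\<phi>'. symp \<phi>' \<and> (\<forall>f. \<phi> (\<phi>' f) = f) \<and> (\<forall>f. \<phi>' (\<phi> f) = f)) \<and>
     (\<forall>f. t (\<phi> f) = \<phi> (pexp N (rot \<alpha> f)))"

text \<open>The expansion through degree \<open>n\<close> commutes with the rotation, so the
  generator of the map agrees with its average up to order \<open>n + 2\<close>. Hence the invariant
  Hamiltonian inherits the low-order terms of the map that decide its leading part: (z \<zeta>)^2 is
  absent, (z \<zeta>)^3 and z^n are present.\<close>

theorem exists_conjugacy:
  assumes t: "symp t"
    and supp: "\<And>i j. i + j \<le> n \<Longrightarrow> coeff2 (zcoord t) i j \<noteq> 0 \<Longrightarrow> i = j + 1 \<or> i = 0 \<and> j = n - 1"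
    and c10: "coeff2 (zcoord t) 1 0 = cis \<alpha>" and c21: "coeff2 (zcoord t) 2 1 = 0"
    and c32: "coeff2 (zcoord t) 3 2 \<noteq> 0" and c0n: "coeff2 (zcoord t) 0 (n - 1) \<noteq> 0"
  obtains A B \<phi> where "nf_constraints n A B" "fps_nth B 0 > 0" "n \<noteq> 5 \<longrightarrow> fps_nth A 0 \<noteq> 0"
    "conjugates t \<phi> (normal_form_hamiltonian n A B)"
proof -
  have c01: "coeff2 (zcoord t) 0 1 = 0" 
  proof -
    have "(1::nat) \<noteq> n - 1" "(1::nat) \<le> n" using n5 by simp_all
    then show ?thesis using supp[of 0 1] by auto
  qed
  obtain H0 where H0: "vord 3 H0" "\<And>f. t f = pexp H0 (rot \<alpha> f)"
    and z: "zexp (toz H0) X2 = const2 (cis (- \<alpha>)) * zcoord t"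
    using symp_factor[OF t c10 c01] by blast
  define t' where "t' = pexp H0"
  have \<rho>H0: "vord 3 (rot \<alpha> H0)" by (rule fhom_vord[OF fhom_rot H0(1)])
  have equi: "dil2 (cis \<alpha>) (zexp (toz H0) X2) = const2 (cis \<alpha>) * zexp (toz (rot \<alpha> H0)) X2"
  proof -
    have "dil2 (cis \<alpha>) X2 = const2 (cis \<alpha>) * X2" by (rule fps2_eqI) (auto simp: coeff2_X2)
    moreover have "dil2 (cis \<alpha>) (zexp (toz H0) X2) = zexp (toz (rot \<alpha> H0)) (dil2 (cis \<alpha>) X2)"
    proof (rule fhom_pexp_conj[OF fhom_dil2])
      show "dil2 (cis \<alpha>) (pb f (const2 (- 2 * \<i>) * toz H0)) = pb (dil2 (cis \<alpha>) f) (const2 (- 2 * \<i>) * toz (rot \<alpha> H0))" for f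
        by (simp add: dil2_pb toz_rot fhom_mult[OF fhom_dil2] fhom_const2[OF fhom_dil2])
    qed (use H0 \<rho>H0 in \<open>auto intro: vord_const2_mult toz_vord\<close>)
    ultimately show ?thesis
      using \<rho>H0 by (simp add: fhom_mult[OF fhom_pexp] fhom_const2[OF fhom_pexp] vord_const2_mult toz_vord)
  qed
  \<comment> \<open>In the degrees up to \<open>n\<close> only the terms z (z \<zeta>)^j and
    \<zeta>^(n - 1) occur; the rotation multiplies all of them by \<open>cis \<alpha>\<close>, the
    last one because \<open>cis \<alpha> ^ n = 1\<close>.\<close>
  have "vord (Suc n) (dil2 (cis \<alpha>) (zexp (toz H0) X2) - const2 (cis \<alpha>) * zexp (toz H0) X2)"
    unfolding vord_diff_iff z
  proof (intro allI impI)
    fix i j assume ij: "i + j < Suc n"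
    show "coeff2 (dil2 (cis \<alpha>) (const2 (cis (- \<alpha>)) * zcoord t)) i j = coeff2 (const2 (cis \<alpha>) * (const2 (cis (- \<alpha>)) * zcoord t)) i j"
    proof (cases "coeff2 (zcoord t) i j = 0")
      case False
      have "cis \<alpha> ^ i * cnj (cis \<alpha>) ^ j = cis \<alpha>"
      proof (rule disjE[OF supp[OF _ False]])
        assume "i = j + 1"
        then show ?thesis using cis_cnj_power[of \<alpha> j 1] by simp
      next
        assume ij0: "i = 0 \<and> j = n - 1"
        have "cis \<alpha> ^ n = cis \<alpha> * cis \<alpha> ^ (n - 1)" using n5 by (simp flip: power_Suc)
        then have 1: "cis \<alpha> * cis \<alpha> ^ (n - 1) = 1" using root by simp
        have 2: "cis \<alpha> ^ (n - 1) * cnj (cis \<alpha>) ^ (n - 1) = 1"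
          using cis_cnj_power[of \<alpha> "n - 1" 0] by simp
        have "w = c" if "c * u = 1" "u * w = 1" for c u w :: complex
          using that by (metis mult.assoc mult_1 mult_1_right)
        from this[OF 1 2] show ?thesis using ij0 by simp
      qed (use ij in simp)
      then show ?thesis by simp
    qed simp
  qed
  then have "vord (Suc n) (const2 (cis (- \<alpha>)) * (const2 (cis \<alpha>) * zexp (toz (rot \<alpha> H0)) X2 - const2 (cis \<alpha>) * zexp (toz H0) X2))"
    unfolding equi by (rule vord_const2_mult)
  also have "const2 (cis (- \<alpha>)) * (const2 (cis \<alpha>) * zexp (toz (rot \<alpha> H0)) X2 - const2 (cis \<alpha>) * zexp (toz H0) X2) =
      zcoord (pexp (rot \<alpha> H0)) - zcoord (pexp H0)"
    unfolding zcoord_pexp[OF H0(1)] zcoord_pexp[OF \<rho>H0]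
    by (simp add: right_diff_distrib const2_collect cis_mult const2_simps(4))
  finally have v: "vord (Suc n) (zcoord (pexp (rot \<alpha> H0)) - zcoord (pexp H0))" .
  have rH: "vord (Suc (Suc n)) (rot \<alpha> H0 - H0)"
    by (rule pexp_inj[OF H0(1) \<rho>H0 zcoord_vord_diff[OF v]]) (use n5 in simp)
  have per: "\<And>f. (rot \<alpha> ^^ n) f = f" by (rule rot_period[OF root])
  have n1: "1 \<le> n" using n5 by simp
  \<comment> \<open>An invariant starting point for the normalisation that leaves all terms up to
    degree \<open>n + 1\<close> untouched.\<close>
  define H1 where "H1 = average (rot \<alpha>) n H0"
  have H1: "vord 3 H1" "rot \<alpha> H1 = H1" "vord (Suc (Suc n)) (H1 - H0)"
    unfolding H1_def
    using vord_average[OF fhom_rot n1 per H0(1)] average_invariant[OF fhom_rot n1 per]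
      vord_average_diff[OF fhom_rot n1 per rH] by blast+
  have start: "vord (Suc n) (t' f - pexp H1 f)" if "vord 1 f" for f
  proof -
    have K: "vord (n + 2) (H1 - H0)" using H1(3) by simp
    have "vord (1 + n + 1) (pexp (H0 + (H1 - H0)) f - pexp H0 f - pb f (H1 - H0))"
      by (rule vord_3_perturb[OF H0(1) K n1 that])
    then have "vord (Suc n) (pexp H1 f - pexp H0 f - pb f (H1 - H0))" by (auto elim: vord_mono)
    moreover have "vord (Suc n) (pb f (H1 - H0))" using vord_pb[OF that K] by simp
    ultimately have "vord (Suc n) (pexp H1 f - pexp H0 f - pb f (H1 - H0) + pb f (H1 - H0))" by (rule vord_add)
    then show ?thesis unfolding t'_def by (subst vord_commute) simp
  qed
  have t': "symp t'" unfolding t'_def by (rule symp_pexp[OF H0(1)])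
  obtain \<xi> H where \<xi>: "vord (Suc (Suc n)) \<xi>" and HH1: "vord (Suc (Suc n)) (H - H1)" and H: "vord 3 H" "rot \<alpha> H = H"
    and conj: "\<And>f. t' (pexp (rot \<alpha> \<xi>) f) = pexp \<xi> (pexp H f)"
    by (rule takens_normal_form[OF fhom_rot n1 per rot_pb, where t = t' and ?H0.0 = H1 and ?k0.0 = "Suc n"])
      (use t' H1 start n5 in \<open>auto simp: symp_def\<close>)
  have \<xi>3: "vord 3 \<xi>" using \<xi> n5 by (auto elim: vord_mono)

  define g where "g = toz H"
  have g_star: "star2 g = g" by (simp add: g_def star2_toz)
  have g_supp: "rweight 0 i j" if "coeff2 g i j \<noteq> 0" for i j
    using rot_invariant_support[OF H(2)] that by (simp add: g_def)
  have g3: "vord 3 g" by (simp add: g_def toz_vord H(1))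
  have gZ: "coeff2 (zexp g X2) i j = cis (- \<alpha>) * coeff2 (zcoord t) i j" if "i + j \<le> n" for i j
  proof -
    have K: "vord (n + 2) (H - H0)"
      using vord_trans[OF HH1 H1(3)] by simp
    have "vord (Suc n) (pexp H f - pexp H0 f)" if "vord 1 f" for f
    proof -
      have "vord (1 + n + 1) (pexp (H0 + (H - H0)) f - pexp H0 f - pb f (H - H0))"
        by (rule vord_3_perturb[OF H0(1) K n1 that])
      then have "vord (Suc n) (pexp H f - pexp H0 f - pb f (H - H0))" by (auto elim: vord_mono)
      moreover have "vord (Suc n) (pb f (H - H0))" using vord_pb[OF that K] by simp
      ultimately have "vord (Suc n) (pexp H f - pexp H0 f - pb f (H - H0) + pb f (H - H0))" by (rule vord_add)
      then show ?thesis by simp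
    qed
    then have "vord (Suc n) (pexp H X2 - pexp H0 X2)" "vord (Suc n) (pexp H Y2 - pexp H0 Y2)" by simp_all
    then have "vord (Suc n) (toz (pexp H X2 - pexp H0 X2) + const2 \<i> * toz (pexp H Y2 - pexp H0 Y2))"
      by (intro vord_add vord_const2_mult toz_vord)
    then have "vord (Suc n) (zcoord (pexp H) - zcoord (pexp H0))"
      by (simp add: zcoord_def fhom_diff[OF fhom_toz] algebra_simps)
    then have "coeff2 (zexp g X2) i j = coeff2 (zexp (toz H0) X2) i j"
      unfolding zcoord_pexp[OF H(1)] zcoord_pexp[OF H0(1)] g_def[symmetric] using that by (simp add: vord_diff_iff)
    then show ?thesis by (simp only: z coeff2_const2_mult)
  qed
  have rweight_deg: "coeff2 g i j = 0" if "i + j < n" "i \<noteq> j" for i j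
  proof (rule ccontr)
    assume "coeff2 g i j \<noteq> 0"
    then obtain p m where pm: "i = p + n * m \<and> j = p \<or> i = p \<and> j = p + n * m"
      using g_supp unfolding resonant_weight_def by blast
    then have "m \<noteq> 0" using that(2) by (cases m) auto
    then have "n * 1 \<le> n * m" by (intro mult_le_mono2) simp
    then show False using pm that(1) by linarith
  qed
  have g4: "vord 4 g"
    unfolding vord_def
  proof (intro allI impI)
    fix i j :: nat assume ij: "i + j < 4"
    show "coeff2 g i j = 0"
    proof (cases "i = j")
      case True
      then show ?thesis using g3 ij by (intro vordD[OF g3]) presburger
    qed (use rweight_deg ij n5 in auto)
  qed
  have zx: "pb X2 (const2 (- 2 * \<i>) * g) = const2 (- 2 * \<i>) * dy2 g" by (simp add: pb_scale_right pb_X2_left)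
  \<comment> \<open>With \<open>g\<close> of order four the second-order terms start in degree five,
    so the coefficient of (z \<zeta>)^2 is proportional to that of z^2 \<zeta> in the map, which is
    zero.\<close>
  have g22: "coeff2 g 2 2 = 0"
  proof -
    have "vord (1 + 2 * 2) (zexp g X2 - X2 - pb X2 (const2 (- 2 * \<i>) * g))"
      by (rule pexp_second_order) (use g4 in \<open>auto intro: vord_const2_mult\<close>)
    then have "coeff2 (zexp g X2 - X2 - pb X2 (const2 (- 2 * \<i>) * g)) 2 1 = 0" by (rule vordD) simp
    then show ?thesis using gZ[of 2 1] c21 n5 unfolding zx by (simp add: coeff2_X2 numeral_2_eq_2)
  qed
  have g5: "vord 5 g"
    unfolding vord_def
  proof (intro allI impI)
    fix i j :: nat assume ij: "i + j < 5"
    show "coeff2 g i j = 0"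
    proof (cases "i = j")
      case True
      then have "i < 2 \<or> i = 2" using ij by linarith
      then show ?thesis using g4 g22 True by (auto simp: vord_def)
    qed (use rweight_deg ij n5 in auto)
  qed
  \<comment> \<open>With the order raised to five, the comparison reaches the coefficient of z^3
    \<zeta>^2; with order four it would stop just short of it.\<close>
  have g33: "coeff2 g 3 3 \<noteq> 0"
  proof
    assume z3: "coeff2 g 3 3 = 0"
    have "vord (1 + 2 * 3) (zexp g X2 - X2 - pb X2 (const2 (- 2 * \<i>) * g))"
      by (rule pexp_second_order) (use g5 in \<open>auto intro: vord_const2_mult\<close>)
    then have "coeff2 (zexp g X2 - X2 - pb X2 (const2 (- 2 * \<i>) * g)) 3 2 = 0" by (rule vordD) simp
    then show False using gZ[of 3 2] c32 n5 z3 unfolding zx by (simp add: coeff2_X2 numeral_3_eq_3)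
  qed
  \<comment> \<open>For large \<open>n\<close> the second-order terms are not negligible in degree
    \<open>n - 1\<close>. Instead, the coefficient of \<zeta>^(n - 1) in a bracket with
    \<open>K\<close> involves only coefficients of \<open>K\<close> with exponents at most one and
    \<open>n\<close>, and all of these would vanish.\<close>
  have g0n: "coeff2 g 0 n \<noteq> 0"
  proof
    assume z0: "coeff2 g 0 n = 0"
    define K where "K = const2 (- 2 * \<i>) * g"
    have K3: "vord 3 K" unfolding K_def by (intro vord_const2_mult g3)
    have Kz: "coeff2 K i j = 0" if "i \<le> 1" "j \<le> n" for i j
    proof (cases "i = j")
      case True
      then show ?thesis using that K3 by (intro vordD[OF K3]) simp
    next
      case False
      have "coeff2 g i j = 0"
      proof (rule ccontr)
        assume ne: "coeff2 g i j \<noteq> 0"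
        then obtain p m where pm: "i = p + n * m \<and> j = p \<or> i = p \<and> j = p + n * m"
          using g_supp unfolding resonant_weight_def by blast
        then have m: "m \<noteq> 0" using False by (cases m) auto
        then have nm: "n * 1 \<le> n * m" by (intro mult_le_mono2) simp
        then have "\<not> (i = p + n * m \<and> j = p)" using that(1) n5 by linarith
        then have "j = p + n * m" "i = p" using pm by auto
        then have "i = 0" "j = n" using that(2) nm by linarith+
        then show False using ne z0 by simp
      qed
      then show ?thesis by (simp add: K_def)
    qed
    have "coeff2 (pb f K) 0 (n - 1) = 0" for f
      unfolding coeff2_pb
    proof (intro sum.neutral ballI)
      fix i j assume "i \<in> {..Suc 0}" "j \<in> {..Suc (n - 1)}"
      then have "coeff2 K (Suc 0 - i) (Suc (n - 1) - j) = 0" using n5 by (intro Kz) auto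
      then show "(of_nat i * of_nat (Suc (n - 1) - j) - of_nat j * of_nat (Suc 0 - i)) *
         (coeff2 f i j * coeff2 K (Suc 0 - i) (Suc (n - 1) - j)) = 0" by simp
    qed
    then have "coeff2 (adp K k X2) 0 (n - 1) = 0" for k
      by (cases k) (simp_all add: adp_Suc coeff2_X2)
    then have "coeff2 (pexp K X2) 0 (n - 1) = 0"
      by (simp add: pexp_def)
    then show False using gZ[of 0 "n - 1"] c0n n5 by (simp add: K_def)
  qed
  have gn0: "coeff2 g n 0 \<noteq> 0" by (metis g0n g_star coeff2_star2 complex_cnj_zero_iff)
  have gW: "W \<tau> g"
    unfolding W_iff_star[OF g_star]
  proof (intro conjI allI impI)
    fix p m assume "\<sigma> * p + \<tau> * m < \<tau>"
    then have "m = 0" "p < 3" using params by (cases m; auto)+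
    then show "coeff2 g (p + n * m) p = 0" using g5 by (simp add: vord_def)
  qed (rule g_supp)

  \<comment> \<open>Rotation by this angle makes the coefficient of z^n the positive number
    \<open>\<beta>\<close>, which yields the sign of the first coefficient of
    \<open>B\<close>.\<close>
  define \<theta> where "\<theta> = - Arg (coeff2 g n 0) / n"
  define \<beta> where "\<beta> = cmod (coeff2 g n 0)"
  have \<beta>: "\<beta> > 0" using gn0 by (simp add: \<beta>_def)
  define G where "G = toz (rot \<theta> H)"
  have Gg: "G = dil2 (cis \<theta>) g" by (simp add: G_def g_def toz_rot)
  have Gn0: "coeff2 G n 0 = of_real \<beta>"
  proof -
    have "real n * \<theta> = - Arg (coeff2 g n 0)" using n5 by (simp add: \<theta>_def)
    then have "cis \<theta> ^ n = cis (- Arg (coeff2 g n 0))" by (simp only: Complex.DeMoivre)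
    moreover have "coeff2 g n 0 = of_real \<beta> * cis (Arg (coeff2 g n 0))"
      by (simp add: \<beta>_def rcis_cmod_Arg[of "coeff2 g n 0", unfolded rcis_def])
    ultimately show ?thesis by (simp add: Gg) (metis cis_inverse cis_neq_zero cis_cnj inverse_unique left_inverse mult.commute mult.left_commute mult_1_right)
  qed
  have G33: "coeff2 G 3 3 = coeff2 g 3 3"
    using cis_cnj_power[of \<theta> 3 0] by (simp add: Gg)
  interpret rh: resonant_hamiltonian n G \<beta>
    by unfold_locales (use Gn0 \<beta> G33 g33 W_dil2[OF gW] in \<open>auto simp: Gg star2_dil2[OF g_star]\<close>)
  obtain \<eta> where \<eta>: "star2 \<eta> = \<eta>" "W (Suc \<sigma>) \<eta>" and nf: "nf (zexp \<eta> G)"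
    by (rule rh.resonant_normal_form)
  obtain X where X: "toz X = \<eta>" using toz_surj[OF \<eta>(1)] by blast
  have X3: "vord 3 X" using rh.W_vord_3[OF \<eta>(2)] X by (metis toz_vord_iff)
  have rX: "rot \<alpha> X = X" using rot_invariant_iff[of X] W_ww_0[OF \<eta>(2)] X by blast
  \<comment> \<open>The transformation does not touch the leading weight, so the leading
    coefficients survive it.\<close>
  have NW1: "W (Suc \<tau>) (zexp \<eta> G - G)"
  proof -
    have K: "W (1 + \<sigma>) (const2 (- 2 * \<i>) * \<eta>)" using \<eta>(2) by (intro W_const2_mult) simp
    have "W (Suc \<tau>) (pb G (const2 (- 2 * \<i>) * \<eta>))" using W_pb[OF rh.G_W K] by simp
    note W1 = this
    have "W (Suc (Suc \<tau>)) (zexp \<eta> G - G - pb G (const2 (- 2 * \<i>) * \<eta>))"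
      using W_pexp_first[OF _ W1] K by simp
    then have "W (Suc \<tau>) (zexp \<eta> G - G - pb G (const2 (- 2 * \<i>) * \<eta>))"
      by (rule W_mono) simp
    from W_add[OF this W1] show ?thesis by simp
  qed
  have NW: "W \<tau> (zexp \<eta> G)" using W_add[OF W_mono[OF NW1] rh.G_W] by simp
  have Nstar: "star2 (zexp \<eta> G) = zexp \<eta> G"
    by (intro star2_zexp \<eta> rh.G_star rh.W_vord_3)
  obtain A B where AB: "nf_constraints n A B" "toz (normal_form_hamiltonian n A B) = zexp \<eta> G"
    by (rule nf_imp_normal_form[OF Nstar NW nf])
  define N where "N = normal_form_hamiltonian n A B"
  have N_eq: "N = pexp X (rot \<theta> H)"
    using AB(2) toz_pexp[OF X3, of "rot \<theta> H"] by (simp add: N_def X G_def flip: toz_inject)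
  have N3: "vord 3 N" by (simp add: N_def vord_normal_form)
  have B0: "fps_nth B 0 > 0"
  proof -
    have "coeff2 (zexp \<eta> G - G) (0 + n * 1) 0 = 0" by (rule W_coeff_pm[OF NW1]) simp
    then have "complex_of_real (nf_coeff n A B (0 + n * 1) 0) = of_real \<beta>"
      unfolding coeff2_toz_nf[symmetric] AB(2) by (simp add: Gn0)
    then have "2 powr (- real n / 2) / 2 * fps_nth B 0 = \<beta>"
      unfolding nf_coeff_pm of_real_eq_iff by simp
    then have "0 < 2 powr (- real n / 2) / 2 * fps_nth B 0" using \<beta> by simp
    then show ?thesis by (rule zero_less_mult_pos) simp
  qed
  have A0: "fps_nth A 0 \<noteq> 0" if "n \<noteq> 5"
  proof -
    have "coeff2 (zexp \<eta> G - G) (3 + n * 0) 3 = 0"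
      by (rule W_coeff_pm[OF NW1]) (use that params in auto)
    then have "complex_of_real (nf_coeff n A B (3 + n * 0) 3) \<noteq> 0"
      unfolding coeff2_toz_nf[symmetric] AB(2) using G33 g33 by simp
    then show ?thesis unfolding nf_coeff_pm by auto
  qed
  define \<psi> \<psi>' where "\<psi> f = pexp X (rot \<theta> f)" and "\<psi>' f = rot (- \<theta>) (pexp (- X) f)" for f
  have X3': "vord 3 (- X)" using X3 by simp
  have \<psi>: "symp \<psi>" "symp \<psi>'" unfolding \<psi>_def[abs_def] \<psi>'_def[abs_def]
    by (rule symp_comp[OF symp_pexp[OF X3] symp_rot]) (rule symp_comp[OF symp_rot symp_pexp[OF X3']])
  have inv: "\<psi> (\<psi>' f) = f" "\<psi>' (\<psi> f) = f" for f
    by (simp_all add: \<psi>_def \<psi>'_def rot_cancel pexp_uminus_cancel[OF X3])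
  have \<psi>rot: "\<psi> (rot \<alpha> f) = rot \<alpha> (\<psi> f)" for f
    using rot_pexp_commute[OF X3 rX] by (simp add: \<psi>_def rot_commute[of \<theta>])
  have \<psi>'rot: "\<psi>' (rot \<alpha> f) = rot \<alpha> (\<psi>' f)" for f by (metis \<psi>rot inv)
  have \<psi>'N: "\<psi>' N = H" using inv(2)[of H] by (simp add: N_eq \<psi>_def)
  define \<phi> \<phi>' where "\<phi> f = pexp \<xi> (\<psi>' f)" and "\<phi>' f = \<psi> (pexp (- \<xi>) f)" for f
  have \<xi>3': "vord 3 (- \<xi>)" using \<xi>3 by simp
  have \<phi>: "symp \<phi>" "symp \<phi>'" unfolding \<phi>_def[abs_def] \<phi>'_def[abs_def]
    by (rule symp_comp[OF symp_pexp[OF \<xi>3] \<psi>(2)]) (rule symp_comp[OF \<psi>(1) symp_pexp[OF \<xi>3']])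
  have inv': "\<phi> (\<phi>' f) = f" "\<phi>' (\<phi> f) = f" for f
    by (simp_all add: \<phi>_def \<phi>'_def inv pexp_uminus_cancel[OF \<xi>3])
  have "t (\<phi> f) = \<phi> (pexp N (rot \<alpha> f))" for f
  proof -
    have "t (\<phi> f) = t' (pexp (rot \<alpha> \<xi>) (rot \<alpha> (\<psi>' f)))"
      by (simp add: H0(2) t'_def \<phi>_def symp_pexp_conj[OF symp_rot \<xi>3])
    also have "\<dots> = pexp \<xi> (pexp H (\<psi>' (rot \<alpha> f)))" by (simp add: conj \<psi>'rot)
    also have "\<dots> = \<phi> (pexp N (rot \<alpha> f))"
      by (simp add: \<phi>_def symp_pexp_conj[OF \<psi>(2) N3] \<psi>'N)
    finally show ?thesis .
  qed
  then have "conjugates t \<phi> N" using \<phi> inv' by (auto simp: conjugates_def)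
  with that[of A B \<phi>] AB(1) B0 A0 show thesis by (simp add: N_def)
qed

text \<open>\<open>T\<close> compares the two conjugacies. Commuting with the rotation makes its
  linear part a rotation as well; positivity of both leading coefficients makes that rotation a
  symmetry of all resonant series, so only the exponential factor remains to be examined.\<close>

theorem conjugacy_unique:
  assumes c: "conjugates t \<phi> (normal_form_hamiltonian n A B)" "conjugates t \<phi>' (normal_form_hamiltonian n A' B')"
    and nf: "nf_constraints n A B" "nf_constraints n A' B'"
    and pos: "fps_nth B 0 > 0" "fps_nth B' 0 > 0" and A': "n \<noteq> 5 \<longrightarrow> fps_nth A' 0 \<noteq> 0"
  shows "A = A' \<and> B = B'"
proof -
  define N N' where "N = normal_form_hamiltonian n A B" and "N' = normal_form_hamiltonian n A' B'"
  have N3: "vord 3 N" "vord 3 N'" by (simp_all add: N_def N'_def vord_normal_form)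
  have rN: "rot \<alpha> N = N" "rot \<alpha> N' = N'" by (simp_all add: N_def N'_def rot_normal_form)
  obtain \<phi>i where \<phi>: "symp \<phi>" "symp \<phi>i" "\<And>f. \<phi> (\<phi>i f) = f" "\<And>f. \<phi>i (\<phi> f) = f" "\<And>f. t (\<phi> f) = \<phi> (pexp N (rot \<alpha> f))"
    using c(1) unfolding conjugates_def N_def by blast
  obtain \<phi>i' where \<phi>': "symp \<phi>'" "symp \<phi>i'" "\<And>f. \<phi>' (\<phi>i' f) = f" "\<And>f. \<phi>i' (\<phi>' f) = f" "\<And>f. t (\<phi>' f) = \<phi>' (pexp N' (rot \<alpha> f))"
    using c(2) unfolding conjugates_def N'_def by blast
  define T where "T f = \<phi>i (\<phi>' f)" for f
  define Ti where "Ti f = \<phi>i' (\<phi> f)" for f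
  have T: "symp T" unfolding T_def[abs_def] by (rule symp_comp[OF \<phi>(2) \<phi>'(1)])
  have TTi: "T (Ti f) = f" for f by (simp add: T_def Ti_def \<phi> \<phi>')
  define E E' where "E f = pexp N (rot \<alpha> f)" and "E' f = pexp N' (rot \<alpha> f)" for f
  have ET: "E (T f) = T (E' f)" for f
    by (metis E_def E'_def T_def \<phi>(3,4,5) \<phi>'(5))
  have ETk: "(E ^^ k) (T f) = T ((E' ^^ k) f)" for k f
    by (induction k) (simp_all add: ET)
  have Ek: "((\<lambda>f. pexp M (rot \<alpha> f)) ^^ k) f = (pexp M ^^ k) ((rot \<alpha> ^^ k) f)" if M: "vord 3 M" "rot \<alpha> M = M" for M k f
  proof (induction k)
    case (Suc k)
    have "rot \<alpha> ((pexp M ^^ k) h) = (pexp M ^^ k) (rot \<alpha> h)" for h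
      by (induction k) (simp_all add: rot_pexp_commute[OF M])
    then show ?case using Suc by simp
  qed simp
  have En: "(E ^^ n) f = pexp (const2 (of_nat n) * N) f" "(E' ^^ n) f = pexp (const2 (of_nat n) * N') f" for f
    unfolding E_def[abs_def] E'_def[abs_def] Ek[OF N3(1) rN(1)] Ek[OF N3(2) rN(2)] pexp_funpow[OF N3(1)] pexp_funpow[OF N3(2)]
      rot_period[OF root] by (rule refl)+
  have nN3: "vord 3 (const2 (of_nat n) * N)" "vord 3 (const2 (of_nat n) * N')" by (intro vord_const2_mult N3)+
  have TN3: "vord 3 (T N')" by (rule fhom_vord[OF symp_fhom[OF T] N3(2)])
  have "pexp (const2 (of_nat n) * N) f = pexp (const2 (of_nat n) * T N') f" for f
  proof -
    have "pexp (const2 (of_nat n) * N) (T (Ti f)) = T (pexp (const2 (of_nat n) * N') (Ti f))"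
      using ETk[of n "Ti f"] by (simp add: En)
    also have "\<dots> = pexp (T (const2 (of_nat n) * N')) (T (Ti f))" by (rule symp_pexp_conj[OF T nN3(2)])
    finally show ?thesis by (simp add: TTi fhom_mult[OF symp_fhom[OF T]] fhom_const2[OF symp_fhom[OF T]])
  qed
  note eq = this
  have "const2 (of_nat n) * N = const2 (of_nat n) * T N'"
    by (rule pexp_inj_eq[OF vord_const2_mult[OF TN3] nN3(1) eq eq])
  then have "const2 (1 / of_nat n) * (const2 (of_nat n) * N) = const2 (1 / of_nat n) * (const2 (of_nat n) * T N')" by simp
  then have NT: "N = T N'" using n5 by (simp add: const2_collect const2_simps(4))
  have Trot: "T (rot \<alpha> f) = rot \<alpha> (T f)" for f
  proof -
    have "pexp N (rot \<alpha> (T f)) = pexp N (T (rot \<alpha> f))"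
      using ET[of f] unfolding E_def E'_def symp_pexp_conj[OF T N3(2)] NT[symmetric] .
    then show ?thesis by (metis pexp_uminus_cancel(2)[OF N3(1)])
  qed
  define Z where "Z = zcoord T"
  have Zd: "dil2 (cis \<alpha>) Z = const2 (cis \<alpha>) * Z"
  proof -
    have "dil2 (cis \<alpha>) Z = zcoord (\<lambda>f. rot \<alpha> (T f))"
      by (simp add: Z_def zcoord_def fhom_add[OF fhom_dil2] fhom_mult[OF fhom_dil2] fhom_const2[OF fhom_dil2] toz_rot)
    also have "\<dots> = zcoord (\<lambda>f. T (rot \<alpha> f))" by (simp add: Trot)
    also have "\<dots> = const2 (cis \<alpha>) * Z" unfolding Z_def by (rule zcoord_rot[OF symp_fhom[OF T]])
    finally show ?thesis .
  qed
  \<comment> \<open>A linear term in the conjugate variable would be multiplied both by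
    \<open>cis \<alpha>\<close> and by its conjugate, and these differ since
    \<open>cis \<alpha> ^ 2 \<noteq> 1\<close>.\<close>
  have Z01: "coeff2 Z 0 1 = 0"
  proof (rule ccontr)
    assume ne: "coeff2 Z 0 1 \<noteq> 0"
    have "coeff2 (dil2 (cis \<alpha>) Z) 0 1 = coeff2 (const2 (cis \<alpha>) * Z) 0 1" using Zd by simp
    then have "cnj (cis \<alpha>) = cis \<alpha>" using ne by simp
    then have "cis \<alpha> ^ 2 = 1" by (metis cis_cnj cis_mult power2_eq_square add.left_inverse cis_zero)
    then show False using primitive[of 2] n5 by simp
  qed
  \<comment> \<open>Area preservation, read off from the constant term of the bracket of
    \<open>Z\<close> with its conjugate.\<close>
  have Z10: "cmod (coeff2 Z 1 0) = 1"
  proof -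
    have c2: "const2 2 = (2 :: complex fps2)"
      using const2_simps(1)[of 1 "1::complex"] by (simp add: const2_simps(4))
    have "pb Z (star2 Z) = const2 (- 2 * \<i>) * pb (toz (T X2)) (toz (T Y2))"
      by (simp add: Z_def zcoord_def fhom_add[OF fhom_star2] fhom_mult[OF fhom_star2] fhom_const2[OF fhom_star2] star2_toz
        pb_add_left pb_add_right pb_diff_right pb_scale_left pb_scale_right const2_simps(5) pb_uminus_right pb_commute[of "toz (T Y2)" "toz (T X2)"])
        (simp add: c2 const2_simps(2))
    also have "\<dots> = toz (pb (T X2) (T Y2))" by (simp add: toz_pb)
    also have "\<dots> = 1" using T by (simp add: symp_def fhom_1[OF fhom_toz])
    finally have "coeff2 (pb Z (star2 Z)) 0 0 = 1" by (simp add: coeff2_1)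
    then have "coeff2 Z 1 0 * cnj (coeff2 Z 1 0) = 1"
      using Z01 by (simp add: coeff2_pb)
    then have "of_real ((cmod (coeff2 Z 1 0))\<^sup>2) = (1 :: complex)" by (simp only: complex_norm_square)
    then have "(cmod (coeff2 Z 1 0))\<^sup>2 = 1" by (simp only: of_real_eq_1_iff)
    then show ?thesis by (simp add: power2_eq_1_iff) (metis norm_ge_zero not_one_le_zero neg_0_le_iff_le)
  qed
  define \<theta> where "\<theta> = Arg (coeff2 Z 1 0)"
  have "coeff2 (zcoord T) 1 0 = cis \<theta>"
    using rcis_cmod_Arg[of "coeff2 Z 1 0"] Z10 by (simp add: \<theta>_def Z_def rcis_def)
  then obtain K where K: "vord 3 K" "\<And>f. T f = pexp K (rot \<theta> f)"
    using symp_factor[OF T] Z01 unfolding Z_def by metis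
  have rK: "rot \<alpha> K = K"
  proof -
    have rK3: "vord 3 (rot \<alpha> K)" by (rule fhom_vord[OF fhom_rot K(1)])
    have "pexp (rot \<alpha> K) h = pexp K h" for h
    proof -
      define f where "f = rot (- \<theta>) (rot (- \<alpha>) h)"
      have "T (rot \<alpha> f) = rot \<alpha> (T f)" by (rule Trot)
      then have "pexp K (rot \<theta> (rot \<alpha> f)) = pexp (rot \<alpha> K) (rot \<alpha> (rot \<theta> f))"
        unfolding K(2) symp_pexp_conj[OF symp_rot K(1)] .
      moreover have "rot \<theta> (rot \<alpha> f) = h" "rot \<alpha> (rot \<theta> f) = h"
        by (simp_all add: f_def rot_cancel rot_commute[of \<theta> \<alpha>])
      ultimately show ?thesis by simp
    qed
    note eq = this
    show ?thesis by (rule pexp_inj_eq[OF K(1) rK3 eq eq])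
  qed
  define G where "G = toz N'"
  define k where "k = toz K"
  have k: "star2 k = k" "W (Suc \<sigma>) k"
    unfolding k_def using rot_invariant_support[OF rK] K(1) by (auto intro: vord_3_resonant simp: star2_toz toz_vord)
  have GN: "toz N = zexp k (dil2 (cis \<theta>) G)"
    unfolding NT K(2) toz_pexp[OF K(1)] by (simp add: k_def G_def toz_rot)
  define c where "c = 2 powr (- real n / 2) / 2"
  have cpos: "c > 0" by (simp add: c_def)
  have W: "W \<tau> G" by (simp add: G_def N'_def W_normal_form)
  define D where "D = dil2 (cis \<theta>) G"
  have WD: "W \<tau> D" unfolding D_def by (rule W_dil2[OF W])
  have W1: "W (Suc \<tau>) (zexp k D - D)"
  proof -
    have K': "W (1 + \<sigma>) (const2 (- 2 * \<i>) * k)" using k(2) by (intro W_const2_mult) simp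
    have "W (Suc \<tau>) (pb D (const2 (- 2 * \<i>) * k))" using W_pb[OF WD K'] by simp
    note W1 = this
    have "W (Suc (Suc \<tau>)) (zexp k D - D - pb D (const2 (- 2 * \<i>) * k))"
      using W_pexp_first[OF _ W1] K' by simp
    then have "W (Suc \<tau>) (zexp k D - D - pb D (const2 (- 2 * \<i>) * k))"
      by (rule W_mono) simp
    from W_add[OF this W1] show ?thesis by simp
  qed
  have "coeff2 (zexp k D - D) (0 + n * 1) 0 = 0" by (rule W_coeff_pm[OF W1]) simp
  then have "coeff2 (toz N) (0 + n * 1) 0 = coeff2 D (0 + n * 1) 0" by (simp add: GN D_def)
  then have cB: "of_real (c * fps_nth B 0) = cis \<theta> ^ n * of_real (c * fps_nth B' 0)"
    unfolding D_def G_def N_def N'_def coeff2_dil2 coeff2_toz_nf nf_coeff_pm by (simp add: c_def)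
  \<comment> \<open>The leading coefficients are both positive and differ by the factor
    \<open>cis \<theta> ^ n\<close> of modulus one.\<close>
  have cn: "cis \<theta> ^ n = 1"
  proof -
    have p: "c * fps_nth B 0 > 0" "c * fps_nth B' 0 > 0" using cpos pos by simp_all
    have "norm (complex_of_real (c * fps_nth B 0)) = norm (cis \<theta> ^ n * complex_of_real (c * fps_nth B' 0))" by (rule arg_cong[OF cB])
    then have "c * fps_nth B 0 = c * fps_nth B' 0" using p
      by (simp only: norm_mult norm_power norm_cis norm_of_real power_one mult_1_left abs_of_pos)
    then have "of_real (c * fps_nth B' 0) = cis \<theta> ^ n * complex_of_real (c * fps_nth B' 0)"
      using cB by (simp only:)
    moreover have "complex_of_real (c * fps_nth B' 0) \<noteq> 0" unfolding of_real_eq_0_iff using p by linarith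
    moreover have "u = 1" if "x = u * x" "x \<noteq> 0" for u x :: complex using that by simp
    ultimately show ?thesis by blast
  qed
  have "D = G"
    unfolding D_def by (rule dil2_invariant[OF W_ww_0[OF W] cn])
  then have GN': "toz N = zexp k G" using GN by (simp add: D_def)
  have G_n0: "coeff2 G n 0 = of_real (c * fps_nth B' 0)"
  proof -
    have "nf_coeff n A' B' n 0 = c * fps_nth B' 0" using nf_coeff_pm[of A' B' 0 1] by (simp add: c_def)
    then show ?thesis unfolding G_def N'_def coeff2_toz_nf by (simp only:)
  qed
  have G_33: "coeff2 G 3 3 \<noteq> 0" if "n \<noteq> 5"
    using coeff2_toz_nf[of A' B' 3 3] nf_coeff_pm[of A' B' 3 0] A' that by (simp add: G_def N'_def)
  interpret rh: resonant_hamiltonian n G "c * fps_nth B' 0"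
    by unfold_locales (use W G_n0 G_33 cpos pos in \<open>auto simp: G_def star2_toz\<close>)
  have "zexp k G = G"
  proof (rule rh.resonant_normal_form_unique[OF _ k])
    show "nf G" unfolding G_def N'_def by (rule nf_normal_form[OF nf(2)])
    show "nf (zexp k G)" unfolding GN'[symmetric] N_def by (rule nf_normal_form[OF nf(1)])
  qed
  then have "toz N = toz N'" using GN' by (simp only: G_def)
  then have "N = N'" by (simp only: toz_inject)
  then show ?thesis unfolding N_def N'_def by (rule normal_form_inject)
qed

end

section \<open>Taylor expansions\<close>

definition ev2 :: "nat \<Rightarrow> 'a::real_normed_field fps2 \<Rightarrow> real \<times> real \<Rightarrow> 'a" where
  "ev2 N f p = (\<Sum>i<N. \<Sum>j<N. coeff2 f i j * of_real (fst p ^ i * snd p ^ j))"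

text \<open>Links functions to formal series through finite-order asymptotics; sums, products and
  polynomial expressions pass through it without convergence arguments.\<close>

definition expands :: "nat \<Rightarrow> (real \<times> real \<Rightarrow> 'a::real_normed_field) \<Rightarrow> 'a fps2 \<Rightarrow> bool" where
  "expands N F f \<longleftrightarrow> (\<lambda>p. F p - ev2 N f p) \<in> O[at 0](\<lambda>p. of_real (norm p ^ N))"

lemma abs_fst_snd_le_norm: "\<bar>fst p\<bar> \<le> norm p" "\<bar>snd p\<bar> \<le> norm p" for p :: "real \<times> real"
  using norm_fst_le[of "fst p" "snd p"] norm_snd_le[of "snd p" "fst p"] by (simp_all)

lemma eventually_norm_less: "r > 0 \<Longrightarrow> \<forall>\<^sub>F p in at 0. norm (p :: real \<times> real) < r"
  by (auto simp: eventually_at intro!: exI[of _ r])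

lemma norm_monom_le: "norm (of_real (fst p ^ i * snd p ^ j) :: 'a::real_normed_field) \<le> norm p ^ (i + j)"
  for p :: "real \<times> real"
proof -
  have "\<bar>fst p\<bar> ^ i * \<bar>snd p\<bar> ^ j \<le> norm p ^ i * norm p ^ j"
    by (intro mult_mono power_mono abs_fst_snd_le_norm) auto
  then show ?thesis by (simp add: norm_mult norm_power power_add)
qed

lemma monom_bigo:
  fixes c :: "'a::real_normed_field"
  assumes "N \<le> i + j"
  shows "(\<lambda>p. c * of_real (fst p ^ i * snd p ^ j)) \<in> O[at 0](\<lambda>p. of_real (norm p ^ N))"
proof (rule landau_o.bigI)
  show "norm c + 1 > 0" by (simp add: add_nonneg_pos)
  show "\<forall>\<^sub>F p in at 0. norm (c * of_real (fst p ^ i * snd p ^ j)) \<le> (norm c + 1) * norm (of_real (norm p ^ N) :: 'a)"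
    using eventually_norm_less[of 1, simplified]
  proof eventually_elim
    case (elim p)
    have "norm (of_real (fst p ^ i * snd p ^ j) :: 'a) \<le> norm p ^ (i + j)" by (rule norm_monom_le)
    also have "\<dots> \<le> norm p ^ N" using elim assms by (intro power_decreasing) auto
    finally show ?case
      unfolding norm_mult[of c] by (intro mult_mono) (auto simp: norm_mult norm_power)
  qed
qed

lemma ev2_diff_bigo:
  assumes "vord N (f - g)" "N \<le> M" "N \<le> M'"
  shows "(\<lambda>p. ev2 M f p - ev2 M' g p) \<in> O[at 0](\<lambda>p. of_real (norm p ^ N))"
proof -
  define L where "L = max M M'"
  define d where "d i j = (if i < M \<and> j < M then coeff2 f i j else 0) - (if i < M' \<and> j < M' then coeff2 g i j else 0)" for i j
  have ext: "ev2 M h p = (\<Sum>i<L. \<Sum>j<L. (if i < M \<and> j < M then coeff2 h i j else 0) * of_real (fst p ^ i * snd p ^ j))"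
    if "M \<le> L" for M h and p :: "real \<times> real"
  proof -
    have "ev2 M h p = (\<Sum>i<M. \<Sum>j<M. (if i < M \<and> j < M then coeff2 h i j else 0) * of_real (fst p ^ i * snd p ^ j))"
      by (simp add: ev2_def)
    also have "\<dots> = (\<Sum>i<M. \<Sum>j<L. (if i < M \<and> j < M then coeff2 h i j else 0) * of_real (fst p ^ i * snd p ^ j))"
      using that by (intro sum.cong refl sum.mono_neutral_left) auto
    also have "\<dots> = (\<Sum>i<L. \<Sum>j<L. (if i < M \<and> j < M then coeff2 h i j else 0) * of_real (fst p ^ i * snd p ^ j))"
      using that by (intro sum.mono_neutral_left) auto
    finally show ?thesis .
  qed
  have "ev2 M f p - ev2 M' g p = (\<Sum>i<L. \<Sum>j<L. d i j * of_real (fst p ^ i * snd p ^ j))" for p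
    by (simp add: ext[of M] ext[of M'] L_def d_def sum_subtractf left_diff_distrib)
  moreover have "(\<lambda>p. d i j * of_real (fst p ^ i * snd p ^ j)) \<in> O[at 0](\<lambda>p. of_real (norm p ^ N))" for i j
  proof (cases "N \<le> i + j")
    case True
    then show ?thesis by (rule monom_bigo)
  next
    case False
    then have "d i j = 0" using assms by (auto simp: d_def vord_diff_iff)
    then show ?thesis by simp
  qed
  ultimately show ?thesis by (simp add: big_sum_in_bigo)
qed

lemma expands_add:
  assumes "expands N F f" "expands N G g"
  shows "expands N (\<lambda>p. F p + G p) (f + g)"
proof -
  have "(\<lambda>p. (F p - ev2 N f p) + (G p - ev2 N g p)) \<in> O[at 0](\<lambda>p. of_real (norm p ^ N))"
    by (rule sum_in_bigo(1)[OF assms[unfolded expands_def]])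
  moreover have "F p + G p - ev2 N (f + g) p = (F p - ev2 N f p) + (G p - ev2 N g p)" for p
    by (simp add: ev2_def algebra_simps sum.distrib)
  ultimately show ?thesis unfolding expands_def by (simp only:)
qed

lemma expands_diff:
  assumes "expands N F f" "expands N G g"
  shows "expands N (\<lambda>p. F p - G p) (f - g)"
proof -
  have "(\<lambda>p. (F p - ev2 N f p) - (G p - ev2 N g p)) \<in> O[at 0](\<lambda>p. of_real (norm p ^ N))"
    by (rule sum_in_bigo(2)[OF assms[unfolded expands_def]])
  moreover have "F p - G p - ev2 N (f - g) p = (F p - ev2 N f p) - (G p - ev2 N g p)" for p
    by (simp add: ev2_def algebra_simps sum_subtractf)
  ultimately show ?thesis unfolding expands_def by (simp only:)
qed

lemma ev2_monom:
  assumes "a < N" "b < N"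
  shows "ev2 N (const2 c * (X2 ^ a * Y2 ^ b)) p = c * of_real (fst p ^ a * snd p ^ b)"
proof -
  have "ev2 N (const2 c * (X2 ^ a * Y2 ^ b)) p =
     (\<Sum>i<N. if i = a then \<Sum>j<N. if j = b then c * of_real (fst p ^ a * snd p ^ b) else 0 else 0)"
    unfolding ev2_def
  proof (intro sum.cong refl)
    fix i
    have "(\<Sum>j<N. coeff2 (const2 c * (X2 ^ a * Y2 ^ b)) i j * of_real (fst p ^ i * snd p ^ j)) =
       (\<Sum>j<N. if i = a \<and> j = b then c * of_real (fst p ^ a * snd p ^ b) else 0)"
      by (intro sum.cong) (auto simp: coeff2_monom)
    then show "(\<Sum>j<N. coeff2 (const2 c * (X2 ^ a * Y2 ^ b)) i j * of_real (fst p ^ i * snd p ^ j)) =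
      (if i = a then \<Sum>j<N. if j = b then c * of_real (fst p ^ a * snd p ^ b) else 0 else 0)" by auto
  qed
  then show ?thesis using assms by simp
qed

lemma ev2_sum: "ev2 N (\<Sum>x\<in>A. f x) p = (\<Sum>x\<in>A. ev2 N (f x) p)"
proof (induction A rule: infinite_finite_induct)
  case (insert x A)
  then show ?case by (simp add: ev2_def sum.distrib algebra_simps)
qed (simp_all add: ev2_def)

text \<open>The product of truncations has exponents up to \<open>2 * N - 2\<close>, so evaluation
  with the bound \<open>2 * N\<close> loses nothing.\<close>

lemma ev2_trunc2_mult: "ev2 (2 * N) (trunc2 N f * trunc2 N g) p = ev2 N f p * ev2 N g p"
proof -
  have m: "const2 a * (X2 ^ i * Y2 ^ j) * (const2 b * (X2 ^ k * Y2 ^ l)) = const2 (a * b) * (X2 ^ (i + k) * Y2 ^ (j + l))"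
    for a b :: 'a and i j k l
    by (simp add: const2_simps power_add algebra_simps)
  have "trunc2 N f * trunc2 N g = (\<Sum>i<N. \<Sum>j<N. \<Sum>k<N. \<Sum>l<N. const2 (coeff2 f i j * coeff2 g k l) * (X2 ^ (i + k) * Y2 ^ (j + l)))"
    unfolding trunc2_def sum_distrib_right unfolding sum_distrib_left m ..
  then have "ev2 (2 * N) (trunc2 N f * trunc2 N g) p = (\<Sum>i<N. \<Sum>j<N. \<Sum>k<N. \<Sum>l<N.
      ev2 (2 * N) (const2 (coeff2 f i j * coeff2 g k l) * (X2 ^ (i + k) * Y2 ^ (j + l))) p)"
    by (simp only: ev2_sum)
  also have "\<dots> = (\<Sum>i<N. \<Sum>j<N. \<Sum>k<N. \<Sum>l<N. (coeff2 f i j * of_real (fst p ^ i * snd p ^ j)) * (coeff2 g k l * of_real (fst p ^ k * snd p ^ l)))"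
    by (intro sum.cong refl, subst ev2_monom) (auto simp: power_add)
  also have "\<dots> = ev2 N f p * ev2 N g p"
    unfolding ev2_def sum_distrib_right unfolding sum_distrib_left ..
  finally show ?thesis .
qed

lemma ev2_bounded: "ev2 N f \<in> O[at 0](\<lambda>p. 1)"
proof -
  have "(\<lambda>p. coeff2 f i j * of_real (fst p ^ i * snd p ^ j)) \<in> O[at 0](\<lambda>p. 1)" for i j
    using monom_bigo[of 0 i j "coeff2 f i j"] by simp
  then show ?thesis unfolding ev2_def[abs_def] by (intro big_sum_in_bigo)
qed

lemma expands_mult:
  assumes "expands N F f" "expands N G g"
  shows "expands N (\<lambda>p. F p * G p) (f * g)"
proof -
  have one: "(\<lambda>p::real\<times>real. of_real (norm p ^ N)) \<in> O[at 0](\<lambda>p. 1 :: 'a)"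
  proof (rule landau_o.bigI[of 1])
    show "\<forall>\<^sub>F p in at 0. norm (of_real (norm (p::real\<times>real) ^ N) :: 'a) \<le> 1 * norm (1 :: 'a)"
      using eventually_norm_less[of 1, simplified]
      by eventually_elim (auto simp: norm_power intro!: power_le_one)
  qed simp
  have G1: "G \<in> O[at 0](\<lambda>p. 1)"
  proof -
    have "(\<lambda>p. G p - ev2 N g p) \<in> O[at 0](\<lambda>p. 1)"
      using assms(2) one unfolding expands_def by (rule landau_o.big_trans)
    from sum_in_bigo(1)[OF this ev2_bounded[of N g]] show ?thesis by simp
  qed
  have 1: "(\<lambda>p. (F p - ev2 N f p) * G p) \<in> O[at 0](\<lambda>p. of_real (norm p ^ N))"
    using landau_o.big.mult[OF assms(1)[unfolded expands_def] G1] by simp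
  have 2: "(\<lambda>p. ev2 N f p * (G p - ev2 N g p)) \<in> O[at 0](\<lambda>p. of_real (norm p ^ N))"
    using landau_o.big.mult[OF ev2_bounded[of N f] assms(2)[unfolded expands_def]] by simp
  have 3: "(\<lambda>p. ev2 (2 * N) (trunc2 N f * trunc2 N g) p - ev2 N (f * g) p) \<in> O[at 0](\<lambda>p. of_real (norm p ^ N))"
    by (rule ev2_diff_bigo) (auto intro!: vord_mult_cong simp: vord_commute[of N "trunc2 N _"] vord_trunc2)
  have "F p * G p - ev2 N (f * g) p = (F p - ev2 N f p) * G p + ev2 N f p * (G p - ev2 N g p) +
      (ev2 (2 * N) (trunc2 N f * trunc2 N g) p - ev2 N (f * g) p)" for p
    unfolding ev2_trunc2_mult by (simp add: algebra_simps)
  then show ?thesis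
    unfolding expands_def by (simp only: sum_in_bigo(1)[OF sum_in_bigo(1)[OF 1 2] 3])
qed

lemma expands_monom: "expands N (\<lambda>p. c * of_real (fst p ^ a * snd p ^ b)) (const2 c * (X2 ^ a * Y2 ^ b))"
proof -
  define M where "M = Suc (N + a + b)"
  have "(\<lambda>p. ev2 M (const2 c * (X2 ^ a * Y2 ^ b)) p - ev2 N (const2 c * (X2 ^ a * Y2 ^ b)) p) \<in> O[at 0](\<lambda>p. of_real (norm p ^ N))"
    by (rule ev2_diff_bigo) (auto simp: M_def)
  moreover have "ev2 M (const2 c * (X2 ^ a * Y2 ^ b)) p = c * of_real (fst p ^ a * snd p ^ b)" for p
    by (rule ev2_monom) (auto simp: M_def)
  ultimately show ?thesis by (simp add: expands_def)
qed

lemma expands_const: "expands N (\<lambda>p. c) (const2 c)"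
  and expands_fst: "expands N (\<lambda>p. of_real (fst p)) X2"
  and expands_snd: "expands N (\<lambda>p. of_real (snd p)) Y2"
  using expands_monom[of N c 0 0] expands_monom[of N 1 1 0] expands_monom[of N 1 0 1] by (simp_all add: const2_simps)

lemma expands_power: "expands N F f \<Longrightarrow> expands N (\<lambda>p. F p ^ k) (f ^ k)"
proof (induction k)
  case 0
  show ?case using expands_const[of N 1] by (simp add: const2_simps)
qed (simp add: expands_mult)

lemma expands_sum: "(\<And>x. x \<in> A \<Longrightarrow> expands N (F x) (f x)) \<Longrightarrow> expands N (\<lambda>p. \<Sum>x\<in>A. F x p) (\<Sum>x\<in>A. f x)"
proof (induction A rule: infinite_finite_induct)
  case (insert x A)
  then show ?case by (simp add: expands_add)
qed (use expands_const[of N 0] in \<open>simp_all add: const2_simps\<close>)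

text \<open>Induction on the degree. Along the line through the origin with slope \<open>b\<close>
  the lowest homogeneous part is t^d times a polynomial in \<open>b\<close>, and at the same time of
  order t^(d + 1); so the polynomial vanishes for every real \<open>b\<close> and has no nonzero
  coefficient.\<close>

lemma expands_zero_imp_vord:
  assumes "expands N (\<lambda>p. 0) (h :: 'a::real_normed_field fps2)"
  shows "vord N h"
proof -
  have "vord d h" if "d \<le> N" for d
    using that
  proof (induction d)
    case (Suc d)
    then have vd: "vord d h" and dN: "d < N" by auto
    define Pd where "Pd b = (\<Sum>j\<le>d. coeff2 h (d - j) j * of_real b ^ j)" for b :: real
    have "Pd b = 0" for b
    proof -
      define T where "T = trunc2 (Suc d) h"
      have ob: "(\<lambda>p. ev2 N h p) \<in> O[at 0](\<lambda>p. of_real (norm p ^ N))"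
        using assms by (simp add: expands_def)
      define D where "D = Abs_fps2 (\<lambda>i j. if i + j = d then coeff2 h i j else 0)"
      have d1: "(\<lambda>p. ev2 N h p - ev2 (Suc d) D p) \<in> O[at 0](\<lambda>p. of_real (norm p ^ Suc d))"
        by (rule ev2_diff_bigo) (use dN vd in \<open>auto simp: vord_diff_iff D_def vord_def less_Suc_eq\<close>)
      have d2: "(\<lambda>p. ev2 N h p) \<in> O[at 0](\<lambda>p. of_real (norm p ^ Suc d))"
      proof (rule landau_o.big_trans[OF ob], rule landau_o.bigI[of 1])
        show "\<forall>\<^sub>F p in at 0. norm (of_real (norm (p::real\<times>real) ^ N) :: 'a) \<le> 1 * norm (of_real (norm p ^ Suc d) :: 'a)"
          using eventually_norm_less[of 1, simplified]
        proof eventually_elim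
          case (elim p)
          then have "norm p ^ N \<le> norm p ^ Suc d" using dN by (intro power_decreasing) auto
          then show ?case by (simp add: norm_mult norm_power)
        qed
      qed simp
      have "(\<lambda>p. ev2 N h p - (ev2 N h p - ev2 (Suc d) D p)) \<in> O[at 0](\<lambda>p. of_real (norm p ^ Suc d))"
        by (rule sum_in_bigo(2)[OF d2 d1])
      then have "ev2 (Suc d) D \<in> O[at 0](\<lambda>p. of_real (norm p ^ Suc d))" by simp
      then obtain C where C: "C > 0" "\<forall>\<^sub>F p in at 0. norm (ev2 (Suc d) D p) \<le> C * norm (of_real (norm (p::real\<times>real) ^ Suc d) :: 'a)"
        by (elim landau_o.bigE)
      have evD: "ev2 (Suc d) D (t, t * b) = of_real t ^ d * Pd b" for t
      proof -
        have "ev2 (Suc d) D (t, t * b) = (\<Sum>i\<le>d. \<Sum>j\<le>d. if i + j = d then of_real t ^ d * (coeff2 h i j * of_real b ^ j) else 0)"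
          unfolding ev2_def lessThan_Suc_atMost D_def
          by (intro sum.cong refl) (auto simp: power_mult_distrib power_add)
        also have "\<dots> = (\<Sum>j\<le>d. \<Sum>i\<le>d. if i = d - j then of_real t ^ d * (coeff2 h i j * of_real b ^ j) else 0)"
          by (subst sum.swap, intro sum.cong refl) auto
        also have "\<dots> = (\<Sum>j\<le>d. of_real t ^ d * (coeff2 h (d - j) j * of_real b ^ j))"
          by (intro sum.cong refl) simp
        finally show ?thesis by (simp add: Pd_def sum_distrib_left)
      qed
      define B where "B = norm (1::real, b)"
      have Bpos: "B > 0" by (simp add: B_def zero_prod_def)
      have nrm: "norm (t, t * b) = \<bar>t\<bar> * B" for t
        using norm_scaleR[of t "(1::real, b)"] by (simp add: B_def)
      obtain r where r: "r > 0" "\<And>p. p \<noteq> 0 \<Longrightarrow> norm p < r \<Longrightarrow> norm (ev2 (Suc d) D p) \<le> C * norm (of_real (norm (p::real\<times>real) ^ Suc d) :: 'a)"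
        using C(2) by (auto simp: eventually_at)
      have bound: "norm (Pd b) \<le> C * B ^ Suc d * t" if "t > 0" "t < r / B" for t
      proof -
        have "norm (ev2 (Suc d) D (t, t * b)) \<le> C * norm (of_real (norm (t, t * b) ^ Suc d) :: 'a)"
        proof (rule r(2))
          show "(t, t * b) \<noteq> 0" using that by (simp add: zero_prod_def)
          show "norm (t, t * b) < r" unfolding nrm using that Bpos by (simp add: pos_less_divide_eq)
        qed
        then have "t ^ d * norm (Pd b) \<le> C * (t * B) ^ Suc d"
          unfolding evD nrm using that Bpos by (simp add: norm_mult norm_power power_mult_distrib abs_mult)
        also have "\<dots> = t ^ d * (C * B ^ Suc d * t)" by (simp add: power_mult_distrib)
        finally have "t ^ d * norm (Pd b) \<le> t ^ d * (C * B ^ Suc d * t)" .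
        then show ?thesis using that by simp
      qed
      have "norm (Pd b) \<le> 0"
      proof (rule field_le_epsilon)
        fix e :: real assume e: "e > 0"
        have K: "C * B ^ Suc d > 0" using C(1) Bpos by simp
        have "r / B > 0" "e / (C * B ^ Suc d) > 0" using r(1) Bpos K e by (simp_all only: divide_pos_pos)
        then obtain t where t: "t > 0" "t < r / B" "t < e / (C * B ^ Suc d)"
          using field_lbound_gt_zero by blast
        have "norm (Pd b) \<le> C * B ^ Suc d * t" by (rule bound[OF t(1,2)])
        also have "\<dots> \<le> C * B ^ Suc d * (e / (C * B ^ Suc d))" using t(3) K by (intro mult_left_mono less_imp_le)
        also have "\<dots> = 0 + e" using C(1) Bpos by simp
        finally show "norm (Pd b) \<le> 0 + e" .
      qed
      then show ?thesis by simp
    qed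
    then have roots: "range of_real \<subseteq> {z :: 'a. (\<Sum>j\<le>d. coeff2 h (d - j) j * z ^ j) = 0}"
      by (auto simp: Pd_def)
    have inf: "infinite (range (of_real :: real \<Rightarrow> 'a))"
      by (simp add: finite_image_iff inj_of_real infinite_UNIV_char_0 inj_on_def)
    have "coeff2 h (d - j) j = 0" if "j \<le> d" for j
    proof (rule ccontr)
      assume "coeff2 h (d - j) j \<noteq> 0"
      with that have "\<exists>k\<le>d. coeff2 h (d - k) k \<noteq> 0" by blast
      from polyfun_rootbound[OF this] have "finite {z :: 'a. (\<Sum>j\<le>d. coeff2 h (d - j) j * z ^ j) = 0}" by blast
      with roots inf show False by (meson finite_subset)
    qed
    then have "coeff2 h i j = 0" if "i + j = d" for i j
      using that by (metis add_diff_cancel_right' le_add2)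
    then show ?case using vd by (auto simp: vord_def less_Suc_eq)
  qed simp
  then show ?thesis by simp
qed

lemma expands_unique:
  assumes "expands N F f" "expands N F g"
  shows "vord N (f - g)"
  using expands_diff[OF assms] by (intro expands_zero_imp_vord) simp

lemma expands_cmap2: "expands N F f \<Longrightarrow> expands N (\<lambda>p. complex_of_real (F p)) (cmap2 f)"
proof -
  have eq: "complex_of_real (F p) - ev2 N (cmap2 f) p = of_real (F p - ev2 N f p)" for p
    by (simp add: ev2_def)
  show "expands N F f \<Longrightarrow> ?thesis"
    unfolding expands_def eq by (simp only: bigo_def norm_of_real real_norm_def mem_Collect_eq of_real_eq_id id_apply)
qed

section \<open>Convergent double power series\<close>

definition power_series_on :: "real \<Rightarrow> (real \<times> real \<Rightarrow> real) \<Rightarrow> real fps2 \<Rightarrow> bool" where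
  "power_series_on r F c \<longleftrightarrow> (\<forall>u v. \<bar>u\<bar> < r \<and> \<bar>v\<bar> < r \<longrightarrow>
     ((\<lambda>(i, j). coeff2 c i j * u ^ i * v ^ j) has_sum F (u, v)) UNIV)"

lemma power_series_onD:
  "power_series_on r F c \<Longrightarrow> \<bar>u\<bar> < r \<Longrightarrow> \<bar>v\<bar> < r \<Longrightarrow>
    ((\<lambda>(i, j). coeff2 c i j * u ^ i * v ^ j) has_sum F (u, v)) UNIV"
  by (simp add: power_series_on_def)

lemma power_series_abs_summable:
  assumes "power_series_on r F c" "0 \<le> \<rho>" "\<rho> < r"
  shows "(\<lambda>(i, j). \<bar>coeff2 c i j\<bar> * \<rho> ^ (i + j)) summable_on UNIV"
proof -
  have "(\<lambda>(i, j). coeff2 c i j * \<rho> ^ i * \<rho> ^ j) summable_on UNIV"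
    using power_series_onD[OF assms(1), of \<rho> \<rho>] assms(2,3) by (auto simp: summable_on_def)
  then have "(\<lambda>x. norm (case x of (i, j) \<Rightarrow> coeff2 c i j * \<rho> ^ i * \<rho> ^ j)) summable_on UNIV"
    by (rule iffD1[OF summable_on_iff_abs_summable_on_real])
  also have "(\<lambda>x. norm (case x of (i, j) \<Rightarrow> coeff2 c i j * \<rho> ^ i * \<rho> ^ j)) = (\<lambda>(i, j). \<bar>coeff2 c i j\<bar> * \<rho> ^ (i + j))"
    using assms(2) by (auto simp: fun_eq_iff abs_mult power_add)
  finally show ?thesis .
qed

text \<open>Outside the square of indices below \<open>N\<close> each monomial has degree at least
  \<open>N\<close>; comparison with the absolutely convergent series at radius \<open>\<rho>\<close>
  bounds the tail by a multiple of the \<open>N\<close>-th power of the norm.\<close>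

lemma expands_power_series:
  assumes ps: "power_series_on r F c" and r: "r > 0"
  shows "expands N F c"
proof -
  define \<rho> where "\<rho> = r / 2"
  have \<rho>: "\<rho> > 0" "\<rho> < r" using r by (auto simp: \<rho>_def)
  define g where "g = (\<lambda>(i, j). \<bar>coeff2 c i j\<bar> * \<rho> ^ (i + j))"
  have g: "g summable_on UNIV" unfolding g_def by (rule power_series_abs_summable[OF ps]) (use \<rho> in auto)
  define B where "B = {..<N} \<times> {..<N}"
  have gB: "g summable_on (UNIV - B)" by (rule summable_on_subset_banach[OF g]) auto
  define M where "M = infsum g (UNIV - B)"
  have M0: "M \<ge> 0" unfolding M_def by (rule infsum_nonneg) (use \<rho> in \<open>auto simp: g_def\<close>)
  have bound: "\<bar>F p - ev2 N c p\<bar> \<le> M / \<rho> ^ N * norm p ^ N" if p: "norm p < \<rho>" for p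
  proof -
    define f where "f = (\<lambda>(i, j). coeff2 c i j * fst p ^ i * snd p ^ j)"
    have "(f has_sum F (fst p, snd p)) UNIV"
      unfolding f_def using abs_fst_snd_le_norm[of p] p \<rho> by (intro power_series_onD[OF ps]) auto
    moreover have "(f has_sum (\<Sum>x\<in>B. f x)) B" by (rule has_sum_finite) (simp add: B_def)
    ultimately have "(f has_sum (F (fst p, snd p) - (\<Sum>x\<in>B. f x))) (UNIV - B)" by (rule has_sum_Diff) simp
    moreover have "(\<Sum>x\<in>B. f x) = ev2 N c p"
      by (simp add: ev2_def B_def f_def sum.cartesian_product mult.assoc)
    ultimately have hs: "(f has_sum (F p - ev2 N c p)) (UNIV - B)" by simp
    define q where "q = (norm p / \<rho>) ^ N"
    have hg: "((\<lambda>x. q * g x) has_sum (q * M)) (UNIV - B)"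
      unfolding M_def by (intro has_sum_cmult_right has_sum_infsum gB)
    have fg: "\<bar>f x\<bar> \<le> q * g x" if "x \<in> UNIV - B" for x
    proof -
      obtain i j where x: "x = (i, j)" by (cases x)
      have ij: "N \<le> i + j" using that by (auto simp: x B_def)
      have "\<bar>f x\<bar> = \<bar>coeff2 c i j\<bar> * (\<bar>fst p\<bar> ^ i * \<bar>snd p\<bar> ^ j)" by (simp add: x f_def abs_mult power_abs)
      also have "\<dots> \<le> \<bar>coeff2 c i j\<bar> * (norm p ^ i * norm p ^ j)"
        by (intro mult_left_mono mult_mono power_mono abs_fst_snd_le_norm) auto
      also have "\<dots> = \<bar>coeff2 c i j\<bar> * \<rho> ^ (i + j) * (norm p / \<rho>) ^ (i + j)"
        using \<rho> by (simp add: power_divide power_add)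
      also have "\<dots> \<le> \<bar>coeff2 c i j\<bar> * \<rho> ^ (i + j) * (norm p / \<rho>) ^ N"
        using p \<rho> ij by (intro mult_left_mono power_decreasing) auto
      finally show ?thesis by (simp add: x g_def q_def mult.commute)
    qed
    have "F p - ev2 N c p \<le> q * M"
      by (rule has_sum_mono[OF hs hg]) (use fg in \<open>force simp: abs_le_iff\<close>)
    moreover have "- (F p - ev2 N c p) \<le> q * M"
      by (rule has_sum_mono[OF has_sum_uminusI[OF hs] hg]) (use fg in \<open>force simp: abs_le_iff\<close>)
    ultimately show ?thesis by (simp add: q_def power_divide abs_le_iff algebra_simps)
  qed
  have "(\<lambda>p. F p - ev2 N c p) \<in> O[at 0](\<lambda>p. of_real (norm p ^ N))"
  proof (rule landau_o.bigI[of "M / \<rho> ^ N + 1"])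
    show "M / \<rho> ^ N + 1 > 0" using M0 \<rho> by (simp add: add_nonneg_pos)
    show "\<forall>\<^sub>F p in at 0. norm (F p - ev2 N c p) \<le> (M / \<rho> ^ N + 1) * norm (of_real (norm p ^ N) :: real)"
      using eventually_norm_less[OF \<rho>(1)]
    proof eventually_elim
      case (elim p)
      have "M / \<rho> ^ N * norm p ^ N \<le> (M / \<rho> ^ N + 1) * norm p ^ N" by (intro mult_right_mono) auto
      with bound[OF elim] show ?case by simp
    qed
  qed
  then show ?thesis by (simp add: expands_def)
qed

text \<open>Passing to a radius \<open>\<rho>\<close> between the point and \<open>r\<close> turns
  the factor \<open>Suc i\<close> produced by differentiation into the bounded quantity
  \<open>real (Suc i) * x ^ i\<close> with \<open>x < 1\<close>.\<close>

lemma power_series_dx2_summable: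
  assumes ps: "power_series_on r F c" and uv: "\<bar>u\<bar> < r" "\<bar>v\<bar> < r"
  shows "(\<lambda>(i, j). coeff2 (dx2 c) i j * u ^ i * v ^ j) summable_on UNIV"
proof -
  define \<rho> where "\<rho> = (max \<bar>u\<bar> \<bar>v\<bar> + r) / 2"
  have \<rho>: "\<bar>u\<bar> < \<rho>" "\<bar>v\<bar> < \<rho>" "\<rho> < r" "\<rho> > 0" using uv by (auto simp: \<rho>_def max_def)
  define x where "x = \<bar>u\<bar> / \<rho>"
  have x: "0 \<le> x" "x < 1" using \<rho> by (auto simp: x_def)
  have "(\<lambda>n. of_nat n * x ^ n) \<longlonglongrightarrow> 0" using x by (intro powser_times_n_limit_0) simp
  then have "Bseq (\<lambda>n. of_nat n * x ^ n)" by (intro convergent_imp_Bseq convergentI)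
  then obtain C where C: "\<And>n. norm (of_nat n * x ^ n) \<le> C" by (auto simp: Bseq_def)
  have b: "real (Suc i) * x ^ i \<le> C + 1" for i
  proof -
    have "real i * x ^ i \<le> C" using C[of i] x by simp
    moreover have "x ^ i \<le> 1" using x by (intro power_le_one) auto
    ultimately show ?thesis by (simp add: algebra_simps)
  qed
  define g where "g = (\<lambda>(i, j). \<bar>coeff2 c i j\<bar> * \<rho> ^ (i + j))"
  have "g summable_on UNIV" unfolding g_def by (rule power_series_abs_summable[OF ps]) (use \<rho> in auto)
  then have "g summable_on (map_prod Suc id ` UNIV)" by (rule summable_on_subset_banach) auto
  then have "(g \<circ> map_prod Suc id) summable_on UNIV"
    by (subst (asm) summable_on_reindex) (auto intro!: inj_onI)
  then have s: "(\<lambda>y. (C + 1) / \<rho> * (g \<circ> map_prod Suc id) y) summable_on UNIV"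
    by (rule summable_on_cmult_right)
  have "(\<lambda>x. norm (case x of (i, j) \<Rightarrow> coeff2 (dx2 c) i j * u ^ i * v ^ j)) summable_on UNIV"
  proof (rule summable_on_comparison_test[OF s])
    fix y :: "nat \<times> nat"
    obtain i j where y: "y = (i, j)" by (cases y)
    have "norm (case y of (i, j) \<Rightarrow> coeff2 (dx2 c) i j * u ^ i * v ^ j) =
        \<bar>coeff2 c (Suc i) j\<bar> * (real (Suc i) * \<bar>u\<bar> ^ i) * \<bar>v\<bar> ^ j"
      by (simp add: y abs_mult power_abs)
    also have "\<dots> \<le> \<bar>coeff2 c (Suc i) j\<bar> * (real (Suc i) * \<bar>u\<bar> ^ i) * \<rho> ^ j"
      using \<rho> by (intro mult_left_mono power_mono) auto
    also have "real (Suc i) * \<bar>u\<bar> ^ i = (real (Suc i) * x ^ i) * \<rho> ^ i"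
      using \<rho> by (simp add: x_def power_divide)
    also have "\<bar>coeff2 c (Suc i) j\<bar> * ((real (Suc i) * x ^ i) * \<rho> ^ i) * \<rho> ^ j \<le> \<bar>coeff2 c (Suc i) j\<bar> * ((C + 1) * \<rho> ^ i) * \<rho> ^ j"
      using \<rho> b[of i] by (intro mult_right_mono mult_left_mono) auto
    also have "\<dots> = (C + 1) / \<rho> * (g \<circ> map_prod Suc id) y"
      using \<rho> by (simp add: y g_def power_add)
    finally show "norm (case y of (i, j) \<Rightarrow> coeff2 (dx2 c) i j * u ^ i * v ^ j) \<le> (C + 1) / \<rho> * (g \<circ> map_prod Suc id) y" .
  qed (rule norm_ge_zero)
  then show ?thesis by (rule iffD2[OF summable_on_iff_abs_summable_on_real])
qed

text \<open>For fixed \<open>v\<close> the double series is summed over the exponents of the second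
  variable, leaving a power series in one variable to which termwise differentiation
  applies.\<close>

lemma power_series_dx2:
  assumes ps: "power_series_on r F c"
  obtains D where "power_series_on r D (dx2 c)"
    "\<And>u v. \<bar>u\<bar> < r \<Longrightarrow> \<bar>v\<bar> < r \<Longrightarrow> ((\<lambda>x. F (x, v)) has_real_derivative D (u, v)) (at u)"
proof -
  define D where "D = (\<lambda>(u, v). \<Sum>\<^sub>\<infinity>(i, j). coeff2 (dx2 c) i j * u ^ i * v ^ j)"
  have D: "power_series_on r D (dx2 c)"
    unfolding power_series_on_def D_def
    using has_sum_infsum[OF power_series_dx2_summable[OF ps]] by simp
  have "((\<lambda>x. F (x, v)) has_real_derivative D (u, v)) (at u)" if u: "\<bar>u\<bar> < r" and v: "\<bar>v\<bar> < r" for u v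
  proof -
    define K where "K = (\<bar>u\<bar> + r) / 2"
    have K: "\<bar>u\<bar> < K" "K < r" "K > 0" using u by (auto simp: K_def)
    define a where "a i = (\<Sum>\<^sub>\<infinity>j. coeff2 c i j * v ^ j)" for i
    have a: "((\<lambda>j. coeff2 c i j * v ^ j) has_sum a i) UNIV" for i
    proof -
      \<comment> \<open>Summability is taken at the positive point \<open>K\<close>, whose power can
        be divided off afterwards; \<open>u\<close> itself may be zero.\<close>
      have "(\<lambda>(i, j). coeff2 c i j * K ^ i * v ^ j) summable_on UNIV"
        using power_series_onD[OF ps, of K v] K v by (auto simp: summable_on_def)
      then have "(\<lambda>(i, j). coeff2 c i j * K ^ i * v ^ j) summable_on (Pair i ` UNIV)"
        by (rule summable_on_subset_banach) auto
      then have "(\<lambda>j. coeff2 c i j * K ^ i * v ^ j) summable_on UNIV"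
        by (subst (asm) summable_on_reindex) (auto simp: inj_on_def o_def)
      then have "(\<lambda>j. inverse (K ^ i) * (coeff2 c i j * K ^ i * v ^ j)) summable_on UNIV"
        by (rule summable_on_cmult_right)
      then have "(\<lambda>j. coeff2 c i j * v ^ j) summable_on UNIV" using K by (simp add: field_simps)
      then show ?thesis unfolding a_def by (rule has_sum_infsum)
    qed
    have F: "(\<lambda>i. a i * x ^ i) sums F (x, v)" if "\<bar>x\<bar> < r" for x
    proof -
      have hs: "((\<lambda>(i, j). coeff2 c i j * x ^ i * v ^ j) has_sum F (x, v)) (Sigma UNIV (\<lambda>_. UNIV))"
        using power_series_onD[OF ps that v] by simp
      have "((\<lambda>i. a i * x ^ i) has_sum F (x, v)) UNIV"
        by (rule has_sum_SigmaD[OF hs]) (use has_sum_cmult_right[OF a, of "x ^ _"] in \<open>simp add: mult_ac\<close>)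
      then show ?thesis by (rule has_sum_imp_sums)
    qed
    have Dsum: "(\<lambda>i. diffs a i * u ^ i) sums D (u, v)"
    proof -
      have hs: "((\<lambda>(i, j). coeff2 (dx2 c) i j * u ^ i * v ^ j) has_sum D (u, v)) (Sigma UNIV (\<lambda>_. UNIV))"
        using power_series_onD[OF D u v] by simp
      have "((\<lambda>i. diffs a i * u ^ i) has_sum D (u, v)) UNIV"
      proof (rule has_sum_SigmaD[OF hs])
        fix i
        show "((\<lambda>j. case (i, j) of (i, j) \<Rightarrow> coeff2 (dx2 c) i j * u ^ i * v ^ j) has_sum diffs a i * u ^ i) UNIV"
          using has_sum_cmult_right[OF a[of "Suc i"], of "real (Suc i) * u ^ i"]
          by (simp add: diffs_def mult_ac del: of_nat_Suc)
      qed
      then show ?thesis by (rule has_sum_imp_sums)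
    qed
    have "((\<lambda>x. \<Sum>i. a i * x ^ i) has_real_derivative (\<Sum>i. diffs a i * u ^ i)) (at u)"
      by (rule termdiffs_strong[where K = K]) (use F[of K] K in \<open>auto intro: sums_summable\<close>)
    also have "(\<Sum>i. diffs a i * u ^ i) = D (u, v)" using Dsum by (rule sums_unique[symmetric])
    finally have "((\<lambda>x. \<Sum>i. a i * x ^ i) has_real_derivative D (u, v)) (at u)" .
    then show ?thesis
    proof (rule has_field_derivative_transform_within_open[where S = "{-r<..<r}"])
      fix x assume "x \<in> {-r<..<r}"
      then have "\<bar>x\<bar> < r" by auto
      from sums_unique[OF F[OF this]] show "(\<Sum>i. a i * x ^ i) = F (x, v)" by simp
    qed (use u in auto)
  qed
  with D that show thesis by blast
qed

definition swap2 :: "'a fps2 \<Rightarrow> 'a fps2" where "swap2 c = Abs_fps2 (\<lambda>i j. coeff2 c j i)"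

lemma power_series_swap: "power_series_on r F c \<Longrightarrow> power_series_on r (\<lambda>p. F (snd p, fst p)) (swap2 c)"
  unfolding power_series_on_def
proof (intro allI impI)
  fix u v assume ps: "\<forall>u v. \<bar>u\<bar> < r \<and> \<bar>v\<bar> < r \<longrightarrow> ((\<lambda>(i, j). coeff2 c i j * u ^ i * v ^ j) has_sum F (u, v)) UNIV"
    and uv: "\<bar>u\<bar> < r \<and> \<bar>v\<bar> < r"
  then have "((\<lambda>(i, j). coeff2 c i j * v ^ i * u ^ j) has_sum F (v, u)) (prod.swap ` UNIV)" by simp
  then have "((\<lambda>(i, j). coeff2 c i j * v ^ i * u ^ j) \<circ> prod.swap has_sum F (v, u)) UNIV"
    by (subst (asm) has_sum_reindex) auto
  then show "((\<lambda>(i, j). coeff2 (swap2 c) i j * u ^ i * v ^ j) has_sum F (snd (u, v), fst (u, v))) UNIV"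
    by (simp add: swap2_def o_def case_prod_unfold mult_ac)
qed

lemma power_series_dy2:
  assumes ps: "power_series_on r F c"
  obtains D where "power_series_on r D (dy2 c)"
    "\<And>u v. \<bar>u\<bar> < r \<Longrightarrow> \<bar>v\<bar> < r \<Longrightarrow> ((\<lambda>y. F (u, y)) has_real_derivative D (u, v)) (at v)"
proof -
  obtain D where D: "power_series_on r D (dx2 (swap2 c))"
    "\<And>u v. \<bar>u\<bar> < r \<Longrightarrow> \<bar>v\<bar> < r \<Longrightarrow> ((\<lambda>x. F (v, x)) has_real_derivative D (u, v)) (at u)"
    using power_series_dx2[OF power_series_swap[OF ps]] by auto
  have "swap2 (dx2 (swap2 c)) = dy2 c" by (rule fps2_eqI) (simp add: swap2_def)
  then have "power_series_on r (\<lambda>p. D (snd p, fst p)) (dy2 c)"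
    using power_series_swap[OF D(1)] by simp
  then show thesis by (rule that) (use D(2) in simp)
qed

section \<open>The Taylor series of the given map\<close>

lemma vector_2_eq: "(vector [u, v] :: real^2) = u *\<^sub>R axis 1 1 + v *\<^sub>R axis 2 1"
  by (simp add: vec_eq_iff forall_2 axis_def)

lemma norm_vector_2_le: "norm (vector [u, v] :: real^2) \<le> \<bar>u\<bar> + \<bar>v\<bar>"
  unfolding vector_2_eq by (rule norm_triangle_le) (simp add: norm_axis_1)

lemma partial_derivatives:
  fixes F :: "real^2 \<Rightarrow> real^2" and J :: "real^2^2" and k :: 2
  assumes F: "F differentiable (at (vector [u, v]))"
  defines "J \<equiv> matrix (frechet_derivative F (at (vector [u, v])))"
  shows "((\<lambda>x. F (vector [x, v]) $ k) has_real_derivative J $ k $ 1) (at u)"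
    "((\<lambda>y. F (vector [u, y]) $ k) has_real_derivative J $ k $ 2) (at v)"
proof -
  define F' where "F' = frechet_derivative F (at (vector [u, v]))"
  have D: "(F has_derivative F') (at (vector [u, v]))"
    unfolding F'_def using F by (simp add: frechet_derivative_works)
  have lin: "linear F'" using D by (rule has_derivative_linear)
  have "((\<lambda>x. vector [x, v] :: real^2) has_derivative (\<lambda>h. h *\<^sub>R axis 1 1)) (at u)"
    unfolding vector_2_eq by (auto intro!: derivative_eq_intros)
  from has_derivative_compose[OF this D]
  have "((\<lambda>x. F (vector [x, v]) $ k) has_derivative (\<lambda>h. F' (h *\<^sub>R axis 1 1) $ k)) (at u)"
    by (rule bounded_linear.has_derivative[OF bounded_linear_vec_nth])
  moreover have "(\<lambda>h. F' (h *\<^sub>R axis 1 1) $ k) = (*) (J $ k $ 1)"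
    by (auto simp: J_def matrix_def F'_def[symmetric] linear_scale[OF lin])
  ultimately show "((\<lambda>x. F (vector [x, v]) $ k) has_real_derivative J $ k $ 1) (at u)"
    by (simp add: has_field_derivative_def)
  have "((\<lambda>y. vector [u, y] :: real^2) has_derivative (\<lambda>h. h *\<^sub>R axis 2 1)) (at v)"
    unfolding vector_2_eq by (auto intro!: derivative_eq_intros)
  from has_derivative_compose[OF this D]
  have "((\<lambda>y. F (vector [u, y]) $ k) has_derivative (\<lambda>h. F' (h *\<^sub>R axis 2 1) $ k)) (at v)"
    by (rule bounded_linear.has_derivative[OF bounded_linear_vec_nth])
  moreover have "(\<lambda>h. F' (h *\<^sub>R axis 2 1) $ k) = (*) (J $ k $ 2)"
    by (auto simp: J_def matrix_def F'_def[symmetric] linear_scale[OF lin])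
  ultimately show "((\<lambda>y. F (vector [u, y]) $ k) has_real_derivative J $ k $ 2) (at v)"
    by (simp add: has_field_derivative_def)
qed

lemma taylor_map_power_series:
  fixes F :: "real^2 \<Rightarrow> real^2"
  assumes "has_taylor_map_at F T 0"
  obtains r where "r > 0" "power_series_on r (\<lambda>p. F (vector [fst p, snd p]) $ 1) (fst T)"
    "power_series_on r (\<lambda>p. F (vector [fst p, snd p]) $ 2) (snd T)"
proof -
  from assms obtain r1 r2 where "r1 > 0" "r2 > 0"
    "\<forall>u v. \<bar>u\<bar> < r1 \<and> \<bar>v\<bar> < r1 \<longrightarrow> ((\<lambda>(i, j). coeff2 (fst T) i j * u ^ i * v ^ j) has_sum F (0 + vector [u, v]) $ 1) UNIV"
    "\<forall>u v. \<bar>u\<bar> < r2 \<and> \<bar>v\<bar> < r2 \<longrightarrow> ((\<lambda>(i, j). coeff2 (snd T) i j * u ^ i * v ^ j) has_sum F (0 + vector [u, v]) $ 2) UNIV"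
    unfolding has_taylor_map_at_def has_power_series_at_def by blast
  then show thesis by (intro that[of "min r1 r2"]) (auto simp: power_series_on_def)
qed

text \<open>Near the origin the determinant of the analytic partial derivatives is the constant one;
  by uniqueness of asymptotic expansions the formal Jacobian is one as well.\<close>

lemma taylor_map_jacobian:
  assumes U: "open U" "0 \<in> U" and area: "area_orientation_preserving_on F U" and T: "has_taylor_map_at F T 0"
  shows "fm_jacobian T = 1"
proof -
  obtain r where r: "r > 0" and ps1: "power_series_on r (\<lambda>p. F (vector [fst p, snd p]) $ 1) (fst T)"
    and ps2: "power_series_on r (\<lambda>p. F (vector [fst p, snd p]) $ 2) (snd T)"
    by (rule taylor_map_power_series[OF T])
  obtain e where e: "e > 0" "ball 0 e \<subseteq> U" using U by (meson open_contains_ball)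
  obtain A11 where A11: "power_series_on r A11 (dx2 (fst T))"
    "\<And>u v. \<bar>u\<bar> < r \<Longrightarrow> \<bar>v\<bar> < r \<Longrightarrow> ((\<lambda>x. F (vector [x, v]) $ 1) has_real_derivative A11 (u, v)) (at u)"
    using power_series_dx2[OF ps1] by auto
  obtain A12 where A12: "power_series_on r A12 (dy2 (fst T))"
    "\<And>u v. \<bar>u\<bar> < r \<Longrightarrow> \<bar>v\<bar> < r \<Longrightarrow> ((\<lambda>y. F (vector [u, y]) $ 1) has_real_derivative A12 (u, v)) (at v)"
    using power_series_dy2[OF ps1] by auto
  obtain A21 where A21: "power_series_on r A21 (dx2 (snd T))"
    "\<And>u v. \<bar>u\<bar> < r \<Longrightarrow> \<bar>v\<bar> < r \<Longrightarrow> ((\<lambda>x. F (vector [x, v]) $ 2) has_real_derivative A21 (u, v)) (at u)"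
    using power_series_dx2[OF ps2] by auto
  obtain A22 where A22: "power_series_on r A22 (dy2 (snd T))"
    "\<And>u v. \<bar>u\<bar> < r \<Longrightarrow> \<bar>v\<bar> < r \<Longrightarrow> ((\<lambda>y. F (vector [u, y]) $ 2) has_real_derivative A22 (u, v)) (at v)"
    using power_series_dy2[OF ps2] by auto
  define J where "J p = A11 p * A22 p - A12 p * A21 p" for p
  have J1: "J p = 1" if p: "norm p < min r (e / 2)" for p
  proof -
    obtain u v where uv: "p = (u, v)" by (cases p)
    have ru: "\<bar>u\<bar> < r" and rv: "\<bar>v\<bar> < r" and "\<bar>u\<bar> < e / 2" "\<bar>v\<bar> < e / 2"
      using abs_fst_snd_le_norm[of p] p by (auto simp: uv)
    then have "norm (vector [u, v] :: real^2) < e" using norm_vector_2_le[of u v] by linarith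
    then have "vector [u, v] \<in> U" using e by auto
    then have d: "F differentiable (at (vector [u, v]))" and det: "det (matrix (frechet_derivative F (at (vector [u, v])))) = 1"
      using area by (auto simp: area_orientation_preserving_on_def)
    have "A11 p = matrix (frechet_derivative F (at (vector [u, v]))) $ 1 $ 1"
      "A12 p = matrix (frechet_derivative F (at (vector [u, v]))) $ 1 $ 2"
      "A21 p = matrix (frechet_derivative F (at (vector [u, v]))) $ 2 $ 1"
      "A22 p = matrix (frechet_derivative F (at (vector [u, v]))) $ 2 $ 2"
      unfolding uv
      using DERIV_unique[OF A11(2)[OF ru rv] partial_derivatives(1)[OF d, of 1]]
        DERIV_unique[OF A12(2)[OF ru rv] partial_derivatives(2)[OF d, of 1]]
        DERIV_unique[OF A21(2)[OF ru rv] partial_derivatives(1)[OF d, of 2]]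
        DERIV_unique[OF A22(2)[OF ru rv] partial_derivatives(2)[OF d, of 2]] by auto
    then show ?thesis using det by (simp add: J_def det_2 mult.commute)
  qed
  show ?thesis
  proof (rule vord_eqI)
    fix N
    have 1: "expands N J (fm_jacobian T)"
      unfolding J_def[abs_def] fm_jacobian_def
      by (intro expands_diff expands_mult expands_power_series[OF _ r] A11(1) A12(1) A21(1) A22(1))
    have "\<forall>\<^sub>F p in at 0. J p - 1 = 0"
      using eventually_norm_less[of "min r (e / 2)"] r e(1) by (auto elim!: eventually_mono simp: J1)
    then have "(\<lambda>p. J p - 1) \<in> O[at 0](\<lambda>p. of_real (norm p ^ N))"
      by (subst landau_o.big.in_cong[where g = "\<lambda>p. 0"]) auto
    from sum_in_bigo(2)[OF 1[unfolded expands_def] this]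
    have "expands N (\<lambda>p. 1) (fm_jacobian T)" by (simp add: expands_def)
    then show "vord N (fm_jacobian T - 1)"
      using expands_unique[OF _ expands_const[of N "1::real"]] by (simp add: const2_simps(4))
  qed
qed

text \<open>The estimate over complex z is pulled back along the isometry from pairs to complex
  numbers, so the Taylor series and the polynomial expression expand the same function to order
  \<open>N\<close>.\<close>

lemma taylor_map_zcoord:
  fixes a b :: "complex poly"
  assumes T: "has_taylor_map_at F T 0"
    and O: "(\<lambda>z. in_complex_coordinate F z - (poly a (z * cnj z) * z + poly b (z * cnj z) * cnj z ^ k))
         \<in> O[at 0](\<lambda>z. of_real (norm z ^ N))"
  shows "vord N (toz (fst T) + const2 \<i> * toz (snd T) -
    ((\<Sum>l\<le>degree a. const2 (coeff a l) * (X2 * Y2) ^ l) * X2 + (\<Sum>l\<le>degree b. const2 (coeff b l) * (X2 * Y2) ^ l) * Y2 ^ k))"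
proof -
  obtain r where r: "r > 0" and ps1: "power_series_on r (\<lambda>p. F (vector [fst p, snd p]) $ 1) (fst T)"
    and ps2: "power_series_on r (\<lambda>p. F (vector [fst p, snd p]) $ 2) (snd T)"
    by (rule taylor_map_power_series[OF T])
  define Z where "Z = X2 + const2 \<i> * Y2"
  define Z' where "Z' = X2 - const2 \<i> * Y2"
  define z where "z p = complex_of_real (fst p) + \<i> * of_real (snd p)" for p :: "real \<times> real"
  have zZ: "expands N z Z" unfolding z_def[abs_def] Z_def
    by (intro expands_add expands_mult expands_const expands_fst expands_snd)
  have cz: "cnj (z p) = of_real (fst p) - \<i> * of_real (snd p)" for p by (simp add: z_def)
  have zZ': "expands N (\<lambda>p. cnj (z p)) Z'" unfolding cz Z'_def
    by (intro expands_diff expands_mult expands_const expands_fst expands_snd)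
  define Q where "Q = (\<Sum>l\<le>degree a. const2 (coeff a l) * (Z * Z') ^ l) * Z + (\<Sum>l\<le>degree b. const2 (coeff b l) * (Z * Z') ^ l) * Z' ^ k"
  have Q: "expands N (\<lambda>p. poly a (z p * cnj (z p)) * z p + poly b (z p * cnj (z p)) * cnj (z p) ^ k) Q"
    unfolding Q_def poly_altdef
    by (intro expands_add expands_mult expands_sum expands_power expands_const zZ zZ')
  define V where "V p = in_complex_coordinate F (z p)" for p
  have VF: "V p = of_real (F (vector [fst p, snd p]) $ 1) + \<i> * of_real (F (vector [fst p, snd p]) $ 2)" for p
    by (simp add: V_def in_complex_coordinate_def z_def complex_eq_iff Let_def)
  have V: "expands N V (cmap2 (fst T) + const2 \<i> * cmap2 (snd T))"
    unfolding VF[abs_def]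
    by (intro expands_add expands_mult expands_const expands_cmap2 expands_power_series[OF ps1 r] expands_power_series[OF ps2 r])
  have nz: "norm (z p) = norm p" for p
    by (cases p) (simp add: z_def cmod_def norm_prod_def)
  have lim: "filterlim z (at 0) (at 0)"
  proof -
    have "(z \<longlongrightarrow> z 0) (at 0)" unfolding z_def by (intro tendsto_intros)
    moreover have "z p \<noteq> 0" if "p \<noteq> 0" for p using nz[of p] that by auto
    ultimately show ?thesis
      by (auto simp: filterlim_at z_def[of 0] eventually_at_filter)
  qed
  have "(\<lambda>p. V p - (poly a (z p * cnj (z p)) * z p + poly b (z p * cnj (z p)) * cnj (z p) ^ k)) \<in> O[at 0](\<lambda>p. of_real (norm p ^ N))"
    using landau_o.big.compose[OF O lim] by (simp add: V_def nz)
  from sum_in_bigo(1)[OF this Q[unfolded expands_def]] have "expands N V Q" by (simp add: expands_def)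
  from expands_unique[OF V this] have "vord N (cmap2 (fst T) + const2 \<i> * cmap2 (snd T) - Q)" .
  then have "vord N (zmap (cmap2 (fst T) + const2 \<i> * cmap2 (snd T) - Q))" by (rule fhom_vord[OF fhom_zmap])
  moreover have zz: "zmap Z = X2" "zmap Z' = Y2" unfolding Z_def Z'_def by (rule zmap_complex)+
  have "zmap Q = (\<Sum>l\<le>degree a. const2 (coeff a l) * (X2 * Y2) ^ l) * X2 + (\<Sum>l\<le>degree b. const2 (coeff b l) * (X2 * Y2) ^ l) * Y2 ^ k"
    unfolding Q_def zz fhom_add[OF fhom_zmap] fhom_mult[OF fhom_zmap] fhom_sum[OF fhom_zmap] fhom_power[OF fhom_zmap]
      fhom_const2[OF fhom_zmap] zz ..
  ultimately show ?thesis
    by (simp add: fhom_diff[OF fhom_zmap] fhom_add[OF fhom_zmap] fhom_mult[OF fhom_zmap] fhom_const2[OF fhom_zmap] toz_def)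
qed

lemma coeff2_complex_form:
  "coeff2 ((\<Sum>l\<le>degree a. const2 (coeff a l) * (X2 * Y2) ^ l) * X2 + (\<Sum>l\<le>degree b. const2 (coeff b l) * (X2 * Y2) ^ l) * Y2 ^ k) i j
    = (if i = j + 1 then coeff a j else 0) + (if j = i + k then coeff b i else (0 :: complex))"
proof -
  have 1: "(\<Sum>l\<le>degree a. const2 (coeff a l) * (X2 * Y2) ^ l) * X2 = (\<Sum>l\<le>degree a. const2 (coeff a l) * (X2 ^ (l + 1) * Y2 ^ l))"
    by (simp add: sum_distrib_left sum_distrib_right power_mult_distrib mult_ac)
  have 2: "(\<Sum>l\<le>degree b. const2 (coeff b l) * (X2 * Y2) ^ l) * Y2 ^ k = (\<Sum>l\<le>degree b. const2 (coeff b l) * (X2 ^ l * Y2 ^ (l + k)))"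
    by (simp add: sum_distrib_left sum_distrib_right power_mult_distrib power_add mult_ac)
  have "coeff2 (\<Sum>l\<le>degree a. const2 (coeff a l) * (X2 ^ (l + 1) * Y2 ^ l)) i j = (\<Sum>l\<le>degree a. if l = j then if i = j + 1 then coeff a j else 0 else 0)"
    unfolding coeff2_sum coeff2_const2_mult coeff2_monom by (intro sum.cong) auto
  also have "\<dots> = (if i = j + 1 then coeff a j else 0)" by (auto simp: coeff_eq_0)
  finally have 3: "coeff2 (\<Sum>l\<le>degree a. const2 (coeff a l) * (X2 ^ (l + 1) * Y2 ^ l)) i j = (if i = j + 1 then coeff a j else 0)" .
  have "coeff2 (\<Sum>l\<le>degree b. const2 (coeff b l) * (X2 ^ l * Y2 ^ (l + k))) i j = (\<Sum>l\<le>degree b. if l = i then if j = i + k then coeff b i else 0 else 0)"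
    unfolding coeff2_sum coeff2_const2_mult coeff2_monom by (intro sum.cong) auto
  also have "\<dots> = (if j = i + k then coeff b i else 0)" by (auto simp: coeff_eq_0)
  finally show ?thesis unfolding 1 2 coeff2_add 3 by simp
qed

theorem theorem1:
  fixes n :: nat and \<alpha>\<^sub>0 :: real
    and F\<^sub>0 :: "real^2 \<Rightarrow> real^2" and U :: "(real^2) set"
    and T :: formal_map and a b :: "complex poly"
  assumes "n \<ge> 5"
    and "open U" and "0 \<in> U"
    and "real_analytic_map_on F\<^sub>0 U"
    and "area_orientation_preserving_on F\<^sub>0 U"
    and "F\<^sub>0 0 = 0"
    and "(F\<^sub>0 has_derivative (\<lambda>v. plane_rotation \<alpha>\<^sub>0 *v v)) (at 0)"
    and "cis \<alpha>\<^sub>0 ^ n = 1"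
    and "\<And>k. 1 \<le> k \<Longrightarrow> k < n \<Longrightarrow> cis \<alpha>\<^sub>0 ^ k \<noteq> 1"
    and "(\<lambda>z. in_complex_coordinate F\<^sub>0 z
           - (poly a (z * cnj z) * z + poly b (z * cnj z) * cnj z ^ (n - 1)))
         \<in> O[at 0](\<lambda>z. of_real (norm z ^ (n + 1)))"
    and "poly a 0 = cis \<alpha>\<^sub>0"
    and "poly (pderiv a) 0 = 0"
    and "poly (pderiv (pderiv a)) 0 \<noteq> 0"
    and "poly b 0 \<noteq> 0"
    and Taylor: "has_taylor_map_at F\<^sub>0 T 0"
  shows "\<exists>!(A\<^sub>0, B\<^sub>0).
           (n = 5 \<longrightarrow> (\<forall>k. (k mod 5 = 1 \<longrightarrow> fps_nth A\<^sub>0 k = 0) \<and>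
                         (k mod 5 = 4 \<longrightarrow> fps_nth B\<^sub>0 k = 0))) \<and>
           (n \<ge> 6 \<longrightarrow> (\<forall>k. k mod 3 = 2 \<longrightarrow> fps_nth B\<^sub>0 k = 0)) \<and>
           fps_nth B\<^sub>0 0 > 0 \<and>
           (\<exists>\<phi> \<Phi>. formal_canonical \<phi> \<and>
              formal_hamiltonian_flow (normal_form_hamiltonian n A\<^sub>0 B\<^sub>0) \<Phi> \<and>
              \<phi> \<circ>\<^sub>f T = (fm_linear (plane_rotation \<alpha>\<^sub>0) \<circ>\<^sub>f \<Phi> 1) \<circ>\<^sub>f \<phi>)"
proof -
  interpret resonant_rotation n \<alpha>\<^sub>0
    by unfold_locales (use assms in auto)
  define Z where "Z = toz (fst T) + const2 \<i> * toz (snd T)"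
  \<comment> \<open>The error of order \<open>n + 1\<close> fixes the coefficients of degree at most
    \<open>n\<close>, among which \<open>b\<close> enters only through its constant term.\<close>
  have coeff: "coeff2 Z i j = (if i = j + 1 then coeff a j else 0) + (if j = i + (n - 1) then coeff b i else 0)"
    if "i + j \<le> n" for i j
    using taylor_map_zcoord[OF Taylor assms(10)] that
    unfolding Z_def vord_diff_iff coeff2_complex_form by simp
  have a0: "coeff a 0 = cis \<alpha>\<^sub>0" using assms(11) by (simp add: poly_0_coeff_0)
  have a1: "coeff a 1 = 0" using assms(12) by (simp add: poly_0_coeff_0 coeff_pderiv)
  have a2: "coeff a 2 \<noteq> 0" using assms(13) by (simp add: poly_0_coeff_0 coeff_pderiv numeral_2_eq_2)
  have b0: "coeff b 0 \<noteq> 0" using assms(14) by (simp add: poly_0_coeff_0)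
  have T0: "no_constant_term T"
  proof -
    have "vord 1 Z" using coeff[of 0 0] assms(1) by (simp add: vord_def)
    then show ?thesis unfolding Z_def no_constant_term_vord using vord_real_parts by auto
  qed
  define t where "t f = subst2 f T" for f
  have t: "symp t"
    unfolding t_def[abs_def] by (rule symp_subst2[OF T0 taylor_map_jacobian[OF assms(2,3,5) Taylor]])
  have tX: "t X2 = fst T" "t Y2 = snd T"
    using T0 by (simp_all add: t_def no_constant_term_vord)
  have zt: "zcoord t = Z" by (simp add: zcoord_def Z_def tX)
  obtain A B \<phi> where AB: "nf_constraints n A B" "fps_nth B 0 > 0" "n \<noteq> 5 \<longrightarrow> fps_nth A 0 \<noteq> 0"
    "conjugates t \<phi> (normal_form_hamiltonian n A B)"
  proof (rule exists_conjugacy[OF t])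
    show "i = j + 1 \<or> i = 0 \<and> j = n - 1" if "i + j \<le> n" "coeff2 (zcoord t) i j \<noteq> 0" for i j
      using that coeff[OF that(1)] assms(1) unfolding zt by (auto split: if_splits)
    show "coeff2 (zcoord t) 1 0 = cis \<alpha>\<^sub>0" "coeff2 (zcoord t) 2 1 = 0" "coeff2 (zcoord t) 3 2 \<noteq> 0"
      "coeff2 (zcoord t) 0 (n - 1) \<noteq> 0"
      unfolding zt using coeff[of 1 0] coeff[of 2 1] coeff[of 3 2] coeff[of 0 "n - 1"] assms(1) a0 a1 a2 b0
      by (simp_all add: numeral_2_eq_2)
  qed blast
  have flow: "formal_hamiltonian_flow (normal_form_hamiltonian n A B) \<Phi> \<Longrightarrow>
      \<Phi> 1 = (pexp (normal_form_hamiltonian n A B) X2, pexp (normal_form_hamiltonian n A B) Y2)" for A B \<Phi>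
    unfolding formal_hamiltonian_flow_iff[OF vord_normal_form] by (simp add: const2_simps(4))
  \<comment> \<open>Formal flows are unique, so the time-one map may be replaced by the exponential,
    and the condition becomes one on operators.\<close>
  have iff: "(\<exists>\<phi> \<Phi>. formal_canonical \<phi> \<and> formal_hamiltonian_flow (normal_form_hamiltonian n A B) \<Phi> \<and>
      \<phi> \<circ>\<^sub>f T = (fm_linear (plane_rotation \<alpha>\<^sub>0) \<circ>\<^sub>f \<Phi> 1) \<circ>\<^sub>f \<phi>) \<longleftrightarrow>
    (\<exists>\<phi>. conjugates t \<phi> (normal_form_hamiltonian n A B))" (is "?L \<longleftrightarrow> ?R") for A B
  proof
    assume ?L
    then obtain \<phi> \<Phi> where \<phi>: "formal_canonical \<phi>" and \<Phi>: "formal_hamiltonian_flow (normal_form_hamiltonian n A B) \<Phi>"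
      and eq: "\<phi> \<circ>\<^sub>f T = (fm_linear (plane_rotation \<alpha>\<^sub>0) \<circ>\<^sub>f \<Phi> 1) \<circ>\<^sub>f \<phi>" by blast
    have n0: "no_constant_term \<phi>" using \<phi> by (simp add: formal_canonical_def)
    obtain \<phi>' where "symp (\<lambda>f. subst2 f \<phi>)" "symp \<phi>'" "\<And>f. subst2 (\<phi>' f) \<phi> = f" "\<And>f. \<phi>' (subst2 f \<phi>) = f"
      using symp_of_formal_canonical[OF \<phi>] by blast
    moreover have "\<forall>f. t (subst2 f \<phi>) = subst2 (pexp (normal_form_hamiltonian n A B) (rot \<alpha>\<^sub>0 f)) \<phi>"
      using eq unfolding flow[OF \<Phi>] conjugacy_iff[OF T0 vord_normal_form n0] t_def .
    ultimately show ?R unfolding conjugates_def by blast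
  next
    assume ?R
    then obtain \<phi> \<phi>' where \<phi>: "symp \<phi>" "symp \<phi>'" "\<And>f. \<phi> (\<phi>' f) = f" "\<And>f. \<phi>' (\<phi> f) = f"
      and eq: "\<And>f. t (\<phi> f) = \<phi> (pexp (normal_form_hamiltonian n A B) (rot \<alpha>\<^sub>0 f))"
      unfolding conjugates_def by blast
    have can: "formal_canonical (\<phi> X2, \<phi> Y2)" by (rule formal_canonical_of_symp[OF \<phi>])
    then have n0: "no_constant_term (\<phi> X2, \<phi> Y2)" by (simp add: formal_canonical_def)
    note \<Phi> = formal_hamiltonian_flow_pexp[OF vord_normal_form[of A B]]
    have conj: "(\<phi> X2, \<phi> Y2) \<circ>\<^sub>f T = (fm_linear (plane_rotation \<alpha>\<^sub>0) \<circ>\<^sub>f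
       (pexp (normal_form_hamiltonian n A B) X2, pexp (normal_form_hamiltonian n A B) Y2)) \<circ>\<^sub>f (\<phi> X2, \<phi> Y2)"
      unfolding conjugacy_iff[OF T0 vord_normal_form n0] subst2_fhom[OF symp_fhom[OF \<phi>(1)]]
      using eq by (simp add: t_def)
    show ?L
    proof (intro exI conjI)
      show "formal_canonical (\<phi> X2, \<phi> Y2)" by (rule can)
      show "formal_hamiltonian_flow (normal_form_hamiltonian n A B)
        (\<lambda>t. (pexp (const2 t * normal_form_hamiltonian n A B) X2, pexp (const2 t * normal_form_hamiltonian n A B) Y2))"
        by (rule \<Phi>)
      show "(\<phi> X2, \<phi> Y2) \<circ>\<^sub>f T = (fm_linear (plane_rotation \<alpha>\<^sub>0) \<circ>\<^sub>f
        (pexp (const2 1 * normal_form_hamiltonian n A B) X2, pexp (const2 1 * normal_form_hamiltonian n A B) Y2)) \<circ>\<^sub>f (\<phi> X2, \<phi> Y2)"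
        using conj by (simp only: const2_simps(4) mult_1)
    qed
  qed
  have con: "(n = 5 \<longrightarrow> (\<forall>k. (k mod 5 = 1 \<longrightarrow> fps_nth A k = 0) \<and> (k mod 5 = 4 \<longrightarrow> fps_nth B k = 0))) \<and>
      (n \<ge> 6 \<longrightarrow> (\<forall>k. k mod 3 = 2 \<longrightarrow> fps_nth B k = 0)) \<and> fps_nth B 0 > 0 \<and> R
      \<longleftrightarrow> nf_constraints n A B \<and> fps_nth B 0 > 0 \<and> R" for A B R
    by (auto simp: nf_constraints_def)
  show ?thesis
    unfolding iff con
  proof (rule ex1I[of _ "(A, B)"])
    show "case (A, B) of (A, B) \<Rightarrow> nf_constraints n A B \<and> fps_nth B 0 > 0 \<and> (\<exists>\<phi>. conjugates t \<phi> (normal_form_hamiltonian n A B))"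
      using AB by auto
  next
    fix x assume x: "case x of (A, B) \<Rightarrow> nf_constraints n A B \<and> fps_nth B 0 > 0 \<and> (\<exists>\<phi>. conjugates t \<phi> (normal_form_hamiltonian n A B))"
    then obtain A' B' \<phi>' where x': "x = (A', B')" "nf_constraints n A' B'" "fps_nth B' 0 > 0"
      "conjugates t \<phi>' (normal_form_hamiltonian n A' B')" by auto
    \<comment> \<open>The constructed pair is put second: its coefficient \<open>fps_nth A 0\<close>
      is known to be nonzero for \<open>n \<noteq> 5\<close>, which is not assumed of a
      competitor.\<close>
    from conjugacy_unique[OF x'(4) AB(4) x'(2) AB(1) x'(3) AB(2,3)] show "x = (A, B)" by (simp add: x'(1))
  qed
qed

end
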